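(* Let $\gamma:\mathbb N^*\to(0,\infty)$ satisfy $\sum_{x\in\mathbb N^*}\gamma(x)<\infty$, and let $Y=(Y(t),t\ge 0)$ be a process on $\bar{\mathbb N}^*$ with the following four properties. (i) $Y$ is càdlàg. (ii) $Y$ is strong Markov. (iii) Starting from any point $i\in\mathbb N^*$, $Y$ waits for an exponential time of mean $\gamma(i)$ before jumping. (iv) Starting from $\infty$, for any finite nonempty $A\subset\mathbb N^*$, we have $\tau_A<\infty$ almost surely, where $\tau_A=\inf\{t\ge 0: Y(t)\in A\}$ (with $\inf\emptyset=\infty$), and the law of $Y(\tau_A)$ is uniform on $A$. Then $Y$ is a K-process with parameters $\gamma$ and $c$, for some $c\ge 0$ (that is, there is $c\ge0$ such that, for every $y\in\bar{\mathbb N}^*$, $Y$ started from $y$ has the same distribution as the K-process $\tilde X^{c,y}$).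
   Context: $\mathbb N^*=\{1,2,\dots\}$ and $\bar{\mathbb N}^*=\{1,2,\dots,\infty\}$ is its one-point compactification, with metric $d(x,y)=|x^{-1}-y^{-1}|$ ($\infty^{-1}=0$). Extend $\gamma$ by $\gamma(\infty)=0$. Definition of the K-process with parameters $\gamma$ and $c\ge0$ (K$(\gamma,c)$-process) started at $y\in\bar{\mathbb N}^*$. Let $(N^{(x)}_t)_{t\ge0}$, $x\in\mathbb N^*$, be i.i.d. Poisson processes of rate 1, with $\sigma^{(x)}_j$ the $j$-th event time of $N^{(x)}$; let $T_0$ and $T^{(x)}_i$, $i\ge1$, $x\in\mathbb N^*$, be i.i.d. exponential random variables of rate 1, independent of the Poisson processes. Let $$\Gamma(t)=\Gamma^{c,y}(t)=\gamma(y)T_0+\sum_{x=1}^\infty\gamma(x)\sum_{i=1}^{N^{(x)}_t}T^{(x)}_i+ct,\qquad t\ge0$$ (empty sums are $0$). Then for $t\ge0$: $\tilde X^{c,y}(t)=y$ if $0\le t<\gamma(y)T_0$; $\tilde X^{c,y}(t)=x$ if $\Gamma(\sigma^{(x)}_j-)\le t<\Gamma(\sigma^{(x)}_j)$ for some $x\in\mathbb N^*$ and $1\le j<\infty$; $\tilde X^{c,y}(t)=\infty$ otherwise. *)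

theory Defs
  imports "HOL-Probability.Probability"
begin

section \<open>The state space\<close>

text \<open>
  The positive integers together with infinity are the subset \<open>Nbar\<close> of \<^typ>\<open>enat\<close>. This space is
  countable, its metric is \<open>nbar_dist\<close>, and its Borel sigma-algebra consists of all subsets, so
  measurability is stated with respect to \<^term>\<open>count_space Nbar\<close>.
\<close>

definition Nbar :: "enat set" where
  "Nbar = {1..}"

definition Nstar :: "enat set" where
  "Nstar = {1..<\<infinity>}"

definition enat_inverse :: "enat \<Rightarrow> real" where
  "enat_inverse x = (case x of enat n \<Rightarrow> 1 / real n | \<infinity> \<Rightarrow> 0)"

definition nbar_dist :: "enat \<Rightarrow> enat \<Rightarrow> real" where
  "nbar_dist x y = \<bar>enat_inverse x - enat_inverse y\<bar>"

lemma Metric_space_Nbar: "Metric_space Nbar nbar_dist"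
proof
  show "nbar_dist x y = 0 \<longleftrightarrow> x = y" if "x \<in> Nbar" "y \<in> Nbar" for x y
    using that by (cases x; cases y) (auto simp: nbar_dist_def enat_inverse_def Nbar_def one_enat_def)
qed (auto simp: nbar_dist_def)

definition cadlag :: "(real \<Rightarrow> enat) \<Rightarrow> bool" where
  "cadlag f \<longleftrightarrow>
    (\<forall>t\<ge>0. ((\<lambda>s. nbar_dist (f s) (f t)) \<longlongrightarrow> 0) (at_right t)) \<and>
    (\<forall>t>0. \<exists>l\<in>Nbar. ((\<lambda>s. nbar_dist (f s) l) \<longlongrightarrow> 0) (at_left t))"

definition extend_infty :: "(nat \<Rightarrow> real) \<Rightarrow> enat \<Rightarrow> real" where
  "extend_infty \<gamma> y = (case y of enat n \<Rightarrow> \<gamma> n | \<infinity> \<Rightarrow> 0)"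

text \<open>
  The law of a process is its distribution on the product sigma-algebra over the time set
  \<open>[0, \<infinity>)\<close>, i.e. it is given by the finite-dimensional distributions.
\<close>

definition path_space :: "(real \<Rightarrow> enat) measure" where
  "path_space = PiM {0..} (\<lambda>_. count_space Nbar)"

definition sample_path :: "(real \<Rightarrow> 'w \<Rightarrow> enat) \<Rightarrow> 'w \<Rightarrow> real \<Rightarrow> enat" where
  "sample_path Y \<omega> = (\<lambda>t\<in>{0..}. Y t \<omega>)"


section \<open>The K-process\<close>

definition (in prob_space) poisson_process :: "real \<Rightarrow> (real \<Rightarrow> 'a \<Rightarrow> nat) \<Rightarrow> bool" where
  "poisson_process rate N \<longleftrightarrow>
    (\<forall>t\<ge>0. N t \<in> M \<rightarrow>\<^sub>M count_space UNIV) \<and>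
    (\<forall>\<omega>\<in>space M. N 0 \<omega> = 0 \<and> mono_on {0..} (\<lambda>t. N t \<omega>) \<and>
      (\<forall>t\<ge>0. ((\<lambda>s. N s \<omega>) \<longlongrightarrow> N t \<omega>) (at_right t))) \<and>
    (\<forall>s t. 0 \<le> s \<and> s < t \<longrightarrow>
      distr M (count_space UNIV) (\<lambda>\<omega>. N t \<omega> - N s \<omega>) = measure_pmf (poisson_pmf (rate * (t - s)))) \<and>
    (\<forall>n (t :: nat \<Rightarrow> real). 0 \<le> t 0 \<and> mono t \<longrightarrow>
      indep_vars (\<lambda>_. count_space UNIV) (\<lambda>i \<omega>. N (t (Suc i)) \<omega> - N (t i) \<omega>) {..<n})"

text \<open>\<open>s\<close> is the time of the \<open>j\<close>-th event of the counting path \<open>n\<close>.\<close>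

definition is_event_time :: "(real \<Rightarrow> nat) \<Rightarrow> nat \<Rightarrow> real \<Rightarrow> bool" where
  "is_event_time n j s \<longleftrightarrow> 0 \<le> s \<and> j \<le> n s \<and> (\<forall>u. 0 \<le> u \<and> u < s \<longrightarrow> n u < j)"

text \<open>
  The random variables driving a K-process: \<open>N x\<close> is the Poisson process attached to \<open>x\<close>, and
  \<open>T x i\<close> the \<open>i\<close>-th exponential variable attached to \<open>x\<close>. Only indices \<open>x \<ge> 1\<close> and \<open>i \<ge> 1\<close> are used.
  The exponential variables are collected in one family whose index \<^const>\<open>None\<close> stands for \<open>T0\<close>.
\<close>

definition T_index :: "(nat \<times> nat) option set" where
  "T_index = insert None (Some ` ({1..} \<times> {1..}))"

definition T_family :: "('v \<Rightarrow> real) \<Rightarrow> (nat \<Rightarrow> nat \<Rightarrow> 'v \<Rightarrow> real) \<Rightarrow> (nat \<times> nat) option \<Rightarrow> 'v \<Rightarrow> real" where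
  "T_family T0 T k = (case k of None \<Rightarrow> T0 | Some (x, i) \<Rightarrow> T x i)"

locale K_inputs = prob_space M for M :: "'v measure" +
  fixes N :: "nat \<Rightarrow> real \<Rightarrow> 'v \<Rightarrow> nat"
    and T0 :: "'v \<Rightarrow> real"
    and T :: "nat \<Rightarrow> nat \<Rightarrow> 'v \<Rightarrow> real"
  assumes N_poisson: "\<And>x. 1 \<le> x \<Longrightarrow> poisson_process 1 (N x)"
    and N_indep: "indep_vars (\<lambda>_. PiM {0..} (\<lambda>_. count_space UNIV)) (\<lambda>x \<omega>. \<lambda>t\<in>{0..}. N x t \<omega>) {1..}"
    and T_exponential:
      "\<And>k. k \<in> T_index \<Longrightarrow> distributed M lborel (T_family T0 T k) (exponential_density 1)"
    and T_indep: "indep_vars (\<lambda>_. borel) (T_family T0 T) T_index"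
    and N_T_indep:
      "indep_set
        (sets (vimage_algebra (space M) (\<lambda>\<omega>. \<lambda>(x, t)\<in>{1..} \<times> {0..}. N x t \<omega>)
          (PiM ({1..} \<times> {0..}) (\<lambda>_. count_space UNIV))))
        (sets (vimage_algebra (space M) (\<lambda>\<omega>. \<lambda>k\<in>T_index. T_family T0 T k \<omega>)
          (PiM T_index (\<lambda>_. borel))))"

text \<open>
  The clock takes values in \<^typ>\<open>ennreal\<close>, so that the sum over \<open>x = 1, 2, \<dots>\<close> (shifted by one below)
  is always defined; negative values of the exponential variables, which occur with
  probability zero, are truncated.
\<close>

definition K_clock ::
  "(nat \<Rightarrow> real) \<Rightarrow> real \<Rightarrow> enat \<Rightarrow> (nat \<Rightarrow> real \<Rightarrow> 'v \<Rightarrow> nat) \<Rightarrow> ('v \<Rightarrow> real) \<Rightarrow> (nat \<Rightarrow> nat \<Rightarrow> 'v \<Rightarrow> real) \<Rightarrow>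
    'v \<Rightarrow> real \<Rightarrow> ennreal" where
  "K_clock \<gamma> c y N T0 T \<omega> t =
    ennreal (extend_infty \<gamma> y * T0 \<omega>) +
    (\<Sum>x. ennreal (\<gamma> (Suc x)) * (\<Sum>i=1..N (Suc x) t \<omega>. ennreal (T (Suc x) i \<omega>))) +
    ennreal (c * t)"

definition K_sits_at ::
  "(nat \<Rightarrow> real) \<Rightarrow> real \<Rightarrow> enat \<Rightarrow> (nat \<Rightarrow> real \<Rightarrow> 'v \<Rightarrow> nat) \<Rightarrow> ('v \<Rightarrow> real) \<Rightarrow> (nat \<Rightarrow> nat \<Rightarrow> 'v \<Rightarrow> real) \<Rightarrow>
    real \<Rightarrow> 'v \<Rightarrow> nat \<Rightarrow> bool" where
  "K_sits_at \<gamma> c y N T0 T t \<omega> x \<longleftrightarrow> 1 \<le> x \<and>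
    (\<exists>j\<ge>1. \<exists>s. is_event_time (\<lambda>u. N x u \<omega>) j s \<and>
      Lim (at_left s) (K_clock \<gamma> c y N T0 T \<omega>) \<le> ennreal t \<and> ennreal t < K_clock \<gamma> c y N T0 T \<omega> s)"

text \<open>
  Almost surely the event times of the different Poisson processes are distinct, so at most one
  \<open>x\<close> satisfies \<open>K_sits_at\<close>. Taking the least one only fixes a (measurable) choice on a null set.
\<close>

definition K_process ::
  "(nat \<Rightarrow> real) \<Rightarrow> real \<Rightarrow> enat \<Rightarrow> (nat \<Rightarrow> real \<Rightarrow> 'v \<Rightarrow> nat) \<Rightarrow> ('v \<Rightarrow> real) \<Rightarrow> (nat \<Rightarrow> nat \<Rightarrow> 'v \<Rightarrow> real) \<Rightarrow>
    real \<Rightarrow> 'v \<Rightarrow> enat" where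
  "K_process \<gamma> c y N T0 T t \<omega> =
    (if t < extend_infty \<gamma> y * T0 \<omega> then y
     else if \<exists>x. K_sits_at \<gamma> c y N T0 T t \<omega> x then enat (LEAST x. K_sits_at \<gamma> c y N T0 T t \<omega> x)
     else \<infinity>)"


section \<open>Processes with arbitrary starting point, and the strong Markov property\<close>

text \<open>\<open>P y\<close> is the law governing the process \<open>Y\<close> when it is started from \<open>y\<close>.\<close>

locale Nbar_process =
  fixes P :: "enat \<Rightarrow> 'w measure"
    and Y :: "real \<Rightarrow> 'w \<Rightarrow> enat"
  assumes prob_space_P: "\<And>y. y \<in> Nbar \<Longrightarrow> prob_space (P y)"
    and sets_P: "\<And>y. y \<in> Nbar \<Longrightarrow> sets (P y) = sets (P \<infinity>)"
    and measurable_Y: "\<And>t. 0 \<le> t \<Longrightarrow> Y t \<in> P \<infinity> \<rightarrow>\<^sub>M count_space Nbar"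
    and start: "\<And>y. y \<in> Nbar \<Longrightarrow> AE \<omega> in P y. Y 0 \<omega> = y"

text \<open>
  The natural filtration, indexed by \<^typ>\<open>ennreal\<close> because stopping times may be infinite; at
  \<open>\<infinity>\<close> it is the sigma-algebra generated by the whole process.
\<close>

definition natural_filtration :: "'w set \<Rightarrow> (real \<Rightarrow> 'w \<Rightarrow> enat) \<Rightarrow> ennreal \<Rightarrow> 'w measure" where
  "natural_filtration \<Omega> Y t = sigma \<Omega> {Y s -` A \<inter> \<Omega> | s A. 0 \<le> s \<and> ennreal s \<le> t \<and> A \<subseteq> Nbar}"

lemma filtration_natural_filtration: "filtration \<Omega> (natural_filtration \<Omega> Y)"
proof
  show "space (natural_filtration \<Omega> Y i) = \<Omega>" for i
    unfolding natural_filtration_def by (rule space_measure_of) auto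
  show "sets (natural_filtration \<Omega> Y i) \<subseteq> sets (natural_filtration \<Omega> Y j)" if "i \<le> j" for i j
  proof -
    have "{Y s -` A \<inter> \<Omega> | s A. 0 \<le> s \<and> ennreal s \<le> i \<and> A \<subseteq> Nbar}
        \<subseteq> {Y s -` A \<inter> \<Omega> | s A. 0 \<le> s \<and> ennreal s \<le> j \<and> A \<subseteq> Nbar}"
      using that order_trans by blast
    then show ?thesis
      unfolding natural_filtration_def by (subst (1 2) sets_measure_of) (auto dest: sigma_sets_mono')
  qed
qed

definition strong_markov :: "(enat \<Rightarrow> 'w measure) \<Rightarrow> (real \<Rightarrow> 'w \<Rightarrow> enat) \<Rightarrow> bool" where
  "strong_markov P Y \<longleftrightarrow>
    (let \<Omega> = space (P \<infinity>); F = natural_filtration \<Omega> Y in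
      \<forall>y\<in>Nbar. \<forall>\<tau> :: 'w \<Rightarrow> ennreal. stopping_time F \<tau> \<longrightarrow>
        (\<forall>G\<in>sets (filtration.pre_sigma \<Omega> F \<tau>). \<forall>B\<in>sets path_space.
          emeasure (P y) {\<omega>\<in>G. \<tau> \<omega> < \<infinity> \<and> sample_path (\<lambda>t. Y (enn2real (\<tau> \<omega>) + t)) \<omega> \<in> B} =
          (\<integral>\<^sup>+\<omega>\<in>{\<omega>\<in>G. \<tau> \<omega> < \<infinity>}.
            emeasure (P (Y (enn2real (\<tau> \<omega>)) \<omega>)) {\<omega>'\<in>\<Omega>. sample_path Y \<omega>' \<in> B} \<partial>P y)))"

definition hitting_time :: "(real \<Rightarrow> 'w \<Rightarrow> enat) \<Rightarrow> enat set \<Rightarrow> 'w \<Rightarrow> ennreal" where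
  "hitting_time Y A \<omega> = Inf {ennreal t | t. 0 \<le> t \<and> Y t \<omega> \<in> A}"

end

theory Submission
  imports Defs
begin

text \<open>
  For a finite set \<open>B\<close> of finite states, record the skeleton of a path: the times spent alternately
  off \<open>B\<close> and at a state of \<open>B\<close>, together with the states of \<open>B\<close> that are visited. The skeletons for
  all \<open>B\<close> determine the finite-dimensional distributions, and the Laplace transforms of its holding
  times determine the law of a skeleton. Put \<open>g x = 1 / (1 + l \<gamma> x)\<close>. For the K-process, the times
  off \<open>B\<close> have Laplace transform \<open>1 / \<Phi> l\<close> (up to the factor \<open>|B|\<close> for the uniform choice of the next
  state), where \<open>\<Phi> l = c l + (\<Sum>x. 1 - g x) + (\<Sum>x\<in>B. g x)\<close>: the clock is a compound Poisson
  subordinator, run until the first event of the processes indexed by \<open>B\<close>.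

  For \<open>Y\<close>, the strong Markov property makes the skeleton a renewal sequence, governed by the joint law
  \<open>\<psi> B l k\<close> of the hitting time of \<open>B\<close> from \<open>\<infinity>\<close> and the state \<open>k\<close> hit. It also expresses \<open>\<psi> B\<close> by the
  resolvent masses \<open>r l k\<close> of the states, started at \<open>\<infinity>\<close>. By the resolvent equation the ratios of
  \<open>v l k = r l k (1 + l \<gamma> k) / \<gamma> k\<close> for different \<open>k\<close> do not depend on \<open>l\<close>, and letting \<open>l\<close> tend to
  \<open>0\<close> the uniform hitting laws force them to be \<open>1\<close>. The resolvent equation then says that
  \<open>1 / (l v l k) - (\<Sum>x. \<gamma> x / (1 + l \<gamma> x))\<close> is independent of \<open>l\<close>; this constant is \<open>c\<close>.
\<close>

section \<open>Uniqueness of Laplace transforms\<close>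

text \<open>Neither process can in general be followed jump by jump, since visits to finite states
  may accumulate in time. Visits to a finite set \<open>B\<close> can be listed in order: a path
  with left limits enters and leaves the states of \<open>B\<close> only finitely often in bounded
  time. No hypothesis says where \<open>Y\<close> goes when it leaves a finite state. That it goes
  to infinity is forced by uniformity: if \<open>i\<close> jumped to \<open>j\<close> with positive
  probability, then \<open>j\<close> would be hit first too often in a large set containing
  \<open>j\<close> but not \<open>i\<close>. Every hold thus ends in a restart at infinity, and this
  is the source of the renewal structure. The constant \<open>c\<close> measures the time spent at
  infinity: of the total resolvent mass 1 / l the finite states carry
  \<open>hold_res_sum l / \<kappa> l\<close>, and the remainder is c / \<open>\<kappa> l\<close>.
  Hence \<open>c\<close> is nonnegative. For the K-process the transform of the skeleton is obtained
  on a time grid, where the cells are independent and each has an explicit mean, by letting the mesh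
  tend to 0.\<close>

abbreviation nexp :: "real \<Rightarrow> ennreal" where
  "nexp t \<equiv> ennreal (exp (- t))"

text \<open>Under the substitution u = exp (- x) the transform at a natural number k becomes the
  k-th moment of a measure on [0, 1]. Stone-Weierstrass passes from moments to continuous functions
  of u, and continuous approximations of indicators give the distribution functions.\<close>

lemma laplace_unique:
  fixes M N :: "real measure"
  assumes fin: "finite_measure M" "finite_measure N"
    and sets: "sets M = sets borel" "sets N = sets borel"
    and nonneg: "AE x in M. 0 \<le> x" "AE x in N. 0 \<le> x"
    and lap: "\<And>a. 0 < a \<Longrightarrow> (\<integral>\<^sup>+x. nexp (a * x) \<partial>M) = (\<integral>\<^sup>+x. nexp (a * x) \<partial>N)"
  shows "M = N"
proof -
  interpret M: finite_measure M by fact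
  interpret N: finite_measure N by fact
  note [measurable_cong] = sets
  \<comment> \<open>The total mass is the moment of order 0, which the hypothesis, stated for
    \<open>0 < a\<close>, does not cover. It is recovered as the limit along a = 1 / (n +
    1).\<close>
  have lim: "(\<lambda>n. \<integral>\<^sup>+x. nexp (1 / Suc n * x) \<partial>K) \<longlonglongrightarrow> emeasure K UNIV"
    if "finite_measure K" "sets K = sets borel" "AE x in K. 0 \<le> x" for K :: "real measure"
  proof -
    interpret K: finite_measure K by fact
    note [measurable_cong] = that(2)
    have "(\<lambda>n. \<integral>\<^sup>+x. nexp (1 / Suc n * x) \<partial>K) \<longlonglongrightarrow> (\<integral>\<^sup>+x. 1 \<partial>K)"
    proof (rule nn_integral_dominated_convergence[where w = "\<lambda>_. 1"])
      show "AE x in K. (\<lambda>n. nexp (1 / Suc n * x)) \<longlonglongrightarrow> 1"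
      proof (rule AE_I2)
        fix x :: real
        have "(\<lambda>n. exp (- (1 / Suc n * x))) \<longlonglongrightarrow> exp (- (0 * x))"
          by (intro tendsto_intros LIMSEQ_Suc[OF lim_1_over_n])
        then show "(\<lambda>n. nexp (1 / Suc n * x)) \<longlonglongrightarrow> 1"
          using tendsto_ennrealI[of _ 1] by simp
      qed
      show "AE x in K. nexp (1 / Suc n * x) \<le> 1" for n
        using that(3) by eventually_elim (auto simp: divide_nonneg_nonneg)
      show "(\<integral>\<^sup>+x. 1 \<partial>K) < \<infinity>"
        by (simp add: K.emeasure_finite less_top[symmetric])
    qed auto
    then show ?thesis
      using sets_eq_imp_space_eq[OF that(2)] by simp
  qed
  have eq0: "emeasure M UNIV = emeasure N UNIV"
    using lim[OF fin(1) sets(1) nonneg(1)] lim[OF fin(2) sets(2) nonneg(2)]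
    unfolding lap[of "1 / Suc n" for n, OF divide_pos_pos[OF zero_less_one of_nat_0_less_iff[THEN iffD2, OF zero_less_Suc]]]
    by (rule LIMSEQ_unique)
  have bnd: "AE x in M. 0 \<le> exp (- x) \<and> exp (- x) \<le> 1" "AE x in N. 0 \<le> exp (- x) \<and> exp (- x) \<le> 1"
    using nonneg by (auto elim!: AE_mp)
  have pow: "(\<integral>x. exp (- x) ^ k \<partial>M) = (\<integral>x. exp (- x) ^ k \<partial>N)" for k :: nat
  proof -
    have "(\<integral>\<^sup>+x. ennreal (exp (- x) ^ k) \<partial>M) = (\<integral>\<^sup>+x. ennreal (exp (- x) ^ k) \<partial>N)"
    proof (cases "k = 0")
      case True
      then show ?thesis
        using eq0 sets_eq_imp_space_eq[OF sets(1)] sets_eq_imp_space_eq[OF sets(2)] by simp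
    next
      case False
      then show ?thesis
        using lap[of "real k"] by (simp add: exp_of_nat_mult[symmetric])
    qed
    then show ?thesis
      by (simp add: integral_eq_nn_integral)
  qed
  have int_pow: "integrable M (\<lambda>x. exp (- x) ^ k)" "integrable N (\<lambda>x. exp (- x) ^ k)" for k :: nat
    using bnd
    by (auto intro!: M.integrable_const_bound[where B=1] N.integrable_const_bound[where B=1]
        elim!: AE_mp simp: power_le_one)
  have cont: "(\<integral>x. f (exp (- x)) \<partial>M) = (\<integral>x. f (exp (- x)) \<partial>N)"
    if f: "continuous_on UNIV f" and f01: "\<And>x. 0 \<le> f x \<and> f x \<le> 1" for f :: "real \<Rightarrow> real"
  proof -
    have [measurable]: "f \<in> borel_measurable borel"
      using f by (rule borel_measurable_continuous_onI)
    define C where "C = measure M UNIV + measure N UNIV"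
    have C: "0 \<le> C" by (simp add: C_def)
    have "\<bar>(\<integral>x. f (exp (- x)) \<partial>M) - (\<integral>x. f (exp (- x)) \<partial>N)\<bar> \<le> e * C" if e: "0 < e" for e
    proof -
      obtain g where g: "real_polynomial_function g" "\<And>x. x \<in> {0..1} \<Longrightarrow> \<bar>f x - g x\<bar> < e"
        using Stone_Weierstrass_real_polynomial_function[of "{0..1}" f e] f e
        by (metis compact_Icc continuous_on_subset top_greatest)
      obtain a n where gs: "g = (\<lambda>x. \<Sum>i\<le>n. a i * x ^ i)"
        using g(1) unfolding real_polynomial_function_iff_sum by auto
      have geq: "(\<integral>x. g (exp (- x)) \<partial>M) = (\<integral>x. g (exp (- x)) \<partial>N)"
        unfolding gs by (simp add: int_pow pow)
      have D: "\<bar>(\<integral>x. f (exp (- x)) \<partial>K) - (\<integral>x. g (exp (- x)) \<partial>K)\<bar> \<le> e * measure K UNIV"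
        if "finite_measure K" "sets K = sets borel" "AE x in K. 0 \<le> exp (- x) \<and> exp (- x) \<le> 1"
          "\<And>k. integrable K (\<lambda>x. exp (- x) ^ k)" for K :: "real measure"
      proof -
        interpret K: finite_measure K by fact
        note [measurable_cong] = that(2)
        have i1: "integrable K (\<lambda>x. f (exp (- x)))"
          using f01 by (intro K.integrable_const_bound[where B=1]) auto
        have i2: "integrable K (\<lambda>x. g (exp (- x)))"
          unfolding gs using that(4) by simp
        have "\<bar>(\<integral>x. f (exp (- x)) \<partial>K) - (\<integral>x. g (exp (- x)) \<partial>K)\<bar> = \<bar>\<integral>x. f (exp (- x)) - g (exp (- x)) \<partial>K\<bar>"
          using i1 i2 by simp
        also have "\<dots> \<le> (\<integral>x. \<bar>f (exp (- x)) - g (exp (- x))\<bar> \<partial>K)"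
          by (rule integral_abs_bound)
        also have "\<dots> \<le> (\<integral>x. e \<partial>K)"
        proof (rule integral_mono_AE)
          show "AE x in K. \<bar>f (exp (- x)) - g (exp (- x))\<bar> \<le> e"
            using that(3) by eventually_elim (use g(2) in \<open>auto intro: less_imp_le\<close>)
        qed (use i1 i2 in auto)
        also have "\<dots> = e * measure K UNIV"
          using sets_eq_imp_space_eq[OF that(2)] by simp
        finally show ?thesis .
      qed
      show ?thesis
        using D[OF fin(1) sets(1) bnd(1) int_pow(1)] D[OF fin(2) sets(2) bnd(2) int_pow(2)] geq
        unfolding C_def by (simp add: algebra_simps)
    qed
    \<comment> \<open>The estimate is used with \<open>e / (C + 1)\<close>; adding 1 covers the case
      \<open>C = 0\<close>.\<close>
    then have "\<bar>(\<integral>x. f (exp (- x)) \<partial>M) - (\<integral>x. f (exp (- x)) \<partial>N)\<bar> \<le> e" if "0 < e" for e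
      using that C spec[of _ "e / (C + 1)"]
      by (smt (verit, best) divide_pos_pos mult_left_mono nonzero_mult_div_cancel_right times_divide_eq_left mult.commute)
    then show ?thesis
      by (meson abs_le_zero_iff dense_ge eq_iff_diff_eq_0)
  qed
  have cdf: "cdf M = cdf N"
  proof
    fix a :: real
    \<comment> \<open>Continuous functions of u that decrease to the indicator of u \<ge> exp (- a),
      that is, of x \<le> a: they are 1 there and have slope \<open>n\<close> just below the
      threshold.\<close>
    define f where "f n u = max 0 (1 - real n * max 0 (exp (- a) - u))" for n and u :: real
    have f01: "0 \<le> f n u \<and> f n u \<le> 1" for n u
      by (auto simp: f_def)
    have L: "(\<lambda>n. \<integral>x. f n (exp (- x)) \<partial>K) \<longlonglongrightarrow> cdf K a"
      if "finite_measure K" "sets K = sets borel" for K :: "real measure"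
    proof -
      interpret K: finite_measure K by fact
      note [measurable_cong] = that(2)
      have "(\<lambda>n. \<integral>x. f n (exp (- x)) \<partial>K) \<longlonglongrightarrow> (\<integral>x. indicator {..a} x \<partial>K)"
      proof (rule integral_dominated_convergence[where w = "\<lambda>_. 1"])
        show "AE x in K. (\<lambda>n. f n (exp (- x))) \<longlonglongrightarrow> indicator {..a} x"
        proof (rule AE_I2)
          fix x :: real
          show "(\<lambda>n. f n (exp (- x))) \<longlonglongrightarrow> indicator {..a} x"
          proof (cases "x \<le> a")
            case True
            then show ?thesis by (auto simp: f_def max_def)
          next
            case False
            define d where "d = exp (- a) - exp (- x)"
            have d: "0 < d" using False by (simp add: d_def)
            obtain n0 where n0: "1 < real n0 * d"
              using reals_Archimedean3[OF d] by blast
            have "f n (exp (- x)) = 0" if "n0 \<le> n" for n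
            proof -
              have "real n0 * d \<le> real n * d"
                using that d by (intro mult_right_mono) auto
              then have "1 < real n * d" using n0 by simp
              then show ?thesis
                using d n0 by (simp add: f_def d_def[symmetric] max_def)
            qed
            then have "eventually (\<lambda>n. f n (exp (- x)) = 0) sequentially"
              by (auto simp: eventually_sequentially)
            then show ?thesis
              using False by (auto intro: tendsto_eventually)
          qed
        qed
        show "AE x in K. norm (f n (exp (- x))) \<le> 1" for n
          using f01 by auto
      qed (auto simp: f_def)
      then show ?thesis
        by (simp add: cdf_def)
    qed
    have "(\<integral>x. f n (exp (- x)) \<partial>M) = (\<integral>x. f n (exp (- x)) \<partial>N)" for n
      using f01 by (intro cont) (auto simp: f_def intro!: continuous_intros)
    then show "cdf M a = cdf N a"
      using L[OF fin(1) sets(1)] L[OF fin(2) sets(2)] LIMSEQ_unique by auto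
  qed
  show ?thesis
    using sets_eq_imp_space_eq[OF sets(1)] sets_eq_imp_space_eq[OF sets(2)]
    by (intro cdf_unique' cdf) (auto simp: finite_borel_measure_def finite_borel_measure_axioms_def fin sets)
qed

text \<open>One coordinate at a time: the factors below \<open>j\<close> are already indicators.\<close>

lemma laplace_prod_indicator:
  fixes V V' :: "nat \<Rightarrow> _ \<Rightarrow> real"
  assumes fin: "finite_measure M" "finite_measure N"
    and [measurable]: "\<And>i. i < n \<Longrightarrow> V i \<in> borel_measurable M" "\<And>i. i < n \<Longrightarrow> V' i \<in> borel_measurable N"
    and nonneg: "\<And>i. i < n \<Longrightarrow> AE x in M. 0 \<le> V i x" "\<And>i. i < n \<Longrightarrow> AE x in N. 0 \<le> V' i x"
    and lap: "\<And>a. (\<And>i. i < n \<Longrightarrow> 0 < a i) \<Longrightarrow>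
      (\<integral>\<^sup>+x. (\<Prod>i<n. nexp (a i * V i x)) \<partial>M) = (\<integral>\<^sup>+x. (\<Prod>i<n. nexp (a i * V' i x)) \<partial>N)"
    and "j \<le> n" "\<And>i. i < j \<Longrightarrow> A i \<in> sets borel" "\<And>i. j \<le> i \<Longrightarrow> i < n \<Longrightarrow> 0 < a i"
  shows "(\<integral>\<^sup>+x. (\<Prod>i<n. if i < j then indicator (A i) (V i x) else nexp (a i * V i x)) \<partial>M) =
    (\<integral>\<^sup>+x. (\<Prod>i<n. if i < j then indicator (A i) (V' i x) else nexp (a i * V' i x)) \<partial>N)"
  using assms(8-10)
proof (induction j arbitrary: a)
  case 0
  then show ?case using lap by simp
next
  case (Suc j)
  \<comment> \<open>The product over the other coordinates serves as a density, so that
    \<open>laplace_unique\<close> applies to the single coordinate \<open>j\<close>. Being at most 1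
    almost everywhere, it keeps the weighted measure finite.\<close>
  define rest where "rest w = (\<Prod>i\<in>{..<n} - {j}. if i < j then indicator (A i) (w i)
    else nexp (a i * w i))" for w :: "nat \<Rightarrow> real"
  have [measurable]: "(\<lambda>x. rest (\<lambda>i. V i x)) \<in> borel_measurable M" "(\<lambda>x. rest (\<lambda>i. V' i x)) \<in> borel_measurable N"
    unfolding rest_def
  proof -
    have "(\<lambda>x. if i < j then indicator (A i) (V i x) else nexp (a i * V i x)) \<in> borel_measurable M"
      "(\<lambda>x. if i < j then indicator (A i) (V' i x) else nexp (a i * V' i x)) \<in> borel_measurable N"
      if i: "i \<in> {..<n} - {j}" for i
    proof -
      have [measurable]: "V i \<in> borel_measurable M" "V' i \<in> borel_measurable N" "i < j \<Longrightarrow> A i \<in> sets borel"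
        using i Suc.prems by auto
      show "(\<lambda>x. if i < j then indicator (A i) (V i x) else nexp (a i * V i x)) \<in> borel_measurable M"
        "(\<lambda>x. if i < j then indicator (A i) (V' i x) else nexp (a i * V' i x)) \<in> borel_measurable N"
        by (cases "i < j"; simp)+
    qed
    then show "(\<lambda>x. \<Prod>i\<in>{..<n} - {j}. if i < j then indicator (A i) (V i x) else nexp (a i * V i x)) \<in> borel_measurable M"
      "(\<lambda>x. \<Prod>i\<in>{..<n} - {j}. if i < j then indicator (A i) (V' i x) else nexp (a i * V' i x)) \<in> borel_measurable N"
      by (auto intro: borel_measurable_prod_ennreal)
  qed
  have jn: "j < n" using Suc.prems by simp
  have rest_le: "AE x in M. rest (\<lambda>i. V i x) \<le> 1" "AE x in N. rest (\<lambda>i. V' i x) \<le> 1"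
  proof -
    have "AE x in M. \<forall>i\<in>{..<n}. 0 \<le> V i x" "AE x in N. \<forall>i\<in>{..<n}. 0 \<le> V' i x"
      using nonneg by (auto intro!: AE_finite_allI)
    moreover have "rest w \<le> 1" if "\<forall>i\<in>{..<n}. 0 \<le> w i" for w
      using that Suc.prems unfolding rest_def
      by (intro prod_le_1) (auto simp: indicator_def less_imp_le mult_nonneg_nonneg)
    ultimately show "AE x in M. rest (\<lambda>i. V i x) \<le> 1" "AE x in N. rest (\<lambda>i. V' i x) \<le> 1"
      by (auto elim!: AE_mp)
  qed
  define K where "K = distr (density M (\<lambda>x. rest (\<lambda>i. V i x))) borel (V j)"
  define L where "L = distr (density N (\<lambda>x. rest (\<lambda>i. V' i x))) borel (V' j)"
  have eqM: "(\<integral>\<^sup>+x. f x \<partial>K) = (\<integral>\<^sup>+x. f (V j x) * rest (\<lambda>i. V i x) \<partial>M)" if [measurable]: "f \<in> borel_measurable borel" for f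
    unfolding K_def using jn by (simp add: nn_integral_distr, subst nn_integral_density) (auto simp: mult.commute)
  have eqN: "(\<integral>\<^sup>+x. f x \<partial>L) = (\<integral>\<^sup>+x. f (V' j x) * rest (\<lambda>i. V' i x) \<partial>N)" if [measurable]: "f \<in> borel_measurable borel" for f
    unfolding L_def using jn by (simp add: nn_integral_distr, subst nn_integral_density) (auto simp: mult.commute)
  have "K = L"
  proof (rule laplace_unique)
    have "emeasure K UNIV \<le> (\<integral>\<^sup>+x. 1 \<partial>M)"
      using eqM[of "\<lambda>_. 1"] nn_integral_mono_AE[OF rest_le(1)] by (simp add: K_def)
    then show "finite_measure K"
      using finite_measure.emeasure_finite[OF fin(1), of "space M"]
      by (intro finite_measureI) (auto simp: K_def top_unique)
    have "emeasure L UNIV \<le> (\<integral>\<^sup>+x. 1 \<partial>N)"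
      using eqN[of "\<lambda>_. 1"] nn_integral_mono_AE[OF rest_le(2)] by (simp add: L_def)
    then show "finite_measure L"
      using finite_measure.emeasure_finite[OF fin(2), of "space N"]
      by (intro finite_measureI) (auto simp: L_def top_unique)
    show "AE x in K. 0 \<le> x" "AE x in L. 0 \<le> x"
      unfolding K_def L_def using nonneg[OF jn] jn
      by (simp_all add: AE_distr_iff, subst AE_density, simp, force elim: AE_mp, subst AE_density, simp, force elim: AE_mp)
    fix b :: real assume b: "0 < b"
    define a' where "a' = a(j := b)"
    have IH: "(\<integral>\<^sup>+x. (\<Prod>i<n. if i < j then indicator (A i) (V i x) else nexp (a' i * V i x)) \<partial>M) =
      (\<integral>\<^sup>+x. (\<Prod>i<n. if i < j then indicator (A i) (V' i x) else nexp (a' i * V' i x)) \<partial>N)"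
      using Suc.prems b by (intro Suc.IH) (auto simp: a'_def)
    have split: "(\<Prod>i<n. if i < j then indicator (A i) (w i) else nexp (a' i * w i)) =
       nexp (b * w j) * rest w" for w
      unfolding rest_def using jn
      by (subst prod.remove[of _ j]) (auto simp: a'_def intro!: arg_cong2[where f="(*)"] prod.cong[OF refl] split: if_splits)
    show "(\<integral>\<^sup>+x. nexp (b * x) \<partial>K) = (\<integral>\<^sup>+x. nexp (b * x) \<partial>L)"
      using IH unfolding split[of "\<lambda>i. V i x" for x] split[of "\<lambda>i. V' i x" for x] by (simp add: eqM eqN)
  qed (auto simp: K_def L_def)
  then have "emeasure K (A j) = emeasure L (A j)" by simp
  then have "(\<integral>\<^sup>+x. indicator (A j) (V j x) * rest (\<lambda>i. V i x) \<partial>M) = (\<integral>\<^sup>+x. indicator (A j) (V' j x) * rest (\<lambda>i. V' i x) \<partial>N)"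
    using Suc.prems(2)[of j] eqM[of "indicator (A j)"] eqN[of "indicator (A j)"]
    by (simp add: K_def L_def)
  moreover have "(\<Prod>i<n. if i < Suc j then indicator (A i) (w i) else nexp (a i * w i)) =
       indicator (A j) (w j) * rest w" for w
    unfolding rest_def using jn
    by (subst prod.remove[of _ j]) (auto simp: less_Suc_eq intro!: arg_cong2[where f="(*)"] prod.cong[OF refl] split: if_splits)
  ultimately show ?case by simp
qed

text \<open>Once all \<open>n\<close> factors are indicators, the integrals are the masses of boxes,
  and these determine a finite measure on the product.\<close>

lemma laplace_vector_unique:
  fixes V V' :: "nat \<Rightarrow> _ \<Rightarrow> real"
  assumes fin: "finite_measure M" "finite_measure N"
    and [measurable]: "\<And>i. i < n \<Longrightarrow> V i \<in> borel_measurable M" "\<And>i. i < n \<Longrightarrow> V' i \<in> borel_measurable N"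
    and nonneg: "\<And>i. i < n \<Longrightarrow> AE x in M. 0 \<le> V i x" "\<And>i. i < n \<Longrightarrow> AE x in N. 0 \<le> V' i x"
    and lap: "\<And>a. (\<And>i. i < n \<Longrightarrow> 0 < a i) \<Longrightarrow>
      (\<integral>\<^sup>+x. (\<Prod>i<n. nexp (a i * V i x)) \<partial>M) = (\<integral>\<^sup>+x. (\<Prod>i<n. nexp (a i * V' i x)) \<partial>N)"
  shows "distr M (PiM {..<n} (\<lambda>_. borel)) (\<lambda>x. \<lambda>i\<in>{..<n}. V i x) = distr N (PiM {..<n} (\<lambda>_. borel)) (\<lambda>x. \<lambda>i\<in>{..<n}. V' i x)"
    (is "?K = ?L")
proof (rule measure_eqI_PiM_infinite)
  have eq: "emeasure ?K (Pi\<^sub>E {..<n} A) = emeasure ?L (Pi\<^sub>E {..<n} A)"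
    if A: "\<And>i. i < n \<Longrightarrow> A i \<in> sets borel" for A
  proof -
    have *: "(\<integral>\<^sup>+x. (\<Prod>i<n. indicator (A i) (V i x)) \<partial>M) = (\<integral>\<^sup>+x. (\<Prod>i<n. indicator (A i) (V' i x)) \<partial>N)"
      using laplace_prod_indicator[OF assms, of n A "\<lambda>_. 1"] A by simp
    have [measurable]: "Pi\<^sub>E {..<n} A \<in> sets (PiM {..<n} (\<lambda>_. borel))"
      using A by (intro sets_PiM_I_finite) auto
    have ind: "(\<Prod>i<n. indicator (A i) (f i) :: ennreal) = indicator (Pi\<^sub>E {..<n} A) (\<lambda>i\<in>{..<n}. f i)" for f :: "nat \<Rightarrow> real"
      by (auto simp: indicator_def prod_eq_1_iff PiE_iff intro!: prod_zero split: if_splits)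
    have "emeasure ?K (Pi\<^sub>E {..<n} A) = (\<integral>\<^sup>+x. indicator (Pi\<^sub>E {..<n} A) (\<lambda>i\<in>{..<n}. V i x) \<partial>M)"
      by (subst nn_integral_indicator[symmetric], simp, subst nn_integral_distr) auto
    also have "\<dots> = (\<integral>\<^sup>+x. indicator (Pi\<^sub>E {..<n} A) (\<lambda>i\<in>{..<n}. V' i x) \<partial>N)"
      using * unfolding ind .
    also have "\<dots> = emeasure ?L (Pi\<^sub>E {..<n} A)"
      by (subst nn_integral_indicator[symmetric], simp, subst nn_integral_distr) auto
    finally show ?thesis .
  qed
  show "emeasure ?K (prod_emb {..<n} (\<lambda>_. borel) J (Pi\<^sub>E J A)) = emeasure ?L (prod_emb {..<n} (\<lambda>_. borel) J (Pi\<^sub>E J A))"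
    if "finite J" "J \<subseteq> {..<n}" "\<And>i. i \<in> J \<Longrightarrow> A i \<in> sets borel" for A J
    using that by (subst (1 2) prod_emb_Pi) (auto intro!: eq simp: prod_emb_Pi)
  interpret finite_measure M by fact
  show "finite_measure ?K"
    by (rule finite_measure_distr) auto
qed auto

section \<open>Finite-dimensional distributions and skeletons\<close>

lemma Nbar_cases: "y \<in> Nbar \<longleftrightarrow> y = \<infinity> \<or> (\<exists>n\<ge>1. y = enat n)"
  by (cases y) (auto simp: Nbar_def one_enat_def)

lemma infty_Nbar [simp]: "\<infinity> \<in> Nbar"
  by (simp add: Nbar_cases)

lemma enat_Nbar [simp]: "enat n \<in> Nbar \<longleftrightarrow> 1 \<le> n"
  by (auto simp: Nbar_cases)

lemma enat_Nstar [simp]: "enat n \<in> Nstar \<longleftrightarrow> 1 \<le> n"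
  by (auto simp: Nstar_def one_enat_def)

lemma pred_count_space_eq:
  assumes "f \<in> M \<rightarrow>\<^sub>M count_space A"
  shows "Measurable.pred M (\<lambda>\<omega>. f \<omega> = z)"
  using measurable_compose[OF assms, of "\<lambda>w. w = z" "count_space UNIV"] by simp

lemma space_path_space: "space path_space = (\<Pi>\<^sub>E t\<in>{0..}. Nbar)"
  by (simp add: path_space_def space_PiM)

lemma measurable_path_space_eval [measurable]:
  "0 \<le> t \<Longrightarrow> (\<lambda>f. f t) \<in> path_space \<rightarrow>\<^sub>M count_space Nbar"
  unfolding path_space_def by (rule measurable_component_singleton) simp

text \<open>The empty set is added for stability under intersection: two cylinders that prescribe
  different states at a common time are disjoint.\<close>

definition finite_cylinders :: "(real \<Rightarrow> enat) set set" where
  "finite_cylinders = insert {} {{f \<in> space path_space. \<forall>t\<in>J. f t = enat (x t)} | J x.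
    finite J \<and> J \<subseteq> {0..} \<and> (\<forall>t\<in>J. 1 \<le> x t)}"

lemma finite_cylindersI:
  "finite J \<Longrightarrow> J \<subseteq> {0..} \<Longrightarrow> (\<And>t. t \<in> J \<Longrightarrow> 1 \<le> x t) \<Longrightarrow>
    {f \<in> space path_space. \<forall>t\<in>J. f t = enat (x t)} \<in> finite_cylinders"
  unfolding finite_cylinders_def by blast

lemma Int_stable_finite_cylinders: "Int_stable finite_cylinders"
proof (rule Int_stableI)
  fix a b assume ab: "a \<in> finite_cylinders" "b \<in> finite_cylinders"
  show "a \<inter> b \<in> finite_cylinders"
  proof (cases "a = {} \<or> b = {}")
    case True
    then show ?thesis by (auto simp: finite_cylinders_def)
  next
    case False
    then obtain J x K z where J: "finite J" "J \<subseteq> {0..}" "\<forall>t\<in>J. 1 \<le> x t"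
      and a: "a = {f \<in> space path_space. \<forall>t\<in>J. f t = enat (x t)}"
      and K: "finite K" "K \<subseteq> {0..}" "\<forall>t\<in>K. 1 \<le> z t"
      and b: "b = {f \<in> space path_space. \<forall>t\<in>K. f t = enat (z t)}"
      using ab unfolding finite_cylinders_def by blast
    show ?thesis
    proof (cases "\<forall>t\<in>J \<inter> K. x t = z t")
      case True
      have "a \<inter> b = {f \<in> space path_space. \<forall>t\<in>J \<union> K. f t = enat (if t \<in> J then x t else z t)}"
        unfolding a b using True by auto
      moreover have "\<dots> \<in> finite_cylinders"
        using J K by (intro finite_cylindersI) auto
      ultimately show ?thesis by simp
    next
      case False
      then have "a \<inter> b = {}" unfolding a b by auto
      then show ?thesis by (simp add: finite_cylinders_def)
    qed
  qed
qed

lemma sets_path_space_finite_cylinders: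
  "sets path_space = sigma_sets (space path_space) finite_cylinders"
proof (rule antisym)
  have sub: "finite_cylinders \<subseteq> sets path_space"
  proof
    fix a assume a: "a \<in> finite_cylinders"
    show "a \<in> sets path_space"
    proof (cases "a = {}")
      case False
      then obtain J x where J: "finite J" "J \<subseteq> {0..}"
        and eq: "a = {f \<in> space path_space. \<forall>t\<in>J. f t = enat (x t)}"
        using a unfolding finite_cylinders_def by blast
      have "{f \<in> space path_space. f t = enat (x t)} \<in> sets path_space" if "t \<in> J" for t
      proof -
        have "Measurable.pred path_space (\<lambda>f. f t = enat (x t))"
          using J that by (intro pred_count_space_eq[where A=Nbar] measurable_path_space_eval) auto
        then show ?thesis by (simp add: pred_def)
      qed
      then show ?thesis
        unfolding eq using J by (cases "J = {}") (auto intro!: sets.sets_Collect_finite_All')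
    qed simp
  qed
  then show "sigma_sets (space path_space) finite_cylinders \<subseteq> sets path_space"
    by (rule sets.sigma_sets_subset)
  interpret sigma_algebra "space path_space" "sigma_sets (space path_space) finite_cylinders"
    using sub sets.space_closed by (intro sigma_algebra_sigma_sets) auto
  show "sets path_space \<subseteq> sigma_sets (space path_space) finite_cylinders"
  proof -
    have "sets path_space = sigma_sets (space path_space) {{f \<in> \<Pi>\<^sub>E i\<in>{0..}. space (count_space Nbar). f i \<in> A} |i A.
      i \<in> {0..} \<and> A \<in> sets (count_space Nbar)}"
      unfolding path_space_def sets_PiM_single space_PiM by simp
    also have "\<dots> \<subseteq> sigma_sets (space path_space) finite_cylinders"
  proof (intro sigma_sets_subset subsetI, elim CollectE exE conjE, hypsubst)
    fix t :: real and A :: "enat set" assume t: "t \<in> {0..}" and A: "A \<in> sets (count_space Nbar)"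
    define S :: "enat \<Rightarrow> (real \<Rightarrow> enat) set" where "S z = {f \<in> space path_space. f t = z}" for z
    have S: "S (enat n) \<in> sigma_sets (space path_space) finite_cylinders" if "1 \<le> n" for n
      using finite_cylindersI[of "{t}" "\<lambda>_. n"] t that unfolding S_def by (intro sigma_sets.Basic) auto
    have Sinf: "S \<infinity> \<in> sigma_sets (space path_space) finite_cylinders"
    proof -
      have "S \<infinity> = space path_space - (\<Union>n\<in>{1..}. S (enat n))"
      proof -
        have "f t \<in> Nbar" if "f \<in> space path_space" for f
          using that t unfolding space_path_space by (auto dest: PiE_mem)
        then show ?thesis
          unfolding S_def by (force simp: Nbar_cases)
      qed
      then show ?thesis using S by (auto intro!: countable_UN')
    qed
    have "{f \<in> \<Pi>\<^sub>E i\<in>{0..}. space (count_space Nbar). f t \<in> A} = (\<Union>z\<in>A. S z)"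
      unfolding S_def space_path_space by auto
    moreover have "(\<Union>z\<in>A. S z) \<in> sigma_sets (space path_space) finite_cylinders"
    proof (rule countable_UN')
      show "countable A" by simp
      show "S ` A \<subseteq> sigma_sets (space path_space) finite_cylinders"
        using A S Sinf by (auto simp: Nbar_cases subset_iff)
    qed
    ultimately show "{f \<in> \<Pi>\<^sub>E i\<in>{0..}. space (count_space Nbar). f t \<in> A} \<in>
        sigma_sets (space path_space) finite_cylinders"
      by simp
  qed
  finally show ?thesis .
  qed
qed

text \<open>Visits to \<open>\<infinity>\<close> need not be tested, being the complement of countably many other events.\<close>

lemma distr_path_space_eqI:
  assumes "prob_space M" "prob_space M'"
    and F [measurable]: "F \<in> M \<rightarrow>\<^sub>M path_space" "F' \<in> M' \<rightarrow>\<^sub>M path_space"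
    and eq: "\<And>J x. finite J \<Longrightarrow> J \<subseteq> {0..} \<Longrightarrow> (\<And>t. t \<in> J \<Longrightarrow> 1 \<le> x t) \<Longrightarrow>
      emeasure M {\<omega> \<in> space M. \<forall>t\<in>J. F \<omega> t = enat (x t)} = emeasure M' {\<omega> \<in> space M'. \<forall>t\<in>J. F' \<omega> t = enat (x t)}"
  shows "distr M path_space F = distr M' path_space F'"
proof (rule measure_eqI_generator_eq[OF Int_stable_finite_cylinders])
  interpret M: prob_space M by fact
  show "finite_cylinders \<subseteq> Pow (space path_space)"
    by (auto simp: finite_cylinders_def)
  fix X assume X: "X \<in> finite_cylinders"
  show "emeasure (distr M path_space F) X = emeasure (distr M' path_space F') X"
  proof (cases "X = {}")
    case False
    then obtain J x where J: "finite J" "J \<subseteq> {0..}" "\<forall>t\<in>J. 1 \<le> x t"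
      and eqX: "X = {f \<in> space path_space. \<forall>t\<in>J. f t = enat (x t)}"
      using X unfolding finite_cylinders_def by blast
    have sX: "X \<in> sets path_space"
      using X unfolding sets_path_space_finite_cylinders by (rule sigma_sets.Basic)
    have "F -` X \<inter> space M = {\<omega> \<in> space M. \<forall>t\<in>J. F \<omega> t = enat (x t)}"
      "F' -` X \<inter> space M' = {\<omega> \<in> space M'. \<forall>t\<in>J. F' \<omega> t = enat (x t)}"
      unfolding eqX using measurable_space[OF F(1)] measurable_space[OF F(2)] by auto
    then show ?thesis
      using eq[of J x] J sX by (simp add: emeasure_distr)
  qed simp
next
  show "range (\<lambda>_::nat. space path_space) \<subseteq> finite_cylinders"
    using finite_cylindersI[of "{}"] by auto
  show "emeasure (distr M path_space F) (space path_space) \<noteq> \<infinity>" for i :: nat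
    using prob_space.emeasure_space_1[OF prob_space.prob_space_distr[OF assms(1) F(1)]] by simp
qed (auto simp: sets_path_space_finite_cylinders)

section \<open>Skeletons of paths and the finite-dimensional distributions they determine\<close>

text \<open>
  The alternation of a path with respect to a finite set \<open>B\<close> of states: it stays at \<open>y\<close> for \<open>V 0\<close>,
  then off \<open>B\<close> for \<open>V (2 i + 1)\<close> and at the state \<open>U i\<close> of \<open>B\<close> for \<open>V (2 i + 2)\<close>, \<open>i = 0, 1, \<dots>\<close>
\<close>

definition skel_at :: "enat \<Rightarrow> nat set \<Rightarrow> (nat \<Rightarrow> nat) \<Rightarrow> (nat \<Rightarrow> real) \<Rightarrow> real \<Rightarrow> nat \<Rightarrow> bool" where
  "skel_at y I u v t x \<longleftrightarrow> (enat x = y \<and> t < v 0) \<or>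
    (\<exists>i\<in>I. u i = x \<and> (\<Sum>j<2*i+2. v j) \<le> t \<and> t < (\<Sum>j<2*i+3. v j))"

text \<open>\<open>K\<close> collects the indices at which \<open>v\<close> is measurable: all of
  them for the durations of a process, only finitely many for coordinates on a finite product
  space.\<close>

lemma pred_skel_at:
  assumes "countable I" "\<And>i. i \<in> I \<Longrightarrow> u i \<in> M \<rightarrow>\<^sub>M count_space UNIV"
    and v: "\<And>j. j \<in> K \<Longrightarrow> v j \<in> borel_measurable M" "0 \<in> K" "\<And>i. i \<in> I \<Longrightarrow> {..<2*i+3} \<subseteq> K"
  shows "Measurable.pred M (\<lambda>\<omega>. skel_at y I (\<lambda>i. u i \<omega>) (\<lambda>i. v i \<omega>) t x)"
proof -
  have [measurable]: "v 0 \<in> borel_measurable M"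
    using v by auto
  have "Measurable.pred M (\<lambda>\<omega>. u i \<omega> = x \<and> (\<Sum>j<2*i+2. v j \<omega>) \<le> t \<and> t < (\<Sum>j<2*i+3. v j \<omega>))" if i: "i \<in> I" for i
  proof -
    have [measurable]: "u i \<in> M \<rightarrow>\<^sub>M count_space UNIV"
      using assms(2) i by auto
    have "{..<2*i+2} \<subseteq> K"
      using v(3)[OF i] by auto
    then have [measurable]: "(\<lambda>\<omega>. \<Sum>j<2*i+2. v j \<omega>) \<in> borel_measurable M" "(\<lambda>\<omega>. \<Sum>j<2*i+3. v j \<omega>) \<in> borel_measurable M"
      using v(3)[OF i] by (auto intro!: borel_measurable_sum v(1) simp del: sum.lessThan_Suc)
    show ?thesis by measurable
  qed
  then have [measurable]: "Measurable.pred M (\<lambda>\<omega>. \<exists>i\<in>I. u i \<omega> = x \<and> (\<Sum>j<2*i+2. v j \<omega>) \<le> t \<and> t < (\<Sum>j<2*i+3. v j \<omega>))"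
    by (intro measurable_pred_countable(2) assms(1))
  show ?thesis
    unfolding skel_at_def by measurable
qed

text \<open>The number of durations up to the end of the \<open>m\<close>-th visit to
  \<open>B\<close>: the initial one and two for each visit.\<close>

definition dim :: "nat \<Rightarrow> nat" where
  "dim m = 2 * m + 1"

text \<open>The transform \<open>L\<close> is a parameter, so that two processes are compared by
  interpreting the locale twice with the same \<open>y\<close>, \<open>B\<close> and
  \<open>L\<close>. The visited states enter the transform through indicators because the durations
  may depend on them.\<close>

locale skeleton = prob_space M for M :: "'a measure" +
  fixes y :: enat and B :: "nat set" and L :: "nat \<Rightarrow> (nat \<Rightarrow> real) \<Rightarrow> (nat \<Rightarrow> nat) \<Rightarrow> ennreal"
    and V :: "nat \<Rightarrow> 'a \<Rightarrow> real" and U :: "nat \<Rightarrow> 'a \<Rightarrow> nat" and Z :: "real \<Rightarrow> 'a \<Rightarrow> enat"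
  assumes finB: "finite B"
    and V_meas [measurable]: "\<And>i. V i \<in> borel_measurable M"
    and U_meas [measurable]: "\<And>i. U i \<in> M \<rightarrow>\<^sub>M count_space UNIV"
    and V_nonneg: "\<And>i. AE \<omega> in M. 0 \<le> V i \<omega>"
    and U_B: "\<And>i. AE \<omega> in M. U i \<omega> \<in> B"
    and Z_meas: "\<And>t. 0 \<le> t \<Longrightarrow> Z t \<in> M \<rightarrow>\<^sub>M count_space Nbar"
    and Z_skel: "AE \<omega> in M. \<forall>t\<ge>0. \<forall>x\<in>B. Z t \<omega> = enat x \<longleftrightarrow> skel_at y UNIV (\<lambda>i. U i \<omega>) (\<lambda>i. V i \<omega>) t x"
    and V_lap: "\<And>m a x. (\<And>i. 0 < a i) \<Longrightarrow> (\<And>i. x i \<in> B) \<Longrightarrow>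
      (\<integral>\<^sup>+\<omega>. (\<Prod>i<dim m. nexp (a i * V i \<omega>)) * (\<Prod>i<m. indicator {x i} (U i \<omega>)) \<partial>M) = L m a x"
begin

text \<open>The joint law of the durations on the event that the first \<open>m\<close> visited
  states are \<open>u\<close>; its total mass is the probability of this event.\<close>

definition law :: "nat \<Rightarrow> (nat \<Rightarrow> nat) \<Rightarrow> (nat \<Rightarrow> real) measure" where
  "law m u = distr (density M (\<lambda>\<omega>. \<Prod>i<m. indicator {u i} (U i \<omega>))) (PiM {..<dim m} (\<lambda>_. borel)) (\<lambda>\<omega>. \<lambda>i\<in>{..<dim m}. V i \<omega>)"

definition event :: "nat \<Rightarrow> real set \<Rightarrow> (real \<Rightarrow> nat) \<Rightarrow> (nat \<Rightarrow> nat) \<Rightarrow> (nat \<Rightarrow> real) set" where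
  "event m J x u = {v \<in> space (PiM {..<dim m} (\<lambda>_. borel)). \<forall>t\<in>J. skel_at y {..<m} u v t (x t)}"

lemma skel_at_restrict:
  assumes "\<And>i. i < m \<Longrightarrow> u i = u' i" "\<And>i. i < dim m \<Longrightarrow> v i = v' i"
  shows "skel_at y {..<m} u v t x = skel_at y {..<m} u' v' t x"
proof -
  have *: "(\<Sum>j<2*i+2. v j) = (\<Sum>j<2*i+2. v' j)" "(\<Sum>j<2*i+3. v j) = (\<Sum>j<2*i+3. v' j)" if "i < m" for i
    by (rule sum.cong[OF refl], rule assms(2), use that in \<open>simp add: dim_def\<close>)+
  have 0: "v 0 = v' 0"
    by (rule assms(2)) (simp add: dim_def)
  show ?thesis
    unfolding skel_at_def 0
    by (intro arg_cong2[where f="(\<or>)"] refl bex_cong) (simp only: lessThan_iff * assms(1))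
qed

lemma event_sets [measurable]:
  assumes "finite J" shows "event m J x u \<in> sets (PiM {..<dim m} (\<lambda>_. borel))"
proof -
  have "Measurable.pred (PiM {..<dim m} (\<lambda>_. borel)) (\<lambda>v. skel_at y {..<m} u v t (x t))" for t
    by (rule pred_skel_at[where K="{..<dim m}"]) (auto simp: dim_def)
  then show ?thesis
    unfolding event_def using assms by (cases "J = {}") (auto simp: pred_def intro!: sets.sets_Collect_finite_All')
qed

lemma skel_sets:
  assumes "finite J" "countable I"
  shows "{\<omega> \<in> space M. \<forall>t\<in>J. skel_at y I (\<lambda>i. U i \<omega>) (\<lambda>i. V i \<omega>) t (x t)} \<in> sets M"
proof -
  have "Measurable.pred M (\<lambda>\<omega>. skel_at y I (\<lambda>i. U i \<omega>) (\<lambda>i. V i \<omega>) t (x t))" for t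
    using assms(2) by (intro pred_skel_at[where K=UNIV]) auto
  then show ?thesis
    using assms by (cases "J = {}") (auto simp: pred_def intro!: sets.sets_Collect_finite_All')
qed

lemma prod_indicator [measurable]:
  "(\<lambda>\<omega>. \<Prod>i<m. indicator {u i} (U i \<omega>) :: ennreal) \<in> borel_measurable M"
proof (rule borel_measurable_prod_ennreal)
  fix i
  show "(\<lambda>\<omega>. indicator {u i} (U i \<omega>) :: ennreal) \<in> borel_measurable M"
    by (rule measurable_compose[OF U_meas]) simp
qed

text \<open>As \<open>B\<close> is finite, the first \<open>m\<close> visited states take finitely
  many values, and with these fixed the event concerns the durations alone.\<close>

lemma emeasure_upto:
  assumes J: "finite J"
  shows "emeasure M {\<omega> \<in> space M. \<forall>t\<in>J. skel_at y {..<m} (\<lambda>i. U i \<omega>) (\<lambda>i. V i \<omega>) t (x t)} =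
    (\<Sum>u\<in>PiE {..<m} (\<lambda>_. B). emeasure (law m u) (event m J x u))"
proof -
  let ?W = "\<lambda>\<omega>. \<lambda>i\<in>{..<dim m}. V i \<omega>"
  have [measurable]: "?W \<in> M \<rightarrow>\<^sub>M PiM {..<dim m} (\<lambda>_. borel)"
    by (rule measurable_restrict) simp
  have fin: "finite (PiE {..<m} (\<lambda>_. B))"
    using finB by (intro finite_PiE) auto
  have law: "emeasure (law m u) (event m J x u) =
      (\<integral>\<^sup>+\<omega>. (\<Prod>i<m. indicator {u i} (U i \<omega>)) * indicator (event m J x u) (?W \<omega>) \<partial>M)" for u
    unfolding law_def using event_sets[OF J, of m x u]
    by (subst emeasure_distr, simp, simp, subst emeasure_density)
      (auto intro!: nn_integral_cong split: split_indicator)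
  have pt: "indicator {\<omega> \<in> space M. \<forall>t\<in>J. skel_at y {..<m} (\<lambda>i. U i \<omega>) (\<lambda>i. V i \<omega>) t (x t)} \<omega> =
     (\<Sum>u\<in>PiE {..<m} (\<lambda>_. B). (\<Prod>i<m. indicator {u i} (U i \<omega>)) * indicator (event m J x u) (?W \<omega>) :: ennreal)"
    if \<omega>: "\<omega> \<in> space M" "\<forall>i\<in>{..<m}. U i \<omega> \<in> B" for \<omega>
  proof -
    let ?u = "\<lambda>i\<in>{..<m}. U i \<omega>"
    have u: "?u \<in> PiE {..<m} (\<lambda>_. B)" using \<omega> by auto
    \<comment> \<open>Exactly one sequence \<open>u\<close> matches the states actually
      visited.\<close>
    have "(\<Sum>u\<in>PiE {..<m} (\<lambda>_. B). (\<Prod>i<m. indicator {u i} (U i \<omega>)) * indicator (event m J x u) (?W \<omega>) :: ennreal) =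
      (\<Sum>u\<in>{?u}. (\<Prod>i<m. indicator {u i} (U i \<omega>)) * indicator (event m J x u) (?W \<omega>))"
    proof (intro sum.mono_neutral_right fin ballI)
      fix u assume u: "u \<in> PiE {..<m} (\<lambda>_. B) - {?u}"
      have "\<exists>i<m. u i \<noteq> U i \<omega>"
      proof (rule ccontr)
        assume "\<not> (\<exists>i<m. u i \<noteq> U i \<omega>)"
        then have eq: "u i = U i \<omega>" if "i < m" for i
          using that by blast
        have "u = ?u"
        proof
          fix i
          show "u i = ?u i"
            using eq[of i] PiE_arb[OF DiffD1[OF u], of i] by (cases "i < m") simp_all
        qed
        then show False using u by simp
      qed
      then obtain i where i: "i < m" "U i \<omega> \<noteq> u i"
        by metis
      have "(\<Prod>i<m. indicator {u i} (U i \<omega>)) = (0::ennreal)"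
        by (rule prod_zero) (use i in \<open>auto intro!: bexI[of _ i]\<close>)
      then show "(\<Prod>i<m. indicator {u i} (U i \<omega>)) * indicator (event m J x u) (?W \<omega>) = (0::ennreal)"
        by simp
    qed (use u in auto)
    also have "\<dots> = indicator (event m J x ?u) (?W \<omega>)"
      by simp
    also have "\<dots> = indicator {\<omega> \<in> space M. \<forall>t\<in>J. skel_at y {..<m} (\<lambda>i. U i \<omega>) (\<lambda>i. V i \<omega>) t (x t)} \<omega>"
      using \<omega>(1) skel_at_restrict[of m ?u "\<lambda>i. U i \<omega>" "?W \<omega>" "\<lambda>i. V i \<omega>"] unfolding event_def indicator_def
      by (simp add: space_PiM)
    finally show ?thesis ..
  qed
  have AEB: "AE \<omega> in M. \<forall>i\<in>{..<m}. U i \<omega> \<in> B"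
    using U_B by (intro AE_finite_allI) auto
  have sets: "{\<omega> \<in> space M. \<forall>t\<in>J. skel_at y {..<m} (\<lambda>i. U i \<omega>) (\<lambda>i. V i \<omega>) t (x t)} \<in> sets M"
    using J by (intro skel_sets) auto
  have "emeasure M {\<omega> \<in> space M. \<forall>t\<in>J. skel_at y {..<m} (\<lambda>i. U i \<omega>) (\<lambda>i. V i \<omega>) t (x t)} =
     (\<integral>\<^sup>+\<omega>. (\<Sum>u\<in>PiE {..<m} (\<lambda>_. B). (\<Prod>i<m. indicator {u i} (U i \<omega>)) * indicator (event m J x u) (?W \<omega>)) \<partial>M)"
    unfolding nn_integral_indicator[OF sets, symmetric]
    using AEB by (intro nn_integral_cong_AE) (auto intro!: pt elim!: AE_mp)
  also have "\<dots> = (\<Sum>u\<in>PiE {..<m} (\<lambda>_. B). emeasure (law m u) (event m J x u))"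
    unfolding law using J by (intro nn_integral_sum) auto
  finally show ?thesis .
qed

text \<open>On the limiting event each of the finitely many times falls into a sojourn with a finite
  index, so finitely many visits settle all of them, and the events for \<open>m\<close> visits
  increase to it.\<close>

lemma emeasure_lim:
  assumes J: "finite J" "J \<subseteq> {0..}" "\<And>t. t \<in> J \<Longrightarrow> x t \<in> B"
  shows "(\<lambda>m. \<Sum>u\<in>PiE {..<m} (\<lambda>_. B). emeasure (law m u) (event m J x u)) \<longlonglongrightarrow>
    emeasure M {\<omega> \<in> space M. \<forall>t\<in>J. Z t \<omega> = enat (x t)}"
proof -
  define G where "G m = {\<omega> \<in> space M. \<forall>t\<in>J. skel_at y {..<m} (\<lambda>i. U i \<omega>) (\<lambda>i. V i \<omega>) t (x t)}" for m
  have [measurable]: "G m \<in> sets M" for m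
    unfolding G_def using J by (intro skel_sets) auto
  have mono: "skel_at y {..<m} u v t z \<Longrightarrow> m \<le> n \<Longrightarrow> skel_at y {..<n} u v t z" for m n u v t z
    unfolding skel_at_def by (meson lessThan_iff less_le_trans)
  have "incseq G"
    unfolding G_def by (intro monoI) (auto intro: mono)
  then have "(\<lambda>m. emeasure M (G m)) \<longlonglongrightarrow> emeasure M (\<Union>m. G m)"
    by (intro Lim_emeasure_incseq) auto
  also have "(\<Union>m. G m) = {\<omega> \<in> space M. \<forall>t\<in>J. skel_at y UNIV (\<lambda>i. U i \<omega>) (\<lambda>i. V i \<omega>) t (x t)}" (is "_ = ?G")
  proof (intro equalityI subsetI)
    fix \<omega> assume "\<omega> \<in> ?G"
    then have w: "\<omega> \<in> space M" and *: "\<forall>t\<in>J. skel_at y UNIV (\<lambda>i. U i \<omega>) (\<lambda>i. V i \<omega>) t (x t)"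
      by auto
    have ex: "\<exists>m. skel_at y {..<m} u v t z" if sk: "skel_at y UNIV u v t z" for u v t z
    proof -
      consider "enat z = y \<and> t < v 0"
        | i where "u i = z" "(\<Sum>j<2*i+2. v j) \<le> t" "t < (\<Sum>j<2*i+3. v j)"
        using sk unfolding skel_at_def by (elim disjE bexE conjE) simp_all
      then show ?thesis
      proof cases
        case (2 i)
        then have "skel_at y {..<Suc i} u v t z"
          unfolding skel_at_def by blast
        then show ?thesis ..
      qed (auto simp: skel_at_def)
    qed
    have "\<forall>t\<in>J. \<exists>m. skel_at y {..<m} (\<lambda>i. U i \<omega>) (\<lambda>i. V i \<omega>) t (x t)"
      using * ex by blast
    then obtain k where k: "\<forall>t\<in>J. skel_at y {..<k t} (\<lambda>i. U i \<omega>) (\<lambda>i. V i \<omega>) t (x t)"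
      by (rule bchoice[THEN exE])
    have "\<omega> \<in> G (Max (insert 0 (k ` J)))"
    proof -
      have "skel_at y {..<Max (insert 0 (k ` J))} (\<lambda>i. U i \<omega>) (\<lambda>i. V i \<omega>) t (x t)" if "t \<in> J" for t
      proof (rule mono)
        show "skel_at y {..<k t} (\<lambda>i. U i \<omega>) (\<lambda>i. V i \<omega>) t (x t)"
          using k that by (rule bspec)
        show "k t \<le> Max (insert 0 (k ` J))"
          using J(1) that by (intro Max_ge) auto
      qed
      then show ?thesis using w unfolding G_def by simp
    qed
    then show "\<omega> \<in> (\<Union>m. G m)" by blast
  next
    fix \<omega> assume "\<omega> \<in> (\<Union>m. G m)"
    then show "\<omega> \<in> ?G"
      unfolding G_def skel_at_def by fast
  qed
  also have "emeasure M ?G = emeasure M {\<omega> \<in> space M. \<forall>t\<in>J. Z t \<omega> = enat (x t)}"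
  proof (rule emeasure_eq_AE)
    show "AE \<omega> in M. \<omega> \<in> ?G \<longleftrightarrow> \<omega> \<in> {\<omega> \<in> space M. \<forall>t\<in>J. Z t \<omega> = enat (x t)}"
      using Z_skel
    proof eventually_elim
      case (elim \<omega>)
      have "Z t \<omega> = enat (x t) \<longleftrightarrow> skel_at y UNIV (\<lambda>i. U i \<omega>) (\<lambda>i. V i \<omega>) t (x t)" if "t \<in> J" for t
        by (rule elim[rule_format]) (use J that in auto)
      then show ?case by (simp cong: ball_cong)
    qed
    show "?G \<in> sets M"
      using J by (intro skel_sets) auto
    have "{\<omega> \<in> space M. Z t \<omega> = enat (x t)} \<in> sets M" if "t \<in> J" for t
    proof -
      have "Measurable.pred M (\<lambda>\<omega>. Z t \<omega> = enat (x t))"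
        using J(2) that by (intro pred_count_space_eq[where A=Nbar] Z_meas) auto
      then show ?thesis by (simp add: pred_def)
    qed
    then show "{\<omega> \<in> space M. \<forall>t\<in>J. Z t \<omega> = enat (x t)} \<in> sets M"
      using J(1) by (cases "J = {}") (auto intro!: sets.sets_Collect_finite_All')
  qed
  finally show ?thesis
    using emeasure_upto[OF J(1)] unfolding G_def by simp
qed

text \<open>\<open>V_lap\<close> quantifies over whole sequences, so \<open>a\<close> is continued
  by 1 and \<open>u\<close> by some \<open>b\<close> in \<open>B\<close>.\<close>

lemma law_lap:
  assumes a: "\<And>i. i < dim m \<Longrightarrow> 0 < a i" and u: "u \<in> PiE {..<m} (\<lambda>_. B)" "b \<in> B"
  shows "(\<integral>\<^sup>+\<omega>. (\<Prod>i<dim m. nexp (a i * V i \<omega>)) \<partial>density M (\<lambda>\<omega>. \<Prod>i<m. indicator {u i} (U i \<omega>))) =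
    L m (\<lambda>i. if i < dim m then a i else 1) (\<lambda>i. if i < m then u i else b)"
  using V_lap[of "\<lambda>i. if i < dim m then a i else 1" "\<lambda>i. if i < m then u i else b" m] a u
  by (subst nn_integral_density) (auto simp: mult.commute PiE_iff)

end

lemma skeleton_law_unique:
  assumes "skeleton M y B L V U Z" "skeleton M' y B L V' U' Z'" and u: "u \<in> PiE {..<m} (\<lambda>_. B)"
  shows "skeleton.law M V U m u = skeleton.law M' V' U' m u"
proof -
  interpret M: skeleton M y B L V U Z by fact
  interpret M': skeleton M' y B L V' U' Z' by fact
  \<comment> \<open>The state \<open>b\<close> needed to continue \<open>u\<close> exists because
    \<open>U 0\<close> lies in \<open>B\<close> almost surely.\<close>
  obtain \<omega> where "U 0 \<omega> \<in> B"
    using eventually_happens'[OF M.ae_filter_bot M.U_B] by blast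
  then obtain b where b: "b \<in> B" by blast
  have fin: "finite_measure (density M (\<lambda>\<omega>. \<Prod>i<m. indicator {u i} (U i \<omega>)))"
  proof (rule finite_measureI)
    have "(\<integral>\<^sup>+\<omega>. (\<Prod>i<m. indicator {u i} (U i \<omega>)) \<partial>M) \<le> (\<integral>\<^sup>+\<omega>. 1 \<partial>M)"
      by (intro nn_integral_mono prod_le_1) (auto simp: indicator_def)
    then show "emeasure (density M (\<lambda>\<omega>. \<Prod>i<m. indicator {u i} (U i \<omega>))) (space (density M (\<lambda>\<omega>. \<Prod>i<m. indicator {u i} (U i \<omega>)))) \<noteq> \<infinity>"
      by (auto simp: emeasure_density M.emeasure_space_1 top_unique cong: nn_integral_cong)
  qed
  have fin': "finite_measure (density M' (\<lambda>\<omega>. \<Prod>i<m. indicator {u i} (U' i \<omega>)))"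
  proof (rule finite_measureI)
    have "(\<integral>\<^sup>+\<omega>. (\<Prod>i<m. indicator {u i} (U' i \<omega>)) \<partial>M') \<le> (\<integral>\<^sup>+\<omega>. 1 \<partial>M')"
      by (intro nn_integral_mono prod_le_1) (auto simp: indicator_def)
    then show "emeasure (density M' (\<lambda>\<omega>. \<Prod>i<m. indicator {u i} (U' i \<omega>))) (space (density M' (\<lambda>\<omega>. \<Prod>i<m. indicator {u i} (U' i \<omega>)))) \<noteq> \<infinity>"
      by (auto simp: emeasure_density M'.emeasure_space_1 top_unique cong: nn_integral_cong)
  qed
  show ?thesis
    unfolding M.law_def M'.law_def
  proof (rule laplace_vector_unique[OF fin fin'])
    show "AE x in density M (\<lambda>\<omega>. \<Prod>i<m. indicator {u i} (U i \<omega>)). 0 \<le> V i x" for i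
      using M.V_nonneg[of i] by (subst AE_density) (auto intro!: M.prod_indicator)
    show "AE x in density M' (\<lambda>\<omega>. \<Prod>i<m. indicator {u i} (U' i \<omega>)). 0 \<le> V' i x" for i
      using M'.V_nonneg[of i] by (subst AE_density) (auto intro!: M'.prod_indicator)
    show "(\<integral>\<^sup>+x. (\<Prod>i<dim m. nexp (a i * V i x)) \<partial>density M (\<lambda>\<omega>. \<Prod>i<m. indicator {u i} (U i \<omega>))) =
       (\<integral>\<^sup>+x. (\<Prod>i<dim m. nexp (a i * V' i x)) \<partial>density M' (\<lambda>\<omega>. \<Prod>i<m. indicator {u i} (U' i \<omega>)))"
      if "\<And>i. i < dim m \<Longrightarrow> 0 < a i" for a
      using M.law_lap[OF that u b] M'.law_lap[OF that u b] by simp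
  qed simp_all
qed

theorem skeleton_unique:
  assumes "skeleton M y B L V U Z" "skeleton M' y B L V' U' Z'"
    and J: "finite J" "J \<subseteq> {0..}" "\<And>t. t \<in> J \<Longrightarrow> x t \<in> B"
  shows "emeasure M {\<omega> \<in> space M. \<forall>t\<in>J. Z t \<omega> = enat (x t)} = emeasure M' {\<omega> \<in> space M'. \<forall>t\<in>J. Z' t \<omega> = enat (x t)}"
proof -
  interpret M: skeleton M y B L V U Z by fact
  interpret M': skeleton M' y B L V' U' Z' by fact
  have "(\<Sum>u\<in>PiE {..<m} (\<lambda>_. B). emeasure (M.law m u) (M.event m J x u)) =
    (\<Sum>u\<in>PiE {..<m} (\<lambda>_. B). emeasure (M'.law m u) (M'.event m J x u))" for m
    using skeleton_law_unique[OF assms(1,2)] by (intro sum.cong) auto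
  then show ?thesis
    using M.emeasure_lim[of J x] M'.emeasure_lim[of J x] J LIMSEQ_unique by simp
qed

section \<open>Regular paths\<close>

text \<open>All that is used of a cadlag path: a finite state is an isolated point, so the indicator
  of being there is right-continuous and has left limits.\<close>

definition regular :: "(real \<Rightarrow> enat) \<Rightarrow> bool" where
  "regular f \<longleftrightarrow> (\<forall>x\<ge>1.
    (\<forall>t\<ge>0. \<forall>\<^sub>F s in at_right t. (f s = enat x) = (f t = enat x)) \<and>
    (\<forall>t>0. \<exists>b. \<forall>\<^sub>F s in at_left t. (f s = enat x) = b))"

text \<open>The point nearest to \<open>enat x\<close> is \<open>enat (x + 1)\<close>, at distance 1
  / x - 1 / (x + 1), which is the radius used.\<close>

lemma nbar_dist_isolated:
  assumes "1 \<le> x" "y \<in> Nbar" "z \<in> Nbar" "nbar_dist y z < 1 / (real x * (real x + 1))"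
  shows "(y = enat x) = (z = enat x)"
proof -
  have far: "1 / (real x * (real x + 1)) \<le> nbar_dist (enat x) z" if "z \<in> Nbar" "z \<noteq> enat x" for z
  proof (cases z)
    case (enat n)
    then have n: "1 \<le> n" "n \<noteq> x" using that by auto
    show ?thesis
    proof (cases "n < x")
      case True
      have "1 / (real x * (real x + 1)) \<le> 1 / (real x * (real x - 1))"
        using True n by (intro divide_left_mono mult_left_mono mult_pos_pos) auto
      moreover have "1 / (real x - 1) - 1 / real x = 1 / (real x * (real x - 1))"
        using True n by (simp add: field_simps)
      moreover have "1 / (real x - 1) \<le> 1 / real n"
        using True n by (intro divide_left_mono mult_pos_pos) auto
      ultimately show ?thesis
        using enat by (simp add: nbar_dist_def enat_inverse_def)
    next
      case False
      have "1 / real n \<le> 1 / (real x + 1)"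
        using False n assms(1) by (intro divide_left_mono) auto
      moreover have "1 / real x - 1 / (real x + 1) = 1 / (real x * (real x + 1))"
        using assms(1) by (simp add: field_simps)
      ultimately show ?thesis
        using enat by (simp add: nbar_dist_def enat_inverse_def)
    qed
  next
    case infinity
    have "1 / (real x * (real x + 1)) \<le> 1 / real x"
      using assms(1) by (intro divide_left_mono mult_pos_pos) auto
    then show ?thesis
      using infinity by (simp add: nbar_dist_def enat_inverse_def)
  qed
  have "nbar_dist y z = nbar_dist z y"
    by (simp add: nbar_dist_def abs_minus_commute)
  then show ?thesis
    using far[of z] far[of y] assms by (metis not_less)
qed

lemma cadlag_imp_regular:
  assumes f: "cadlag f" and N: "\<And>t. 0 \<le> t \<Longrightarrow> f t \<in> Nbar"
  shows "regular f"
  unfolding regular_def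
proof (intro allI impI conjI)
  fix x :: nat and t :: real assume x: "1 \<le> x"
  let ?d = "1 / (real x * (real x + 1))"
  have d: "0 < ?d" using x by simp
  {
    assume t: "0 \<le> t"
    have "((\<lambda>s. nbar_dist (f s) (f t)) \<longlongrightarrow> 0) (at_right t)"
      using f t unfolding cadlag_def by blast
    then have "\<forall>\<^sub>F s in at_right t. nbar_dist (f s) (f t) < ?d"
      by (rule order_tendstoD(2)) (rule d)
    moreover have "\<forall>\<^sub>F s in at_right t. s \<in> {t<..}"
      by (auto simp: eventually_at_filter)
    ultimately show "\<forall>\<^sub>F s in at_right t. (f s = enat x) = (f t = enat x)"
    proof eventually_elim
      case (elim s)
      then show ?case
        using t by (intro nbar_dist_isolated[OF x] N) auto
    qed
  }
  {
    assume t: "0 < t"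
    obtain l where l: "l \<in> Nbar" "((\<lambda>s. nbar_dist (f s) l) \<longlongrightarrow> 0) (at_left t)"
      using f t unfolding cadlag_def by blast
    have "\<forall>\<^sub>F s in at_left t. nbar_dist (f s) l < ?d"
      using l(2) by (rule order_tendstoD(2)) (rule d)
    moreover have "\<forall>\<^sub>F s in at_left t. s \<in> {0<..<t}"
      by (rule eventually_at_left_real) (rule t)
    ultimately have "\<forall>\<^sub>F s in at_left t. (f s = enat x) = (l = enat x)"
    proof eventually_elim
      case (elim s)
      then show ?case
        using l(1) by (intro nbar_dist_isolated[OF x] N) auto
    qed
    then show "\<exists>b. \<forall>\<^sub>F s in at_left t. (f s = enat x) = b" ..
  }
qed

lemma regular_cong:
  assumes "regular f" "\<And>t. 0 \<le> t \<Longrightarrow> f t = g t"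
  shows "regular g"
  unfolding regular_def
proof (intro allI impI conjI)
  fix x :: nat and t :: real assume x: "1 \<le> x"
  {
    assume t: "0 \<le> t"
    have "\<forall>\<^sub>F s in at_right t. (f s = enat x) = (f t = enat x)"
      using assms(1) x t unfolding regular_def by blast
    moreover have "\<forall>\<^sub>F s in at_right t. s \<in> {t<..}"
      by (auto simp: eventually_at_filter)
    ultimately show "\<forall>\<^sub>F s in at_right t. (g s = enat x) = (g t = enat x)"
      by eventually_elim (use t in \<open>simp add: assms(2)[symmetric]\<close>)
  }
  {
    assume t: "0 < t"
    obtain b where "\<forall>\<^sub>F s in at_left t. (f s = enat x) = b"
      using assms(1) x t unfolding regular_def by blast
    moreover have "\<forall>\<^sub>F s in at_left t. s \<in> {0<..<t}"
      by (rule eventually_at_left_real) (rule t)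
    ultimately have "\<forall>\<^sub>F s in at_left t. (g s = enat x) = b"
      by eventually_elim (simp add: assms(2)[symmetric])
    then show "\<exists>b. \<forall>\<^sub>F s in at_left t. (g s = enat x) = b" ..
  }
qed

text \<open>Restricted to nonnegative times, so that a shifted path is again extensional and hence a
  point of the path space.\<close>

definition shift :: "real \<Rightarrow> (real \<Rightarrow> enat) \<Rightarrow> real \<Rightarrow> enat" where
  "shift s f = (\<lambda>t\<in>{0..}. f (s + t))"

lemma shift_apply [simp]: "0 \<le> t \<Longrightarrow> shift s f t = f (s + t)"
  by (simp add: shift_def)

lemma at_right_shift: "at_right (s + t) = filtermap (\<lambda>u. s + u) (at_right (t::real))"
  using filtermap_at_right_shift[of "- s" t] by (simp add: add.commute)

lemma at_left_shift: "at_left (s + t) = filtermap (\<lambda>u. s + u) (at_left (t::real))"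
proof -
  have "at_left (s + t) = filtermap uminus (at_right (- s + - t))"
    by (subst at_left_minus) simp
  then show ?thesis
    unfolding at_right_shift at_left_minus[of t] filtermap_filtermap by simp
qed

lemma regular_shift:
  assumes f: "regular f" and s: "0 \<le> s"
  shows "regular (shift s f)"
proof (rule regular_cong[of "\<lambda>t. f (s + t)"])
  show "regular (\<lambda>t. f (s + t))"
    unfolding regular_def
  proof (intro allI impI conjI)
    fix x :: nat and t :: real assume x: "1 \<le> x"
    {
      assume t: "0 \<le> t"
      then have "\<forall>\<^sub>F u in at_right (s + t). (f u = enat x) = (f (s + t) = enat x)"
        using f x s unfolding regular_def by auto
      then show "\<forall>\<^sub>F u in at_right t. (f (s + u) = enat x) = (f (s + t) = enat x)"
        unfolding at_right_shift eventually_filtermap .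
    }
    {
      assume t: "0 < t"
      then have "0 < s + t" using s by simp
      then obtain b where "\<forall>\<^sub>F u in at_left (s + t). (f u = enat x) = b"
        using f x unfolding regular_def by blast
      then show "\<exists>b. \<forall>\<^sub>F u in at_left t. (f (s + u) = enat x) = b"
        unfolding at_left_shift eventually_filtermap by blast
    }
  qed
qed simp

text \<open>A trace space: the set of regular paths need not belong to the product sigma-algebra,
  because a measurable set of \<open>path_space\<close> is determined by countably many
  times.\<close>

definition regular_paths :: "(real \<Rightarrow> enat) measure" where
  "regular_paths = restrict_space path_space {f. regular f}"

lemma space_regular_paths: "space regular_paths = {f \<in> \<Pi>\<^sub>E t\<in>{0..}. Nbar. regular f}"
  by (auto simp: regular_paths_def space_restrict_space space_path_space)

lemma regular_paths_Nbar: "f \<in> space regular_paths \<Longrightarrow> 0 \<le> t \<Longrightarrow> f t \<in> Nbar"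
  by (auto simp: space_regular_paths)

lemma measurable_regular_pathsI:
  assumes "\<And>t. 0 \<le> t \<Longrightarrow> (\<lambda>\<omega>. F \<omega> t) \<in> M \<rightarrow>\<^sub>M count_space Nbar"
    and "\<And>\<omega>. \<omega> \<in> space M \<Longrightarrow> F \<omega> \<in> extensional {0..}" "\<And>\<omega>. \<omega> \<in> space M \<Longrightarrow> regular (F \<omega>)"
  shows "F \<in> M \<rightarrow>\<^sub>M regular_paths"
  unfolding regular_paths_def path_space_def
proof (rule measurable_restrict_space2)
  show "F \<in> M \<rightarrow>\<^sub>M Pi\<^sub>M {0..} (\<lambda>_. count_space Nbar)"
  proof (rule measurable_PiM_single')
    show "F \<in> space M \<rightarrow> (\<Pi>\<^sub>E i\<in>{0..}. space (count_space Nbar))"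
      using assms(2) measurable_space[OF assms(1)] by (auto simp: PiE_def)
  qed (use assms(1) in auto)
qed (use assms(3) in auto)

lemma measurable_eval_const: "0 \<le> t \<Longrightarrow> (\<lambda>f. f t) \<in> regular_paths \<rightarrow>\<^sub>M count_space Nbar"
  unfolding regular_paths_def by (rule measurable_restrict_space1) (rule measurable_path_space_eval)

definition grid_above :: "nat \<Rightarrow> real \<Rightarrow> real" where
  "grid_above n t = (real (nat \<lfloor>t * real (Suc n)\<rfloor>) + 1) / real (Suc n)"

lemma grid_above_bounds:
  assumes "0 \<le> t"
  shows "t < grid_above n t" "grid_above n t \<le> t + 1 / real (Suc n)"
proof -
  define N where "N = real (Suc n)"
  have N: "0 < N" by (simp add: N_def)
  have r: "real (nat \<lfloor>t * N\<rfloor>) = of_int \<lfloor>t * N\<rfloor>"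
    using assms N by (simp add: of_nat_nat)
  have "t * N < of_int \<lfloor>t * N\<rfloor> + 1" "of_int \<lfloor>t * N\<rfloor> + 1 \<le> t * N + 1"
    by linarith+
  then have "t < (of_int \<lfloor>t * N\<rfloor> + 1) / N" "(of_int \<lfloor>t * N\<rfloor> + 1) / N \<le> (t * N + 1) / N"
    using N by (simp_all only: pos_less_divide_eq divide_right_mono[OF _ less_imp_le])
  moreover have "(t * N + 1) / N = t + 1 / N"
    using N by (simp add: field_simps)
  ultimately show "t < grid_above n t" "grid_above n t \<le> t + 1 / real (Suc n)"
    unfolding grid_above_def N_def[symmetric] r by simp_all
qed

lemma filterlim_grid_above:
  assumes "0 \<le> t"
  shows "filterlim (\<lambda>n. grid_above n t) (at_right t) sequentially"
  unfolding filterlim_at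
proof
  show "\<forall>\<^sub>F n in sequentially. grid_above n t \<in> {t<..} \<and> grid_above n t \<noteq> t"
    using grid_above_bounds(1)[OF assms] by (intro always_eventually) (auto dest: less_imp_neq[THEN not_sym])
  show "(\<lambda>n. grid_above n t) \<longlonglongrightarrow> t"
  proof (rule tendsto_sandwich[of "\<lambda>_. t" _ _ "\<lambda>n. t + 1 / real (Suc n)"])
    have "(\<lambda>n. t + 1 / real (Suc n)) \<longlonglongrightarrow> t + 0"
      by (intro tendsto_intros LIMSEQ_Suc[OF lim_1_over_n])
    then show "(\<lambda>n. t + 1 / real (Suc n)) \<longlonglongrightarrow> t" by simp
    show "\<forall>\<^sub>F n in sequentially. t \<le> grid_above n t"
      by (rule always_eventually) (simp add: less_imp_le[OF grid_above_bounds(1)[OF assms]])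
    show "\<forall>\<^sub>F n in sequentially. grid_above n t \<le> t + 1 / real (Suc n)"
      by (rule always_eventually) (simp only: grid_above_bounds(2)[OF assms] simp_thms)
  qed simp
qed

text \<open>The times \<open>grid_above n\<close> take countably many values, so evaluation at them
  is measurable. They decrease to the random time from strictly above, and by right-continuity the
  answer to whether the state is \<open>x\<close> is eventually the right one.\<close>

lemma pred_eval:
  assumes F: "F \<in> M \<rightarrow>\<^sub>M regular_paths" and T [measurable]: "T \<in> borel_measurable M"
    and T0: "\<And>\<omega>. \<omega> \<in> space M \<Longrightarrow> 0 \<le> T \<omega>" and x: "1 \<le> x"
  shows "Measurable.pred M (\<lambda>\<omega>. F \<omega> (T \<omega>) = enat x)"
proof -
  have [measurable]: "Measurable.pred M (\<lambda>\<omega>. F \<omega> ((real k + 1) / real (Suc n)) = enat x)" for k n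
    by (rule pred_count_space_eq[OF measurable_compose[OF F measurable_eval_const]]) simp
  have "Measurable.pred M (\<lambda>\<omega>. F \<omega> (grid_above n (T \<omega>)) = enat x)" for n
  proof -
    have eq: "(\<lambda>\<omega>. F \<omega> (grid_above n (T \<omega>)) = enat x) =
      (\<lambda>\<omega>. \<exists>k. nat \<lfloor>T \<omega> * real (Suc n)\<rfloor> = k \<and> F \<omega> ((real k + 1) / real (Suc n)) = enat x)"
      by (simp add: grid_above_def del: of_nat_Suc)
    show ?thesis unfolding eq by measurable
  qed
  then have meas: "Measurable.pred M (\<lambda>\<omega>. \<exists>N. \<forall>n\<ge>N. F \<omega> (grid_above n (T \<omega>)) = enat x)"
    by measurable
  have key: "F \<omega> (T \<omega>) = enat x \<longleftrightarrow> (\<exists>N. \<forall>n\<ge>N. F \<omega> (grid_above n (T \<omega>)) = enat x)" if \<omega>: "\<omega> \<in> space M" for \<omega>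
  proof -
    have "regular (F \<omega>)"
      using measurable_space[OF F \<omega>] by (simp add: space_regular_paths)
    then have "\<forall>\<^sub>F s in at_right (T \<omega>). (F \<omega> s = enat x) = (F \<omega> (T \<omega>) = enat x)"
      using x T0[OF \<omega>] unfolding regular_def by blast
    then have ev: "\<forall>\<^sub>F n in sequentially. (F \<omega> (grid_above n (T \<omega>)) = enat x) = (F \<omega> (T \<omega>) = enat x)"
      by (rule eventually_compose_filterlim[OF _ filterlim_grid_above[OF T0[OF \<omega>]]])
    show ?thesis
    proof
      assume "F \<omega> (T \<omega>) = enat x"
      then show "\<exists>N. \<forall>n\<ge>N. F \<omega> (grid_above n (T \<omega>)) = enat x"
        using ev by (simp add: eventually_sequentially)
    next
      assume "\<exists>N. \<forall>n\<ge>N. F \<omega> (grid_above n (T \<omega>)) = enat x"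
      then have "\<forall>\<^sub>F n in sequentially. F \<omega> (grid_above n (T \<omega>)) = enat x"
        by (simp add: eventually_sequentially)
      with ev have "\<forall>\<^sub>F n in sequentially. F \<omega> (T \<omega>) = enat x"
        by eventually_elim simp
      then show "F \<omega> (T \<omega>) = enat x" by simp
    qed
  qed
  show ?thesis
    using meas by (simp only: measurable_cong[of M, OF key])
qed

lemma measurable_eval:
  assumes F: "F \<in> M \<rightarrow>\<^sub>M regular_paths" and T: "T \<in> borel_measurable M"
    and T0: "\<And>\<omega>. \<omega> \<in> space M \<Longrightarrow> 0 \<le> T \<omega>"
  shows "(\<lambda>\<omega>. F \<omega> (T \<omega>)) \<in> M \<rightarrow>\<^sub>M count_space Nbar"
  unfolding measurable_count_space_eq2_countable
proof
  show N: "(\<lambda>\<omega>. F \<omega> (T \<omega>)) \<in> space M \<rightarrow> Nbar"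
    using measurable_space[OF F] T0 regular_paths_Nbar by auto
  have fin: "(\<lambda>\<omega>. F \<omega> (T \<omega>)) -` {enat x} \<inter> space M \<in> sets M" if "1 \<le> x" for x
  proof -
    have "(\<lambda>\<omega>. F \<omega> (T \<omega>)) -` {enat x} \<inter> space M = {\<omega> \<in> space M. F \<omega> (T \<omega>) = enat x}" by auto
    then show ?thesis using pred_eval[OF F T T0 that] by (simp add: pred_def)
  qed
  show "\<forall>a\<in>Nbar. (\<lambda>\<omega>. F \<omega> (T \<omega>)) -` {a} \<inter> space M \<in> sets M"
  proof
    fix a :: enat assume a: "a \<in> Nbar"
    show "(\<lambda>\<omega>. F \<omega> (T \<omega>)) -` {a} \<inter> space M \<in> sets M"
    proof (cases a)
      case (enat n)
      then show ?thesis using a fin[of n] by simp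
    next
      case infinity
      have "(\<lambda>\<omega>. F \<omega> (T \<omega>)) -` {a} \<inter> space M = space M - (\<Union>x\<in>{1..}. (\<lambda>\<omega>. F \<omega> (T \<omega>)) -` {enat x} \<inter> space M)"
      proof (intro equalityI subsetI)
        fix \<omega> assume "\<omega> \<in> space M - (\<Union>x\<in>{1..}. (\<lambda>\<omega>. F \<omega> (T \<omega>)) -` {enat x} \<inter> space M)"
        then have w: "\<omega> \<in> space M" and ne: "\<And>x. 1 \<le> x \<Longrightarrow> F \<omega> (T \<omega>) \<noteq> enat x"
          by auto
        have "F \<omega> (T \<omega>) \<in> Nbar"
          using N w by (rule funcset_mem)
        then have "F \<omega> (T \<omega>) = a"
          using ne infinity by (cases "F \<omega> (T \<omega>)") auto
        then show "\<omega> \<in> (\<lambda>\<omega>. F \<omega> (T \<omega>)) -` {a} \<inter> space M"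
          using w by simp
      qed (use infinity in simp)
      also have "\<dots> \<in> sets M"
        by (intro sets.Diff sets.top sets.countable_UN'' fin) simp_all
      finally show ?thesis .
    qed
  qed
qed

lemma measurable_shift:
  assumes F: "F \<in> M \<rightarrow>\<^sub>M regular_paths" and T: "T \<in> borel_measurable M"
    and T0: "\<And>\<omega>. \<omega> \<in> space M \<Longrightarrow> 0 \<le> T \<omega>"
  shows "(\<lambda>\<omega>. shift (T \<omega>) (F \<omega>)) \<in> M \<rightarrow>\<^sub>M regular_paths"
proof (rule measurable_regular_pathsI)
  fix t :: real assume t: "0 \<le> t"
  have "(\<lambda>\<omega>. F \<omega> (T \<omega> + t)) \<in> M \<rightarrow>\<^sub>M count_space Nbar"
    using T T0 t by (intro measurable_eval F) auto
  then show "(\<lambda>\<omega>. shift (T \<omega>) (F \<omega>) t) \<in> M \<rightarrow>\<^sub>M count_space Nbar"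
    using t by simp
next
  fix \<omega> assume \<omega>: "\<omega> \<in> space M"
  show "shift (T \<omega>) (F \<omega>) \<in> extensional {0..}"
    by (simp add: shift_def)
  show "regular (shift (T \<omega>) (F \<omega>))"
    using measurable_space[OF F \<omega>] T0[OF \<omega>] by (intro regular_shift) (auto simp: space_regular_paths)
qed

lemma shift_regular_paths:
  "f \<in> space regular_paths \<Longrightarrow> 0 \<le> s \<Longrightarrow> shift s f \<in> space regular_paths"
  using measurable_space[OF measurable_shift[of "\<lambda>f. f" regular_paths "\<lambda>_. s"]] by simp

section \<open>Hitting times\<close>

text \<open>On \<open>Nbar\<close> these are the clopen sets: finite sets of finite states and their
  complements. They include the sets whose hitting law is prescribed and the sets
  \<open>Nbar - {enat x}\<close>, whose hitting time is the end of a hold at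
  \<open>x\<close>.\<close>

definition clopen :: "enat set \<Rightarrow> bool" where
  "clopen A \<longleftrightarrow> (\<exists>F. finite F \<and> (\<forall>x\<in>F. 1 \<le> x) \<and>
     ((\<forall>y\<in>Nbar. y \<in> A \<longleftrightarrow> y \<in> enat ` F) \<or> (\<forall>y\<in>Nbar. y \<in> A \<longleftrightarrow> y \<notin> enat ` F)))"

lemma clopen_finite: "finite F \<Longrightarrow> (\<And>x. x \<in> F \<Longrightarrow> 1 \<le> x) \<Longrightarrow> clopen (enat ` F)"
  unfolding clopen_def by blast

lemma clopen_exit: "1 \<le> x \<Longrightarrow> clopen (Nbar - {enat x})"
  unfolding clopen_def by (intro exI[of _ "{x}"]) auto

lemma clopen_eventually:
  assumes A: "clopen A" and f: "f \<in> space regular_paths" and t: "0 \<le> t"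
  shows "\<forall>\<^sub>F s in at_right t. (f s \<in> A) = (f t \<in> A)"
proof -
  obtain F where F: "finite F" "\<forall>x\<in>F. 1 \<le> x"
    and A': "(\<forall>y\<in>Nbar. y \<in> A \<longleftrightarrow> y \<in> enat ` F) \<or> (\<forall>y\<in>Nbar. y \<in> A \<longleftrightarrow> y \<notin> enat ` F)"
    using A unfolding clopen_def by blast
  have "\<forall>\<^sub>F s in at_right t. \<forall>x\<in>F. (f s = enat x) = (f t = enat x)"
    using f F t by (intro eventually_ball_finite) (auto simp: space_regular_paths regular_def)
  moreover have "\<forall>\<^sub>F s in at_right t. s \<in> {t<..}"
    by (auto simp: eventually_at_filter)
  ultimately show ?thesis
  proof eventually_elim
    case (elim s)
    have "f s \<in> Nbar" "f t \<in> Nbar"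
      using elim t regular_paths_Nbar[OF f] by auto
    moreover have "f s \<in> enat ` F \<longleftrightarrow> f t \<in> enat ` F"
      using elim by (metis imageE imageI)
    ultimately show ?case using A' by blast
  qed
qed

definition hit :: "enat set \<Rightarrow> (real \<Rightarrow> enat) \<Rightarrow> ennreal" where
  "hit A f = Inf {ennreal t | t. 0 \<le> t \<and> f t \<in> A}"

lemma hit_le: "0 \<le> t \<Longrightarrow> f t \<in> A \<Longrightarrow> hit A f \<le> ennreal t"
  unfolding hit_def by (rule Inf_lower) blast

lemma hit_before: "0 \<le> t \<Longrightarrow> ennreal t < hit A f \<Longrightarrow> f t \<notin> A"
  using hit_le[of t f A] by (meson not_less)

lemma hit_less_iff: "hit A f < a \<longleftrightarrow> (\<exists>t\<ge>0. ennreal t < a \<and> f t \<in> A)"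
  unfolding hit_def Inf_less_iff by blast

text \<open>If the path were outside the clopen set at the infimum, it would stay outside for a
  while afterwards, and the infimum would be larger.\<close>

lemma hit_attained:
  assumes A: "clopen A" and f: "f \<in> space regular_paths" and fin: "hit A f < \<infinity>"
  shows "f (enn2real (hit A f)) \<in> A"
proof (rule ccontr)
  let ?s = "enn2real (hit A f)"
  have s: "ennreal ?s = hit A f" using fin by simp
  assume "f ?s \<notin> A"
  then have "\<forall>\<^sub>F u in at_right ?s. f u \<notin> A"
    using clopen_eventually[OF A f, of ?s] by simp
  then obtain b where b: "?s < b" "\<forall>u. ?s < u \<and> u < b \<longrightarrow> f u \<notin> A"
    by (auto simp: eventually_at_right_field)
  have "hit A f < ennreal b"
    using b(1) s by (metis enn2real_nonneg ennreal_lessI order_le_less_trans)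
  then obtain t where t: "0 \<le> t" "ennreal t < ennreal b" "f t \<in> A"
    unfolding hit_less_iff by blast
  have "?s \<le> t"
    using hit_le[OF t(1), of f A] t(3) t(1) by (metis enn2real_leI)
  moreover have "t < b" using t by (simp add: ennreal_less_iff)
  ultimately show False
    using b(2) t(3) \<open>f ?s \<notin> A\<close> by (metis order_le_less)
qed

text \<open>A path that has entered a clopen set stays there for a while, so an entry before
  \<open>t\<close> is seen at a rational time before \<open>t\<close>. Only countably many
  coordinates up to \<open>t\<close> are involved. This yields measurability, and also the stopping
  time property for the raw natural filtration, without completion or right-continuity.\<close>

lemma hit_le_iff:
  assumes A: "clopen A" and f: "f \<in> space regular_paths" and t: "0 \<le> t"
  shows "hit A f \<le> ennreal t \<longleftrightarrow> f t \<in> A \<or> (\<exists>r\<in>\<rat>. 0 \<le> r \<and> r < t \<and> f r \<in> A)"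
proof
  assume le: "hit A f \<le> ennreal t"
  let ?s = "enn2real (hit A f)"
  have fin: "hit A f < \<infinity>"
    by (rule le_less_trans[OF le]) (simp only: infinity_ennreal_def ennreal_less_top)
  have sA: "f ?s \<in> A" by (rule hit_attained[OF A f fin])
  have "?s \<le> t" by (rule enn2real_leI[OF t le])
  show "f t \<in> A \<or> (\<exists>r\<in>\<rat>. 0 \<le> r \<and> r < t \<and> f r \<in> A)"
  proof (cases "?s = t")
    case False
    with \<open>?s \<le> t\<close> have "?s < t" by (rule le_neq_trans)
    have "\<forall>\<^sub>F u in at_right ?s. f u \<in> A"
      using clopen_eventually[OF A f, of ?s] sA by simp
    then obtain b where b: "?s < b" "\<forall>u. ?s < u \<and> u < b \<longrightarrow> f u \<in> A"
      by (auto simp: eventually_at_right_field)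
    obtain r where r: "r \<in> \<rat>" "?s < r" "r < min b t"
      using Rats_dense_in_real[of ?s "min b t"] b(1) \<open>?s < t\<close> by auto
    moreover have "0 \<le> r" using r(2) enn2real_nonneg[of "hit A f"] by linarith
    ultimately show ?thesis using b by auto
  qed (use sA in simp)
next
  assume "f t \<in> A \<or> (\<exists>r\<in>\<rat>. 0 \<le> r \<and> r < t \<and> f r \<in> A)"
  then show "hit A f \<le> ennreal t"
  proof
    assume "\<exists>r\<in>\<rat>. 0 \<le> r \<and> r < t \<and> f r \<in> A"
    then obtain r where "0 \<le> r" "r < t" "f r \<in> A" by blast
    then show ?thesis using hit_le[of r f A] by (meson ennreal_leI less_imp_le order_trans)
  qed (use hit_le t in blast)
qed

lemma measurable_hit [measurable]:
  assumes A: "clopen A"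
  shows "hit A \<in> borel_measurable regular_paths"
proof (rule borel_measurableI_le)
  fix a :: ennreal
  show "{f \<in> space regular_paths. hit A f \<le> a} \<in> sets regular_paths"
  proof (cases a)
    case (real t)
    have [measurable]: "Measurable.pred regular_paths (\<lambda>f. f r \<in> A)" if "0 \<le> r" for r
      using measurable_compose[OF measurable_eval_const[OF that], of "\<lambda>y. y \<in> A" "count_space UNIV"] by simp
    have "Measurable.pred regular_paths (\<lambda>f. 0 \<le> r \<and> r < t \<and> f r \<in> A)" for r
    proof (cases "0 \<le> r")
      case True
      then show ?thesis by measurable
    next
      case False
      then show ?thesis by simp
    qed
    then have [measurable]: "Measurable.pred regular_paths (\<lambda>f. \<exists>r\<in>\<rat>. 0 \<le> r \<and> r < t \<and> f r \<in> A)"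
      by (intro measurable_pred_countable(2) countable_rat)
    have "Measurable.pred regular_paths (\<lambda>f. f t \<in> A \<or> (\<exists>r\<in>\<rat>. 0 \<le> r \<and> r < t \<and> f r \<in> A))"
      using real(1) by measurable
    moreover have "{f \<in> space regular_paths. hit A f \<le> a} =
       {f \<in> space regular_paths. f t \<in> A \<or> (\<exists>r\<in>\<rat>. 0 \<le> r \<and> r < t \<and> f r \<in> A)}"
      unfolding real(2) by (intro Collect_cong conj_cong refl hit_le_iff[OF A _ real(1)])
    ultimately show ?thesis by (simp add: pred_def)
  next
    case top
    have "{f \<in> space regular_paths. hit A f \<le> a} = space regular_paths"
      unfolding top by simp
    then show ?thesis by (simp only: sets.top)
  qed
qed

section \<open>The strong Markov property on path space\<close>

lemma nn_integral_distr_density: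
  assumes [measurable]: "w \<in> borel_measurable M" "F \<in> M \<rightarrow>\<^sub>M N" "f \<in> borel_measurable N"
  shows "(\<integral>\<^sup>+x. f x \<partial>distr (density M w) N F) = (\<integral>\<^sup>+\<omega>. w \<omega> * f (F \<omega>) \<partial>M)"
  by (subst nn_integral_distr; (subst nn_integral_density)?) simp_all

lemma emeasure_distr_density:
  assumes [measurable]: "w \<in> borel_measurable M" "F \<in> M \<rightarrow>\<^sub>M N" "A \<in> sets N"
  shows "emeasure (distr (density M w) N F) A = (\<integral>\<^sup>+\<omega>. w \<omega> * indicator A (F \<omega>) \<partial>M)"
  using nn_integral_distr_density[of w M F N "indicator A"] by simp

lemma stopping_time_hit:
  fixes Y :: "real \<Rightarrow> 'w \<Rightarrow> enat"
  assumes A: "clopen A" and path: "\<And>\<omega>. \<omega> \<in> \<Omega> \<Longrightarrow> sample_path Y \<omega> \<in> space regular_paths"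
  shows "stopping_time (natural_filtration \<Omega> Y) (\<lambda>\<omega>. hit A (sample_path Y \<omega>))"
proof
  fix a :: ennreal
  interpret filtration \<Omega> "natural_filtration \<Omega> Y" by (rule filtration_natural_filtration)
  show "Measurable.pred (natural_filtration \<Omega> Y a) (\<lambda>\<omega>. hit A (sample_path Y \<omega>) \<le> a)"
  proof (cases a)
    case (real t)
    have basic: "{\<omega> \<in> \<Omega>. Y r \<omega> \<in> A} \<in> sets (natural_filtration \<Omega> Y a)" if r: "0 \<le> r" "r \<le> t" for r
    proof -
      have "{\<omega> \<in> \<Omega>. Y r \<omega> \<in> A} = Y r -` (A \<inter> Nbar) \<inter> \<Omega>"
        using regular_paths_Nbar[OF path r(1)] r by (auto simp: sample_path_def)
      moreover have "Y r -` (A \<inter> Nbar) \<inter> \<Omega> \<in> {Y s -` A \<inter> \<Omega> | s A. 0 \<le> s \<and> ennreal s \<le> a \<and> A \<subseteq> Nbar}"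
        using r real by (intro CollectI exI[of _ r] exI[of _ "A \<inter> Nbar"]) (simp add: ennreal_leI)
      ultimately show ?thesis
        unfolding natural_filtration_def by (subst sets_measure_of) (auto intro!: sigma_sets.Basic)
    qed
    have "{\<omega> \<in> \<Omega>. hit A (sample_path Y \<omega>) \<le> a} =
       {\<omega> \<in> \<Omega>. Y t \<omega> \<in> A} \<union> (\<Union>r\<in>{r\<in>\<rat>. 0 \<le> r \<and> r < t}. {\<omega> \<in> \<Omega>. Y r \<omega> \<in> A})"
      using hit_le_iff[OF A path] real by (auto simp: sample_path_def)
    also have "\<dots> \<in> sets (natural_filtration \<Omega> Y a)"
      using real basic by (intro sets.Un sets.countable_UN'' countable_Collect countable_rat) auto
    finally show ?thesis
      by (simp add: pred_def space_F)
  qed simp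
qed

lemma hitting_time_eq_hit: "hitting_time Y A \<omega> = hit A (sample_path Y \<omega>)"
proof -
  have "{ennreal t | t. 0 \<le> t \<and> Y t \<omega> \<in> A} = {ennreal t | t. 0 \<le> t \<and> sample_path Y \<omega> t \<in> A}"
    by (auto simp: sample_path_def)
  then show ?thesis
    unfolding hitting_time_def hit_def by simp
qed

text \<open>The strong Markov property on path space for the two kinds of stopping times that occur
  below: hitting times of clopen sets, with a weight \<open>g\<close> of the hitting time, and
  constants.\<close>

locale regular_markov =
  fixes Q :: "enat \<Rightarrow> (real \<Rightarrow> enat) measure"
  assumes prob_Q: "y \<in> Nbar \<Longrightarrow> prob_space (Q y)"
    and sets_Q: "y \<in> Nbar \<Longrightarrow> sets (Q y) = sets regular_paths"
    and start_Q: "y \<in> Nbar \<Longrightarrow> AE f in Q y. f 0 = y"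
    and markov_hit: "y \<in> Nbar \<Longrightarrow> clopen A \<Longrightarrow> g \<in> borel_measurable borel \<Longrightarrow> \<Phi> \<in> borel_measurable regular_paths \<Longrightarrow>
      (\<integral>\<^sup>+f. g (hit A f) * indicator {..<\<infinity>} (hit A f) * \<Phi> (shift (enn2real (hit A f)) f) \<partial>Q y) =
      (\<integral>\<^sup>+f. g (hit A f) * indicator {..<\<infinity>} (hit A f) * (\<integral>\<^sup>+f'. \<Phi> f' \<partial>Q (f (enn2real (hit A f)))) \<partial>Q y)"
    and markov_const: "y \<in> Nbar \<Longrightarrow> 0 \<le> t \<Longrightarrow> \<Phi> \<in> borel_measurable regular_paths \<Longrightarrow>
      (\<integral>\<^sup>+f. \<Phi> (shift t f) \<partial>Q y) = (\<integral>\<^sup>+f. (\<integral>\<^sup>+f'. \<Phi> f' \<partial>Q (f t)) \<partial>Q y)"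

locale regular_process = Nbar_process P Y for P :: "enat \<Rightarrow> 'w measure" and Y +
  assumes cadlag: "\<And>\<omega>. \<omega> \<in> space (P \<infinity>) \<Longrightarrow> cadlag (\<lambda>t. Y t \<omega>)"
    and strong_markov: "strong_markov P Y"
begin

definition Q :: "enat \<Rightarrow> (real \<Rightarrow> enat) measure" where
  "Q y = distr (P y) regular_paths (sample_path Y)"

lemma space_P: "y \<in> Nbar \<Longrightarrow> space (P y) = space (P \<infinity>)"
  by (rule sets_eq_imp_space_eq) (rule sets_P)

lemma path_measurable_infty: "sample_path Y \<in> P \<infinity> \<rightarrow>\<^sub>M regular_paths"
proof (rule measurable_regular_pathsI)
  show "(\<lambda>\<omega>. sample_path Y \<omega> t) \<in> P \<infinity> \<rightarrow>\<^sub>M count_space Nbar" if "0 \<le> t" for t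
    using measurable_Y[OF that] that by (simp add: sample_path_def)
  fix \<omega> assume \<omega>: "\<omega> \<in> space (P \<infinity>)"
  show "regular (sample_path Y \<omega>)"
    by (rule regular_cong[OF cadlag_imp_regular[OF cadlag[OF \<omega>]]])
      (use measurable_space[OF measurable_Y \<omega>] in \<open>auto simp: sample_path_def\<close>)
qed (auto simp: sample_path_def)

lemma path_measurable [measurable]: "y \<in> Nbar \<Longrightarrow> sample_path Y \<in> P y \<rightarrow>\<^sub>M regular_paths"
  using path_measurable_infty measurable_cong_sets[OF sets_P refl] by blast

lemma path_space: "\<omega> \<in> space (P \<infinity>) \<Longrightarrow> sample_path Y \<omega> \<in> space regular_paths"
  by (rule measurable_space[OF path_measurable_infty])

lemma Q_kernel: "Q \<in> count_space Nbar \<rightarrow>\<^sub>M subprob_algebra regular_paths"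
  by (auto simp: Q_def space_subprob_algebra intro!: prob_space_imp_subprob_space prob_space.prob_space_distr prob_space_P)

text \<open>The hypothesis concerns events of the past and of the future. It is extended to
  integrands one factor at a time: from indicators of the stopping time to \<open>g\<close>, then
  from indicators of the future path to \<open>\<Phi>\<close>, both times by the equality of two
  measures.\<close>

lemma SM_path:
  fixes h :: "(real \<Rightarrow> enat) \<Rightarrow> ennreal"
  assumes y: "y \<in> Nbar" and h [measurable]: "h \<in> borel_measurable regular_paths"
    and st: "stopping_time (natural_filtration (space (P \<infinity>)) Y) (\<lambda>\<omega>. h (sample_path Y \<omega>))"
    and g [measurable]: "g \<in> borel_measurable borel" and \<Phi> [measurable]: "\<Phi> \<in> borel_measurable regular_paths"
  shows "(\<integral>\<^sup>+f. g (h f) * indicator {..<\<infinity>} (h f) * \<Phi> (shift (enn2real (h f)) f) \<partial>Q y) =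
    (\<integral>\<^sup>+f. g (h f) * indicator {..<\<infinity>} (h f) * (\<integral>\<^sup>+f'. \<Phi> f' \<partial>Q (f (enn2real (h f)))) \<partial>Q y)"
proof -
  let ?\<Omega> = "space (P \<infinity>)"
  let ?F = "natural_filtration ?\<Omega> Y"
  let ?X = "sample_path Y"
  interpret filtration ?\<Omega> ?F by (rule filtration_natural_filtration)
  define \<tau> where "\<tau> \<omega> = h (?X \<omega>)" for \<omega>
  note [measurable] = path_measurable[OF y]
  have [measurable]: "\<tau> \<in> borel_measurable (P y)"
    unfolding \<tau>_def by measurable
  have [measurable]: "(\<lambda>\<omega>. ?X \<omega> (enn2real (\<tau> \<omega>))) \<in> P y \<rightarrow>\<^sub>M count_space Nbar"
    by (rule measurable_eval) auto
  have [measurable]: "(\<lambda>\<omega>. shift (enn2real (\<tau> \<omega>)) (?X \<omega>)) \<in> P y \<rightarrow>\<^sub>M regular_paths"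
    by (rule measurable_shift) auto
  have kernel [measurable]: "(\<lambda>\<omega>. Q (?X \<omega> (enn2real (\<tau> \<omega>)))) \<in> P y \<rightarrow>\<^sub>M subprob_algebra regular_paths"
    by (rule measurable_compose[OF _ Q_kernel]) measurable
  have base: "emeasure (P y) {\<omega> \<in> ?\<Omega>. \<tau> \<omega> \<in> A \<and> \<tau> \<omega> < \<infinity> \<and> shift (enn2real (\<tau> \<omega>)) (?X \<omega>) \<in> B} =
      (\<integral>\<^sup>+\<omega>. indicator A (\<tau> \<omega>) * indicator {..<\<infinity>} (\<tau> \<omega>) * emeasure (Q (?X \<omega> (enn2real (\<tau> \<omega>)))) B \<partial>P y)"
    if A: "A \<in> sets borel" and B: "B \<in> sets regular_paths" for A B
  proof -
    obtain B' where B': "B' \<in> sets path_space" "B = {f. regular f} \<inter> B'"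
      using B unfolding regular_paths_def sets_restrict_space by auto
    define G where "G = {\<omega> \<in> ?\<Omega>. \<tau> \<omega> \<in> A}"
    have "\<tau> -` A \<inter> space (pre_sigma \<tau>) \<in> sets (pre_sigma \<tau>)"
      using measurable_stopping_time_pre_sigma[OF st[folded \<tau>_def]] A by (rule measurable_sets)
    then have G: "G \<in> sets (pre_sigma \<tau>)"
      unfolding G_def by (simp add: space_pre_sigma vimage_def Int_def conj_commute)
    have "emeasure (P y) {\<omega>\<in>G. \<tau> \<omega> < \<infinity> \<and> sample_path (\<lambda>t. Y (enn2real (\<tau> \<omega>) + t)) \<omega> \<in> B'} =
          (\<integral>\<^sup>+\<omega>\<in>{\<omega>\<in>G. \<tau> \<omega> < \<infinity>}. emeasure (P (Y (enn2real (\<tau> \<omega>)) \<omega>)) {\<omega>'\<in>?\<Omega>. ?X \<omega>' \<in> B'} \<partial>P y)"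
      using strong_markov y st[folded \<tau>_def] G B'(1) unfolding strong_markov_def Let_def by blast
    moreover have "{\<omega>\<in>G. \<tau> \<omega> < \<infinity> \<and> sample_path (\<lambda>t. Y (enn2real (\<tau> \<omega>) + t)) \<omega> \<in> B'} =
       {\<omega> \<in> ?\<Omega>. \<tau> \<omega> \<in> A \<and> \<tau> \<omega> < \<infinity> \<and> shift (enn2real (\<tau> \<omega>)) (?X \<omega>) \<in> B}"
    proof -
      have "sample_path (\<lambda>t. Y (enn2real (\<tau> \<omega>) + t)) \<omega> = shift (enn2real (\<tau> \<omega>)) (?X \<omega>)" for \<omega>
        by (auto simp: sample_path_def shift_def restrict_def)
      moreover have "regular (shift (enn2real (\<tau> \<omega>)) (?X \<omega>))" if "\<omega> \<in> ?\<Omega>" for \<omega>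
        using shift_regular_paths[OF path_space[OF that]] by (simp add: space_regular_paths)
      ultimately show ?thesis unfolding G_def B' by auto
    qed
    moreover have "(\<integral>\<^sup>+\<omega>\<in>{\<omega>\<in>G. \<tau> \<omega> < \<infinity>}. emeasure (P (Y (enn2real (\<tau> \<omega>)) \<omega>)) {\<omega>'\<in>?\<Omega>. ?X \<omega>' \<in> B'} \<partial>P y) =
      (\<integral>\<^sup>+\<omega>. indicator A (\<tau> \<omega>) * indicator {..<\<infinity>} (\<tau> \<omega>) * emeasure (Q (?X \<omega> (enn2real (\<tau> \<omega>)))) B \<partial>P y)"
    proof (rule nn_integral_cong)
      fix \<omega> assume "\<omega> \<in> space (P y)"
      then have \<omega>: "\<omega> \<in> ?\<Omega>" using space_P[OF y] by simp
      let ?z = "?X \<omega> (enn2real (\<tau> \<omega>))"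
      have z: "?z \<in> Nbar" "Y (enn2real (\<tau> \<omega>)) \<omega> = ?z"
        using regular_paths_Nbar[OF path_space[OF \<omega>]] by (auto simp: sample_path_def)
      have "emeasure (Q ?z) B = emeasure (P ?z) (?X -` B \<inter> space (P ?z))"
        unfolding Q_def using B z by (intro emeasure_distr) auto
      also have "?X -` B \<inter> space (P ?z) = {\<omega>'\<in>?\<Omega>. ?X \<omega>' \<in> B'}"
        using path_space B' space_P[OF z(1)] by (auto simp: space_regular_paths)
      finally show "emeasure (P (Y (enn2real (\<tau> \<omega>)) \<omega>)) {\<omega>'\<in>?\<Omega>. ?X \<omega>' \<in> B'} * indicator {\<omega>\<in>G. \<tau> \<omega> < \<infinity>} \<omega> =
          indicator A (\<tau> \<omega>) * indicator {..<\<infinity>} (\<tau> \<omega>) * emeasure (Q ?z) B"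
        using \<omega> z by (auto simp: G_def split: split_indicator)
    qed
    ultimately show ?thesis by simp
  qed
  have ne: "space (P y) \<noteq> {}"
    using prob_space_P[OF y] by (rule prob_space.not_empty)
  have gB: "(\<integral>\<^sup>+\<omega>. g (\<tau> \<omega>) * indicator {..<\<infinity>} (\<tau> \<omega>) * indicator B (shift (enn2real (\<tau> \<omega>)) (?X \<omega>)) \<partial>P y) =
      (\<integral>\<^sup>+\<omega>. g (\<tau> \<omega>) * indicator {..<\<infinity>} (\<tau> \<omega>) * emeasure (Q (?X \<omega> (enn2real (\<tau> \<omega>)))) B \<partial>P y)"
    if B [measurable]: "B \<in> sets regular_paths" for B
  proof -
    have [measurable]: "(\<lambda>\<omega>. emeasure (Q (?X \<omega> (enn2real (\<tau> \<omega>)))) B) \<in> borel_measurable (P y)"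
      by (rule measurable_compose[OF kernel measurable_emeasure_subprob_algebra[OF B]])
    \<comment> \<open>With the future event \<open>B\<close> fixed, both sides are measures in the
      value of the stopping time, and \<open>base\<close> says that they agree.\<close>
    define K where "K = distr (density (P y) (\<lambda>\<omega>. indicator {..<\<infinity>} (\<tau> \<omega>) * indicator B (shift (enn2real (\<tau> \<omega>)) (?X \<omega>)))) borel \<tau>"
    define L where "L = distr (density (P y) (\<lambda>\<omega>. indicator {..<\<infinity>} (\<tau> \<omega>) * emeasure (Q (?X \<omega> (enn2real (\<tau> \<omega>)))) B)) borel \<tau>"
    have "K = L"
    proof (rule measure_eqI)
      fix A assume "A \<in> sets K"
      then have A [measurable]: "A \<in> sets borel" by (simp add: K_def)
      have "emeasure K A = (\<integral>\<^sup>+\<omega>. indicator {\<omega> \<in> ?\<Omega>. \<tau> \<omega> \<in> A \<and> \<tau> \<omega> < \<infinity> \<and> shift (enn2real (\<tau> \<omega>)) (?X \<omega>) \<in> B} \<omega> \<partial>P y)"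
        unfolding K_def using space_P[OF y]
        by (subst emeasure_distr_density) (auto intro!: nn_integral_cong split: split_indicator)
      also have "\<dots> = emeasure (P y) {\<omega> \<in> space (P y). \<tau> \<omega> \<in> A \<and> \<tau> \<omega> < \<infinity> \<and> shift (enn2real (\<tau> \<omega>)) (?X \<omega>) \<in> B}"
        unfolding space_P[OF y, symmetric] by (rule nn_integral_indicator) measurable
      also have "\<dots> = emeasure L A"
        unfolding space_P[OF y] base[OF A B] L_def
        by (subst emeasure_distr_density) (auto intro!: nn_integral_cong split: split_indicator)
      finally show "emeasure K A = emeasure L A" .
    qed (simp add: K_def L_def)
    then have "(\<integral>\<^sup>+x. g x \<partial>K) = (\<integral>\<^sup>+x. g x \<partial>L)" by simp
    then show ?thesis
      unfolding K_def L_def by (simp add: nn_integral_distr nn_integral_density mult_ac)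
  qed
  define W where "W \<omega> = g (\<tau> \<omega>) * indicator {..<\<infinity>} (\<tau> \<omega>)" for \<omega>
  have [measurable]: "W \<in> borel_measurable (P y)" unfolding W_def by measurable
  \<comment> \<open>Now the weight \<open>W\<close> is fixed and both sides are read as measures on
    path space, the second one as a mixture of the laws \<open>Q\<close> over the state
    reached.\<close>
  define K where "K = distr (density (P y) W) regular_paths (\<lambda>\<omega>. shift (enn2real (\<tau> \<omega>)) (?X \<omega>))"
  define L where "L = density (P y) W \<bind> (\<lambda>\<omega>. Q (?X \<omega> (enn2real (\<tau> \<omega>))))"
  have kernel': "(\<lambda>\<omega>. Q (?X \<omega> (enn2real (\<tau> \<omega>)))) \<in> density (P y) W \<rightarrow>\<^sub>M subprob_algebra regular_paths"
    using kernel by simp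
  have "K = L"
  proof (rule measure_eqI)
    show "sets K = sets L"
      unfolding K_def L_def by (subst sets_bind[OF sets_kernel[OF kernel']]) (use ne in simp_all)
    fix B assume "B \<in> sets K"
    then have B [measurable]: "B \<in> sets regular_paths" by (simp add: K_def)
    have [measurable]: "(\<lambda>\<omega>. emeasure (Q (?X \<omega> (enn2real (\<tau> \<omega>)))) B) \<in> borel_measurable (P y)"
      by (rule measurable_compose[OF kernel measurable_emeasure_subprob_algebra[OF B]])
    have "emeasure K B = (\<integral>\<^sup>+\<omega>. W \<omega> * indicator B (shift (enn2real (\<tau> \<omega>)) (?X \<omega>)) \<partial>P y)"
      unfolding K_def by (subst emeasure_distr_density) simp_all
    also have "\<dots> = (\<integral>\<^sup>+\<omega>. W \<omega> * emeasure (Q (?X \<omega> (enn2real (\<tau> \<omega>)))) B \<partial>P y)"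
      unfolding W_def by (rule gB[OF B])
    also have "\<dots> = emeasure L B"
      unfolding L_def using ne by (subst emeasure_bind[OF _ kernel' B]) (simp_all add: nn_integral_density)
    finally show "emeasure K B = emeasure L B" .
  qed
  then have "(\<integral>\<^sup>+x. \<Phi> x \<partial>K) = (\<integral>\<^sup>+x. \<Phi> x \<partial>L)" by simp
  moreover have "(\<integral>\<^sup>+x. \<Phi> x \<partial>K) = (\<integral>\<^sup>+\<omega>. W \<omega> * \<Phi> (shift (enn2real (\<tau> \<omega>)) (?X \<omega>)) \<partial>P y)"
    unfolding K_def by (simp add: nn_integral_distr nn_integral_density)
  moreover have "(\<integral>\<^sup>+x. \<Phi> x \<partial>L) = (\<integral>\<^sup>+\<omega>. W \<omega> * (\<integral>\<^sup>+f'. \<Phi> f' \<partial>Q (?X \<omega> (enn2real (\<tau> \<omega>)))) \<partial>P y)"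
    unfolding L_def nn_integral_bind[OF \<Phi> kernel']
    by (rule nn_integral_density) (auto intro!: measurable_compose[OF kernel nn_integral_measurable_subprob_algebra])
  ultimately have main: "(\<integral>\<^sup>+\<omega>. W \<omega> * \<Phi> (shift (enn2real (\<tau> \<omega>)) (?X \<omega>)) \<partial>P y) =
    (\<integral>\<^sup>+\<omega>. W \<omega> * (\<integral>\<^sup>+f'. \<Phi> f' \<partial>Q (?X \<omega> (enn2real (\<tau> \<omega>)))) \<partial>P y)" by simp
  have [measurable]: "(\<lambda>f. f (enn2real (h f))) \<in> regular_paths \<rightarrow>\<^sub>M count_space Nbar"
    "(\<lambda>f. shift (enn2real (h f)) f) \<in> regular_paths \<rightarrow>\<^sub>M regular_paths"
    by (intro measurable_eval measurable_shift; simp)+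
  have [measurable]: "(\<lambda>f. \<integral>\<^sup>+f'. \<Phi> f' \<partial>Q (f (enn2real (h f)))) \<in> borel_measurable regular_paths"
    by (rule measurable_compose[OF _ measurable_compose[OF Q_kernel nn_integral_measurable_subprob_algebra[OF \<Phi>]]]) measurable
  show ?thesis
    unfolding Q_def[of y] by (subst (1 2) nn_integral_distr) (use main in \<open>simp_all add: W_def \<tau>_def\<close>)
qed

sublocale regular_markov Q
proof (rule regular_markov.intro)
  fix y assume y: "y \<in> Nbar"
  show "prob_space (Q y)"
    unfolding Q_def using prob_space_P[OF y] by (rule prob_space.prob_space_distr) (rule path_measurable[OF y])
  show "sets (Q y) = sets regular_paths" by (simp add: Q_def)
  show "AE f in Q y. f 0 = y"
  proof -
    have "{f \<in> space regular_paths. f 0 = y} \<in> sets regular_paths"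
      using pred_count_space_eq[OF measurable_eval_const[of 0]] by (simp add: pred_def)
    then show ?thesis
      unfolding Q_def using start[OF y] by (subst AE_distr_iff[OF path_measurable[OF y]]) (auto simp: sample_path_def)
  qed
  show "(\<integral>\<^sup>+f. g (hit A f) * indicator {..<\<infinity>} (hit A f) * \<Phi> (shift (enn2real (hit A f)) f) \<partial>Q y) =
      (\<integral>\<^sup>+f. g (hit A f) * indicator {..<\<infinity>} (hit A f) * (\<integral>\<^sup>+f'. \<Phi> f' \<partial>Q (f (enn2real (hit A f)))) \<partial>Q y)"
    if "clopen A" "g \<in> borel_measurable borel" "\<Phi> \<in> borel_measurable regular_paths" for A g \<Phi>
    using that stopping_time_hit[OF that(1) path_space] by (intro SM_path[OF y]) auto
  show "(\<integral>\<^sup>+f. \<Phi> (shift t f) \<partial>Q y) = (\<integral>\<^sup>+f. (\<integral>\<^sup>+f'. \<Phi> f' \<partial>Q (f t)) \<partial>Q y)"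
    if "0 \<le> t" "\<Phi> \<in> borel_measurable regular_paths" for t \<Phi>
    using SM_path[OF y, of "\<lambda>_. ennreal t" "\<lambda>_. 1" \<Phi>] that by (simp add: stopping_time_const)
qed

end

section \<open>The entrance law from infinity\<close>

lemma nn_integral_exponential_laplace:
  assumes l: "0 < l" and a: "0 \<le> a"
  shows "(\<integral>\<^sup>+x. ennreal (exponential_density l x) * nexp (a * x) \<partial>lborel) = ennreal (l / (l + a))"
proof -
  have la: "0 < l + a" using assms by simp
  have "(\<integral>\<^sup>+x. ennreal (exponential_density l x) * nexp (a * x) \<partial>lborel) =
      (\<integral>\<^sup>+x. ennreal (l / (l + a)) * ennreal (exponential_density (l + a) x) \<partial>lborel)"
  proof (intro nn_integral_cong)
    fix x :: real
    have "exp (- (l * x)) * exp (- (a * x)) = exp (- ((l + a) * x))"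
      by (simp add: exp_add[symmetric] algebra_simps)
    then show "ennreal (exponential_density l x) * nexp (a * x) =
        ennreal (l / (l + a)) * ennreal (exponential_density (l + a) x)"
      using assms la by (simp add: exponential_density_def ennreal_mult''[symmetric] mult.commute[of x])
  qed
  also have "\<dots> = ennreal (l / (l + a)) * (\<integral>\<^sup>+x. ennreal (exponential_density (l + a) x) \<partial>lborel)"
    by (rule nn_integral_cmult) simp
  also have "(\<integral>\<^sup>+x. ennreal (exponential_density (l + a) x) \<partial>lborel) = 1"
    using prob_space.emeasure_space_1[OF prob_space_exponential_density[OF la]]
    by (simp add: emeasure_density)
  finally show ?thesis by simp
qed

text \<open>The Laplace transform at \<open>l\<close> of an exponential time of mean
  \<open>\<gamma> x\<close>.\<close>

definition hold_lap :: "(nat \<Rightarrow> real) \<Rightarrow> real \<Rightarrow> nat \<Rightarrow> real" where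
  "hold_lap \<gamma> l x = 1 / (1 + l * \<gamma> x)"

text \<open>The mean discounted length of such a time, that is, (1 -
  \<open>hold_lap \<gamma> l x\<close>) / l for l > 0. For \<open>\<gamma> x > 0\<close> it equals 1
  / (1 / \<gamma> x + l).\<close>

definition hold_res :: "(nat \<Rightarrow> real) \<Rightarrow> real \<Rightarrow> nat \<Rightarrow> real" where
  "hold_res \<gamma> l x = \<gamma> x / (1 + l * \<gamma> x)"

lemma one_minus_hold_lap: "0 < \<gamma> x \<Longrightarrow> 0 \<le> l \<Longrightarrow> 1 - hold_lap \<gamma> l x = l * hold_res \<gamma> l x"
proof -
  assume "0 < \<gamma> x" "0 \<le> l"
  then have "1 + l * \<gamma> x \<noteq> 0" by (smt (verit) mult_nonneg_nonneg)
  then show ?thesis by (simp add: hold_lap_def hold_res_def field_simps)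
qed

locale uniform_markov = regular_markov Q for Q +
  fixes \<gamma> :: "nat \<Rightarrow> real"
  assumes \<gamma>_pos: "1 \<le> x \<Longrightarrow> 0 < \<gamma> x"
    and \<gamma>_summable: "summable (\<lambda>x. \<gamma> (Suc x))"
    and exit_finite: "1 \<le> i \<Longrightarrow> AE f in Q (enat i). hit (Nbar - {enat i}) f < \<infinity>"
    and exit_exponential: "1 \<le> i \<Longrightarrow>
      distributed (Q (enat i)) lborel (\<lambda>f. enn2real (hit (Nbar - {enat i}) f)) (exponential_density (1 / \<gamma> i))"
    and hit_finite: "finite F \<Longrightarrow> F \<noteq> {} \<Longrightarrow> F \<subseteq> {1..} \<Longrightarrow> AE f in Q \<infinity>. hit (enat ` F) f < \<infinity>"
    and hit_uniform: "finite F \<Longrightarrow> F \<noteq> {} \<Longrightarrow> F \<subseteq> {1..} \<Longrightarrow> k \<in> F \<Longrightarrow>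
      emeasure (Q \<infinity>) {f \<in> space regular_paths. f (enn2real (hit (enat ` F) f)) = enat k} = ennreal (1 / card F)"
begin

abbreviation S :: "(real \<Rightarrow> enat) measure" where "S \<equiv> regular_paths"

definition exit :: "nat \<Rightarrow> (real \<Rightarrow> enat) \<Rightarrow> real" where
  "exit i f = enn2real (hit (Nbar - {enat i}) f)"

definition entry :: "nat set \<Rightarrow> (real \<Rightarrow> enat) \<Rightarrow> real" where
  "entry F f = enn2real (hit (enat ` F) f)"

lemma prob_infty: "prob_space (Q \<infinity>)"
  by (rule prob_Q) simp

lemma prob_enat: "1 \<le> i \<Longrightarrow> prob_space (Q (enat i))"
  by (rule prob_Q) simp

lemma sets_infty [measurable_cong]: "sets (Q \<infinity>) = sets S"
  by (rule sets_Q) simp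

lemma sets_enat: "1 \<le> i \<Longrightarrow> sets (Q (enat i)) = sets S"
  by (rule sets_Q) simp

lemma space_Q: "y \<in> Nbar \<Longrightarrow> space (Q y) = space S"
  by (rule sets_eq_imp_space_eq) (rule sets_Q)

lemma measurable_Q: "y \<in> Nbar \<Longrightarrow> measurable (Q y) N = measurable S N"
  by (rule measurable_cong_sets) (simp_all add: sets_Q)

lemma exit_meas [measurable]: "1 \<le> i \<Longrightarrow> exit i \<in> borel_measurable S"
  unfolding exit_def[abs_def] by (intro borel_measurable_enn2real measurable_hit clopen_exit)

lemma exit_nonneg [simp]: "0 \<le> exit i f"
  by (simp add: exit_def)

lemma entry_meas: "finite F \<Longrightarrow> F \<subseteq> {1..} \<Longrightarrow> entry F \<in> borel_measurable S"
  unfolding entry_def[abs_def] by (intro borel_measurable_enn2real measurable_hit clopen_finite) auto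

lemma entry_nonneg [simp]: "0 \<le> entry F f"
  by (simp add: entry_def)

lemma shift_meas: "T \<in> borel_measurable S \<Longrightarrow> (\<And>f. 0 \<le> T f) \<Longrightarrow> (\<lambda>f. shift (T f) f) \<in> S \<rightarrow>\<^sub>M S"
  by (rule measurable_shift) auto

lemma eval_meas: "T \<in> borel_measurable S \<Longrightarrow> (\<And>f. 0 \<le> T f) \<Longrightarrow> (\<lambda>f. f (T f)) \<in> S \<rightarrow>\<^sub>M count_space Nbar"
  by (rule measurable_eval) auto

lemma hit_iff: "hit A f < \<infinity> \<Longrightarrow> t < enn2real (hit A f) \<Longrightarrow> 0 \<le> t \<Longrightarrow> f t \<notin> A"
  using hit_before[of t A f] ennreal_less_iff[of t "enn2real (hit A f)"] by simp

lemma exit_stay: "hit (Nbar - {enat i}) f < \<infinity> \<Longrightarrow> f \<in> space S \<Longrightarrow> 0 \<le> t \<Longrightarrow> t < exit i f \<Longrightarrow> f t = enat i"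
  using hit_iff[of "Nbar - {enat i}" f t] regular_paths_Nbar[of f t] unfolding exit_def by blast

lemma exit_leave: "1 \<le> i \<Longrightarrow> hit (Nbar - {enat i}) f < \<infinity> \<Longrightarrow> f \<in> space S \<Longrightarrow> f (exit i f) \<noteq> enat i"
  using hit_attained[OF clopen_exit, of i f] unfolding exit_def by blast

lemma entry_before: "hit (enat ` F) f < \<infinity> \<Longrightarrow> 0 \<le> t \<Longrightarrow> t < entry F f \<Longrightarrow> f t \<notin> enat ` F"
  unfolding entry_def by (rule hit_iff)

lemma entry_in: "finite F \<Longrightarrow> F \<subseteq> {1..} \<Longrightarrow> hit (enat ` F) f < \<infinity> \<Longrightarrow> f \<in> space S \<Longrightarrow> f (entry F f) \<in> enat ` F"
  unfolding entry_def by (rule hit_attained[OF clopen_finite]) auto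

lemma entry_eqI:
  assumes "0 \<le> t" "f t \<in> enat ` F" "\<And>s. 0 \<le> s \<Longrightarrow> s < t \<Longrightarrow> f s \<notin> enat ` F"
  shows "entry F f = t"
proof -
  have "hit (enat ` F) f = ennreal t"
  proof (rule antisym)
    show "hit (enat ` F) f \<le> ennreal t" by (rule hit_le) (use assms in auto)
    show "ennreal t \<le> hit (enat ` F) f"
    proof (rule ccontr)
      assume "\<not> ennreal t \<le> hit (enat ` F) f"
      then obtain s where "0 \<le> s" "ennreal s < ennreal t" "f s \<in> enat ` F"
        unfolding not_le hit_less_iff by blast
      then show False using assms(3)[of s] by (simp add: ennreal_less_iff)
    qed
  qed
  then show ?thesis using assms(1) by (simp add: entry_def)
qed

lemma entry_AE:
  assumes F: "finite F" "F \<noteq> {}" "F \<subseteq> {1..}"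
  shows "AE f in Q \<infinity>. hit (enat ` F) f < \<infinity> \<and> f (entry F f) \<in> enat ` F"
  using hit_finite[OF F] AE_space[of "Q \<infinity>"]
  by eventually_elim (use entry_in[OF F(1,3)] space_Q[of \<infinity>] in auto)

definition ind :: "bool \<Rightarrow> ennreal" where "ind b = (if b then 1 else 0)"

lemma ind_meas: "Measurable.pred M P \<Longrightarrow> (\<lambda>x. ind (P x)) \<in> borel_measurable M"
  unfolding ind_def by measurable

lemma pred_eval_meas: "T \<in> borel_measurable S \<Longrightarrow> (\<And>f. 0 \<le> T f) \<Longrightarrow> Measurable.pred S (\<lambda>f. f (T f) = z)"
  by (rule pred_count_space_eq[OF eval_meas])

text \<open>The strong Markov property at the entry into \<open>F\<close>, sorted by the finitely
  many states that can be entered: given this state, the entry time and the future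
  factorise.\<close>

lemma markov_entry:
  assumes F: "finite F" "F \<noteq> {}" "F \<subseteq> {1..}"
    and g [measurable]: "g \<in> borel_measurable borel" and \<Phi> [measurable]: "\<Phi> \<in> borel_measurable S"
  shows "(\<integral>\<^sup>+f. g (entry F f) * \<Phi> (shift (entry F f) f) \<partial>Q \<infinity>) =
    (\<Sum>k\<in>F. (\<integral>\<^sup>+f. g (entry F f) * ind (f (entry F f) = enat k) \<partial>Q \<infinity>) * (\<integral>\<^sup>+f. \<Phi> f \<partial>Q (enat k)))"
proof -
  note [measurable] = entry_meas[OF F(1,3)] pred_eval_meas[OF entry_meas[OF F(1,3)] entry_nonneg]
  have cl: "clopen (enat ` F)" using F by (intro clopen_finite) auto
  have "(\<integral>\<^sup>+f. g (entry F f) * \<Phi> (shift (entry F f) f) \<partial>Q \<infinity>) =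
     (\<integral>\<^sup>+f. g (enn2real (hit (enat ` F) f)) * indicator {..<\<infinity>} (hit (enat ` F) f) * \<Phi> (shift (enn2real (hit (enat ` F) f)) f) \<partial>Q \<infinity>)"
    using entry_AE[OF F] unfolding entry_def by (intro nn_integral_cong_AE) auto
  also have "\<dots> = (\<integral>\<^sup>+f. g (enn2real (hit (enat ` F) f)) * indicator {..<\<infinity>} (hit (enat ` F) f) *
      (\<integral>\<^sup>+f'. \<Phi> f' \<partial>Q (f (enn2real (hit (enat ` F) f)))) \<partial>Q \<infinity>)"
    using markov_hit[of \<infinity> "enat ` F" "\<lambda>x. g (enn2real x)" \<Phi>] cl by simp
  also have "\<dots> = (\<integral>\<^sup>+f. (\<Sum>k\<in>F. g (entry F f) * ind (f (entry F f) = enat k) * (\<integral>\<^sup>+f. \<Phi> f \<partial>Q (enat k))) \<partial>Q \<infinity>)"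
  proof (rule nn_integral_cong_AE)
    show "AE f in Q \<infinity>. g (enn2real (hit (enat ` F) f)) * indicator {..<\<infinity>} (hit (enat ` F) f) *
      (\<integral>\<^sup>+f'. \<Phi> f' \<partial>Q (f (enn2real (hit (enat ` F) f)))) =
      (\<Sum>k\<in>F. g (entry F f) * ind (f (entry F f) = enat k) * (\<integral>\<^sup>+f. \<Phi> f \<partial>Q (enat k)))"
      using entry_AE[OF F]
    proof eventually_elim
      case (elim f)
      then obtain k where k: "k \<in> F" "f (entry F f) = enat k" by blast
      have "(\<Sum>j\<in>F. g (entry F f) * ind (f (entry F f) = enat j) * (\<integral>\<^sup>+f. \<Phi> f \<partial>Q (enat j))) =
         (\<Sum>j\<in>{k}. g (entry F f) * ind (f (entry F f) = enat j) * (\<integral>\<^sup>+f. \<Phi> f \<partial>Q (enat j)))"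
        using k F by (intro sum.mono_neutral_right) (auto simp: ind_def)
      then show ?case using elim k unfolding entry_def by (simp add: ind_def)
    qed
  qed
  also have "\<dots> = (\<Sum>k\<in>F. (\<integral>\<^sup>+f. g (entry F f) * ind (f (entry F f) = enat k) \<partial>Q \<infinity>) * (\<integral>\<^sup>+f. \<Phi> f \<partial>Q (enat k)))"
  proof (subst nn_integral_sum)
    fix k
    have [measurable]: "(\<lambda>f. ind (f (entry F f) = enat k)) \<in> borel_measurable S"
      by (rule ind_meas) measurable
    show "(\<lambda>f. g (entry F f) * ind (f (entry F f) = enat k) * (\<integral>\<^sup>+f. \<Phi> f \<partial>Q (enat k))) \<in> borel_measurable (Q \<infinity>)"
      by measurable
  next
    show "(\<Sum>k\<in>F. \<integral>\<^sup>+f. g (entry F f) * ind (f (entry F f) = enat k) * (\<integral>\<^sup>+f. \<Phi> f \<partial>Q (enat k)) \<partial>Q \<infinity>) =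
      (\<Sum>k\<in>F. (\<integral>\<^sup>+f. g (entry F f) * ind (f (entry F f) = enat k) \<partial>Q \<infinity>) * (\<integral>\<^sup>+f. \<Phi> f \<partial>Q (enat k)))"
    proof (rule sum.cong[OF refl])
      fix k
      have [measurable]: "(\<lambda>f. ind (f (entry F f) = enat k)) \<in> borel_measurable S"
        by (rule ind_meas) measurable
      show "(\<integral>\<^sup>+f. g (entry F f) * ind (f (entry F f) = enat k) * (\<integral>\<^sup>+f. \<Phi> f \<partial>Q (enat k)) \<partial>Q \<infinity>) =
        (\<integral>\<^sup>+f. g (entry F f) * ind (f (entry F f) = enat k) \<partial>Q \<infinity>) * (\<integral>\<^sup>+f. \<Phi> f \<partial>Q (enat k))"
        by (rule nn_integral_multc) measurable
    qed
  qed
  finally show ?thesis .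
qed

lemma entry_uniform:
  assumes F: "finite F" "F \<subseteq> {1..}" "k \<in> F"
  shows "(\<integral>\<^sup>+f. ind (f (entry F f) = enat k) \<partial>Q \<infinity>) = ennreal (1 / card F)"
proof -
  have "(\<integral>\<^sup>+f. ind (f (entry F f) = enat k) \<partial>Q \<infinity>) = (\<integral>\<^sup>+f. indicator {f \<in> space S. f (entry F f) = enat k} f \<partial>Q \<infinity>)"
    by (rule nn_integral_cong) (auto simp: ind_def space_Q)
  also have "\<dots> = emeasure (Q \<infinity>) {f \<in> space S. f (entry F f) = enat k}"
    using pred_eval_meas[OF entry_meas[OF F(1,2)] entry_nonneg, of "enat k"]
    by (intro nn_integral_indicator) (simp add: pred_def sets_infty)
  also have "\<dots> = ennreal (1 / card F)"
    unfolding entry_def using F by (intro hit_uniform) auto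
  finally show ?thesis .
qed

text \<open>Let n = \<open>card F\<close>, add \<open>i\<close> to \<open>F\<close>, and start at
  infinity. If the enlarged set is entered at \<open>j\<close>, or at \<open>i\<close> and the next
  jump leads to \<open>j\<close>, then \<open>F\<close> is entered at \<open>j\<close>. By
  uniformity the probability q of that jump satisfies (q + 1) / (n + 1) \<le> 1 / n, whence q \<le>
  1 / n.\<close>

lemma exit_to_bound:
  assumes F: "finite F" "F \<subseteq> {1..}" "i \<notin> F" "1 \<le> i" "j \<in> F"
  shows "(\<integral>\<^sup>+f. ind (f (exit i f) = enat j) \<partial>Q (enat i)) \<le> ennreal (1 / card F)"
proof -
  define A where "A = insert i F"
  have A: "finite A" "A \<noteq> {}" "A \<subseteq> {1..}" and cA: "card A = card F + 1"
    using F by (auto simp: A_def)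
  have j1: "1 \<le> j" "i \<noteq> j" using F by auto
  define \<Psi> where "\<Psi> f = ind (hit (Nbar - {enat i}) f < \<infinity> \<and> f (exit i f) = enat j)" for f
  \<comment> \<open>The two ways of reaching \<open>j\<close>. The tests at time 0 make
    \<open>\<Phi>\<close> vanish when the enlarged set is entered at any other state.\<close>
  define \<Phi> where "\<Phi> f = ind (f 0 = enat j) + ind (f 0 = enat i) * \<Psi> f" for f
  note [measurable] = exit_meas[OF F(4)] pred_eval_meas[OF exit_meas[OF F(4)] exit_nonneg] clopen_exit[OF F(4)]
  have m0: "Measurable.pred S (\<lambda>f. f 0 = z)" for z
    using pred_eval_meas[of "\<lambda>_. 0"] by simp
  have [measurable]: "\<Psi> \<in> borel_measurable S"
    unfolding \<Psi>_def[abs_def] by (rule ind_meas) measurable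
  have [measurable]: "(\<lambda>f. ind (f 0 = z)) \<in> borel_measurable S" for z
    by (rule ind_meas) (rule m0)
  have [measurable]: "\<Phi> \<in> borel_measurable S"
    unfolding \<Phi>_def[abs_def] by measurable
  have path: "\<Phi> (shift (entry A f) f) \<le> ind (f (entry F f) = enat j)"
    if f: "f \<in> space S" "hit (enat ` A) f < \<infinity>" for f
  proof -
    let ?s = "shift (entry A f) f"
    have before: "f s \<notin> enat ` A" if "0 \<le> s" "s < entry A f" for s
      using entry_before[OF f(2) that] .
    have "\<Psi> ?s = 1 \<or> \<Psi> ?s = 0" by (simp add: \<Psi>_def ind_def)
    then consider "f (entry A f) = enat j" | "f (entry A f) = enat i" "\<Psi> ?s = 1" | "\<Phi> ?s = 0"
      unfolding \<Phi>_def by (cases "f (entry A f) = enat j"; cases "f (entry A f) = enat i") (auto simp: ind_def)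
    then show ?thesis
    proof cases
      case 1
      have "entry F f = entry A f"
        using 1 F before by (intro entry_eqI) (auto simp: A_def)
      then show ?thesis
        using 1 j1 by (simp add: \<Phi>_def ind_def)
    next
      case 2
      have s: "?s \<in> space S" using f by (intro shift_regular_paths) auto
      have *: "hit (Nbar - {enat i}) ?s < \<infinity>" "?s (exit i ?s) = enat j"
        using 2(2) unfolding \<Psi>_def ind_def by (auto split: if_splits)
      \<comment> \<open>While \<open>i\<close> is held no state of \<open>F\<close> is visited,
        since \<open>i\<close> is not in \<open>F\<close>.\<close>
      have "entry F f = entry A f + exit i ?s"
      proof (rule entry_eqI)
        show "f (entry A f + exit i ?s) \<in> enat ` F" using *(2) F by simp
        fix s assume s0: "0 \<le> s" "s < entry A f + exit i ?s"
        show "f s \<notin> enat ` F"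
        proof (cases "s < entry A f")
          case True
          then show ?thesis using before[OF s0(1)] by (auto simp: A_def)
        next
          case False
          then have "?s (s - entry A f) = enat i"
            using s0 by (intro exit_stay[OF *(1) s]) auto
          then show ?thesis using False F(3) by auto
        qed
      qed simp
      then have "f (entry F f) = enat j" using *(2) by simp
      then show ?thesis using 2 j1 by (simp add: \<Phi>_def ind_def)
    qed simp
  qed
  have "(\<integral>\<^sup>+f. \<Phi> (shift (entry A f) f) \<partial>Q \<infinity>) \<le> (\<integral>\<^sup>+f. ind (f (entry F f) = enat j) \<partial>Q \<infinity>)"
    using hit_finite[OF A] AE_space[of "Q \<infinity>"] by (intro nn_integral_mono_AE, eventually_elim) (use path space_Q in auto)
  then have le: "(\<integral>\<^sup>+f. \<Phi> (shift (entry A f) f) \<partial>Q \<infinity>) \<le> ennreal (1 / card F)"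
    using entry_uniform[OF F(1,2,5)] by simp
  define q where "q = (\<integral>\<^sup>+f. ind (f (exit i f) = enat j) \<partial>Q (enat i))"
  have "(\<integral>\<^sup>+f. 1 \<partial>Q (enat j)) \<le> (\<integral>\<^sup>+f. \<Phi> f \<partial>Q (enat j))"
    using start_Q[of "enat j"] j1 by (intro nn_integral_mono_AE) (auto simp: \<Phi>_def ind_def)
  then have qj: "1 \<le> (\<integral>\<^sup>+f. \<Phi> f \<partial>Q (enat j))"
    using prob_space.emeasure_space_1[OF prob_enat[OF j1(1)]] by simp
  have qi: "(\<integral>\<^sup>+f. \<Phi> f \<partial>Q (enat i)) = q"
    unfolding q_def
  proof (rule nn_integral_cong_AE)
    show "AE f in Q (enat i). \<Phi> f = ind (f (exit i f) = enat j)"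
      using start_Q[of "enat i", simplified, OF F(4)[simplified]] exit_finite[OF F(4)]
      by eventually_elim (use j1 in \<open>auto simp: \<Phi>_def \<Psi>_def ind_def\<close>)
  qed
  have "ennreal (1 / card A) * q + ennreal (1 / card A) * 1 \<le> ennreal (1 / card A) * q + ennreal (1 / card A) * (\<integral>\<^sup>+f. \<Phi> f \<partial>Q (enat j))"
    by (intro add_left_mono mult_left_mono qj) simp
  also have "\<dots> = (\<Sum>k\<in>{i,j}. ennreal (1 / card A) * (\<integral>\<^sup>+f. \<Phi> f \<partial>Q (enat k)))"
    using j1 qi by simp
  also have "\<dots> \<le> (\<Sum>k\<in>A. ennreal (1 / card A) * (\<integral>\<^sup>+f. \<Phi> f \<partial>Q (enat k)))"
    using A F by (intro sum_mono2) (auto simp: A_def)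
  also have "\<dots> = (\<integral>\<^sup>+f. \<Phi> (shift (entry A f) f) \<partial>Q \<infinity>)"
    using markov_entry[OF A, of "\<lambda>_. 1" \<Phi>] entry_uniform[OF A(1,3)] by simp
  finally have *: "ennreal (1 / card A) * q + ennreal (1 / card A) \<le> ennreal (1 / card F)"
    using le by (simp add: order_trans)
  have n0: "0 < real (card F)" using F by (simp add: card_gt_0_iff) (metis empty_iff)
  have "q \<le> (\<integral>\<^sup>+f. 1 \<partial>Q (enat i))"
    unfolding q_def by (intro nn_integral_mono) (simp add: ind_def)
  also have "\<dots> = 1" using prob_space.emeasure_space_1[OF prob_enat[OF F(4)]] by simp
  finally obtain r where r: "q = ennreal r" "0 \<le> r"
    by (cases q) (auto simp: top_unique)
  have "ennreal ((r + 1) / (real (card F) + 1)) \<le> ennreal (1 / card F)"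
    using * r by (simp add: cA ennreal_mult''[symmetric] ennreal_plus[symmetric] add_divide_distrib add.commute[of 1] del: ennreal_plus)
  then have "(r + 1) / (real (card F) + 1) \<le> 1 / card F"
    by (subst (asm) ennreal_le_iff) auto
  then have "r \<le> 1 / card F"
    using n0 by (simp add: field_simps)
  then show ?thesis
    unfolding q_def[symmetric] r(1) by (rule ennreal_leI)
qed

text \<open>The set \<open>F\<close> in \<open>exit_to_bound\<close> can be taken arbitrarily large
  around \<open>j\<close>. So no finite state is reached with positive probability, and infinity is
  all that remains.\<close>

lemma exit_to_infty:
  assumes i: "1 \<le> i"
  shows "AE f in Q (enat i). f (exit i f) = \<infinity>"
proof -
  note [measurable] = pred_eval_meas[OF exit_meas[OF i] exit_nonneg]
  note [measurable_cong] = sets_enat[OF i]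
  have "AE f in Q (enat i). f (exit i f) \<noteq> enat j" if j: "1 \<le> j" "j \<noteq> i" for j
  proof -
    let ?q = "\<integral>\<^sup>+f. ind (f (exit i f) = enat j) \<partial>Q (enat i)"
    have "?q \<le> ennreal (1 / real (Suc n))" for n
    proof -
      \<comment> \<open>This set contains \<open>j\<close>, avoids \<open>i\<close>, and has at
        least n + 1 elements.\<close>
      have "card ({1..i + j + n + 1} - {i}) = i + j + n"
        using i by (simp add: card_Diff_singleton)
      moreover have "?q \<le> ennreal (1 / card ({1..i + j + n + 1} - {i}))"
        by (rule exit_to_bound) (use i j in auto)
      ultimately have "?q \<le> ennreal (1 / (i + j + n))" by (simp only:)
      also have "\<dots> \<le> ennreal (1 / real (Suc n))"
        using i j by (intro ennreal_leI divide_left_mono) auto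
      finally show ?thesis .
    qed
    then have "?q \<le> 0"
      by (intro LIMSEQ_le_const[OF tendsto_ennrealI[OF LIMSEQ_Suc[OF lim_1_over_n], simplified]]) auto
    moreover have [measurable]: "(\<lambda>f. ind (f (exit i f) = enat j)) \<in> borel_measurable (Q (enat i))"
      by (rule ind_meas) measurable
    ultimately have "AE f in Q (enat i). ind (f (exit i f) = enat j) = 0"
      by (simp add: nn_integral_0_iff_AE)
    then show ?thesis by eventually_elim (auto simp: ind_def split: if_splits)
  qed
  then have "AE f in Q (enat i). \<forall>j. 1 \<le> j \<longrightarrow> j \<noteq> i \<longrightarrow> f (exit i f) \<noteq> enat j"
    by (auto simp: AE_all_countable)
  then show ?thesis
    using exit_finite[OF i] AE_space[of "Q (enat i)"]
  proof eventually_elim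
    case (elim f)
    then have f: "f \<in> space S" using space_Q[of "enat i"] i by simp
    have "f (exit i f) \<in> Nbar" "f (exit i f) \<noteq> enat i"
      using regular_paths_Nbar[OF f] exit_leave[OF i elim(2) f] by auto
    then show ?case
      using elim(1) by (cases "f (exit i f)") auto
  qed
qed

text \<open>Since a hold ends at infinity, whatever its length, the future after it is governed by
  \<open>Q \<infinity>\<close> and independent of that length.\<close>

lemma markov_exit:
  assumes i: "1 \<le> i" and g [measurable]: "g \<in> borel_measurable borel" and \<Phi> [measurable]: "\<Phi> \<in> borel_measurable S"
  shows "(\<integral>\<^sup>+f. g (exit i f) * \<Phi> (shift (exit i f) f) \<partial>Q (enat i)) =
    (\<integral>\<^sup>+f. g (exit i f) \<partial>Q (enat i)) * (\<integral>\<^sup>+f. \<Phi> f \<partial>Q \<infinity>)"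
proof -
  note [measurable] = exit_meas[OF i]
  note [measurable_cong] = sets_enat[OF i]
  let ?h = "hit (Nbar - {enat i})"
  have "(\<integral>\<^sup>+f. g (exit i f) * \<Phi> (shift (exit i f) f) \<partial>Q (enat i)) =
     (\<integral>\<^sup>+f. g (enn2real (?h f)) * indicator {..<\<infinity>} (?h f) * \<Phi> (shift (enn2real (?h f)) f) \<partial>Q (enat i))"
    using exit_finite[OF i] unfolding exit_def by (intro nn_integral_cong_AE) (auto elim!: AE_mp)
  also have "\<dots> = (\<integral>\<^sup>+f. g (enn2real (?h f)) * indicator {..<\<infinity>} (?h f) *
      (\<integral>\<^sup>+f'. \<Phi> f' \<partial>Q (f (enn2real (?h f)))) \<partial>Q (enat i))"
    using markov_hit[of "enat i" "Nbar - {enat i}" "\<lambda>x. g (enn2real x)" \<Phi>] clopen_exit[OF i] i by simp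
  also have "\<dots> = (\<integral>\<^sup>+f. g (exit i f) * (\<integral>\<^sup>+f. \<Phi> f \<partial>Q \<infinity>) \<partial>Q (enat i))"
  proof (rule nn_integral_cong_AE)
    show "AE f in Q (enat i). g (enn2real (?h f)) * indicator {..<\<infinity>} (?h f) *
      (\<integral>\<^sup>+f'. \<Phi> f' \<partial>Q (f (enn2real (?h f)))) = g (exit i f) * (\<integral>\<^sup>+f. \<Phi> f \<partial>Q \<infinity>)"
      using exit_finite[OF i] exit_to_infty[OF i] unfolding exit_def by eventually_elim simp
  qed
  also have "\<dots> = (\<integral>\<^sup>+f. g (exit i f) \<partial>Q (enat i)) * (\<integral>\<^sup>+f. \<Phi> f \<partial>Q \<infinity>)"
    by (rule nn_integral_multc) measurable
  finally show ?thesis .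
qed

lemma exit_laplace:
  assumes i: "1 \<le> i" and l: "0 \<le> l"
  shows "(\<integral>\<^sup>+f. nexp (l * exit i f) \<partial>Q (enat i)) = ennreal (hold_lap \<gamma> l i)"
proof -
  have g: "0 < 1 / \<gamma> i" using \<gamma>_pos[OF i] by simp
  have "(\<integral>\<^sup>+f. nexp (l * exit i f) \<partial>Q (enat i)) =
     (\<integral>\<^sup>+x. ennreal (exponential_density (1 / \<gamma> i) x) * nexp (l * x) \<partial>lborel)"
    unfolding exit_def using distributed_nn_integral[OF exit_exponential[OF i], of "\<lambda>x. nexp (l * x)"] by simp
  also have "\<dots> = ennreal (hold_lap \<gamma> l i)"
    using nn_integral_exponential_laplace[OF g l] \<gamma>_pos[OF i] l by (simp add: hold_lap_def field_simps)
  finally show ?thesis .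
qed

end

section \<open>Discounted occupation integrals along a path\<close>

lemma nn_integral_exp_Icc:
  assumes l: "0 < l" and s: "0 \<le> s"
  shows "(\<integral>\<^sup>+t. nexp (l * t) * indicator {0..s} t \<partial>lborel) = ennreal ((1 - exp (- (l * s))) / l)"
proof -
  have "(\<integral>\<^sup>+t. nexp (l * t) * indicator {0..s} t \<partial>lborel) =
      ennreal (- (exp (- (l * s)) / l) - - (exp (- (l * 0)) / l))"
    using l s by (intro nn_integral_FTC_Icc) (auto intro!: derivative_eq_intros)
  also have "- (exp (- (l * s)) / l) - - (exp (- (l * 0)) / l) = (1 - exp (- (l * s))) / l"
    using l by (simp add: field_simps)
  finally show ?thesis .
qed

lemma nn_integral_exp_Ici:
  assumes l: "0 < l"
  shows "(\<integral>\<^sup>+t. nexp (l * t) * indicator {0..} t \<partial>lborel) = ennreal (1 / l)"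
proof -
  have "(\<integral>\<^sup>+t. nexp (l * t) * indicator {0..} t \<partial>lborel) =
      (\<integral>\<^sup>+t. ennreal (1 / l) * ennreal (exponential_density l t) \<partial>lborel)"
    using l by (intro nn_integral_cong)
      (auto simp: exponential_density_def ennreal_mult''[symmetric] mult.commute split: split_indicator)
  also have "\<dots> = ennreal (1 / l) * (\<integral>\<^sup>+t. ennreal (exponential_density l t) \<partial>lborel)"
    by (rule nn_integral_cmult) simp
  also have "(\<integral>\<^sup>+x. ennreal (exponential_density l x) \<partial>lborel) = 1"
    using prob_space.emeasure_space_1[OF prob_space_exponential_density[OF l]]
    by (simp add: emeasure_density)
  finally show ?thesis by simp
qed

definition occupation :: "real \<Rightarrow> (enat \<Rightarrow> ennreal) \<Rightarrow> (real \<Rightarrow> enat) \<Rightarrow> ennreal" where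
  "occupation l w f = (\<integral>\<^sup>+t. nexp (l * t) * indicator {0..} t * w (f t) \<partial>lborel)"

lemma occupation_joint_meas:
  "(\<lambda>(f, t). nexp (l * t) * indicator {0..} t * w (f t)) \<in> borel_measurable (regular_paths \<Otimes>\<^sub>M lborel)"
proof -
  \<comment> \<open>\<open>max 0\<close> keeps the evaluation at nonnegative times; the indicator
    later removes the difference.\<close>
  have "(\<lambda>p. fst p (max 0 (snd p))) \<in> regular_paths \<Otimes>\<^sub>M lborel \<rightarrow>\<^sub>M count_space Nbar"
    by (rule measurable_eval) auto
  then have [measurable]: "(\<lambda>p. w (fst p (max 0 (snd p)))) \<in> borel_measurable (regular_paths \<Otimes>\<^sub>M lborel)"
    by (rule measurable_compose) simp
  have "(\<lambda>p. nexp (l * snd p) * indicator {0..} (snd p) * w (fst p (max 0 (snd p)))) \<in> borel_measurable (regular_paths \<Otimes>\<^sub>M lborel)"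
    by measurable
  also have "(\<lambda>p. nexp (l * snd p) * indicator {0..} (snd p) * w (fst p (max 0 (snd p)))) =
     (\<lambda>(f, t). nexp (l * t) * indicator {0..} t * w (f t))"
    by (auto simp: fun_eq_iff max_def split: split_indicator)
  finally show ?thesis .
qed

lemma occupation_meas [measurable]: "occupation l w \<in> borel_measurable regular_paths"
  unfolding occupation_def[abs_def] using lborel.borel_measurable_nn_integral[OF occupation_joint_meas] by simp

lemma occupation_path_meas:
  fixes w :: "enat \<Rightarrow> ennreal"
  assumes f: "f \<in> space regular_paths"
  shows "(\<lambda>t. w (f t) * indicator {0..} t) \<in> borel_measurable lborel"
proof -
  have "(\<lambda>t. (\<lambda>_. f) t (max 0 t)) \<in> lborel \<rightarrow>\<^sub>M count_space Nbar"
    by (rule measurable_eval) (use f in auto)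
  then have [measurable]: "(\<lambda>t. w (f (max 0 t))) \<in> borel_measurable lborel"
    by (rule measurable_compose) simp
  have "(\<lambda>t. w (f (max 0 t)) * indicator {0..} t) \<in> borel_measurable lborel"
    by measurable
  also have "(\<lambda>t. w (f (max 0 t)) * indicator {0..} t) = (\<lambda>t. w (f t) * indicator {0..} t)"
    by (auto simp: fun_eq_iff max_def split: split_indicator)
  finally show ?thesis .
qed

lemma nn_integral_shift_real:
  fixes h :: "real \<Rightarrow> ennreal"
  assumes "h \<in> borel_measurable borel"
  shows "(\<integral>\<^sup>+t. h t \<partial>lborel) = (\<integral>\<^sup>+t. h (s + t) \<partial>lborel)"
  using nn_integral_real_affine[OF assms, of 1 s] by simp

lemma occupation_shift:
  assumes f: "f \<in> space regular_paths" and s: "0 \<le> s"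
  shows "(\<integral>\<^sup>+t. nexp (l * t) * indicator {s..} t * w (f t) \<partial>lborel) =
    nexp (l * s) * occupation l w (shift s f)"
proof -
  have eq: "nexp (l * t) * indicator {s..} t * w (f t) =
      nexp (l * t) * indicator {s..} t * (w (f t) * indicator {0..} t)" for t
    using s by (auto split: split_indicator)
  have [measurable]: "(\<lambda>t. w (f t) * indicator {0..} t) \<in> borel_measurable borel"
    using occupation_path_meas[OF f] by simp
  have "(\<integral>\<^sup>+t. nexp (l * t) * indicator {s..} t * w (f t) \<partial>lborel) =
      (\<integral>\<^sup>+t. nexp (l * (s + t)) * indicator {s..} (s + t) * (w (f (s + t)) * indicator {0..} (s + t)) \<partial>lborel)"
    unfolding eq by (rule nn_integral_shift_real) measurable
  also have "\<dots> = (\<integral>\<^sup>+t. nexp (l * s) * (nexp (l * t) * indicator {0..} t * w (shift s f t)) \<partial>lborel)"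
  proof (rule nn_integral_cong)
    fix t :: real
    have "nexp (l * (s + t)) = nexp (l * s) * nexp (l * t)"
      by (simp add: ennreal_mult''[symmetric] exp_add[symmetric] distrib_left)
    then show "nexp (l * (s + t)) * indicator {s..} (s + t) * (w (f (s + t)) * indicator {0..} (s + t)) =
        nexp (l * s) * (nexp (l * t) * indicator {0..} t * w (shift s f t))"
      using s by (cases "0 \<le> t") (simp_all add: mult.assoc)
  qed
  also have "\<dots> = nexp (l * s) * occupation l w (shift s f)"
    unfolding occupation_def
  proof (rule nn_integral_cmult)
    have [measurable]: "(\<lambda>t. w (shift s f t) * indicator {0..} t) \<in> borel_measurable lborel"
      by (rule occupation_path_meas) (rule shift_regular_paths[OF f s])
    have "(\<lambda>t. nexp (l * t) * (w (shift s f t) * indicator {0..} t)) \<in> borel_measurable lborel"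
      by measurable
    then show "(\<lambda>t. nexp (l * t) * indicator {0..} t * w (shift s f t)) \<in> borel_measurable lborel"
      by (simp add: mult_ac)
  qed
  finally show ?thesis .
qed

lemma occupation_split:
  assumes f: "f \<in> space regular_paths" and s: "0 \<le> s" and w: "\<And>t. 0 \<le> t \<Longrightarrow> t < s \<Longrightarrow> w (f t) = c" and l: "0 < l"
  shows "occupation l w f = ennreal ((1 - exp (- (l * s))) / l) * c + nexp (l * s) * occupation l w (shift s f)"
proof -
  have [measurable]: "(\<lambda>t. w (f t) * indicator {0..} t) \<in> borel_measurable lborel"
    using occupation_path_meas[OF f] .
  have "occupation l w f = (\<integral>\<^sup>+t. nexp (l * t) * indicator {0..s} t * c +
      nexp (l * t) * indicator {s..} t * (w (f t) * indicator {0..} t) \<partial>lborel)"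
    unfolding occupation_def
  proof (rule nn_integral_cong_AE)
    have "AE t in lborel. t \<noteq> s" by (rule AE_lborel_singleton)
    then show "AE t in lborel. nexp (l * t) * indicator {0..} t * w (f t) = nexp (l * t) * indicator {0..s} t * c +
      nexp (l * t) * indicator {s..} t * (w (f t) * indicator {0..} t)"
      by eventually_elim (use s w in \<open>auto split: split_indicator\<close>)
  qed
  also have "\<dots> = (\<integral>\<^sup>+t. nexp (l * t) * indicator {0..s} t * c \<partial>lborel) +
      (\<integral>\<^sup>+t. nexp (l * t) * indicator {s..} t * (w (f t) * indicator {0..} t) \<partial>lborel)"
    by (rule nn_integral_add) measurable
  also have "(\<integral>\<^sup>+t. nexp (l * t) * indicator {0..s} t * c \<partial>lborel) = ennreal ((1 - exp (- (l * s))) / l) * c"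
    by (subst nn_integral_multc) (simp_all add: nn_integral_exp_Icc[OF l s])
  also have "(\<integral>\<^sup>+t. nexp (l * t) * indicator {s..} t * (w (f t) * indicator {0..} t) \<partial>lborel) =
      (\<integral>\<^sup>+t. nexp (l * t) * indicator {s..} t * w (f t) \<partial>lborel)"
    using s by (intro nn_integral_cong) (auto split: split_indicator)
  finally show ?thesis
    unfolding occupation_shift[OF f s] .
qed

text \<open>For each u \<ge> 0, exp (- l u) - exp (- m u) is (m - l) exp (- m u) times the integral
  of exp ((m - l) t) over 0 \<le> t \<le> u. Integrating against the weight and exchanging the
  integrals gives a resolvent identity path by path, before any Markov property.\<close>

lemma occupation_resolvent:
  assumes f: "f \<in> space regular_paths" and lm: "0 < l" "l < m"
  shows "occupation l w f = occupation m w f +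
    ennreal (m - l) * (\<integral>\<^sup>+t. nexp (l * t) * indicator {0..} t * occupation m w (shift t f) \<partial>lborel)"
proof -
  define W where "W u = w (f u) * indicator {0..} u" for u
  have [measurable]: "W \<in> borel_measurable lborel"
    unfolding W_def[abs_def] by (rule occupation_path_meas[OF f])
  have inner: "nexp (l * t) * indicator {0..} t * occupation m w (shift t f) =
      (\<integral>\<^sup>+u. ennreal (exp ((m - l) * t)) * (nexp (m * u) * indicator {0..} t * indicator {t..} u * W u) \<partial>lborel)" for t
  proof (cases "0 \<le> t")
    case True
    have "(\<integral>\<^sup>+u. ennreal (exp ((m - l) * t)) * (nexp (m * u) * indicator {0..} t * indicator {t..} u * W u) \<partial>lborel) =
        ennreal (exp ((m - l) * t)) * (\<integral>\<^sup>+u. nexp (m * u) * indicator {0..} t * indicator {t..} u * W u \<partial>lborel)"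
      by (rule nn_integral_cmult) measurable
    also have "(\<integral>\<^sup>+u. nexp (m * u) * indicator {0..} t * indicator {t..} u * W u \<partial>lborel) =
       (\<integral>\<^sup>+u. nexp (m * u) * indicator {t..} u * w (f u) \<partial>lborel)"
      using True by (intro nn_integral_cong) (auto simp: W_def split: split_indicator)
    also have "\<dots> = nexp (m * t) * occupation m w (shift t f)"
      by (rule occupation_shift[OF f True])
    also have "ennreal (exp ((m - l) * t)) * (nexp (m * t) * occupation m w (shift t f)) =
       nexp (l * t) * occupation m w (shift t f)"
    proof -
      have "exp ((m - l) * t) * exp (- (m * t)) = exp (- (l * t))"
        unfolding mult_exp_exp by (simp add: left_diff_distrib)
      then show ?thesis
        by (simp add: mult.assoc[symmetric] ennreal_mult''[symmetric])
    qed
    finally show ?thesis using True by simp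
  qed simp
  have "(\<integral>\<^sup>+t. nexp (l * t) * indicator {0..} t * occupation m w (shift t f) \<partial>lborel) =
     (\<integral>\<^sup>+u. (\<integral>\<^sup>+t. ennreal (exp ((m - l) * t)) * (nexp (m * u) * indicator {0..} t * indicator {t..} u * W u) \<partial>lborel) \<partial>lborel)"
    unfolding inner
  proof (rule lborel_pair.Fubini'[symmetric])
    have "(\<lambda>(t, u). ennreal (exp ((m - l) * t)) * (nexp (m * u) * indicator {0..} t * indicator {p. fst p \<le> snd p} (t, u) * W u)) \<in>
        borel_measurable (lborel \<Otimes>\<^sub>M lborel)"
      by measurable
    also have "(\<lambda>(t, u). ennreal (exp ((m - l) * t)) * (nexp (m * u) * indicator {0..} t * indicator {p. fst p \<le> snd p} (t, u) * W u)) =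
        (\<lambda>(t, u). ennreal (exp ((m - l) * t)) * (nexp (m * u) * indicator {0..} t * indicator {t..} u * W u))"
      by (auto simp: fun_eq_iff split: split_indicator)
    finally show "(\<lambda>(t, u). ennreal (exp ((m - l) * t)) * (nexp (m * u) * indicator {0..} t * indicator {t..} u * W u)) \<in>
        borel_measurable (lborel \<Otimes>\<^sub>M lborel)" .
  qed
  also have "\<dots> = (\<integral>\<^sup>+u. ennreal ((exp (- (l * u)) - exp (- (m * u))) / (m - l)) * W u \<partial>lborel)"
  proof (rule nn_integral_cong)
    fix u :: real
    show "(\<integral>\<^sup>+t. ennreal (exp ((m - l) * t)) * (nexp (m * u) * indicator {0..} t * indicator {t..} u * W u) \<partial>lborel) =
      ennreal ((exp (- (l * u)) - exp (- (m * u))) / (m - l)) * W u"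
    proof (cases "0 \<le> u")
      case True
      have "(\<integral>\<^sup>+t. ennreal (exp ((m - l) * t)) * (nexp (m * u) * indicator {0..} t * indicator {t..} u * W u) \<partial>lborel) =
         (\<integral>\<^sup>+t. ennreal (exp ((m - l) * t)) * indicator {0..u} t * (nexp (m * u) * W u) \<partial>lborel)"
        by (intro nn_integral_cong) (auto simp: mult_ac split: split_indicator)
      also have "\<dots> = (\<integral>\<^sup>+t. ennreal (exp ((m - l) * t)) * indicator {0..u} t \<partial>lborel) * (nexp (m * u) * W u)"
        by (rule nn_integral_multc) measurable
      also have "(\<integral>\<^sup>+t. ennreal (exp ((m - l) * t)) * indicator {0..u} t \<partial>lborel) =
          ennreal (exp ((m - l) * u) / (m - l) - exp ((m - l) * 0) / (m - l))"
        using lm True by (intro nn_integral_FTC_Icc) (auto intro!: derivative_eq_intros)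
      also have "\<dots> * (nexp (m * u) * W u) =
          ennreal ((exp ((m - l) * u) / (m - l) - exp ((m - l) * 0) / (m - l)) * exp (- (m * u))) * W u"
        by (simp add: mult.assoc[symmetric] ennreal_mult''[symmetric])
      also have "(exp ((m - l) * u) / (m - l) - exp ((m - l) * 0) / (m - l)) * exp (- (m * u)) =
          (exp (- (l * u)) - exp (- (m * u))) / (m - l)"
      proof -
        have "exp ((m - l) * u) * exp (- (m * u)) = exp (- (l * u))"
          unfolding mult_exp_exp by (simp add: left_diff_distrib)
        then show ?thesis by (simp add: diff_divide_distrib left_diff_distrib)
      qed
      finally show ?thesis .
    qed (auto simp: W_def)
  qed
  finally have I: "(\<integral>\<^sup>+t. nexp (l * t) * indicator {0..} t * occupation m w (shift t f) \<partial>lborel) =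
     (\<integral>\<^sup>+u. ennreal ((exp (- (l * u)) - exp (- (m * u))) / (m - l)) * W u \<partial>lborel)" .
  have "ennreal (m - l) * (\<integral>\<^sup>+u. ennreal ((exp (- (l * u)) - exp (- (m * u))) / (m - l)) * W u \<partial>lborel) =
     (\<integral>\<^sup>+u. ennreal (m - l) * (ennreal ((exp (- (l * u)) - exp (- (m * u))) / (m - l)) * W u) \<partial>lborel)"
    by (rule nn_integral_cmult[symmetric]) measurable
  also have "\<dots> = (\<integral>\<^sup>+u. ennreal (exp (- (l * u)) - exp (- (m * u))) * W u \<partial>lborel)"
    using lm by (intro nn_integral_cong) (simp add: mult.assoc[symmetric] ennreal_mult'[symmetric])
  finally have J: "ennreal (m - l) * (\<integral>\<^sup>+u. ennreal ((exp (- (l * u)) - exp (- (m * u))) / (m - l)) * W u \<partial>lborel) =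
    (\<integral>\<^sup>+u. ennreal (exp (- (l * u)) - exp (- (m * u))) * W u \<partial>lborel)" .
  have occW: "occupation n w f = (\<integral>\<^sup>+u. nexp (n * u) * W u \<partial>lborel)" for n
    unfolding occupation_def W_def by (simp add: mult_ac)
  have "occupation m w f + (\<integral>\<^sup>+u. ennreal (exp (- (l * u)) - exp (- (m * u))) * W u \<partial>lborel) =
     (\<integral>\<^sup>+u. nexp (m * u) * W u + ennreal (exp (- (l * u)) - exp (- (m * u))) * W u \<partial>lborel)"
    unfolding occW by (rule nn_integral_add[symmetric]) measurable
  also have "\<dots> = occupation l w f"
    unfolding occW
  proof (rule nn_integral_cong)
    fix u :: real
    show "nexp (m * u) * W u + ennreal (exp (- (l * u)) - exp (- (m * u))) * W u = nexp (l * u) * W u"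
    proof (cases "0 \<le> u")
      case True
      then have "exp (- (m * u)) \<le> exp (- (l * u))"
        using lm by (simp add: mult_right_mono)
      then show ?thesis
        by (simp add: distrib_right[symmetric] ennreal_plus[symmetric] del: ennreal_plus)
    qed (simp add: W_def)
  qed
  finally show ?thesis
    unfolding I J by simp
qed

section \<open>The resolvent and its decompositions at holds, entries and fixed times\<close>

context uniform_markov
begin

definition resolvent :: "real \<Rightarrow> enat \<Rightarrow> (enat \<Rightarrow> ennreal) \<Rightarrow> ennreal" where
  "resolvent l y w = (\<integral>\<^sup>+f. occupation l w f \<partial>Q y)"

definition \<psi> :: "nat set \<Rightarrow> real \<Rightarrow> nat \<Rightarrow> ennreal" where
  "\<psi> F l k = (\<integral>\<^sup>+f. nexp (l * entry F f) * ind (f (entry F f) = enat k) \<partial>Q \<infinity>)"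

lemma resolvent_enat:
  assumes i: "1 \<le> i" and l: "0 < l"
  shows "resolvent l (enat i) w = ennreal (hold_res \<gamma> l i) * w (enat i) + ennreal (hold_lap \<gamma> l i) * resolvent l \<infinity> w"
proof -
  note [measurable] = exit_meas[OF i]
  note [measurable] = shift_meas[OF exit_meas[OF i] exit_nonneg]
  note [measurable_cong] = sets_enat[OF i]
  interpret I: prob_space "Q (enat i)" by (rule prob_enat[OF i])
  have "resolvent l (enat i) w = (\<integral>\<^sup>+f. ennreal ((1 - exp (- (l * exit i f))) / l) * w (enat i) +
      nexp (l * exit i f) * occupation l w (shift (exit i f) f) \<partial>Q (enat i))"
    unfolding resolvent_def
  proof (rule nn_integral_cong_AE)
    show "AE f in Q (enat i). occupation l w f = ennreal ((1 - exp (- (l * exit i f))) / l) * w (enat i) +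
      nexp (l * exit i f) * occupation l w (shift (exit i f) f)"
      using exit_finite[OF i] AE_space[of "Q (enat i)"]
    proof eventually_elim
      case (elim f)
      then have f: "f \<in> space S" using space_Q[of "enat i"] i by simp
      show ?case
        by (rule occupation_split[OF f exit_nonneg _ l]) (simp add: exit_stay[OF elim(1) f])
    qed
  qed
  also have "\<dots> = (\<integral>\<^sup>+f. ennreal ((1 - exp (- (l * exit i f))) / l) * w (enat i) \<partial>Q (enat i)) +
      (\<integral>\<^sup>+f. nexp (l * exit i f) * occupation l w (shift (exit i f) f) \<partial>Q (enat i))"
    by (rule nn_integral_add) measurable
  also have "(\<integral>\<^sup>+f. nexp (l * exit i f) * occupation l w (shift (exit i f) f) \<partial>Q (enat i)) = ennreal (hold_lap \<gamma> l i) * resolvent l \<infinity> w"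
    unfolding resolvent_def using markov_exit[OF i, of "\<lambda>x. nexp (l * x)" "occupation l w"] exit_laplace[OF i, of l] l by simp
  also have "(\<integral>\<^sup>+f. ennreal ((1 - exp (- (l * exit i f))) / l) * w (enat i) \<partial>Q (enat i)) =
     (\<integral>\<^sup>+f. ennreal ((1 - exp (- (l * exit i f))) / l) \<partial>Q (enat i)) * w (enat i)"
    by (rule nn_integral_multc) measurable
  also have "(\<integral>\<^sup>+f. ennreal ((1 - exp (- (l * exit i f))) / l) \<partial>Q (enat i)) = ennreal (hold_res \<gamma> l i)"
  proof -
    let ?x = "\<integral>\<^sup>+f. ennreal ((1 - exp (- (l * exit i f))) / l) \<partial>Q (enat i)"
    have le: "exp (- (l * exit i f)) \<le> 1" for f
      using l by simp
    \<comment> \<open>Subtraction in \<open>ennreal\<close> is avoided: a complementary term is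
      added, and being finite it can be cancelled at the end.\<close>
    have "?x + (\<integral>\<^sup>+f. ennreal (1 / l) * nexp (l * exit i f) \<partial>Q (enat i)) =
        (\<integral>\<^sup>+f. ennreal ((1 - exp (- (l * exit i f))) / l) + ennreal (1 / l) * nexp (l * exit i f) \<partial>Q (enat i))"
      by (rule nn_integral_add[symmetric]) measurable
    also have "\<dots> = (\<integral>\<^sup>+f. ennreal (1 / l) \<partial>Q (enat i))"
      using l le by (intro nn_integral_cong)
        (simp add: ennreal_mult''[symmetric] ennreal_plus[symmetric] add_divide_distrib[symmetric] del: ennreal_plus)
    also have "\<dots> = ennreal (1 / l)" by (simp add: I.emeasure_space_1)
    also have "(\<integral>\<^sup>+f. ennreal (1 / l) * nexp (l * exit i f) \<partial>Q (enat i)) = ennreal (1 / l) * ennreal (hold_lap \<gamma> l i)"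
      using exit_laplace[OF i, of l] l by (subst nn_integral_cmult) simp_all
    finally have "?x + ennreal (hold_lap \<gamma> l i / l) = ennreal (1 / l)"
      using l \<gamma>_pos[OF i] by (simp add: ennreal_mult''[symmetric] hold_lap_def mult.commute)
    moreover have "ennreal (hold_res \<gamma> l i) + ennreal (hold_lap \<gamma> l i / l) = ennreal (1 / l)"
    proof -
      have "hold_res \<gamma> l i = (1 - hold_lap \<gamma> l i) / l"
        using one_minus_hold_lap[of \<gamma> i l] \<gamma>_pos[OF i] l by (simp add: field_simps)
      then have "hold_res \<gamma> l i + hold_lap \<gamma> l i / l = 1 / l"
        by (simp add: diff_divide_distrib)
      moreover have "0 \<le> hold_res \<gamma> l i" "0 \<le> hold_lap \<gamma> l i"
        using l \<gamma>_pos[OF i] by (simp_all add: hold_res_def hold_lap_def)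
      ultimately show ?thesis using l by (simp add: ennreal_plus[symmetric] del: ennreal_plus)
    qed
    ultimately have "ennreal (hold_lap \<gamma> l i / l) + ?x = ennreal (hold_lap \<gamma> l i / l) + ennreal (hold_res \<gamma> l i)"
      by (simp add: add.commute)
    then show ?thesis
      unfolding ennreal_add_left_cancel by simp
  qed
  finally show ?thesis .
qed

text \<open>A weight supported on \<open>F\<close> collects nothing before \<open>F\<close> is
  entered, so of that period only the discount factor remains.\<close>

lemma resolvent_entry:
  assumes F: "finite F" "F \<noteq> {}" "F \<subseteq> {1..}" and l: "0 < l" and w: "\<And>z. z \<notin> enat ` F \<Longrightarrow> w z = 0"
  shows "resolvent l \<infinity> w = (\<Sum>k\<in>F. \<psi> F l k * resolvent l (enat k) w)"
proof -
  have "resolvent l \<infinity> w = (\<integral>\<^sup>+f. nexp (l * entry F f) * occupation l w (shift (entry F f) f) \<partial>Q \<infinity>)"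
    unfolding resolvent_def
  proof (rule nn_integral_cong_AE)
    show "AE f in Q \<infinity>. occupation l w f = nexp (l * entry F f) * occupation l w (shift (entry F f) f)"
      using entry_AE[OF F] AE_space[of "Q \<infinity>"]
    proof eventually_elim
      case (elim f)
      then have f: "f \<in> space S" using space_Q[of \<infinity>] by simp
      have "w (f t) = 0" if "0 \<le> t" "t < entry F f" for t
        using entry_before[of F f t] elim that by (intro w) auto
      then show ?case
        using occupation_split[where w=w and c=0 and l=l and s="entry F f", OF f entry_nonneg] l by simp
    qed
  qed
  also have "\<dots> = (\<Sum>k\<in>F. \<psi> F l k * resolvent l (enat k) w)"
    using markov_entry[OF F, of "\<lambda>x. nexp (l * x)" "occupation l w"] by (simp add: \<psi>_def resolvent_def)
  finally show ?thesis .
qed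

text \<open>The pathwise identity \<open>occupation_resolvent\<close>, averaged. The shift by a
  fixed time is resolved by the Markov property at constant times, with an exchange of integrals
  before and after.\<close>

lemma resolvent_equation:
  assumes lm: "0 < l" "l < m"
  shows "resolvent l \<infinity> w = resolvent m \<infinity> w + ennreal (m - l) * resolvent l \<infinity> (\<lambda>z. resolvent m z w)"
proof -
  interpret I: prob_space "Q \<infinity>" by (rule prob_infty)
  interpret pair_sigma_finite "Q \<infinity>" lborel ..
  have [measurable]: "(\<lambda>p. occupation m w (shift (max 0 (snd p)) (fst p))) \<in> borel_measurable (Q \<infinity> \<Otimes>\<^sub>M lborel)"
  proof (rule measurable_compose[OF _ occupation_meas])
    show "(\<lambda>p. shift (max 0 (snd p)) (fst p)) \<in> Q \<infinity> \<Otimes>\<^sub>M lborel \<rightarrow>\<^sub>M regular_paths"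
    proof (rule measurable_shift)
      show "fst \<in> Q \<infinity> \<Otimes>\<^sub>M lborel \<rightarrow>\<^sub>M regular_paths"
        by (rule measurable_compose[OF measurable_fst]) (simp add: measurable_Q)
    qed simp_all
  qed
  have "(\<lambda>p. nexp (l * snd p) * indicator {0..} (snd p) * occupation m w (shift (max 0 (snd p)) (fst p))) \<in> borel_measurable (Q \<infinity> \<Otimes>\<^sub>M lborel)"
    by measurable
  also have "(\<lambda>p. nexp (l * snd p) * indicator {0..} (snd p) * occupation m w (shift (max 0 (snd p)) (fst p))) =
     (\<lambda>(f, t). nexp (l * t) * indicator {0..} t * occupation m w (shift t f))"
    by (auto simp: fun_eq_iff max_def split: split_indicator)
  finally have J [measurable]: "(\<lambda>(f, t). nexp (l * t) * indicator {0..} t * occupation m w (shift t f)) \<in> borel_measurable (Q \<infinity> \<Otimes>\<^sub>M lborel)" .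
  have J': "(\<lambda>f. \<integral>\<^sup>+t. nexp (l * t) * indicator {0..} t * occupation m w (shift t f) \<partial>lborel) \<in> borel_measurable (Q \<infinity>)"
    using lborel.borel_measurable_nn_integral[OF J] by simp
  have "resolvent l \<infinity> w = (\<integral>\<^sup>+f. occupation m w f + ennreal (m - l) * (\<integral>\<^sup>+t. nexp (l * t) * indicator {0..} t * occupation m w (shift t f) \<partial>lborel) \<partial>Q \<infinity>)"
    unfolding resolvent_def by (rule nn_integral_cong) (simp add: occupation_resolvent[OF _ lm] space_Q)
  also have "\<dots> = resolvent m \<infinity> w + ennreal (m - l) * (\<integral>\<^sup>+f. (\<integral>\<^sup>+t. nexp (l * t) * indicator {0..} t * occupation m w (shift t f) \<partial>lborel) \<partial>Q \<infinity>)"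
    unfolding resolvent_def using J' by (subst nn_integral_add) (simp_all add: nn_integral_cmult measurable_Q)
  also have "(\<integral>\<^sup>+f. (\<integral>\<^sup>+t. nexp (l * t) * indicator {0..} t * occupation m w (shift t f) \<partial>lborel) \<partial>Q \<infinity>) =
     (\<integral>\<^sup>+t. (\<integral>\<^sup>+f. nexp (l * t) * indicator {0..} t * occupation m w (shift t f) \<partial>Q \<infinity>) \<partial>lborel)"
    by (rule Fubini'[symmetric]) (rule J)
  also have "\<dots> = (\<integral>\<^sup>+t. (\<integral>\<^sup>+f. nexp (l * t) * indicator {0..} t * resolvent m (f t) w \<partial>Q \<infinity>) \<partial>lborel)"
  proof (rule nn_integral_cong)
    fix t :: real
    show "(\<integral>\<^sup>+f. nexp (l * t) * indicator {0..} t * occupation m w (shift t f) \<partial>Q \<infinity>) =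
      (\<integral>\<^sup>+f. nexp (l * t) * indicator {0..} t * resolvent m (f t) w \<partial>Q \<infinity>)"
    proof (cases "0 \<le> t")
      case True
      have "(\<integral>\<^sup>+f. occupation m w (shift t f) \<partial>Q \<infinity>) = (\<integral>\<^sup>+f. resolvent m (f t) w \<partial>Q \<infinity>)"
        unfolding resolvent_def by (rule markov_const) (use True in auto)
      moreover have "(\<lambda>f. resolvent m (f t) w) \<in> borel_measurable (Q \<infinity>)"
        using measurable_compose[OF measurable_eval_const[OF True], of "\<lambda>z. resolvent m z w" borel] by (simp add: measurable_Q)
      moreover have "(\<lambda>f. occupation m w (shift t f)) \<in> borel_measurable (Q \<infinity>)"
        using shift_meas[of "\<lambda>_. t"] True by (simp add: measurable_Q measurable_compose[OF _ occupation_meas])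
      ultimately show ?thesis
        by (simp add: nn_integral_cmult)
    qed simp
  qed
  also have "\<dots> = (\<integral>\<^sup>+f. (\<integral>\<^sup>+t. nexp (l * t) * indicator {0..} t * resolvent m (f t) w \<partial>lborel) \<partial>Q \<infinity>)"
    by (rule Fubini') (use occupation_joint_meas[of l "\<lambda>z. resolvent m z w"] in \<open>simp cong: measurable_cong_sets\<close>)
  also have "\<dots> = resolvent l \<infinity> (\<lambda>z. resolvent m z w)"
    by (simp add: resolvent_def occupation_def)
  finally show ?thesis .
qed

end

text \<open>The \<Phi> of the overview: by \<open>one_minus_hold_lap\<close> the middle term is the
  sum of 1 - \<open>hold_lap \<gamma> l x\<close> over all finite states.\<close>

definition exponent :: "(nat \<Rightarrow> real) \<Rightarrow> real \<Rightarrow> nat set \<Rightarrow> real \<Rightarrow> real" where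
  "exponent \<gamma> c F l = c * l + l * (\<Sum>n. hold_res \<gamma> l (Suc n)) + (\<Sum>x\<in>F. hold_lap \<gamma> l x)"

lemma hold_lap_pos: "0 < \<gamma> x \<Longrightarrow> 0 \<le> l \<Longrightarrow> 0 < hold_lap \<gamma> l x"
  unfolding hold_lap_def by (simp add: add_pos_nonneg)

lemma hold_res_pos: "0 < \<gamma> x \<Longrightarrow> 0 \<le> l \<Longrightarrow> 0 < hold_res \<gamma> l x"
  unfolding hold_res_def by (simp add: add_pos_nonneg)

lemma hold_res_le: "0 < \<gamma> x \<Longrightarrow> 0 \<le> l \<Longrightarrow> hold_res \<gamma> l x \<le> \<gamma> x"
  unfolding hold_res_def by (simp add: divide_le_eq add_pos_nonneg mult_nonneg_nonneg)

lemma hold_res_summable: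
  assumes "\<And>x. 1 \<le> x \<Longrightarrow> 0 < \<gamma> x" "summable (\<lambda>x. \<gamma> (Suc x))" "0 \<le> l"
  shows "summable (\<lambda>n. hold_res \<gamma> l (Suc n))"
proof (rule summable_comparison_test'[OF assms(2)])
  show "norm (hold_res \<gamma> l (Suc n)) \<le> \<gamma> (Suc n)" if "0 \<le> n" for n
    using hold_res_pos[of \<gamma> "Suc n" l] hold_res_le[of \<gamma> "Suc n" l] assms(1)[of "Suc n"] assms(3) by simp
qed

text \<open>With \<open>hold_res\<close> written as 1 / (1 / \<gamma> x + l), the first identity is
  the resolvent equation of a scalar; the second is the same after division by
  \<open>hold_res \<gamma> l x\<close>.\<close>

lemma hold_res_diff:
  assumes "0 < \<gamma> x" "0 \<le> l" "0 \<le> m"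
  shows "(m - l) * (hold_res \<gamma> l x * hold_res \<gamma> m x) = hold_res \<gamma> l x - hold_res \<gamma> m x"
    "1 - (m - l) * hold_res \<gamma> m x = hold_res \<gamma> m x / hold_res \<gamma> l x"
proof -
  have a: "0 < 1 + l * \<gamma> x" "0 < 1 + m * \<gamma> x"
    using assms by (simp_all add: add_pos_nonneg)
  have "hold_res \<gamma> l x - hold_res \<gamma> m x = (\<gamma> x * (1 + m * \<gamma> x) - \<gamma> x * (1 + l * \<gamma> x)) / ((1 + l * \<gamma> x) * (1 + m * \<gamma> x))"
    using a unfolding hold_res_def by (subst diff_frac_eq) auto
  also have "\<gamma> x * (1 + m * \<gamma> x) - \<gamma> x * (1 + l * \<gamma> x) = (m - l) * (\<gamma> x * \<gamma> x)"
    by (simp add: algebra_simps)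
  finally show "(m - l) * (hold_res \<gamma> l x * hold_res \<gamma> m x) = hold_res \<gamma> l x - hold_res \<gamma> m x"
    by (simp add: hold_res_def)
  have "1 - (m - l) * hold_res \<gamma> m x = (1 + m * \<gamma> x - (m - l) * \<gamma> x) / (1 + m * \<gamma> x)"
    using a unfolding hold_res_def by (simp add: diff_divide_distrib)
  also have "1 + m * \<gamma> x - (m - l) * \<gamma> x = 1 + l * \<gamma> x"
    by (simp add: algebra_simps)
  finally show "1 - (m - l) * hold_res \<gamma> m x = hold_res \<gamma> m x / hold_res \<gamma> l x"
    using assms(1) by (simp add: hold_res_def)
qed

section \<open>From the masses of the states to the hitting transforms and the constant c\<close>

context uniform_markov
begin

definition \<delta> :: "nat \<Rightarrow> enat \<Rightarrow> ennreal" where "\<delta> k z = ind (z = enat k)"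

definition res_mass :: "real \<Rightarrow> nat \<Rightarrow> real" where "res_mass l k = enn2real (resolvent l \<infinity> (\<delta> k))"

definition hit_lap :: "nat set \<Rightarrow> real \<Rightarrow> nat \<Rightarrow> real" where "hit_lap F l k = enn2real (\<psi> F l k)"

lemma resolvent_mono: "(\<And>z. w z \<le> w' z) \<Longrightarrow> resolvent l y w \<le> resolvent l y w'"
  unfolding resolvent_def occupation_def by (intro nn_integral_mono mult_left_mono) auto

lemma resolvent_one: "0 < l \<Longrightarrow> resolvent l \<infinity> (\<lambda>_. 1) = ennreal (1 / l)"
  unfolding resolvent_def occupation_def
  by (simp add: nn_integral_exp_Ici prob_space.emeasure_space_1[OF prob_infty])

lemma resolvent_\<delta>: "0 < l \<Longrightarrow> resolvent l \<infinity> (\<delta> k) = ennreal (res_mass l k)"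
proof -
  assume l: "0 < l"
  have "resolvent l \<infinity> (\<delta> k) \<le> ennreal (1 / l)"
    unfolding resolvent_one[OF l, symmetric] by (rule resolvent_mono) (simp add: \<delta>_def ind_def)
  then have "resolvent l \<infinity> (\<delta> k) < \<top>"
    by (rule le_less_trans) simp
  then show ?thesis by (simp add: res_mass_def)
qed

lemma res_mass_nonneg [simp]: "0 \<le> res_mass l k"
  by (simp add: res_mass_def)

lemma hit_lap_nonneg [simp]: "0 \<le> hit_lap F l k"
  by (simp add: hit_lap_def)

lemma \<psi>_hit_lap: "0 \<le> l \<Longrightarrow> \<psi> F l k = ennreal (hit_lap F l k)"
proof -
  assume l: "0 \<le> l"
  have "\<psi> F l k \<le> (\<integral>\<^sup>+f. 1 \<partial>Q \<infinity>)"
    unfolding \<psi>_def using l by (intro nn_integral_mono) (auto simp: ind_def)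
  also have "\<dots> = 1" by (simp add: prob_space.emeasure_space_1[OF prob_infty])
  finally have "\<psi> F l k < \<top>" by (rule le_less_trans) simp
  then show ?thesis by (simp add: hit_lap_def)
qed

lemma resolvent_add:
  "resolvent l \<infinity> (\<lambda>z. a * w z + b * w' z) = a * resolvent l \<infinity> w + b * resolvent l \<infinity> w'"
proof -
  have m: "(\<lambda>t. nexp (l * t) * indicator {0..} t * u (f t)) \<in> borel_measurable lborel"
    if "f \<in> space S" for f and u :: "enat \<Rightarrow> ennreal"
  proof -
    have [measurable]: "(\<lambda>t. u (f t) * indicator {0..} t) \<in> borel_measurable lborel"
      by (rule occupation_path_meas[OF that])
    have "(\<lambda>t. nexp (l * t) * (u (f t) * indicator {0..} t)) \<in> borel_measurable lborel"
      by measurable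
    then show ?thesis by (simp add: mult_ac)
  qed
  have "occupation l (\<lambda>z. a * w z + b * w' z) f = a * occupation l w f + b * occupation l w' f" if f: "f \<in> space S" for f
  proof -
    have "occupation l (\<lambda>z. a * w z + b * w' z) f =
       (\<integral>\<^sup>+t. a * (nexp (l * t) * indicator {0..} t * w (f t)) +
          b * (nexp (l * t) * indicator {0..} t * w' (f t)) \<partial>lborel)"
      unfolding occupation_def by (intro nn_integral_cong) (simp add: distrib_left mult_ac)
    also have "\<dots> = a * occupation l w f + b * occupation l w' f"
      unfolding occupation_def using m[OF f, of w] m[OF f, of w'] by (subst nn_integral_add) (simp_all add: nn_integral_cmult)
    finally show ?thesis .
  qed
  then have "resolvent l \<infinity> (\<lambda>z. a * w z + b * w' z) = (\<integral>\<^sup>+f. a * occupation l w f + b * occupation l w' f \<partial>Q \<infinity>)"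
    unfolding resolvent_def by (intro nn_integral_cong) (simp add: space_Q)
  also have "\<dots> = a * resolvent l \<infinity> w + b * resolvent l \<infinity> w'"
    unfolding resolvent_def by (subst nn_integral_add) (simp_all add: nn_integral_cmult measurable_Q)
  finally show ?thesis .
qed

lemma resolvent_suminf: "resolvent l \<infinity> (\<lambda>z. \<Sum>n. w n z) = (\<Sum>n. resolvent l \<infinity> (w n))"
proof -
  have "occupation l (\<lambda>z. \<Sum>n. w n z) f = (\<Sum>n. occupation l (w n) f)" if f: "f \<in> space S" for f
  proof -
    have m: "(\<lambda>t. nexp (l * t) * indicator {0..} t * w n (f t)) \<in> borel_measurable lborel" for n
    proof -
      have [measurable]: "(\<lambda>t. w n (f t) * indicator {0..} t) \<in> borel_measurable lborel"
        by (rule occupation_path_meas[OF f])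
      have "(\<lambda>t. nexp (l * t) * (w n (f t) * indicator {0..} t)) \<in> borel_measurable lborel"
        by measurable
      then show ?thesis by (simp add: mult_ac)
    qed
    show ?thesis
      unfolding occupation_def using m by (subst nn_integral_suminf[symmetric]) simp_all
  qed
  then have "resolvent l \<infinity> (\<lambda>z. \<Sum>n. w n z) = (\<integral>\<^sup>+f. (\<Sum>n. occupation l (w n) f) \<partial>Q \<infinity>)"
    unfolding resolvent_def by (intro nn_integral_cong) (simp add: space_Q)
  also have "\<dots> = (\<Sum>n. resolvent l \<infinity> (w n))"
    unfolding resolvent_def by (rule nn_integral_suminf) (simp add: measurable_Q)
  finally show ?thesis .
qed

lemma resolvent_cong_Nbar:
  assumes "\<And>z. z \<in> Nbar \<Longrightarrow> w z = w' z"
  shows "resolvent l \<infinity> w = resolvent l \<infinity> w'"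
  unfolding resolvent_def occupation_def
  by (intro nn_integral_cong) (auto simp: space_Q assms regular_paths_Nbar split: split_indicator)

text \<open>From a finite state, the mass at \<open>k\<close> consists of the first hold, if this is
  at \<open>k\<close>, and of what is collected after the restart at infinity, discounted by the
  first hold.\<close>

lemma resolvent_\<delta>_eq:
  assumes k: "1 \<le> k" and l: "0 < l" and z: "z \<in> Nbar"
  shows "resolvent l z (\<delta> k) = ennreal (hold_res \<gamma> l k) * \<delta> k z + ennreal (res_mass l k) * (case z of enat i \<Rightarrow> ennreal (hold_lap \<gamma> l i) | \<infinity> \<Rightarrow> 1)"
proof (cases z)
  case (enat i)
  then show ?thesis
    using resolvent_enat[of i l "\<delta> k"] resolvent_\<delta>[OF l, of k] z l by (auto simp: \<delta>_def ind_def mult.commute)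
next
  case infinity
  then show ?thesis using resolvent_\<delta>[OF l, of k] by (simp add: \<delta>_def ind_def)
qed

definition hold_lap_at :: "real \<Rightarrow> enat \<Rightarrow> ennreal" where
  "hold_lap_at l z = (case z of enat i \<Rightarrow> ennreal (hold_lap \<gamma> l i) | \<infinity> \<Rightarrow> 1)"

text \<open>The integral of \<open>hold_lap_at m\<close> against the resolvent enters the resolvent equation, because started
  at a finite state the process waits there and then restarts at \<open>\<infinity>\<close>.\<close>

definition res_lap :: "real \<Rightarrow> real \<Rightarrow> real" where
  "res_lap l m = enn2real (resolvent l \<infinity> (hold_lap_at m))"

lemma suminf_single_ennreal: "(\<Sum>n. if n = j then (a::ennreal) else 0) = a"
  using suminf_finite[of "{j}" "\<lambda>n. if n = j then a else 0"] by simp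

text \<open>A partition of unity. It expresses \<open>hold_lap_at\<close>, which does not vanish at
  infinity, through weights at finite states, whose resolvents are the numbers
  \<open>res_mass\<close>.\<close>

lemma hold_lap_at_sum:
  assumes z: "z \<in> Nbar" and m: "0 < m"
  shows "1 * hold_lap_at m z + 1 * (\<Sum>n. ennreal (m * hold_res \<gamma> m (Suc n)) * \<delta> (Suc n) z) = 1"
proof (cases z)
  case (enat i)
  then obtain j where j: "i = Suc j" using z by (cases i) auto
  have "(\<Sum>n. ennreal (m * hold_res \<gamma> m (Suc n)) * \<delta> (Suc n) z) = (\<Sum>n. if n = j then ennreal (m * hold_res \<gamma> m (Suc j)) else 0)"
    using enat j by (intro suminf_cong) (auto simp: \<delta>_def ind_def)
  also have "\<dots> = ennreal (m * hold_res \<gamma> m (Suc j))" by (rule suminf_single_ennreal)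
  also have "m * hold_res \<gamma> m (Suc j) = 1 - hold_lap \<gamma> m i"
    using one_minus_hold_lap[of \<gamma> "Suc j" m] \<gamma>_pos[of "Suc j"] m j by simp
  finally have *: "(\<Sum>n. ennreal (m * hold_res \<gamma> m (Suc n)) * \<delta> (Suc n) z) = ennreal (1 - hold_lap \<gamma> m i)" .
  have gi: "0 < \<gamma> i" using \<gamma>_pos[of i] j by simp
  have "0 \<le> m * hold_res \<gamma> m i"
    using hold_res_pos[of \<gamma> i m] gi m by simp
  then have "hold_lap \<gamma> m i \<le> 1" "0 \<le> hold_lap \<gamma> m i"
    using one_minus_hold_lap[of \<gamma> i m] hold_lap_pos[of \<gamma> i m] gi m by linarith+
  then show ?thesis
    unfolding * using enat by (simp add: hold_lap_at_def ennreal_plus[symmetric] del: ennreal_plus)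
next
  case infinity
  then show ?thesis by (simp add: hold_lap_at_def \<delta>_def ind_def)
qed

lemma resolvent_hold_lap:
  assumes l: "0 < l" and m: "0 < m"
  shows "resolvent l \<infinity> (hold_lap_at m) + (\<Sum>n. ennreal (m * hold_res \<gamma> m (Suc n)) * ennreal (res_mass l (Suc n))) = ennreal (1 / l)"
proof -
  have each: "resolvent l \<infinity> (\<lambda>z. ennreal (m * hold_res \<gamma> m (Suc n)) * \<delta> (Suc n) z) = ennreal (m * hold_res \<gamma> m (Suc n)) * ennreal (res_mass l (Suc n))" for n
    using resolvent_add[of l "ennreal (m * hold_res \<gamma> m (Suc n))" "\<delta> (Suc n)" 0 "\<lambda>_. 0"] resolvent_\<delta>[OF l] by simp
  have "ennreal (1 / l) = resolvent l \<infinity> (\<lambda>z. 1 * hold_lap_at m z + 1 * (\<Sum>n. ennreal (m * hold_res \<gamma> m (Suc n)) * \<delta> (Suc n) z))"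
    unfolding resolvent_one[OF l, symmetric] by (rule resolvent_cong_Nbar) (simp only: hold_lap_at_sum[OF _ m])
  also have "\<dots> = resolvent l \<infinity> (hold_lap_at m) + (\<Sum>n. resolvent l \<infinity> (\<lambda>z. ennreal (m * hold_res \<gamma> m (Suc n)) * \<delta> (Suc n) z))"
    unfolding resolvent_add resolvent_suminf by simp
  finally show ?thesis unfolding each by simp
qed

lemma resolvent_hold_lap_eq:
  assumes l: "0 < l" and m: "0 < m"
  shows "resolvent l \<infinity> (hold_lap_at m) = ennreal (res_lap l m)"
proof -
  have "resolvent l \<infinity> (hold_lap_at m) \<le> ennreal (1 / l)"
    unfolding resolvent_hold_lap[OF l m, symmetric] by (rule le_iff_add[THEN iffD2]) blast
  then have "resolvent l \<infinity> (hold_lap_at m) < \<top>" by (rule le_less_trans) simp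
  then show ?thesis by (simp add: res_lap_def)
qed

lemma res_mass_sum:
  assumes l: "0 < l" and m: "0 < m"
  shows "(\<lambda>n. m * hold_res \<gamma> m (Suc n) * res_mass l (Suc n)) sums (1 / l - res_lap l m)"
proof -
  have nn: "0 \<le> m * hold_res \<gamma> m (Suc n) * res_mass l (Suc n)" for n
    using hold_res_pos[of \<gamma> "Suc n" m] \<gamma>_pos[of "Suc n"] m by simp
  have eq: "resolvent l \<infinity> (hold_lap_at m) + (\<Sum>n. ennreal (m * hold_res \<gamma> m (Suc n) * res_mass l (Suc n))) = ennreal (1 / l)"
    using resolvent_hold_lap[OF l m] hold_res_pos[of \<gamma> "Suc n" m for n] \<gamma>_pos[of "Suc n" for n] m
    by (simp add: ennreal_mult''[symmetric])
  have "(\<Sum>n. ennreal (m * hold_res \<gamma> m (Suc n) * res_mass l (Suc n))) \<le> ennreal (1 / l)"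
    unfolding eq[symmetric] by (rule le_iff_add[THEN iffD2]) (auto simp: add.commute)
  then have "(\<Sum>n. ennreal (m * hold_res \<gamma> m (Suc n) * res_mass l (Suc n))) \<noteq> \<top>"
    by (auto simp: top_unique)
  then have sm: "summable (\<lambda>n. m * hold_res \<gamma> m (Suc n) * res_mass l (Suc n))"
    by (rule summable_suminf_not_top[OF nn])
  note R = resolvent_hold_lap_eq[OF l m]
  have "ennreal (res_lap l m + (\<Sum>n. m * hold_res \<gamma> m (Suc n) * res_mass l (Suc n))) = ennreal (1 / l)"
    using eq unfolding R suminf_ennreal2[OF nn sm] by (simp add: res_lap_def suminf_nonneg[OF sm nn])
  then have "res_lap l m + (\<Sum>n. m * hold_res \<gamma> m (Suc n) * res_mass l (Suc n)) = 1 / l"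
    using l suminf_nonneg[OF sm nn] by (subst (asm) ennreal_inj) (auto simp: res_lap_def)
  then show ?thesis
    using summable_sums[OF sm] by (metis add_diff_cancel_left')
qed

lemma res_mass_resolvent:
  assumes lm: "0 < l" "l < m" and k: "1 \<le> k"
  shows "res_mass l k = res_mass m k + (m - l) * (hold_res \<gamma> m k * res_mass l k + res_mass m k * res_lap l m)"
proof -
  have m: "0 < m" using lm by simp
  have hp: "0 \<le> hold_res \<gamma> m k" using hold_res_pos[of \<gamma> k m] \<gamma>_pos[OF k] m by simp
  have R: "resolvent l \<infinity> (hold_lap_at m) = ennreal (res_lap l m)"
    by (rule resolvent_hold_lap_eq[OF lm(1) m])
  have "resolvent l \<infinity> (\<delta> k) = resolvent m \<infinity> (\<delta> k) + ennreal (m - l) * resolvent l \<infinity> (\<lambda>z. resolvent m z (\<delta> k))"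
    by (rule resolvent_equation[OF lm])
  also have "resolvent l \<infinity> (\<lambda>z. resolvent m z (\<delta> k)) = resolvent l \<infinity> (\<lambda>z. ennreal (hold_res \<gamma> m k) * \<delta> k z + ennreal (res_mass m k) * hold_lap_at m z)"
    unfolding hold_lap_at_def by (rule resolvent_cong_Nbar) (rule resolvent_\<delta>_eq[OF k m])
  also have "\<dots> = ennreal (hold_res \<gamma> m k * res_mass l k + res_mass m k * res_lap l m)"
    unfolding resolvent_add resolvent_\<delta>[OF lm(1)] R using hp by (simp add: ennreal_mult''[symmetric] res_lap_def)
  finally have "ennreal (res_mass l k) = ennreal (res_mass m k + (m - l) * (hold_res \<gamma> m k * res_mass l k + res_mass m k * res_lap l m))"
    unfolding resolvent_\<delta>[OF lm(1)] resolvent_\<delta>[OF m] using hp lm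
    by (simp add: ennreal_mult''[symmetric] ennreal_plus[symmetric] res_lap_def del: ennreal_plus)
  then show ?thesis
    using hp lm by (subst (asm) ennreal_inj) (auto simp: res_lap_def intro!: add_nonneg_nonneg mult_nonneg_nonneg)
qed

text \<open>The mass at \<open>k\<close> is decomposed at the entry into \<open>F\<close>: entry at
  \<open>k\<close> contributes a hold, and entry at any \<open>j\<close> contributes the mass from
  infinity once more, discounted. The factor in parentheses collects these returns and does not
  depend on \<open>k\<close>.\<close>

lemma hit_lap_eq:
  assumes F: "finite F" "F \<subseteq> {1..}" "k \<in> F" and l: "0 < l"
  shows "hit_lap F l k * hold_res \<gamma> l k = res_mass l k * (1 - (\<Sum>j\<in>F. hit_lap F l j * hold_lap \<gamma> l j))"
proof -
  have k: "1 \<le> k" using F by auto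
  have hp: "0 \<le> hold_res \<gamma> l k" using hold_res_pos[of \<gamma> k l] \<gamma>_pos[OF k] l by simp
  have gp: "0 \<le> hold_lap \<gamma> l j" if "j \<in> F" for j
    using hold_lap_pos[of \<gamma> j l] \<gamma>_pos[of j] l F that by (auto simp: less_imp_le)
  have w: "\<delta> k z = 0" if "z \<notin> enat ` F" for z
    using that F by (auto simp: \<delta>_def ind_def)
  have "resolvent l \<infinity> (\<delta> k) = (\<Sum>j\<in>F. \<psi> F l j * resolvent l (enat j) (\<delta> k))"
    by (rule resolvent_entry[OF F(1) _ F(2) l w]) (use F in auto)
  also have "\<dots> = (\<Sum>j\<in>F. ennreal (hit_lap F l j * (hold_res \<gamma> l k * (if j = k then 1 else 0) + res_mass l k * hold_lap \<gamma> l j)))"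
  proof (rule sum.cong[OF refl])
    fix j assume j: "j \<in> F"
    then have "enat j \<in> Nbar" using F by auto
    then have "resolvent l (enat j) (\<delta> k) = ennreal (hold_res \<gamma> l k * (if j = k then 1 else 0) + res_mass l k * hold_lap \<gamma> l j)"
      using resolvent_\<delta>_eq[OF k l, of "enat j"] hp gp[OF j] l
      by (cases "j = k") (simp_all add: \<delta>_def ind_def ennreal_mult'')
    moreover have "0 \<le> hold_res \<gamma> l k * (if j = k then 1 else 0) + res_mass l k * hold_lap \<gamma> l j"
      using hp gp[OF j] by (intro add_nonneg_nonneg mult_nonneg_nonneg) auto
    ultimately show "\<psi> F l j * resolvent l (enat j) (\<delta> k) = ennreal (hit_lap F l j * (hold_res \<gamma> l k * (if j = k then 1 else 0) + res_mass l k * hold_lap \<gamma> l j))"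
      using l by (simp only: \<psi>_hit_lap[OF less_imp_le] ennreal_mult''[symmetric])
  qed
  also have "\<dots> = ennreal (\<Sum>j\<in>F. hit_lap F l j * (hold_res \<gamma> l k * (if j = k then 1 else 0) + res_mass l k * hold_lap \<gamma> l j))"
    using hp gp by (intro sum_ennreal) (auto intro!: mult_nonneg_nonneg add_nonneg_nonneg)
  finally have "res_mass l k = (\<Sum>j\<in>F. hit_lap F l j * (hold_res \<gamma> l k * (if j = k then 1 else 0) + res_mass l k * hold_lap \<gamma> l j))"
    unfolding resolvent_\<delta>[OF l] using hp gp
    by (subst (asm) ennreal_inj) (auto intro!: sum_nonneg mult_nonneg_nonneg add_nonneg_nonneg)
  also have "\<dots> = (\<Sum>j\<in>F. if j = k then hit_lap F l k * hold_res \<gamma> l k else 0) + res_mass l k * (\<Sum>j\<in>F. hit_lap F l j * hold_lap \<gamma> l j)"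
    unfolding sum_distrib_left sum.distrib[symmetric] by (rule sum.cong) (auto simp: algebra_simps)
  also have "(\<Sum>j\<in>F. if j = k then hit_lap F l k * hold_res \<gamma> l k else 0) = hit_lap F l k * hold_res \<gamma> l k"
    using F by (simp add: sum.delta)
  finally show ?thesis by (simp add: right_diff_distrib)
qed

text \<open>From infinity \<open>k\<close> is reached in finite time almost surely, so the
  discounted hitting probability of \<open>{k}\<close> is positive; by \<open>hit_lap_eq\<close> the
  mass cannot vanish.\<close>

lemma res_mass_pos:
  assumes k: "1 \<le> k" and l: "0 < l"
  shows "0 < res_mass l k"
proof -
  have F: "finite {k}" "{k} \<noteq> {}" "{k} \<subseteq> {1..}" using k by auto
  have "\<psi> {k} l k \<noteq> 0"
  proof
    assume "\<psi> {k} l k = 0"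
    moreover have "(\<lambda>f. nexp (l * entry {k} f) * ind (f (entry {k} f) = enat k)) \<in> borel_measurable (Q \<infinity>)"
    proof -
      note [measurable] = entry_meas[OF F(1,3)] ind_meas[OF pred_eval_meas[OF entry_meas[OF F(1,3)] entry_nonneg]]
      show ?thesis by measurable
    qed
    ultimately have "AE f in Q \<infinity>. nexp (l * entry {k} f) * ind (f (entry {k} f) = enat k) = 0"
      unfolding \<psi>_def by (subst (asm) nn_integral_0_iff_AE) auto
    moreover have "AE f in Q \<infinity>. hit (enat ` {k}) f < \<infinity> \<and> f (entry {k} f) \<in> enat ` {k}"
      by (rule entry_AE[OF F])
    ultimately have "AE f in Q \<infinity>. False"
      by eventually_elim (auto simp: ind_def)
    then show False using prob_space.AE_False[OF prob_infty] by simp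
  qed
  then have "0 < hit_lap {k} l k"
    using \<psi>_hit_lap[of l "{k}" k] l hit_lap_nonneg[of "{k}" l k] by (cases "hit_lap {k} l k = 0") (auto simp: less_le)
  moreover have "0 < hold_res \<gamma> l k" using hold_res_pos[of \<gamma> k l] \<gamma>_pos[OF k] l by simp
  ultimately have "res_mass l k \<noteq> 0"
    using hit_lap_eq[of "{k}" k l] k l by auto
  then show ?thesis using res_mass_nonneg[of l k] by linarith
qed

text \<open>The v of the overview. One visit to \<open>k\<close> collects
  \<open>hold_res \<gamma> l k\<close> on average, so this is the expected discounted number of
  visits.\<close>

definition norm_mass :: "real \<Rightarrow> nat \<Rightarrow> real" where "norm_mass l k = res_mass l k / hold_res \<gamma> l k"

lemma norm_mass_pos: "1 \<le> k \<Longrightarrow> 0 < l \<Longrightarrow> 0 < norm_mass l k"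
  unfolding norm_mass_def using res_mass_pos[of k l] hold_res_pos[of \<gamma> k l] \<gamma>_pos[of k] by simp

text \<open>By \<open>hold_res_diff\<close> the factor 1 - (m - l) *
  \<open>hold_res \<gamma> m k\<close> is a quotient that the normalisation absorbs. The remaining
  factor is the same for all states, so ratios between states do not change with
  \<open>l\<close>.\<close>

lemma norm_mass_resolvent:
  assumes lm: "0 < l" "l < m" and k: "1 \<le> k"
  shows "norm_mass l k = norm_mass m k * (1 + (m - l) * res_lap l m)"
proof -
  have h: "0 < hold_res \<gamma> l k" "0 < hold_res \<gamma> m k"
    using hold_res_pos[of \<gamma> k] \<gamma>_pos[OF k] lm by auto
  have "res_mass l k * (1 - (m - l) * hold_res \<gamma> m k) = res_mass m k * (1 + (m - l) * res_lap l m)"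
    using res_mass_resolvent[OF lm k] by (simp add: algebra_simps)
  then have "res_mass l k * (hold_res \<gamma> m k / hold_res \<gamma> l k) = res_mass m k * (1 + (m - l) * res_lap l m)"
    using hold_res_diff(2)[of \<gamma> k l m] \<gamma>_pos[OF k] lm by simp
  then show ?thesis
    unfolding norm_mass_def using h by (simp add: field_simps)
qed

lemma hit_lap_limit:
  assumes F: "finite F" "F \<subseteq> {1..}" "k \<in> F"
  shows "(\<lambda>n. hit_lap F (1 / real (Suc n)) k) \<longlonglongrightarrow> 1 / card F"
proof -
  note [measurable] = entry_meas[OF F(1,2)] ind_meas[OF pred_eval_meas[OF entry_meas[OF F(1,2)] entry_nonneg]]
  have "(\<lambda>n. \<psi> F (1 / real (Suc n)) k) \<longlonglongrightarrow> (\<integral>\<^sup>+f. ind (f (entry F f) = enat k) \<partial>Q \<infinity>)"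
    unfolding \<psi>_def
  proof (rule nn_integral_dominated_convergence[where w = "\<lambda>_. 1"])
    show "AE f in Q \<infinity>. (\<lambda>n. nexp (1 / real (Suc n) * entry F f) * ind (f (entry F f) = enat k)) \<longlonglongrightarrow> ind (f (entry F f) = enat k)"
    proof (rule AE_I2)
      fix f
      have "(\<lambda>n. exp (- (1 / real (Suc n) * entry F f))) \<longlonglongrightarrow> exp (- (0 * entry F f))"
        by (intro tendsto_intros LIMSEQ_Suc[OF lim_1_over_n])
      then have "(\<lambda>n. nexp (1 / real (Suc n) * entry F f)) \<longlonglongrightarrow> ennreal 1"
        by (intro tendsto_ennrealI) simp
      then show "(\<lambda>n. nexp (1 / real (Suc n) * entry F f) * ind (f (entry F f) = enat k)) \<longlonglongrightarrow> ind (f (entry F f) = enat k)"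
        by (cases "f (entry F f) = enat k") (simp_all add: ind_def)
    qed
    show "AE f in Q \<infinity>. nexp (1 / real (Suc n) * entry F f) * ind (f (entry F f) = enat k) \<le> 1" for n
      by (rule AE_I2) (simp add: ind_def)
    show "(\<integral>\<^sup>+f. 1 \<partial>Q \<infinity>) < \<infinity>"
      by (simp add: prob_space.emeasure_space_1[OF prob_infty])
  qed measurable
  then have "(\<lambda>n. ennreal (hit_lap F (1 / real (Suc n)) k)) \<longlonglongrightarrow> ennreal (1 / card F)"
    unfolding entry_uniform[OF F] by (simp add: \<psi>_hit_lap)
  then show ?thesis
    by (subst (asm) tendsto_ennreal_iff) (auto intro!: always_eventually)
qed

text \<open>For \<open>F = {k, j}\<close> and every \<open>l < m\<close>, the ratio of the two
  discounted hitting probabilities equals the ratio of the normalised masses at \<open>l\<close>,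
  hence the one at \<open>m\<close>. As l tends to 0 the former tends to 1 by uniformity.\<close>

lemma norm_mass_const:
  assumes k: "1 \<le> k" and j: "1 \<le> j" and m: "0 < m"
  shows "norm_mass m k = norm_mass m j"
proof (cases "k = j")
  case False
  define F where "F = {k, j}"
  have F: "finite F" "F \<subseteq> {1..}" "k \<in> F" "j \<in> F" and cF: "card F = 2"
    using k j False by (auto simp: F_def)
  have eq: "hit_lap F l k * norm_mass m j = hit_lap F l j * norm_mass m k" if l: "0 < l" "l < m" for l
  proof -
    define a where "a = 1 - (\<Sum>i\<in>F. hit_lap F l i * hold_lap \<gamma> l i)"
    define b where "b = 1 + (m - l) * res_lap l m"
    have h: "0 < hold_res \<gamma> l k" "0 < hold_res \<gamma> l j"
      using hold_res_pos[of \<gamma> k l] hold_res_pos[of \<gamma> j l] \<gamma>_pos k j l by auto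
    have "hit_lap F l k = norm_mass l k * a" "hit_lap F l j = norm_mass l j * a"
      using hit_lap_eq[OF F(1,2,3) l(1)] hit_lap_eq[OF F(1,2,4) l(1)] h unfolding norm_mass_def a_def by (simp_all add: field_simps)
    moreover have "norm_mass l k = norm_mass m k * b" "norm_mass l j = norm_mass m j * b"
      unfolding b_def using norm_mass_resolvent[OF l] k j by auto
    ultimately show ?thesis by simp
  qed
  have "\<forall>\<^sub>F n in sequentially. 1 / real (Suc n) < m"
    using LIMSEQ_Suc[OF lim_1_over_n] m by (rule order_tendstoD)
  then have ev: "\<forall>\<^sub>F n in sequentially. hit_lap F (1 / real (Suc n)) k * norm_mass m j = hit_lap F (1 / real (Suc n)) j * norm_mass m k"
    by eventually_elim (rule eq; simp)
  have L1: "(\<lambda>n. hit_lap F (1 / real (Suc n)) k * norm_mass m j) \<longlonglongrightarrow> 1 / card F * norm_mass m j"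
    by (intro tendsto_intros hit_lap_limit F)
  have L2: "(\<lambda>n. hit_lap F (1 / real (Suc n)) j * norm_mass m k) \<longlonglongrightarrow> 1 / card F * norm_mass m k"
    by (intro tendsto_intros hit_lap_limit F)
  have "1 / card F * norm_mass m j = 1 / card F * norm_mass m k"
    by (rule LIMSEQ_unique[OF tendsto_cong[THEN iffD1, OF ev L1] L2])
  then show ?thesis using cF by simp
qed simp

text \<open>The reciprocal of the value that \<open>norm_mass l\<close> has at every state. With the
  \<open>c\<close> of \<open>psi_formula\<close> it equals
  \<open>exponent \<gamma> c {} l\<close>.\<close>

definition \<kappa> :: "real \<Rightarrow> real" where "\<kappa> l = 1 / norm_mass l 1"

lemma \<kappa>_pos: "0 < l \<Longrightarrow> 0 < \<kappa> l"
  unfolding \<kappa>_def using norm_mass_pos[of 1 l] by simp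

lemma res_mass_\<kappa>:
  assumes "1 \<le> k" "0 < l" shows "res_mass l k = hold_res \<gamma> l k / \<kappa> l"
  using norm_mass_const[of k 1 l] norm_mass_pos[of 1 l] hold_res_pos[of \<gamma> k l] \<gamma>_pos[of k] assms
  unfolding \<kappa>_def norm_mass_def[of l k] by (simp add: field_simps)

text \<open>By \<open>hit_lap_eq\<close> all the hitting transforms equal
  \<open>a / \<kappa> l\<close> with one unknown \<open>a\<close>, and the definition of
  \<open>a\<close> becomes a linear equation for it.\<close>

lemma hit_lap_\<kappa>:
  assumes F: "finite F" "F \<subseteq> {1..}" "k \<in> F" and l: "0 < l"
  shows "hit_lap F l k = 1 / (\<kappa> l + (\<Sum>x\<in>F. hold_lap \<gamma> l x))"
proof -
  define a where "a = 1 - (\<Sum>i\<in>F. hit_lap F l i * hold_lap \<gamma> l i)"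
  have p: "hit_lap F l j = a / \<kappa> l" if "j \<in> F" for j
  proof -
    have "1 \<le> j" using F that by auto
    then have h: "0 < hold_res \<gamma> l j" using hold_res_pos[of \<gamma> j l] \<gamma>_pos[of j] l by simp
    have "hit_lap F l j * hold_res \<gamma> l j = hold_res \<gamma> l j / \<kappa> l * a"
      using hit_lap_eq[OF F(1,2) that l] res_mass_\<kappa>[OF \<open>1 \<le> j\<close> l] by (simp add: a_def)
    then have "(hit_lap F l j - a / \<kappa> l) * hold_res \<gamma> l j = 0" by (simp add: algebra_simps)
    then show ?thesis using h by simp
  qed
  have g: "0 \<le> (\<Sum>x\<in>F. hold_lap \<gamma> l x)"
    using hold_lap_pos[of \<gamma> _ l] \<gamma>_pos F l by (intro sum_nonneg) (auto simp: less_imp_le)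
  have "(\<Sum>i\<in>F. hit_lap F l i * hold_lap \<gamma> l i) = (\<Sum>i\<in>F. a / \<kappa> l * hold_lap \<gamma> l i)"
    by (rule sum.cong) (simp_all add: p)
  then have "a = 1 - (\<Sum>i\<in>F. a / \<kappa> l * hold_lap \<gamma> l i)"
    using a_def by simp
  then have "a = 1 - a / \<kappa> l * (\<Sum>x\<in>F. hold_lap \<gamma> l x)"
    by (simp add: sum_distrib_left)
  then have "a * (\<kappa> l + (\<Sum>x\<in>F. hold_lap \<gamma> l x)) = \<kappa> l"
    using \<kappa>_pos[OF l] by (simp add: field_simps)
  then have "a / \<kappa> l = 1 / (\<kappa> l + (\<Sum>x\<in>F. hold_lap \<gamma> l x))"
    using \<kappa>_pos[OF l] g by (subst frac_eq_eq) auto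
  then show ?thesis
    using p[OF F(3)] by simp
qed

definition hold_res_sum :: "real \<Rightarrow> real" where "hold_res_sum l = (\<Sum>n. hold_res \<gamma> l (Suc n))"

lemma hold_res_sum_sums: "0 \<le> l \<Longrightarrow> (\<lambda>n. hold_res \<gamma> l (Suc n)) sums hold_res_sum l"
  unfolding hold_res_sum_def by (intro summable_sums hold_res_summable \<gamma>_pos \<gamma>_summable)

text \<open>\<open>res_lap l m\<close> is computed twice: from the total mass, where
  \<open>hold_res_diff\<close> splits the series of \<open>res_mass_sum\<close> into a difference,
  and from the ratio of \<open>\<kappa> m\<close> to \<open>\<kappa> l\<close>. Comparing the two
  separates \<open>l\<close> from \<open>m\<close>.\<close>

lemma \<kappa>_resolvent:
  assumes lm: "0 < l" "l < m"
  shows "\<kappa> m / m - hold_res_sum m = \<kappa> l / l - hold_res_sum l"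
proof -
  have m: "0 < m" using lm by simp
  have "(\<lambda>n. m / \<kappa> l * (hold_res \<gamma> l (Suc n) - hold_res \<gamma> m (Suc n))) sums (m / \<kappa> l * (hold_res_sum l - hold_res_sum m))"
    using lm by (intro sums_mult sums_diff hold_res_sum_sums) auto
  also have "(\<lambda>n. m / \<kappa> l * (hold_res \<gamma> l (Suc n) - hold_res \<gamma> m (Suc n))) = (\<lambda>n. (m - l) * (m * hold_res \<gamma> m (Suc n) * res_mass l (Suc n)))"
  proof
    fix n
    show "m / \<kappa> l * (hold_res \<gamma> l (Suc n) - hold_res \<gamma> m (Suc n)) = (m - l) * (m * hold_res \<gamma> m (Suc n) * res_mass l (Suc n))"
      using hold_res_diff(1)[of \<gamma> "Suc n" l m] \<gamma>_pos[of "Suc n"] lm res_mass_\<kappa>[of "Suc n" l]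
      by (simp add: mult_ac)
  qed
  finally have "m / \<kappa> l * (hold_res_sum l - hold_res_sum m) = (m - l) * (1 / l - res_lap l m)"
    using sums_mult[OF res_mass_sum[OF lm(1) m], of "m - l"] sums_unique2 by blast
  moreover have "\<kappa> m = \<kappa> l * (1 + (m - l) * res_lap l m)"
    using norm_mass_resolvent[OF lm, of 1] norm_mass_pos[of 1 l] norm_mass_pos[of 1 m] lm unfolding \<kappa>_def by (simp add: field_simps)
  ultimately have "\<kappa> m = \<kappa> l * (1 + (m - l) / l - m / \<kappa> l * (hold_res_sum l - hold_res_sum m))"
    by (simp add: right_diff_distrib)
  also have "1 + (m - l) / l = m / l"
    using lm by (simp add: field_simps)
  also have "\<kappa> l * (m / l - m / \<kappa> l * (hold_res_sum l - hold_res_sum m)) = m * (\<kappa> l / l - (hold_res_sum l - hold_res_sum m))"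
    using \<kappa>_pos[OF lm(1)] by (simp add: field_simps)
  finally show ?thesis using m by simp
qed

theorem psi_formula:
  "\<exists>c\<ge>0. \<forall>F l k. finite F \<longrightarrow> F \<subseteq> {1..} \<longrightarrow> k \<in> F \<longrightarrow> 0 < l \<longrightarrow> \<psi> F l k = ennreal (1 / exponent \<gamma> c F l)"
proof -
  \<comment> \<open>The choice of the argument 1 is immaterial, as the next step shows.\<close>
  define c where "c = \<kappa> 1 - hold_res_sum 1"
  have c: "\<kappa> l / l - hold_res_sum l = c" if "0 < l" for l
    using \<kappa>_resolvent[of l 1] \<kappa>_resolvent[of 1 l] that unfolding c_def by (cases l "1::real" rule: linorder_cases) auto
  \<comment> \<open>At l = 1 the finite states carry at most the total resolvent mass 1. Their
    masses are \<open>hold_res\<close> divided by \<open>\<kappa> 1\<close>, so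
    \<open>hold_res_sum 1\<close> is at most \<open>\<kappa> 1\<close>.\<close>
  have "0 \<le> c"
  proof -
    have "(\<lambda>n. ennreal (res_mass 1 (Suc n))) sums (\<Sum>n. resolvent 1 \<infinity> (\<delta> (Suc n)))"
      using resolvent_\<delta>[of 1] by (simp add: summable_sums)
    have "(\<Sum>n. ennreal (res_mass 1 (Suc n))) = resolvent 1 \<infinity> (\<lambda>z. \<Sum>n. \<delta> (Suc n) z)"
      using resolvent_\<delta>[of 1] by (simp add: resolvent_suminf)
    also have "\<dots> \<le> resolvent 1 \<infinity> (\<lambda>_. 1)"
    proof (rule resolvent_mono)
      fix z
      show "(\<Sum>n. \<delta> (Suc n) z) \<le> 1"
      proof (cases z)
        case (enat i)
        have "(\<Sum>n. \<delta> (Suc n) z) \<le> (\<Sum>n. if n = i - 1 then 1 else 0)"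
          using enat by (intro suminf_le) (auto simp: \<delta>_def ind_def)
        then show ?thesis by (simp add: suminf_single_ennreal)
      qed (simp add: \<delta>_def ind_def)
    qed
    finally have le: "(\<Sum>n. ennreal (res_mass 1 (Suc n))) \<le> 1" by (simp add: resolvent_one)
    have "res_mass 1 (Suc n) = 1 / \<kappa> 1 * hold_res \<gamma> 1 (Suc n)" for n
      using res_mass_\<kappa>[of "Suc n" 1] by simp
    moreover have "(\<lambda>n. 1 / \<kappa> 1 * hold_res \<gamma> 1 (Suc n)) sums (1 / \<kappa> 1 * hold_res_sum 1)"
      by (intro sums_mult hold_res_sum_sums) simp
    ultimately have "(\<lambda>n. res_mass 1 (Suc n)) sums (1 / \<kappa> 1 * hold_res_sum 1)" by simp
    then have "(\<Sum>n. ennreal (res_mass 1 (Suc n))) = ennreal (1 / \<kappa> 1 * hold_res_sum 1)"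
      by (subst suminf_ennreal2) (auto dest: sums_summable sums_unique)
    with le have "1 / \<kappa> 1 * hold_res_sum 1 \<le> 1" by simp
    then show ?thesis
      using \<kappa>_pos[of 1] by (simp add: c_def field_simps)
  qed
  moreover have "\<psi> F l k = ennreal (1 / exponent \<gamma> c F l)"
    if "finite F" "F \<subseteq> {1..}" "k \<in> F" "0 < l" for F l k
  proof -
    have "\<kappa> l = c * l + l * hold_res_sum l"
      using c[OF that(4)] that(4) by (simp add: field_simps)
    then show ?thesis
      using hit_lap_\<kappa>[OF that] \<psi>_hit_lap[of l F k] that(4) by (simp add: exponent_def hold_res_sum_def)
  qed
  ultimately show ?thesis by blast
qed

end

section \<open>The skeleton of the process\<close>

context uniform_markov
begin

text \<open>The default 0 is not a state and lies in no \<open>B\<close> considered here.\<close>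

definition entry_state :: "nat set \<Rightarrow> (real \<Rightarrow> enat) \<Rightarrow> nat" where
  "entry_state B f = (case f (entry B f) of enat k \<Rightarrow> k | \<infinity> \<Rightarrow> 0)"

text \<open>\<^const>\<open>max\<close> only serves to make the index of \<open>exit\<close> positive for every path.\<close>

definition hold :: "nat set \<Rightarrow> (real \<Rightarrow> enat) \<Rightarrow> real" where
  "hold B f = exit (max 1 (entry_state B f)) (shift (entry B f) f)"

definition next_path :: "nat set \<Rightarrow> (real \<Rightarrow> enat) \<Rightarrow> real \<Rightarrow> enat" where
  "next_path B f = shift (hold B f) (shift (entry B f) f)"

text \<open>Both times of the next cycle are finite, so that their images under
  \<open>enn2real\<close> are the true times.\<close>

definition finite_cycle :: "nat set \<Rightarrow> (real \<Rightarrow> enat) \<Rightarrow> bool" where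
  "finite_cycle B f \<longleftrightarrow> hit (enat ` B) f < \<infinity> \<and> hit (Nbar - {enat (entry_state B f)}) (shift (entry B f) f) < \<infinity>"

definition initial :: "enat \<Rightarrow> (real \<Rightarrow> enat) \<Rightarrow> real" where
  "initial y f = (case y of enat i \<Rightarrow> exit i f | \<infinity> \<Rightarrow> 0)"

definition paths :: "enat \<Rightarrow> nat set \<Rightarrow> nat \<Rightarrow> (real \<Rightarrow> enat) \<Rightarrow> real \<Rightarrow> enat" where
  "paths y B i f = (next_path B ^^ i) (shift (initial y f) f)"

definition times :: "enat \<Rightarrow> nat set \<Rightarrow> nat \<Rightarrow> (real \<Rightarrow> enat) \<Rightarrow> real" where
  "times y B j f = (if j = 0 then initial y f else if odd j then entry B (paths y B ((j - 1) div 2) f)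
     else hold B (paths y B ((j - 2) div 2) f))"

definition states :: "enat \<Rightarrow> nat set \<Rightarrow> nat \<Rightarrow> (real \<Rightarrow> enat) \<Rightarrow> nat" where
  "states y B i f = entry_state B (paths y B i f)"

text \<open>The integrand for \<open>m\<close> cycles of a path without initial hold; the indices of
  \<open>a\<close> are therefore one less than those of \<open>times\<close>.\<close>

definition prodlap :: "nat set \<Rightarrow> nat \<Rightarrow> (nat \<Rightarrow> real) \<Rightarrow> (nat \<Rightarrow> nat) \<Rightarrow> (real \<Rightarrow> enat) \<Rightarrow> ennreal" where
  "prodlap B m a x f = (\<Prod>i<m. nexp (a (2 * i) * entry B ((next_path B ^^ i) f)) *
     nexp (a (2 * i + 1) * hold B ((next_path B ^^ i) f)) * ind (entry_state B ((next_path B ^^ i) f) = x i))"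

lemma hold_nonneg [simp]: "0 \<le> hold B f"
  by (simp add: hold_def)

lemma initial_nonneg [simp]: "0 \<le> initial y f"
  by (simp add: initial_def split: enat.split)

context
  fixes B :: "nat set"
  assumes B: "finite B" "B \<noteq> {}" "B \<subseteq> {1..}"
begin

lemma entry_B [measurable]: "entry B \<in> borel_measurable S"
  by (rule entry_meas[OF B(1,3)])

lemma shift_entry_meas [measurable]: "(\<lambda>f. shift (entry B f) f) \<in> S \<rightarrow>\<^sub>M S"
  by (rule shift_meas) auto

lemma entry_state_meas [measurable]: "entry_state B \<in> S \<rightarrow>\<^sub>M count_space UNIV"
  unfolding entry_state_def[abs_def] by (rule measurable_compose[OF eval_meas[OF entry_B entry_nonneg]]) simp

lemma hold_meas [measurable]: "hold B \<in> borel_measurable S"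
  unfolding hold_def[abs_def]
proof (rule measurable_compose_countable[OF _ entry_state_meas])
  fix i
  show "(\<lambda>f. exit (max 1 i) (shift (entry B f) f)) \<in> borel_measurable S"
    by (rule measurable_compose[OF shift_entry_meas exit_meas]) simp
qed

lemma next_path_meas [measurable]: "next_path B \<in> S \<rightarrow>\<^sub>M S"
  unfolding next_path_def[abs_def] by (rule measurable_shift[OF shift_entry_meas hold_meas]) simp

lemma next_path_pow_meas [measurable]: "next_path B ^^ i \<in> S \<rightarrow>\<^sub>M S"
proof (induction i)
  case (Suc i)
  then show ?case
    using measurable_comp[OF Suc next_path_meas] by (simp add: comp_def)
qed (simp add: id_def)

lemma prodlap_meas [measurable]: "prodlap B m a x \<in> borel_measurable S"
proof -
  have [measurable]: "(\<lambda>f. entry B ((next_path B ^^ i) f)) \<in> borel_measurable S" "(\<lambda>f. hold B ((next_path B ^^ i) f)) \<in> borel_measurable S"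
    "(\<lambda>f. entry_state B ((next_path B ^^ i) f)) \<in> S \<rightarrow>\<^sub>M count_space UNIV" for i
    by (rule measurable_compose[OF next_path_pow_meas], measurable)+
  have [measurable]: "(\<lambda>f. ind (entry_state B ((next_path B ^^ i) f) = x i)) \<in> borel_measurable S" for i
    by (rule ind_meas) measurable
  show ?thesis
    unfolding prodlap_def[abs_def] by (intro borel_measurable_prod_ennreal) measurable
qed

lemma prodlap_Suc:
  "prodlap B (Suc m) a x f = nexp (a 0 * entry B f) * nexp (a 1 * hold B f) * ind (entry_state B f = x 0) *
     prodlap B m (\<lambda>i. a (i + 2)) (\<lambda>i. x (Suc i)) (next_path B f)"
  unfolding prodlap_def by (subst prod.lessThan_Suc_shift) (simp add: funpow_swap1)

lemma entry_state_AE: "AE f in Q \<infinity>. entry_state B f \<in> B \<and> f (entry B f) = enat (entry_state B f)"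
  using entry_AE[OF B] by eventually_elim (auto simp: entry_state_def)

lemma entry_state_pos: "entry_state B f \<in> B \<Longrightarrow> hold B f = exit (entry_state B f) (shift (entry B f) f)"
  using B(3) by (auto simp: hold_def max_def)

text \<open>A cycle is split off by the strong Markov property at its entry and again at its exit.
  The exit lands at infinity, where the remaining cycles start afresh, so the transform is a
  product.\<close>

lemma prodlap_integral:
  assumes "\<And>i. 0 < a i" "\<And>i. x i \<in> B"
  shows "(\<integral>\<^sup>+f. prodlap B m a x f \<partial>Q \<infinity>) = (\<Prod>i<m. \<psi> B (a (2 * i)) (x i) * ennreal (hold_lap \<gamma> (a (2 * i + 1)) (x i)))"
  using assms
proof (induction m arbitrary: a x)
  case 0
  then show ?case
    by (simp add: prodlap_def prob_space.emeasure_space_1[OF prob_infty])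
next
  case (Suc m)
  let ?a = "\<lambda>i. a (i + 2)" and ?x = "\<lambda>i. x (Suc i)"
  have x0: "1 \<le> x 0" using Suc.prems(2)[of 0] B by auto
  note [measurable] = exit_meas[OF x0]
  \<comment> \<open>What follows the entry at \<open>x 0\<close>, as a functional of the path
    shifted to that entry.\<close>
  define \<Psi> where "\<Psi> f = nexp (a 1 * exit (x 0) f) * prodlap B m ?a ?x (shift (exit (x 0) f) f)" for f
  have \<Psi>m [measurable]: "\<Psi> \<in> borel_measurable S"
    unfolding \<Psi>_def[abs_def]
    by (intro borel_measurable_times_ennreal measurable_compose[OF shift_meas prodlap_meas]) auto
  have [measurable]: "(\<lambda>f. ind (f 0 = enat (x 0))) \<in> borel_measurable S"
    using pred_eval_meas[of "\<lambda>_. 0"] by (intro ind_meas) simp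
  have "(\<integral>\<^sup>+f. prodlap B (Suc m) a x f \<partial>Q \<infinity>) =
    (\<integral>\<^sup>+f. nexp (a 0 * entry B f) * (ind (shift (entry B f) f 0 = enat (x 0)) * \<Psi> (shift (entry B f) f)) \<partial>Q \<infinity>)"
  proof (rule nn_integral_cong_AE)
    show "AE f in Q \<infinity>. prodlap B (Suc m) a x f =
        nexp (a 0 * entry B f) * (ind (shift (entry B f) f 0 = enat (x 0)) * \<Psi> (shift (entry B f) f))"
      using entry_state_AE
    proof eventually_elim
      case (elim f)
      show ?case
      proof (cases "entry_state B f = x 0")
        case True
        then show ?thesis
          using elim entry_state_pos[of f] by (simp add: prodlap_Suc \<Psi>_def ind_def next_path_def mult.assoc)
      next
        case False
        then show ?thesis
          using elim by (simp add: prodlap_Suc ind_def)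
      qed
    qed
  qed
  also have "\<dots> = (\<Sum>k\<in>B. \<psi> B (a 0) k * (\<integral>\<^sup>+f. ind (f 0 = enat (x 0)) * \<Psi> f \<partial>Q (enat k)))"
    using markov_entry[OF B, of "\<lambda>t. nexp (a 0 * t)" "\<lambda>f. ind (f 0 = enat (x 0)) * \<Psi> f"]
    by (simp add: \<psi>_def)
  also have "\<dots> = (\<Sum>k\<in>B. if k = x 0 then \<psi> B (a 0) (x 0) * (\<integral>\<^sup>+f. \<Psi> f \<partial>Q (enat (x 0))) else 0)"
  proof (rule sum.cong[OF refl])
    fix k assume k: "k \<in> B"
    then have "enat k \<in> Nbar" using B by auto
    then have "(\<integral>\<^sup>+f. ind (f 0 = enat (x 0)) * \<Psi> f \<partial>Q (enat k)) = (\<integral>\<^sup>+f. (if k = x 0 then \<Psi> f else 0) \<partial>Q (enat k))"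
      using start_Q[of "enat k"] by (intro nn_integral_cong_AE) (auto simp: ind_def elim!: AE_mp)
    then show "\<psi> B (a 0) k * (\<integral>\<^sup>+f. ind (f 0 = enat (x 0)) * \<Psi> f \<partial>Q (enat k)) =
        (if k = x 0 then \<psi> B (a 0) (x 0) * (\<integral>\<^sup>+f. \<Psi> f \<partial>Q (enat (x 0))) else 0)"
      by (cases "k = x 0") simp_all
  qed
  also have "\<dots> = \<psi> B (a 0) (x 0) * (\<integral>\<^sup>+f. \<Psi> f \<partial>Q (enat (x 0)))"
    using B(1) Suc.prems(2)[of 0] by (simp add: sum.delta)
  also have "(\<integral>\<^sup>+f. \<Psi> f \<partial>Q (enat (x 0))) = ennreal (hold_lap \<gamma> (a 1) (x 0)) * (\<integral>\<^sup>+f. prodlap B m ?a ?x f \<partial>Q \<infinity>)"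
    unfolding \<Psi>_def using markov_exit[OF x0, of "\<lambda>t. nexp (a 1 * t)" "prodlap B m ?a ?x"]
      exit_laplace[OF x0, of "a 1"] Suc.prems(1)[of 1] by simp
  also have "(\<integral>\<^sup>+f. prodlap B m ?a ?x f \<partial>Q \<infinity>) = (\<Prod>i<m. \<psi> B (?a (2 * i)) (?x i) * ennreal (hold_lap \<gamma> (?a (2 * i + 1)) (?x i)))"
    using Suc.prems by (intro Suc.IH) auto
  finally show ?case
    by (subst prod.lessThan_Suc_shift) (simp add: mult.assoc)
qed

text \<open>The Markov identities concern integrals, so an almost sure property is transported as an
  indicator of integral 1: first through the exit from each state of \<open>B\<close>, then through
  the entry into \<open>B\<close>.\<close>

lemma AE_next_path:
  assumes Pr [measurable]: "Measurable.pred S Pr" and AE: "AE f in Q \<infinity>. Pr f"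
  shows "AE f in Q \<infinity>. finite_cycle B f \<and> Pr (next_path B f)"
proof -
  define \<Phi> where "\<Phi> f = (\<Sum>k\<in>B. ind (f 0 = enat k \<and> hit (Nbar - {enat k}) f < \<infinity> \<and> Pr (shift (exit k f) f)))" for f
  have m: "(\<lambda>f. ind (f 0 = enat k \<and> hit (Nbar - {enat k}) f < \<infinity> \<and> Pr (shift (exit k f) f))) \<in> borel_measurable S" if k: "k \<in> B" for k
  proof (rule ind_meas)
    have k1: "1 \<le> k" using k B by auto
    have [measurable]: "Measurable.pred S (\<lambda>f. f 0 = enat k)"
      using pred_eval_meas[of "\<lambda>_. 0"] by simp
    have [measurable]: "Measurable.pred S (\<lambda>f. Pr (shift (exit k f) f))"
      by (rule measurable_compose[OF shift_meas[OF exit_meas[OF k1] exit_nonneg] Pr])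
    note [measurable] = clopen_exit[OF k1]
    show "Measurable.pred S (\<lambda>f. f 0 = enat k \<and> hit (Nbar - {enat k}) f < \<infinity> \<and> Pr (shift (exit k f) f))"
      by measurable
  qed
  have [measurable]: "\<Phi> \<in> borel_measurable S"
    unfolding \<Phi>_def[abs_def] by (rule borel_measurable_sum) (rule m)
  have Q1: "(\<integral>\<^sup>+f. \<Phi> f \<partial>Q (enat k)) = 1" if k: "k \<in> B" for k
  proof -
    have k1: "1 \<le> k" using k B by auto
    interpret K: prob_space "Q (enat k)" by (rule prob_enat[OF k1])
    note [measurable_cong] = sets_enat[OF k1]
    have PrS: "Measurable.pred S (\<lambda>f. Pr (shift (exit k f) f))"
      by (rule measurable_compose[OF shift_meas[OF exit_meas[OF k1] exit_nonneg] Pr])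
    have "(\<integral>\<^sup>+f. ind (Pr f) \<partial>Q \<infinity>) = (\<integral>\<^sup>+f. 1 \<partial>Q \<infinity>)"
      using AE by (intro nn_integral_cong_AE) (auto simp: ind_def elim!: AE_mp)
    then have "(\<integral>\<^sup>+f. ind (Pr f) \<partial>Q \<infinity>) = 1" by (simp add: prob_space.emeasure_space_1[OF prob_infty])
    then have "(\<integral>\<^sup>+f. ind (Pr (shift (exit k f) f)) \<partial>Q (enat k)) = 1"
      using markov_exit[OF k1, of "\<lambda>_. 1" "\<lambda>f. ind (Pr f)"] ind_meas[OF Pr] by (simp add: K.emeasure_space_1)
    moreover have "(\<integral>\<^sup>+f. ind (Pr (shift (exit k f) f)) \<partial>Q (enat k)) = emeasure (Q (enat k)) {f \<in> space S. Pr (shift (exit k f) f)}"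
    proof -
      have "(\<integral>\<^sup>+f. ind (Pr (shift (exit k f) f)) \<partial>Q (enat k)) = (\<integral>\<^sup>+f. indicator {f \<in> space S. Pr (shift (exit k f) f)} f \<partial>Q (enat k))"
        by (rule nn_integral_cong) (use k1 in \<open>simp add: ind_def space_Q indicator_def\<close>)
      then show ?thesis using PrS by (simp add: pred_def sets_enat[OF k1])
    qed
    ultimately have "AE f in Q (enat k). Pr (shift (exit k f) f)"
      using PrS K.AE_iff_emeasure_eq_1[of "\<lambda>f. Pr (shift (exit k f) f)"] k1 by (simp add: pred_def sets_enat[OF k1] space_Q)
    then have "AE f in Q (enat k). \<Phi> f = 1"
      using start_Q[of "enat k", simplified, OF k1[simplified]] exit_finite[OF k1]
    proof eventually_elim
      case (elim f)
      have "\<Phi> f = (\<Sum>j\<in>B. if j = k then 1 else 0)"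
        unfolding \<Phi>_def using elim by (intro sum.cong) (auto simp: ind_def)
      then show ?case using k B(1) by (simp add: sum.delta)
    qed
    then have "(\<integral>\<^sup>+f. \<Phi> f \<partial>Q (enat k)) = (\<integral>\<^sup>+f. 1 \<partial>Q (enat k))"
      by (rule nn_integral_cong_AE)
    then show ?thesis by (simp add: K.emeasure_space_1)
  qed
  interpret I: prob_space "Q \<infinity>" by (rule prob_infty)
  have c0: "0 < card B" using B by (simp add: card_gt_0_iff)
  have "(\<integral>\<^sup>+f. \<Phi> (shift (entry B f) f) \<partial>Q \<infinity>) = (\<Sum>k\<in>B. ennreal (1 / card B) * 1)"
    using markov_entry[OF B, of "\<lambda>_. 1" \<Phi>] Q1 entry_uniform[OF B(1,3)] by simp
  also have "\<dots> = ennreal (\<Sum>k\<in>B. 1 / card B)"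
    by (simp only: mult_1_right) (rule sum_ennreal, simp)
  also have "(\<Sum>k\<in>B. 1 / card B) = 1" using c0 by simp
  finally have int1: "(\<integral>\<^sup>+f. \<Phi> (shift (entry B f) f) \<partial>Q \<infinity>) = 1" by simp
  have \<Phi>01: "\<Phi> f = 0 \<or> \<Phi> f = 1" for f
  proof (cases "\<exists>k\<in>B. f 0 = enat k")
    case True
    then obtain k where k: "k \<in> B" "f 0 = enat k" by blast
    have "\<Phi> f = (\<Sum>j\<in>B. if j = k then ind (hit (Nbar - {enat k}) f < \<infinity> \<and> Pr (shift (exit k f) f)) else 0)"
      unfolding \<Phi>_def using k by (intro sum.cong) (auto simp: ind_def)
    then show ?thesis using k B(1) by (simp add: sum.delta ind_def)
  next
    case False
    then have "\<Phi> f = 0" unfolding \<Phi>_def by (intro sum.neutral) (auto simp: ind_def)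
    then show ?thesis by simp
  qed
  have sM: "{f \<in> space S. \<Phi> (shift (entry B f) f) = 1} \<in> sets S" by measurable
  have "(\<integral>\<^sup>+f. \<Phi> (shift (entry B f) f) \<partial>Q \<infinity>) = (\<integral>\<^sup>+f. indicator {f \<in> space S. \<Phi> (shift (entry B f) f) = 1} f \<partial>Q \<infinity>)"
  proof (rule nn_integral_cong)
    fix f assume "f \<in> space (Q \<infinity>)"
    then show "\<Phi> (shift (entry B f) f) = indicator {f \<in> space S. \<Phi> (shift (entry B f) f) = 1} f"
      using \<Phi>01[of "shift (entry B f) f"] by (auto simp: space_Q indicator_def)
  qed
  then have "emeasure (Q \<infinity>) {f \<in> space S. \<Phi> (shift (entry B f) f) = 1} = 1"
    using int1 sM by (simp add: sets_infty)
  then have "AE f in Q \<infinity>. \<Phi> (shift (entry B f) f) = 1"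
    using I.AE_iff_emeasure_eq_1[of "\<lambda>f. \<Phi> (shift (entry B f) f) = 1"] sM by (simp add: space_Q sets_infty)
  then show ?thesis
    using hit_finite[OF B] entry_state_AE
  proof eventually_elim
    case (elim f)
    have "\<exists>k\<in>B. ind (shift (entry B f) f 0 = enat k \<and> hit (Nbar - {enat k}) (shift (entry B f) f) < \<infinity> \<and>
        Pr (shift (exit k (shift (entry B f) f)) (shift (entry B f) f))) \<noteq> 0"
      using elim(1) unfolding \<Phi>_def by (metis (no_types, lifting) sum.neutral zero_neq_one)
    then obtain k where k: "k \<in> B" "f (entry B f) = enat k" "hit (Nbar - {enat k}) (shift (entry B f) f) < \<infinity>"
       "Pr (shift (exit k (shift (entry B f) f)) (shift (entry B f) f))"
      by (auto simp: ind_def split: if_splits)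
    then have "entry_state B f = k" by (simp add: entry_state_def)
    then show ?case
      using k elim(2) entry_state_pos[of f] by (simp add: finite_cycle_def next_path_def)
  qed
qed

lemma finite_cycle_pred: "Measurable.pred S (\<lambda>f. finite_cycle B f)"
proof -
  have cl: "clopen (enat ` B)" using B by (intro clopen_finite) auto
  have "Measurable.pred S (\<lambda>f. hit (Nbar - {enat (entry_state B f)}) (shift (entry B f) f) < \<infinity>)"
  proof (rule measurable_compose_countable[OF _ entry_state_meas])
    fix i :: nat
    show "Measurable.pred S (\<lambda>f. hit (Nbar - {enat i}) (shift (entry B f) f) < \<infinity>)"
    proof (cases "1 \<le> i")
      case True
      have [measurable]: "(\<lambda>f. hit (Nbar - {enat i}) (shift (entry B f) f)) \<in> borel_measurable S"
        by (rule measurable_compose[OF shift_entry_meas measurable_hit[OF clopen_exit[OF True]]])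
      show ?thesis by measurable
    next
      case False
      \<comment> \<open>Only \<open>i = 0\<close> is left. As \<open>enat 0\<close> is outside
        \<open>Nbar\<close>, nothing is removed.\<close>
      have "clopen (Nbar - {enat i})"
        using False unfolding clopen_def by (intro exI[of _ "{}"]) auto
      then have [measurable]: "(\<lambda>f. hit (Nbar - {enat i}) (shift (entry B f) f)) \<in> borel_measurable S"
        by (rule measurable_compose[OF shift_entry_meas measurable_hit])
      show ?thesis by measurable
    qed
  qed
  then show ?thesis
    unfolding finite_cycle_def using measurable_hit[OF cl] by measurable
qed

lemma finite_cycle_AE: "AE f in Q \<infinity>. \<forall>i. finite_cycle B ((next_path B ^^ i) f)"
proof -
  have "AE f in Q \<infinity>. finite_cycle B ((next_path B ^^ i) f)" for i
  proof (induction i)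
    case 0
    then show ?case using AE_next_path[of "\<lambda>_. True"] by simp
  next
    case (Suc i)
    have "Measurable.pred S (\<lambda>f. finite_cycle B ((next_path B ^^ i) f))"
      by (rule measurable_compose[OF next_path_pow_meas finite_cycle_pred])
    then show ?case
      using AE_next_path[OF _ Suc] by (simp add: funpow_swap1)
  qed
  then show ?thesis by (simp add: AE_all_countable)
qed

end

end

section \<open>The initial hold and the skeleton read off a path\<close>

context uniform_markov
begin

context
  fixes B :: "nat set" and y :: enat
  assumes B: "finite B" "B \<noteq> {}" "B \<subseteq> {1..}" and y: "y \<in> Nbar"
begin

lemma initial_meas [measurable]: "initial y \<in> borel_measurable S"
  using y by (cases y) (simp_all add: initial_def[abs_def] exit_meas)

lemma shift_initial_meas [measurable]: "(\<lambda>f. shift (initial y f) f) \<in> S \<rightarrow>\<^sub>M S"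
  by (rule shift_meas) auto

lemma paths_meas: "paths y B i \<in> S \<rightarrow>\<^sub>M S"
  unfolding paths_def[abs_def] by (rule measurable_compose[OF shift_initial_meas next_path_pow_meas[OF B]])

lemma times_meas: "times y B j \<in> borel_measurable S"
  unfolding times_def[abs_def]
  using measurable_compose[OF paths_meas entry_B[OF B]] measurable_compose[OF paths_meas hold_meas[OF B]]
  by (cases "j = 0"; cases "odd j") simp_all

lemma states_meas: "states y B i \<in> S \<rightarrow>\<^sub>M count_space UNIV"
  unfolding states_def[abs_def] by (rule measurable_compose[OF paths_meas entry_state_meas[OF B]])

lemma times_nonneg: "0 \<le> times y B j f"
  by (simp add: times_def)

lemma shift_0: "f \<in> space S \<Longrightarrow> shift 0 f = f"
  by (auto simp: space_regular_paths shift_def fun_eq_iff restrict_def PiE_def extensional_def)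

lemma AE_initial:
  assumes Pr [measurable]: "Measurable.pred S Pr" and AE: "AE f in Q \<infinity>. Pr f"
  shows "AE f in Q y. Pr (shift (initial y f) f)"
proof (cases y)
  case (enat i)
  then have i: "1 \<le> i" using y by simp
  interpret K: prob_space "Q (enat i)" by (rule prob_enat[OF i])
  have PrS: "Measurable.pred S (\<lambda>f. Pr (shift (exit i f) f))"
    by (rule measurable_compose[OF shift_meas[OF exit_meas[OF i] exit_nonneg] Pr])
  have "(\<integral>\<^sup>+f. ind (Pr f) \<partial>Q \<infinity>) = (\<integral>\<^sup>+f. 1 \<partial>Q \<infinity>)"
    using AE by (intro nn_integral_cong_AE) (auto simp: ind_def elim!: AE_mp)
  then have "(\<integral>\<^sup>+f. ind (Pr f) \<partial>Q \<infinity>) = 1" by (simp add: prob_space.emeasure_space_1[OF prob_infty])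
  then have "(\<integral>\<^sup>+f. ind (Pr (shift (exit i f) f)) \<partial>Q (enat i)) = 1"
    using markov_exit[OF i, of "\<lambda>_. 1" "\<lambda>f. ind (Pr f)"] ind_meas[OF Pr] by (simp add: K.emeasure_space_1)
  moreover have "(\<integral>\<^sup>+f. ind (Pr (shift (exit i f) f)) \<partial>Q (enat i)) = emeasure (Q (enat i)) {f \<in> space S. Pr (shift (exit i f) f)}"
  proof -
    have "(\<integral>\<^sup>+f. ind (Pr (shift (exit i f) f)) \<partial>Q (enat i)) = (\<integral>\<^sup>+f. indicator {f \<in> space S. Pr (shift (exit i f) f)} f \<partial>Q (enat i))"
      by (rule nn_integral_cong) (use i in \<open>simp add: ind_def space_Q indicator_def\<close>)
    then show ?thesis using PrS by (simp add: pred_def sets_enat[OF i])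
  qed
  ultimately have "AE f in Q (enat i). Pr (shift (exit i f) f)"
    using PrS K.AE_iff_emeasure_eq_1[of "\<lambda>f. Pr (shift (exit i f) f)"] i by (simp add: pred_def sets_enat[OF i] space_Q)
  then show ?thesis unfolding enat initial_def by simp
next
  case infinity
  show ?thesis
    unfolding infinity using AE AE_space[of "Q \<infinity>"] by eventually_elim (simp add: initial_def space_Q shift_0)
qed

lemma initial_integral:
  assumes a: "0 \<le> a" and \<Phi> [measurable]: "\<Phi> \<in> borel_measurable S"
  shows "(\<integral>\<^sup>+f. nexp (a * initial y f) * \<Phi> (shift (initial y f) f) \<partial>Q y) =
    ennreal (1 / (1 + a * extend_infty \<gamma> y)) * (\<integral>\<^sup>+f. \<Phi> f \<partial>Q \<infinity>)"
proof (cases y)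
  case (enat i)
  then have i: "1 \<le> i" using y by simp
  show ?thesis
    unfolding enat using markov_exit[OF i, of "\<lambda>t. nexp (a * t)" \<Phi>] exit_laplace[OF i a]
    by (simp add: initial_def hold_lap_def extend_infty_def)
next
  case infinity
  have "(\<integral>\<^sup>+f. \<Phi> (shift 0 f) \<partial>Q \<infinity>) = (\<integral>\<^sup>+f. \<Phi> f \<partial>Q \<infinity>)"
    by (rule nn_integral_cong) (simp add: space_Q shift_0)
  then show ?thesis
    unfolding infinity by (simp add: initial_def extend_infty_def)
qed

lemma prod_double:
  fixes F G :: "nat \<Rightarrow> 'b :: comm_monoid_mult"
  shows "(\<Prod>j<2*m+1. F j) = F 0 * (\<Prod>i<m. F (2*i+1) * F (2*i+2))"
  by (induction m) (simp_all add: mult_ac numeral_2_eq_2)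

lemma times_laplace:
  assumes a: "\<And>i. 0 < a i" and x: "\<And>i. x i \<in> B"
  shows "(\<integral>\<^sup>+f. (\<Prod>j<2*m+1. nexp (a j * times y B j f)) * (\<Prod>i<m. indicator {x i} (states y B i f)) \<partial>Q y) =
    ennreal (1 / (1 + a 0 * extend_infty \<gamma> y)) *
      (\<Prod>i<m. \<psi> B (a (2 * i + 1)) (x i) * ennreal (hold_lap \<gamma> (a (2 * i + 2)) (x i)))"
proof -
  have "(\<Prod>j<2*m+1. nexp (a j * times y B j f)) * (\<Prod>i<m. indicator {x i} (states y B i f)) =
     nexp (a 0 * initial y f) * prodlap B m (\<lambda>i. a (i + 1)) x (shift (initial y f) f)" for f
    unfolding prod_double prodlap_def mult.assoc prod.distrib[symmetric]
    by (rule arg_cong2[where f="(*)"])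
      (auto simp: times_def states_def paths_def ind_def indicator_def intro!: prod.cong)
  then have "(\<integral>\<^sup>+f. (\<Prod>j<2*m+1. nexp (a j * times y B j f)) * (\<Prod>i<m. indicator {x i} (states y B i f)) \<partial>Q y) =
     ennreal (1 / (1 + a 0 * extend_infty \<gamma> y)) * (\<integral>\<^sup>+f. prodlap B m (\<lambda>i. a (i + 1)) x f \<partial>Q \<infinity>)"
    using initial_integral[of "a 0" "prodlap B m (\<lambda>i. a (i + 1)) x"] prodlap_meas[OF B] less_imp_le[OF a] by simp
  also have "(\<integral>\<^sup>+f. prodlap B m (\<lambda>i. a (i + 1)) x f \<partial>Q \<infinity>) = (\<Prod>i<m. \<psi> B (a (2 * i + 1)) (x i) * ennreal (hold_lap \<gamma> (a (2 * i + 2)) (x i)))"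
    using prodlap_integral[OF B, of "\<lambda>i. a (i + 1)" x m] a x by simp
  finally show ?thesis .
qed

lemma times_simps:
  "times y B 0 f = initial y f" "times y B (2 * i + 1) f = entry B (paths y B i f)"
  "times y B (2 * i + 2) f = hold B (paths y B i f)"
  by (simp_all add: times_def del: add_2_eq_Suc')

lemma sum_times:
  "(\<Sum>j<2*i+2. times y B j f) = (\<Sum>j<2*i+1. times y B j f) + entry B (paths y B i f)"
  "(\<Sum>j<2*i+3. times y B j f) = (\<Sum>j<2*i+2. times y B j f) + hold B (paths y B i f)"
proof -
  have "(\<Sum>j<Suc (2*i+1). times y B j f) = (\<Sum>j<2*i+1. times y B j f) + entry B (paths y B i f)"
    "(\<Sum>j<Suc (2*i+2). times y B j f) = (\<Sum>j<2*i+2. times y B j f) + hold B (paths y B i f)"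
    by (simp_all only: sum.lessThan_Suc times_simps)
  then show "(\<Sum>j<2*i+2. times y B j f) = (\<Sum>j<2*i+1. times y B j f) + entry B (paths y B i f)"
    "(\<Sum>j<2*i+3. times y B j f) = (\<Sum>j<2*i+2. times y B j f) + hold B (paths y B i f)"
    by (simp_all add: numeral_3_eq_3 del: sum.lessThan_Suc)
qed

text \<open>A statement about one path. \<open>E i\<close> is the end of the \<open>i\<close>-th
  cycle and \<open>A i\<close> the next arrival in \<open>B\<close>. The recorded visits are all
  visits once the times \<open>E i\<close> are unbounded. If they were bounded, the path would enter
  and leave states of the finite set \<open>B\<close> arbitrarily close to their limit, against the
  existence of left limits.\<close>

lemma skel_path:
  assumes f: "f \<in> space S" and finite_cycle: "\<And>i. finite_cycle B (paths y B i f)"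
    and init: "\<And>t. 0 \<le> t \<Longrightarrow> t < initial y f \<Longrightarrow> f t = y"
    and t: "0 \<le> t" and x: "x \<in> B"
  shows "f t = enat x \<longleftrightarrow> skel_at y UNIV (\<lambda>i. states y B i f) (\<lambda>j. times y B j f) t x"
proof -
  define E where "E i = (\<Sum>j<2*i+1. times y B j f)" for i
  define A where "A i = (\<Sum>j<2*i+2. times y B j f)" for i
  have E0: "E 0 = initial y f" by (simp add: E_def times_simps(1))
  have A_E: "A i = E i + entry B (paths y B i f)" for i
    unfolding A_def E_def by (rule sum_times(1))
  have E_A: "E (Suc i) = A i + hold B (paths y B i f)" for i
    unfolding A_def E_def using sum_times(2)[of f i] by (simp add: numeral_3_eq_3)
  have E3: "(\<Sum>j<2*i+3. times y B j f) = E (Suc i)" for i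
    unfolding E_def by (simp add: numeral_3_eq_3)
  have E_nn: "0 \<le> E i" for i
    unfolding E_def by (intro sum_nonneg times_nonneg)
  have E_le_A: "E i \<le> A i" for i using A_E by simp
  have A_le_E: "A i \<le> E (Suc i)" for i using E_A by simp
  have path: "paths y B i f = shift (E i) f" for i
  proof (induction i)
    case 0
    then show ?case by (simp add: paths_def E0)
  next
    case (Suc i)
    have "paths y B (Suc i) f = next_path B (paths y B i f)"
      by (simp add: paths_def)
    also have "\<dots> = shift (hold B (paths y B i f)) (shift (entry B (paths y B i f)) (shift (E i) f))"
      unfolding next_path_def Suc[symmetric] ..
    also have "\<dots> = shift (E (Suc i)) f"
      unfolding E_A A_E by (auto simp: shift_def fun_eq_iff restrict_def algebra_simps)
    finally show ?case .
  qed
  have pS: "shift (E i) f \<in> space S" for i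
    by (rule shift_regular_paths[OF f E_nn])
  have off: "f s \<notin> enat ` B" if "E i \<le> s" "s < A i" for i s
  proof -
    have "shift (E i) f (s - E i) \<notin> enat ` B"
      using that finite_cycle[of i] A_E[of i] unfolding path finite_cycle_def by (intro entry_before) auto
    then show ?thesis using that by simp
  qed
  have stB: "states y B i f \<in> B" and stA: "f (A i) = enat (states y B i f)" for i
  proof -
    have "shift (E i) f (entry B (shift (E i) f)) \<in> enat ` B"
      using finite_cycle[of i] pS unfolding path finite_cycle_def by (intro entry_in[OF B(1,3)]) auto
    moreover have "shift (E i) f (entry B (shift (E i) f)) = f (A i)"
      unfolding A_E path by simp
    moreover have "states y B i f = (case shift (E i) f (entry B (shift (E i) f)) of enat k \<Rightarrow> k | \<infinity> \<Rightarrow> 0)"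
      by (simp add: states_def entry_state_def path)
    ultimately show "states y B i f \<in> B" "f (A i) = enat (states y B i f)" by auto
  qed
  have shA: "shift (entry B (shift (E i) f)) (shift (E i) f) = shift (A i) f" for i
    unfolding A_E path by (auto simp: shift_def fun_eq_iff restrict_def algebra_simps)
  have hold_eq: "hold B (paths y B i f) = exit (states y B i f) (shift (A i) f)" for i
    using entry_state_pos[OF B, of "paths y B i f"] stB[of i] unfolding states_def path shA by simp
  have A_nn: "0 \<le> A i" for i using E_nn[of i] E_le_A[of i] by linarith
  have pA: "shift (A i) f \<in> space S" for i
    by (rule shift_regular_paths[OF f A_nn])
  have finA: "hit (Nbar - {enat (states y B i f)}) (shift (A i) f) < \<infinity>" for i
    using finite_cycle[of i] unfolding finite_cycle_def path shA states_def by simp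
  have on: "f s = enat (states y B i f)" if "A i \<le> s" "s < E (Suc i)" for i s
  proof -
    have "shift (A i) f (s - A i) = enat (states y B i f)"
      using that E_A[of i] hold_eq[of i] by (intro exit_stay[OF finA pA]) auto
    then show ?thesis using that by simp
  qed
  have leave: "f (E (Suc i)) \<noteq> enat (states y B i f)" for i
  proof -
    have "1 \<le> states y B i f" using stB[of i] B by auto
    then have "shift (A i) f (exit (states y B i f) (shift (A i) f)) \<noteq> enat (states y B i f)"
      by (rule exit_leave[OF _ finA pA])
    then show ?thesis by (simp add: E_A hold_eq)
  qed
  have strict: "A i < E (Suc i)" for i
    using leave[of i] stA[of i] A_le_E[of i] by (cases "A i = E (Suc i)") auto
  have E_mono: "E i < E (Suc i)" for i
    using E_le_A[of i] strict[of i] by linarith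
  then have smE: "strict_mono E" by (rule strict_mono_Suc_iff[THEN iffD2, OF allI])
  have unbdd: "\<exists>i. t < E i"
  proof (rule ccontr)
    assume "\<not> (\<exists>i. t < E i)"
    then have bd: "E i \<le> t" for i by (simp add: not_less)
    obtain L where L: "E \<longlonglongrightarrow> L"
      using incseq_convergent[OF strict_mono_mono[OF smE], of t] bd by blast
    have EL: "E i < L" for i
      using E_mono[of i] incseq_le[OF strict_mono_mono[OF smE] L, of "Suc i"] by linarith
    have L0: "0 < L" using EL[of 0] E_nn[of 0] by linarith
    have "\<forall>x\<in>B. \<exists>b. \<forall>\<^sub>F s in at_left L. (f s = enat x) = b"
      using f L0 B unfolding space_regular_paths regular_def by auto
    then obtain b where b: "\<forall>x\<in>B. \<forall>\<^sub>F s in at_left L. (f s = enat x) = b x"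
      by (rule bchoice[THEN exE])
    have "\<forall>\<^sub>F s in at_left L. \<forall>x\<in>B. (f s = enat x) = b x"
      using b by (intro eventually_ball_finite B)
    then obtain M where M: "M < L" "\<And>s. M < s \<Longrightarrow> s < L \<Longrightarrow> \<forall>x\<in>B. (f s = enat x) = b x"
      by (auto simp: eventually_at_left_field)
    obtain i where i: "M < E i"
      using order_tendstoD(1)[OF L M(1)] by (auto simp: eventually_sequentially)
    have "M < A i" "A i < L" "M < E (Suc i)" "E (Suc i) < L"
      using i E_le_A[of i] strict[of i] EL[of "Suc i"] by linarith+
    then have "(f (A i) = enat (states y B i f)) = (f (E (Suc i)) = enat (states y B i f))"
      using M(2)[of "A i"] M(2)[of "E (Suc i)"] stB[of i] by simp
    then show False using stA[of i] leave[of i] by simp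
  qed
  show ?thesis
  proof
    assume ft: "f t = enat x"
    show "skel_at y UNIV (\<lambda>i. states y B i f) (\<lambda>j. times y B j f) t x"
    proof (cases "t < E 0")
      case True
      then show ?thesis
        using init[OF t] ft unfolding skel_at_def E0 by (simp add: times_simps(1))
    next
      case False
      \<comment> \<open>The first cycle end beyond \<open>t\<close>; it singles out the cycle that
        contains \<open>t\<close>.\<close>
      define n where "n = (LEAST i. t < E i)"
      have n: "t < E n" unfolding n_def using unbdd by (rule LeastI_ex)
      then obtain i where i: "n = Suc i" using False by (cases n) auto
      have "E i \<le> t"
        using not_less_Least[of i "\<lambda>i. t < E i"] i unfolding n_def[symmetric] by (simp add: not_less)
      moreover have "A i \<le> t"
        using off[of i t] \<open>E i \<le> t\<close> ft x by (metis imageI not_less)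
      ultimately have "states y B i f = x" "A i \<le> t" "t < E (Suc i)"
        using on[of i t] n i ft by auto
      then show ?thesis
        unfolding skel_at_def E3 A_def[symmetric] by blast
    qed
  next
    assume "skel_at y UNIV (\<lambda>i. states y B i f) (\<lambda>j. times y B j f) t x"
    then show "f t = enat x"
      unfolding skel_at_def E3 A_def[symmetric] times_simps(1)
      using init[OF t] on by auto
  qed
qed

lemma skeleton_Q:
  assumes psi: "\<And>l k. 0 < l \<Longrightarrow> k \<in> B \<Longrightarrow> \<psi> B l k = ennreal (1 / exponent \<gamma> c B l)"
  shows "skeleton (Q y) y B (\<lambda>m a x. ennreal (1 / (1 + a 0 * extend_infty \<gamma> y)) *
      (\<Prod>i<m. ennreal (1 / exponent \<gamma> c B (a (2 * i + 1))) * ennreal (hold_lap \<gamma> (a (2 * i + 2)) (x i))))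
    (times y B) (states y B) (\<lambda>t f. f t)"
proof (intro skeleton.intro skeleton_axioms.intro prob_Q[OF y])
  have mQ: "measurable (Q y) N = measurable S N" for N :: "'b measure"
    by (rule measurable_Q[OF y])
  have mQ2: "measurable (Q y) N = measurable S N" for N :: "'c measure"
    by (rule measurable_Q[OF y])
  show "finite B" by (rule B)
  show "times y B i \<in> borel_measurable (Q y)" for i
    unfolding measurable_Q[OF y] by (rule times_meas)
  show "states y B i \<in> Q y \<rightarrow>\<^sub>M count_space UNIV" for i
    unfolding measurable_Q[OF y] by (rule states_meas)
  show "AE f in Q y. 0 \<le> times y B i f" for i
    by (simp add: times_nonneg)
  have finite_cycle: "AE f in Q y. \<forall>i. finite_cycle B (paths y B i f)"
    unfolding paths_def
  proof (rule AE_initial[OF _ finite_cycle_AE[OF B]])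
    have "Measurable.pred S (\<lambda>f. finite_cycle B ((next_path B ^^ i) f))" for i
      by (rule measurable_compose[OF next_path_pow_meas[OF B] finite_cycle_pred[OF B]])
    then show "Measurable.pred S (\<lambda>f. \<forall>i. finite_cycle B ((next_path B ^^ i) f))" by measurable
  qed
  have init: "AE f in Q y. \<forall>t. 0 \<le> t \<longrightarrow> t < initial y f \<longrightarrow> f t = y"
  proof (cases y)
    case (enat i)
    then have i: "1 \<le> i" using y by simp
    show ?thesis
      unfolding enat using exit_finite[OF i] AE_space[of "Q (enat i)"]
    proof eventually_elim
      case (elim f)
      then show ?case
        using exit_stay[OF elim(1)] i by (simp add: initial_def space_Q)
    qed
  qed (simp add: initial_def)
  have sp: "AE f in Q y. f \<in> space S"
    using AE_space[of "Q y"] by (simp add: space_Q[OF y])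
  show "AE f in Q y. \<forall>t\<ge>0. \<forall>x\<in>B. f t = enat x \<longleftrightarrow> skel_at y UNIV (\<lambda>i. states y B i f) (\<lambda>i. times y B i f) t x"
    using finite_cycle init sp
  proof eventually_elim
    case (elim f)
    show ?case
      by (intro allI impI ballI, rule skel_path) (use elim in auto)
  qed
  show "AE f in Q y. states y B i f \<in> B" for i
    using finite_cycle sp
  proof eventually_elim
    case (elim f)
    have "paths y B i f \<in> space S"
      using measurable_space[OF paths_meas elim(2)] .
    then have "paths y B i f (entry B (paths y B i f)) \<in> enat ` B"
      using elim(1) unfolding finite_cycle_def by (intro entry_in[OF B(1,3)]) auto
    then show ?case unfolding states_def entry_state_def by auto
  qed
  show "(\<lambda>f. f t) \<in> Q y \<rightarrow>\<^sub>M count_space Nbar" if "0 \<le> t" for t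
    unfolding measurable_Q[OF y] by (rule measurable_eval_const[OF that])
  show "(\<integral>\<^sup>+f. (\<Prod>i<dim m. nexp (a i * times y B i f)) * (\<Prod>i<m. indicator {x i} (states y B i f)) \<partial>Q y) =
      ennreal (1 / (1 + a 0 * extend_infty \<gamma> y)) *
      (\<Prod>i<m. ennreal (1 / exponent \<gamma> c B (a (2 * i + 1))) * ennreal (hold_lap \<gamma> (a (2 * i + 2)) (x i)))"
    if a: "\<And>i. 0 < a i" and x: "\<And>i. x i \<in> B" for m a x
    unfolding dim_def times_laplace[OF a x] using psi[OF a x] by simp
qed

end

end

section \<open>Event times and the clock\<close>

definition counting :: "(real \<Rightarrow> nat) \<Rightarrow> bool" where
  "counting n \<longleftrightarrow> n 0 = 0 \<and> mono_on {0..} n \<and> (\<forall>t\<ge>0. (n \<longlongrightarrow> n t) (at_right t))"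

definition evt :: "(real \<Rightarrow> nat) \<Rightarrow> nat \<Rightarrow> real" where
  "evt n j = Inf {u. 0 \<le> u \<and> j \<le> n u}"

text \<open>Tested at natural times only, which makes it a countable condition; by monotonicity
  nothing is lost. It guards \<open>evt\<close>, which otherwise is an infimum over the empty
  set.\<close>

definition reached :: "(real \<Rightarrow> nat) \<Rightarrow> nat \<Rightarrow> bool" where
  "reached n j \<longleftrightarrow> (\<exists>k::nat. j \<le> n (real k))"

lemma counting_mono: "counting n \<Longrightarrow> 0 \<le> s \<Longrightarrow> s \<le> t \<Longrightarrow> n s \<le> n t"
  unfolding counting_def by (elim conjE, rule mono_onD) auto

lemma counting_right:
  assumes n: "counting n" and t: "0 \<le> t"
  shows "\<forall>\<^sub>F s in at_right t. n s = n t"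
proof -
  have "(n \<longlongrightarrow> n t) (at_right t)"
    using n t unfolding counting_def by blast
  then have "\<forall>\<^sub>F s in at_right t. n s < n t + 1"
    by (rule order_tendstoD(2)) simp
  moreover have "\<forall>\<^sub>F s in at_right t. s \<in> {t<..}"
    by (auto simp: eventually_at_filter)
  ultimately show ?thesis
  proof eventually_elim
    case (elim s)
    then have "n t \<le> n s" by (intro counting_mono[OF n t]) simp
    then show ?case using elim by simp
  qed
qed

lemma reachedI:
  assumes n: "counting n" and u: "0 \<le> u" "j \<le> n u"
  shows "reached n j"
proof -
  have "u \<le> real (nat \<lceil>u\<rceil>)" by (rule real_nat_ceiling_ge)
  then have "n u \<le> n (real (nat \<lceil>u\<rceil>))" by (rule counting_mono[OF n u(1)])
  then show ?thesis unfolding reached_def using u(2) by (meson order_trans)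
qed

lemma evt_nonneg:
  assumes "reached n j" shows "0 \<le> evt n j"
  unfolding evt_def using assms unfolding reached_def
  by (intro cInf_greatest) (auto intro: of_nat_0_le_iff)

lemma evt_le:
  assumes "0 \<le> u" "j \<le> n u" shows "evt n j \<le> u"
  unfolding evt_def using assms by (intro cInf_lower bdd_belowI[of _ 0]) auto

lemma evt_before: "0 \<le> u \<Longrightarrow> u < evt n j \<Longrightarrow> n u < j"
  using evt_le[of u j n] by (meson not_less)

lemma evt_attained:
  assumes n: "counting n" and r: "reached n j"
  shows "j \<le> n (evt n j)"
proof (rule ccontr)
  assume "\<not> j \<le> n (evt n j)"
  have e0: "0 \<le> evt n j" by (rule evt_nonneg[OF r])
  obtain b where b: "evt n j < b" "\<And>s. evt n j < s \<Longrightarrow> s < b \<Longrightarrow> n s = n (evt n j)"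
    using counting_right[OF n e0] by (auto simp: eventually_at_right_field)
  have "b \<le> u" if u: "0 \<le> u" "j \<le> n u" for u
  proof (rule ccontr)
    assume "\<not> b \<le> u"
    moreover have "evt n j \<le> u" by (rule evt_le[of u j n, OF u])
    ultimately have "n u = n (evt n j)" using b(2)[of u] by (cases "u = evt n j") auto
    then show False using u \<open>\<not> j \<le> n (evt n j)\<close> by simp
  qed
  moreover have "{u. 0 \<le> u \<and> j \<le> n u} \<noteq> {}"
    using r of_nat_0_le_iff unfolding reached_def by blast
  ultimately have "b \<le> evt n j"
    unfolding evt_def by (intro cInf_greatest) auto
  then show False using b(1) by simp
qed

text \<open>Counts and event times form a Galois connection; measurability of event times and of
  counts at random times both rest on this equivalence.\<close>

lemma evt_le_iff:
  assumes n: "counting n" and t: "0 \<le> t"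
  shows "j \<le> n t \<longleftrightarrow> reached n j \<and> evt n j \<le> t"
proof
  assume "j \<le> n t"
  then show "reached n j \<and> evt n j \<le> t"
    using reachedI[OF n t] evt_le[OF t] by blast
next
  assume *: "reached n j \<and> evt n j \<le> t"
  then have "n (evt n j) \<le> n t"
    using evt_nonneg by (intro counting_mono[OF n]) auto
  then show "j \<le> n t" using evt_attained[OF n] * by (meson order_trans)
qed

lemma evt_pos:
  assumes n: "counting n" and r: "reached n j" and j: "1 \<le> j"
  shows "0 < evt n j"
proof (rule ccontr)
  assume "\<not> 0 < evt n j"
  then have "evt n j = 0" using evt_nonneg[OF r] by simp
  then show False using evt_attained[OF n r] j n by (simp add: counting_def)
qed

lemma is_event_time_iff:
  assumes n: "counting n"
  shows "is_event_time n j s \<longleftrightarrow> reached n j \<and> s = evt n j"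
proof
  assume *: "is_event_time n j s"
  then have s: "0 \<le> s" "j \<le> n s" "\<And>u. 0 \<le> u \<Longrightarrow> u < s \<Longrightarrow> n u < j"
    unfolding is_event_time_def by auto
  have r: "reached n j" by (rule reachedI[OF n s(1,2)])
  have "evt n j \<le> s" by (rule evt_le[of s j n, OF s(1,2)])
  moreover have "\<not> evt n j < s"
    using s(3)[OF evt_nonneg[OF r]] evt_attained[OF n r] by auto
  ultimately show "reached n j \<and> s = evt n j" using r by simp
next
  assume "reached n j \<and> s = evt n j"
  then show "is_event_time n j s"
    unfolding is_event_time_def using evt_nonneg evt_attained[OF n] evt_before by blast
qed

lemma reached_meas:
  assumes "\<And>t. 0 \<le> t \<Longrightarrow> N t \<in> M \<rightarrow>\<^sub>M count_space UNIV"
  shows "Measurable.pred M (\<lambda>\<omega>. reached (\<lambda>u. N u \<omega>) j)"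
proof -
  have [measurable]: "N (real k) \<in> M \<rightarrow>\<^sub>M count_space UNIV" for k by (rule assms) simp
  show ?thesis unfolding reached_def by measurable
qed

lemma evt_meas:
  assumes N: "\<And>t. 0 \<le> t \<Longrightarrow> N t \<in> M \<rightarrow>\<^sub>M count_space UNIV"
    and c: "\<And>\<omega>. \<omega> \<in> space M \<Longrightarrow> counting (\<lambda>u. N u \<omega>)"
  shows "(\<lambda>\<omega>. if reached (\<lambda>u. N u \<omega>) j then evt (\<lambda>u. N u \<omega>) j else 0) \<in> borel_measurable M"
proof (rule borel_measurableI_le)
  fix a :: real
  note [measurable] = reached_meas[of N, OF N]
  have "{\<omega> \<in> space M. (if reached (\<lambda>u. N u \<omega>) j then evt (\<lambda>u. N u \<omega>) j else 0) \<le> a} =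
    (if 0 \<le> a then {\<omega> \<in> space M. j \<le> N a \<omega> \<or> \<not> reached (\<lambda>u. N u \<omega>) j} else {})"
  proof (cases "0 \<le> a")
    case True
    then show ?thesis
      using evt_le_iff[OF c True] by auto
  next
    case False
    then show ?thesis
      using evt_nonneg by force
  qed
  also have "\<dots> \<in> sets M"
  proof (cases "0 \<le> a")
    case True
    then have [measurable]: "N a \<in> M \<rightarrow>\<^sub>M count_space UNIV" by (rule N)
    have "{\<omega> \<in> space M. j \<le> N a \<omega> \<or> \<not> reached (\<lambda>u. N u \<omega>) j} \<in> sets M" by measurable
    then show ?thesis using True by simp
  qed simp
  finally show "{\<omega> \<in> space M. (if reached (\<lambda>u. N u \<omega>) j then evt (\<lambda>u. N u \<omega>) j else 0) \<le> a} \<in> sets M" .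
qed

lemma counting_at_meas:
  assumes N: "\<And>t. 0 \<le> t \<Longrightarrow> N t \<in> M \<rightarrow>\<^sub>M count_space UNIV"
    and c: "\<And>\<omega>. \<omega> \<in> space M \<Longrightarrow> counting (\<lambda>u. N u \<omega>)"
    and T [measurable]: "\<tau> \<in> borel_measurable M" and T0: "\<And>\<omega>. \<omega> \<in> space M \<Longrightarrow> 0 \<le> \<tau> \<omega>"
  shows "(\<lambda>\<omega>. N (\<tau> \<omega>) \<omega>) \<in> M \<rightarrow>\<^sub>M count_space UNIV"
proof -
  note [measurable] = reached_meas[of N, OF N] evt_meas[of N, OF N c]
  have ge: "{\<omega> \<in> space M. j \<le> N (\<tau> \<omega>) \<omega>} \<in> sets M" for j
  proof -
    have "{\<omega> \<in> space M. j \<le> N (\<tau> \<omega>) \<omega>} =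
      {\<omega> \<in> space M. reached (\<lambda>u. N u \<omega>) j \<and> (if reached (\<lambda>u. N u \<omega>) j then evt (\<lambda>u. N u \<omega>) j else 0) \<le> \<tau> \<omega>}"
      using evt_le_iff[OF c T0] by auto
    also have "\<dots> \<in> sets M" by measurable
    finally show ?thesis .
  qed
  show ?thesis
    unfolding measurable_count_space_eq2_countable
  proof (intro conjI ballI)
    fix k :: nat
    have "(\<lambda>\<omega>. N (\<tau> \<omega>) \<omega>) -` {k} \<inter> space M = {\<omega> \<in> space M. k \<le> N (\<tau> \<omega>) \<omega>} - {\<omega> \<in> space M. Suc k \<le> N (\<tau> \<omega>) \<omega>}"
      by auto
    then show "(\<lambda>\<omega>. N (\<tau> \<omega>) \<omega>) -` {k} \<inter> space M \<in> sets M" using ge by simp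
  qed simp
qed

text \<open>For a monotone path the left limit is a supremum along one fixed sequence of times,
  which makes its measurability evident.\<close>

definition left_lim :: "(real \<Rightarrow> ennreal) \<Rightarrow> real \<Rightarrow> ennreal" where
  "left_lim \<Gamma> s = (SUP n. \<Gamma> (max 0 (s - 1 / real (Suc n))))"

lemma left_lim_tendsto:
  assumes mono: "\<And>s t. 0 \<le> s \<Longrightarrow> s \<le> t \<Longrightarrow> \<Gamma> s \<le> \<Gamma> t" and s: "0 < s"
  shows "(\<Gamma> \<longlongrightarrow> left_lim \<Gamma> s) (at_left s)"
proof (rule order_tendstoI)
  fix a assume "a < left_lim \<Gamma> s"
  then obtain n where n: "a < \<Gamma> (max 0 (s - 1 / real (Suc n)))"
    unfolding left_lim_def less_SUP_iff by blast
  define b where "b = max 0 (s - 1 / real (Suc n))"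
  have b: "0 \<le> b" "b < s" using s by (simp_all add: b_def)
  have "\<forall>\<^sub>F u in at_left s. u \<in> {b<..<s}"
    by (rule eventually_at_left_real[OF b(2)])
  then show "\<forall>\<^sub>F u in at_left s. a < \<Gamma> u"
  proof eventually_elim
    case (elim u)
    then have "\<Gamma> b \<le> \<Gamma> u" using b by (intro mono) auto
    then show ?case using n unfolding b_def by (rule less_le_trans[rotated])
  qed
next
  fix a assume a: "left_lim \<Gamma> s < a"
  have "\<forall>\<^sub>F u in at_left s. u \<in> {0<..<s}"
    by (rule eventually_at_left_real[OF s])
  then show "\<forall>\<^sub>F u in at_left s. \<Gamma> u < a"
  proof eventually_elim
    case (elim u)
    then have "0 < s - u" by simp
    then obtain n where "1 / real (Suc n) < s - u"
      using nat_approx_posE by blast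
    then have "\<Gamma> u \<le> \<Gamma> (max 0 (s - 1 / real (Suc n)))"
      using elim by (intro mono) auto
    also have "\<dots> \<le> left_lim \<Gamma> s"
      unfolding left_lim_def by (rule SUP_upper) simp
    finally show ?case using a by simp
  qed
qed

lemma Lim_left_lim:
  assumes "\<And>s t. 0 \<le> s \<Longrightarrow> s \<le> t \<Longrightarrow> \<Gamma> s \<le> \<Gamma> t" "0 < s"
  shows "Lim (at_left s) \<Gamma> = left_lim \<Gamma> s"
  by (rule tendsto_Lim[OF _ left_lim_tendsto]) (use assms in auto)

section \<open>Measurability of the clock and of the K-process\<close>

context K_inputs
begin

lemma N_meas: "1 \<le> x \<Longrightarrow> 0 \<le> t \<Longrightarrow> N x t \<in> M \<rightarrow>\<^sub>M count_space UNIV"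
  using N_poisson unfolding poisson_process_def by blast

lemma N_counting: "1 \<le> x \<Longrightarrow> \<omega> \<in> space M \<Longrightarrow> counting (\<lambda>u. N x u \<omega>)"
  using N_poisson unfolding poisson_process_def counting_def by blast

lemma T_meas: "1 \<le> x \<Longrightarrow> 1 \<le> i \<Longrightarrow> T x i \<in> borel_measurable M"
  using distributed_measurable[OF T_exponential[of "Some (x, i)"]] by (simp add: T_index_def T_family_def[abs_def] image_iff)

lemma T0_meas [measurable]: "T0 \<in> borel_measurable M"
  using distributed_measurable[OF T_exponential[of None]] by (simp add: T_index_def T_family_def[abs_def])

abbreviation incr :: "real \<Rightarrow> nat \<Rightarrow> nat \<Rightarrow> 'v \<Rightarrow> nat" where
  "incr h x j \<omega> \<equiv> N x (real (Suc j) * h) \<omega> - N x (real j * h) \<omega>"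

abbreviation clock :: "(nat \<Rightarrow> real) \<Rightarrow> real \<Rightarrow> enat \<Rightarrow> 'v \<Rightarrow> real \<Rightarrow> ennreal" where
  "clock \<gamma> c y \<equiv> K_clock \<gamma> c y N T0 T"

lemma clock_mono:
  assumes "0 \<le> c" "\<omega> \<in> space M" "0 \<le> s" "s \<le> t"
  shows "clock \<gamma> c y \<omega> s \<le> clock \<gamma> c y \<omega> t"
  unfolding K_clock_def
proof (intro add_mono order_refl suminf_le mult_left_mono sum_mono2 ennreal_leI)
  fix x
  show "{1..N (Suc x) s \<omega>} \<subseteq> {1..N (Suc x) t \<omega>}"
    using counting_mono[OF N_counting[of "Suc x" \<omega>] assms(3,4)] assms(2) by auto
qed (use assms in \<open>auto intro: mult_left_mono\<close>)

lemma clock_at_meas: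
  assumes [measurable]: "\<tau> \<in> borel_measurable M" and T0: "\<And>\<omega>. \<omega> \<in> space M \<Longrightarrow> 0 \<le> \<tau> \<omega>"
  shows "(\<lambda>\<omega>. clock \<gamma> c y \<omega> (\<tau> \<omega>)) \<in> borel_measurable M"
proof -
  have [measurable]: "(\<lambda>\<omega>. \<Sum>i=1..N (Suc x) (\<tau> \<omega>) \<omega>. ennreal (T (Suc x) i \<omega>)) \<in> borel_measurable M" for x
  proof (rule measurable_compose_countable[where g="\<lambda>\<omega>. N (Suc x) (\<tau> \<omega>) \<omega>"])
    show "(\<lambda>\<omega>. N (Suc x) (\<tau> \<omega>) \<omega>) \<in> M \<rightarrow>\<^sub>M count_space UNIV"
      by (rule counting_at_meas) (use N_meas N_counting T0 in auto)
    fix k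
    show "(\<lambda>\<omega>. \<Sum>i=1..k. ennreal (T (Suc x) i \<omega>)) \<in> borel_measurable M"
    proof (rule borel_measurable_sum)
      fix i assume "i \<in> {1..k}"
      then have [measurable]: "T (Suc x) i \<in> borel_measurable M" by (intro T_meas) auto
      show "(\<lambda>\<omega>. ennreal (T (Suc x) i \<omega>)) \<in> borel_measurable M" by measurable
    qed
  qed
  show ?thesis unfolding K_clock_def by measurable
qed

lemma left_clock_at_meas:
  assumes [measurable]: "\<tau> \<in> borel_measurable M"
  shows "(\<lambda>\<omega>. left_lim (clock \<gamma> c y \<omega>) (\<tau> \<omega>)) \<in> borel_measurable M"
  unfolding left_lim_def by (intro borel_measurable_SUP clock_at_meas) auto

lemma sits_iff:
  assumes c: "0 \<le> c" and \<omega>: "\<omega> \<in> space M" and x: "1 \<le> x"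
  shows "K_sits_at \<gamma> c y N T0 T t \<omega> x \<longleftrightarrow>
    (\<exists>j\<ge>1. reached (\<lambda>u. N x u \<omega>) j \<and> left_lim (clock \<gamma> c y \<omega>) (evt (\<lambda>u. N x u \<omega>) j) \<le> ennreal t \<and>
       ennreal t < clock \<gamma> c y \<omega> (evt (\<lambda>u. N x u \<omega>) j))"
proof -
  note n = N_counting[OF x \<omega>]
  have L: "Lim (at_left (evt (\<lambda>u. N x u \<omega>) j)) (clock \<gamma> c y \<omega>) = left_lim (clock \<gamma> c y \<omega>) (evt (\<lambda>u. N x u \<omega>) j)"
    if "1 \<le> j" "reached (\<lambda>u. N x u \<omega>) j" for j
    by (rule Lim_left_lim[OF clock_mono[OF c \<omega>] evt_pos[OF n that(2,1)]])
  show ?thesis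
    unfolding K_sits_at_def is_event_time_iff[OF n] using x L by auto
qed

lemma sits_meas:
  assumes c: "0 \<le> c"
  shows "Measurable.pred M (\<lambda>\<omega>. K_sits_at \<gamma> c y N T0 T t \<omega> x)"
proof (cases "1 \<le> x")
  case True
  let ?e = "\<lambda>j \<omega>. if reached (\<lambda>u. N x u \<omega>) j then evt (\<lambda>u. N x u \<omega>) j else 0"
  note [measurable] = reached_meas[of "N x" M, OF N_meas[OF True]]
  have e [measurable]: "?e j \<in> borel_measurable M" for j
    by (rule evt_meas) (use N_meas N_counting True in auto)
  have [measurable]: "(\<lambda>\<omega>. clock \<gamma> c y \<omega> (?e j \<omega>)) \<in> borel_measurable M"
      "(\<lambda>\<omega>. left_lim (clock \<gamma> c y \<omega>) (?e j \<omega>)) \<in> borel_measurable M" for j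
    using evt_nonneg by (intro clock_at_meas left_clock_at_meas; auto)+
  have meas: "Measurable.pred M (\<lambda>\<omega>. \<exists>j. 1 \<le> j \<and> reached (\<lambda>u. N x u \<omega>) j \<and> left_lim (clock \<gamma> c y \<omega>) (?e j \<omega>) \<le> ennreal t \<and>
       ennreal t < clock \<gamma> c y \<omega> (?e j \<omega>))" by measurable
  have eq: "K_sits_at \<gamma> c y N T0 T t \<omega> x \<longleftrightarrow> (\<exists>j. 1 \<le> j \<and> reached (\<lambda>u. N x u \<omega>) j \<and> left_lim (clock \<gamma> c y \<omega>) (?e j \<omega>) \<le> ennreal t \<and>
       ennreal t < clock \<gamma> c y \<omega> (?e j \<omega>))" if "\<omega> \<in> space M" for \<omega>
    unfolding sits_iff[OF c that True] by auto
  show ?thesis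
    by (rule measurable_cong[THEN iffD2, OF eq meas])
next
  case False
  then show ?thesis by (simp add: K_sits_at_def)
qed

lemma K_process_meas:
  assumes c: "0 \<le> c" and y: "y \<in> Nbar"
  shows "K_process \<gamma> c y N T0 T t \<in> M \<rightarrow>\<^sub>M count_space Nbar"
proof -
  note [measurable] = sits_meas[OF c]
  have "K_process \<gamma> c y N T0 T t \<in> M \<rightarrow>\<^sub>M count_space UNIV"
    unfolding K_process_def[abs_def] by measurable
  moreover have "K_process \<gamma> c y N T0 T t \<omega> \<in> Nbar" for \<omega>
  proof -
    have "1 \<le> (LEAST x. K_sits_at \<gamma> c y N T0 T t \<omega> x)" if "\<exists>x. K_sits_at \<gamma> c y N T0 T t \<omega> x"
      using LeastI_ex[OF that] by (simp add: K_sits_at_def)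
    then show ?thesis using y by (auto simp: K_process_def)
  qed
  ultimately show ?thesis
    unfolding measurable_count_space_eq2_countable by auto
qed

end

section \<open>The driving variables on a time grid\<close>

text \<open>The generating function of the Poisson distribution and its single terms: a cell either
  leaves its number of events free or prescribes it.\<close>

lemma nn_integral_poisson_power:
  assumes h: "0 < h" and g: "0 \<le> g"
  shows "(\<integral>\<^sup>+n. ennreal g ^ n \<partial>measure_pmf (poisson_pmf h)) = nexp (h * (1 - g))"
    "(\<integral>\<^sup>+n. of_bool (n = m) * ennreal g ^ n \<partial>measure_pmf (poisson_pmf h)) = ennreal (h ^ m / fact m * exp (- h) * g ^ m)"
proof -
  have "(\<lambda>n. (h * g) ^ n /\<^sub>R fact n) sums exp (h * g)"
    by (rule exp_converges)
  then have "(\<lambda>n. exp (- h) * ((h * g) ^ n /\<^sub>R fact n)) sums (exp (- h) * exp (h * g))"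
    by (rule sums_mult)
  then have s: "(\<lambda>n. pmf (poisson_pmf h) n * g ^ n) sums (exp (- h) * exp (h * g))"
    using h by (simp add: pmf_poisson power_mult_distrib divide_inverse mult_ac)
  have "(\<integral>\<^sup>+n. ennreal g ^ n \<partial>measure_pmf (poisson_pmf h)) = (\<Sum>n. ennreal (pmf (poisson_pmf h) n * g ^ n))"
    using g by (simp add: nn_integral_measure_pmf nn_integral_count_space_nat ennreal_mult'' ennreal_power)
  also have "\<dots> = ennreal (exp (- h) * exp (h * g))"
    using s g by (subst suminf_ennreal2) (auto simp: sums_iff)
  also have "exp (- h) * exp (h * g) = exp (- (h * (1 - g)))"
    unfolding mult_exp_exp by (simp add: right_diff_distrib)
  finally show "(\<integral>\<^sup>+n. ennreal g ^ n \<partial>measure_pmf (poisson_pmf h)) = nexp (h * (1 - g))" .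
  have "(\<integral>\<^sup>+n. of_bool (n = m) * ennreal g ^ n \<partial>measure_pmf (poisson_pmf h)) =
      (\<integral>\<^sup>+n. ennreal g ^ m * indicator {m} n \<partial>measure_pmf (poisson_pmf h))"
    by (intro nn_integral_cong) (auto split: split_indicator)
  also have "\<dots> = ennreal g ^ m * ennreal (pmf (poisson_pmf h) m)"
    by (simp add: emeasure_pmf_single)
  also have "\<dots> = ennreal (h ^ m / fact m * exp (- h) * g ^ m)"
    using h g by (simp add: pmf_poisson ennreal_power ennreal_mult''[symmetric] mult_ac)
  finally show "(\<integral>\<^sup>+n. of_bool (n = m) * ennreal g ^ n \<partial>measure_pmf (poisson_pmf h)) = ennreal (h ^ m / fact m * exp (- h) * g ^ m)" .
qed

context K_inputs
begin

lemma T_nonneg: "AE \<omega> in M. 0 \<le> T0 \<omega> \<and> (\<forall>x\<ge>1. \<forall>i\<ge>1. 0 \<le> T x i \<omega>)"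
proof -
  have *: "AE \<omega> in M. 0 \<le> T_family T0 T k \<omega>" if k: "k \<in> T_index" for k
  proof -
    have [measurable]: "T_family T0 T k \<in> borel_measurable M"
      using distributed_measurable[OF T_exponential[OF k]] by simp
    have "AE x in distr M lborel (T_family T0 T k). 0 \<le> x"
      unfolding distributed_distr_eq_density[OF T_exponential[OF k]]
      by (subst AE_density) (auto simp: exponential_density_def)
    then show ?thesis by (subst (asm) AE_distr_iff) auto
  qed
  have "AE \<omega> in M. \<forall>k\<in>T_index. 0 \<le> T_family T0 T k \<omega>"
    using * by (subst AE_ball_countable) auto
  then show ?thesis
  proof eventually_elim
    case (elim \<omega>)
    have "0 \<le> T0 \<omega>"
      using bspec[OF elim, of None] by (simp add: T_index_def T_family_def)
    moreover have "0 \<le> T x i \<omega>" if "1 \<le> x" "1 \<le> i" for x i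
      using bspec[OF elim, of "Some (x, i)"] that by (simp add: T_index_def T_family_def)
    ultimately show ?case by blast
  qed
qed

lemma T_laplace:
  assumes k: "k \<in> T_index" and a: "0 \<le> a"
  shows "(\<integral>\<^sup>+\<omega>. nexp (a * T_family T0 T k \<omega>) \<partial>M) = ennreal (1 / (1 + a))"
  using distributed_nn_integral[OF T_exponential[OF k], of "\<lambda>x. nexp (a * x)"]
    nn_integral_exponential_laplace[of 1 a] a by simp

text \<open>The blocks of one type are disjoint, so each exponential variable occurs at most once
  and independence turns the mean into a product.\<close>

lemma T_blocks_laplace:
  fixes S :: "nat \<Rightarrow> nat \<Rightarrow> nat"
  assumes S: "\<And>x. mono (S x)" and a: "\<And>x j. 0 \<le> a x j" and b: "0 \<le> b"
  shows "(\<integral>\<^sup>+\<omega>. nexp (b * T0 \<omega>) * (\<Prod>x\<in>{1..L}. \<Prod>j<J. \<Prod>i\<in>{S x j<..S x (Suc j)}. nexp (a x j * T x i \<omega>)) \<partial>M) =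
    ennreal (1 / (1 + b)) * (\<Prod>x\<in>{1..L}. \<Prod>j<J. ennreal (1 / (1 + a x j)) ^ (S x (Suc j) - S x j))"
proof -
  define Tr where "Tr = (SIGMA x:{1..L}. SIGMA j:{..<J}. {S x j<..S x (Suc j)})"
  define \<phi> :: "nat \<times> nat \<times> nat \<Rightarrow> (nat \<times> nat) option" where "\<phi> p = Some (fst p, snd (snd p))" for p
  \<comment> \<open>The coefficient belongs to the block \<open>j\<close>, which the index of a
    variable does not show; it is recovered by inverting \<open>\<phi>\<close> on
    \<open>Tr\<close>.\<close>
  define coef where "coef k = (case k of None \<Rightarrow> b | Some _ \<Rightarrow> (let p = inv_into Tr \<phi> k in a (fst p) (fst (snd p))))" for k
  have finTr: "finite Tr" unfolding Tr_def by (intro finite_SigmaI) auto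
  have inj: "inj_on \<phi> Tr"
  proof (rule inj_onI)
    fix p q assume pq: "p \<in> Tr" "q \<in> Tr" "\<phi> p = \<phi> q"
    obtain x j i x' j' i' where pe: "p = (x, j, i)" "q = (x', j', i')" by (cases p; cases q) auto
    have e: "x' = x" "i' = i" using pq(3) unfolding pe \<phi>_def by auto
    have i: "S x j < i" "i \<le> S x (Suc j)" "S x j' < i" "i \<le> S x (Suc j')"
      using pq(1,2) unfolding pe Tr_def e by auto
    have "\<not> Suc j \<le> j'" "\<not> Suc j' \<le> j"
      using i monoD[OF S[of x], of "Suc j" j'] monoD[OF S[of x], of "Suc j'" j] by linarith+
    then show "p = q" unfolding pe e by simp
  qed
  have coef_Some: "coef (\<phi> (x, j, i)) = a x j" if "(x, j, i) \<in> Tr" for x j i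
    using inv_into_f_f[OF inj that] by (simp add: coef_def \<phi>_def Let_def)
  have coef0: "0 \<le> coef k" for k
    using a b by (auto simp: coef_def Let_def split: option.split)
  define I where "I = insert None (\<phi> ` Tr)"
  have I: "finite I" "I \<subseteq> T_index"
    using finTr unfolding I_def T_index_def by (auto simp: \<phi>_def Tr_def)
  have None: "None \<notin> \<phi> ` Tr" by (auto simp: \<phi>_def)
  have prods: "(\<Prod>k\<in>I. G k) = G None * (\<Prod>x\<in>{1..L}. \<Prod>j<J. \<Prod>i\<in>{S x j<..S x (Suc j)}. G (\<phi> (x, j, i)))"
    for G :: "(nat \<times> nat) option \<Rightarrow> ennreal"
  proof -
    have "(\<Prod>k\<in>I. G k) = G None * (\<Prod>k\<in>\<phi> ` Tr. G k)"
      unfolding I_def using finTr None by simp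
    also have "(\<Prod>k\<in>\<phi> ` Tr. G k) = (\<Prod>p\<in>Tr. G (\<phi> p))"
      using inj by (simp add: prod.reindex)
    also have "\<dots> = (\<Prod>x\<in>{1..L}. \<Prod>j<J. \<Prod>i\<in>{S x j<..S x (Suc j)}. G (\<phi> (x, j, i)))"
      unfolding Tr_def by (simp add: prod.Sigma case_prod_beta)
    finally show ?thesis .
  qed
  have TrI: "(x, j, i) \<in> Tr" if "x \<in> {1..L}" "j < J" "i \<in> {S x j<..S x (Suc j)}" for x j i
    using that unfolding Tr_def by auto
  have "(\<integral>\<^sup>+\<omega>. nexp (b * T0 \<omega>) * (\<Prod>x\<in>{1..L}. \<Prod>j<J. \<Prod>i\<in>{S x j<..S x (Suc j)}. nexp (a x j * T x i \<omega>)) \<partial>M) =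
     (\<integral>\<^sup>+\<omega>. (\<Prod>k\<in>I. nexp (coef k * T_family T0 T k \<omega>)) \<partial>M)"
  proof (rule nn_integral_cong)
    fix \<omega>
    show "nexp (b * T0 \<omega>) * (\<Prod>x\<in>{1..L}. \<Prod>j<J. \<Prod>i\<in>{S x j<..S x (Suc j)}. nexp (a x j * T x i \<omega>)) =
       (\<Prod>k\<in>I. nexp (coef k * T_family T0 T k \<omega>))"
      unfolding prods
    proof (intro arg_cong2[where f="(*)"] prod.cong refl)
      show "nexp (b * T0 \<omega>) = nexp (coef None * T_family T0 T None \<omega>)"
        by (simp add: coef_def T_family_def)
      fix x j i assume "x \<in> {1..L}" "j \<in> {..<J}" "i \<in> {S x j<..S x (Suc j)}"
      then show "nexp (a x j * T x i \<omega>) = nexp (coef (\<phi> (x, j, i)) * T_family T0 T (\<phi> (x, j, i)) \<omega>)"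
        using coef_Some[OF TrI] by (simp add: T_family_def \<phi>_def)
    qed
  qed
  also have "\<dots> = (\<Prod>k\<in>I. \<integral>\<^sup>+\<omega>. nexp (coef k * T_family T0 T k \<omega>) \<partial>M)"
  proof (rule indep_vars_nn_integral[OF I(1)])
    show "indep_vars (\<lambda>_. borel) (\<lambda>k \<omega>. nexp (coef k * T_family T0 T k \<omega>)) I"
      by (rule indep_vars_compose2[OF indep_vars_subset[OF T_indep I(2)]]) measurable
  qed simp
  also have "\<dots> = (\<Prod>k\<in>I. ennreal (1 / (1 + coef k)))"
    using I(2) coef0 by (intro prod.cong refl T_laplace) auto
  also have "\<dots> = ennreal (1 / (1 + b)) * (\<Prod>x\<in>{1..L}. \<Prod>j<J. ennreal (1 / (1 + a x j)) ^ (S x (Suc j) - S x j))"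
    unfolding prods
  proof (intro arg_cong2[where f="(*)"] prod.cong refl)
    show "ennreal (1 / (1 + coef None)) = ennreal (1 / (1 + b))" by (simp add: coef_def)
    fix x j assume xj: "x \<in> {1..L}" "j \<in> {..<J}"
    have "(\<Prod>i\<in>{S x j<..S x (Suc j)}. ennreal (1 / (1 + coef (\<phi> (x, j, i))))) = (\<Prod>i\<in>{S x j<..S x (Suc j)}. ennreal (1 / (1 + a x j)))"
      using xj by (intro prod.cong refl) (simp add: coef_Some[OF TrI])
    then show "(\<Prod>i\<in>{S x j<..S x (Suc j)}. ennreal (1 / (1 + coef (\<phi> (x, j, i))))) = ennreal (1 / (1 + a x j)) ^ (S x (Suc j) - S x j)"
      by simp
  qed
  finally show ?thesis .
qed

text \<open>Independence enters twice: between the types, and between the disjoint cells of one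
  type.\<close>

lemma N_increments:
  assumes h: "0 < h"
  shows "(\<integral>\<^sup>+\<omega>. (\<Prod>x\<in>{1..L}. \<Prod>j<J. F x j (incr h x j \<omega>)) \<partial>M) =
    (\<Prod>x\<in>{1..L}. \<Prod>j<J. \<integral>\<^sup>+n. F x j n \<partial>measure_pmf (poisson_pmf h))"
proof -
  have ind: "indep_vars (\<lambda>_. borel) (\<lambda>x \<omega>. \<Prod>j<J. F x j (incr h x j \<omega>)) {1..L}"
  proof -
    define H :: "nat \<Rightarrow> (real \<Rightarrow> nat) \<Rightarrow> ennreal" where "H x n = (\<Prod>j<J. F x j (n (real (Suc j) * h) - n (real j * h)))" for x n
    have "indep_vars (\<lambda>_. borel) (\<lambda>x \<omega>. H x (\<lambda>t\<in>{0..}. N x t \<omega>)) {1..L}"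
    proof (rule indep_vars_compose2[OF indep_vars_subset[OF N_indep]])
      fix x
      show "H x \<in> borel_measurable (Pi\<^sub>M {0..} (\<lambda>_. count_space UNIV))"
        unfolding H_def[abs_def]
      proof (rule borel_measurable_prod_ennreal)
        fix j
        have [measurable]: "(\<lambda>n. n (real (Suc j) * h)) \<in> Pi\<^sub>M {0..} (\<lambda>_. count_space (UNIV :: nat set)) \<rightarrow>\<^sub>M count_space UNIV"
          "(\<lambda>n. n (real j * h)) \<in> Pi\<^sub>M {0..} (\<lambda>_. count_space (UNIV :: nat set)) \<rightarrow>\<^sub>M count_space UNIV"
          using h by (intro measurable_component_singleton; simp)+
        show "(\<lambda>n. F x j (n (real (Suc j) * h) - n (real j * h))) \<in> borel_measurable (Pi\<^sub>M {0..} (\<lambda>_. count_space UNIV))"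
          by measurable
      qed
    qed auto
    then show ?thesis
      using h by (simp add: H_def)
  qed
  have each: "(\<integral>\<^sup>+\<omega>. (\<Prod>j<J. F x j (incr h x j \<omega>)) \<partial>M) =
      (\<Prod>j<J. \<integral>\<^sup>+n. F x j n \<partial>measure_pmf (poisson_pmf h))" if x: "1 \<le> x" for x
  proof -
    have P: "poisson_process 1 (N x)" by (rule N_poisson[OF x])
    have iv: "indep_vars (\<lambda>_. count_space UNIV) (\<lambda>i \<omega>. incr h x i \<omega>) {..<J}"
    proof -
      have "mono (\<lambda>i. real i * h)" using h by (intro monoI mult_right_mono) auto
      then have "0 \<le> (\<lambda>i. real i * h) 0 \<and> mono (\<lambda>i. real i * h)" by simp
      then show ?thesis
        using P unfolding poisson_process_def by (elim conjE) (drule spec[of _ J], drule spec[of _ "\<lambda>i. real i * h"], blast)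
    qed
    have "(\<integral>\<^sup>+\<omega>. (\<Prod>j<J. F x j (incr h x j \<omega>)) \<partial>M) =
        (\<Prod>j<J. \<integral>\<^sup>+\<omega>. F x j (incr h x j \<omega>) \<partial>M)"
      by (rule indep_vars_nn_integral[OF _ indep_vars_compose2[OF iv]]) auto
    also have "\<dots> = (\<Prod>j<J. \<integral>\<^sup>+n. F x j n \<partial>measure_pmf (poisson_pmf h))"
    proof (rule prod.cong[OF refl])
      fix j
      have d: "distr M (count_space UNIV) (\<lambda>\<omega>. incr h x j \<omega>) = measure_pmf (poisson_pmf h)"
      proof -
        have "0 \<le> real j * h \<and> real j * h < real (Suc j) * h" using h by simp
        then have "distr M (count_space UNIV) (\<lambda>\<omega>. incr h x j \<omega>) =
           measure_pmf (poisson_pmf (1 * (real (Suc j) * h - real j * h)))"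
          using P unfolding poisson_process_def by blast
        also have "1 * (real (Suc j) * h - real j * h) = h" by (simp add: algebra_simps)
        finally show ?thesis .
      qed
      have [measurable]: "N x (real (Suc j) * h) \<in> M \<rightarrow>\<^sub>M count_space UNIV" "N x (real j * h) \<in> M \<rightarrow>\<^sub>M count_space UNIV"
        using h x by (intro N_meas; simp)+
      show "(\<integral>\<^sup>+\<omega>. F x j (incr h x j \<omega>) \<partial>M) = (\<integral>\<^sup>+n. F x j n \<partial>measure_pmf (poisson_pmf h))"
        unfolding d[symmetric] by (subst nn_integral_distr) (auto simp del: of_nat_Suc)
    qed
    finally show ?thesis .
  qed
  have "(\<integral>\<^sup>+\<omega>. (\<Prod>x\<in>{1..L}. \<Prod>j<J. F x j (incr h x j \<omega>)) \<partial>M) =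
     (\<Prod>x\<in>{1..L}. \<integral>\<^sup>+\<omega>. (\<Prod>j<J. F x j (incr h x j \<omega>)) \<partial>M)"
    by (rule indep_vars_nn_integral[OF _ ind]) auto
  then show ?thesis using each by simp
qed

text \<open>Along the grid of mesh \<open>h\<close> the increments of all the Poisson processes are independent and, given these,
  so are the blocks of exponential variables consumed in the cells.\<close>

lemma cells_finite:
  fixes ch :: "nat \<Rightarrow> nat \<Rightarrow> nat \<Rightarrow> ennreal"
  assumes h: "0 < h" and a: "\<And>x j. 0 \<le> a x j" and b: "0 \<le> b"
  shows "(\<integral>\<^sup>+\<omega>. nexp (b * T0 \<omega>) * (\<Prod>x\<in>{1..L}. \<Prod>j<J.
      ch x j (incr h x j \<omega>) *
      (\<Prod>i\<in>{N x (real j * h) \<omega> <..N x (real (Suc j) * h) \<omega>}. nexp (a x j * T x i \<omega>))) \<partial>M) =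
    ennreal (1 / (1 + b)) * (\<Prod>x\<in>{1..L}. \<Prod>j<J. \<integral>\<^sup>+n. ch x j n * ennreal (1 / (1 + a x j)) ^ n \<partial>measure_pmf (poisson_pmf h))"
proof -
  define K where "K = {1..L} \<times> {..J}"
  define PN :: "(nat \<times> real \<Rightarrow> nat) measure" where "PN = Pi\<^sub>M ({1..} \<times> {0..}) (\<lambda>_. count_space (UNIV :: nat set))"
  define X0 where "X0 \<omega> = (\<lambda>(x, t)\<in>{1..} \<times> {0..}. N x t \<omega>)" for \<omega>
  define X where "X \<omega> = (\<lambda>(x, j)\<in>K. N x (real j * h) \<omega>)" for \<omega>
  define Y where "Y \<omega> = (\<lambda>k\<in>T_index. T_family T0 T k \<omega>)" for \<omega>
  define PK where "PK = Pi\<^sub>M K (\<lambda>_. count_space (UNIV :: nat set))"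
  define PT where "PT = Pi\<^sub>M T_index (\<lambda>_. borel :: real measure)"
  have X0m: "X0 \<in> M \<rightarrow>\<^sub>M PN"
    unfolding PN_def X0_def[abs_def] case_prod_beta
    by (rule measurable_restrict) (auto intro: N_meas)
  have Ym: "Y \<in> M \<rightarrow>\<^sub>M PT"
    unfolding PT_def Y_def[abs_def] using distributed_measurable[OF T_exponential] by (intro measurable_restrict) simp
  define \<phi> :: "(nat \<times> real \<Rightarrow> nat) \<Rightarrow> nat \<times> nat \<Rightarrow> nat" where "\<phi> u = (\<lambda>(x, j)\<in>K. u (x, real j * h))" for u
  have \<phi>m: "\<phi> \<in> PN \<rightarrow>\<^sub>M PK"
    unfolding PN_def PK_def \<phi>_def[abs_def] case_prod_beta
    using h by (intro measurable_restrict measurable_component_singleton) (auto simp: K_def)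
  have X\<phi>: "X \<omega> = \<phi> (X0 \<omega>)" for \<omega>
    using h by (auto simp: fun_eq_iff X_def X0_def \<phi>_def K_def restrict_def)
  have Xm: "X \<in> M \<rightarrow>\<^sub>M PK"
    using measurable_compose[OF X0m \<phi>m] unfolding X\<phi>[symmetric] .
  interpret PX: prob_space "distr M PK X" by (rule prob_space_distr[OF Xm])
  interpret PY: prob_space "distr M PT Y" by (rule prob_space_distr[OF Ym])
  \<comment> \<open>Independence restated as a product law, so that Fubini applies. Only finitely
    many grid values of the Poisson processes enter, hence \<open>X\<close> in place of
    \<open>X0\<close>.\<close>
  have prod: "distr M PK X \<Otimes>\<^sub>M distr M PT Y = distr M (PK \<Otimes>\<^sub>M PT) (\<lambda>\<omega>. (X \<omega>, Y \<omega>))"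
  proof (rule pair_measure_eqI)
    show "sigma_finite_measure (distr M PK X)" "sigma_finite_measure (distr M PT Y)"
      by unfold_locales
    show "sets (distr M PK X \<Otimes>\<^sub>M distr M PT Y) = sets (distr M (PK \<Otimes>\<^sub>M PT) (\<lambda>\<omega>. (X \<omega>, Y \<omega>)))"
      by (simp cong: sets_pair_measure_cong)
    fix A B assume "A \<in> sets (distr M PK X)" "B \<in> sets (distr M PT Y)"
    then have A: "A \<in> sets PK" and B: "B \<in> sets PT" by simp_all
    have "X -` A \<inter> space M = X0 -` (\<phi> -` A \<inter> space PN) \<inter> space M"
      using measurable_space[OF X0m] by (auto simp: X\<phi>)
    moreover have "\<phi> -` A \<inter> space PN \<in> sets PN"
      using \<phi>m A by (rule measurable_sets)
    ultimately have "X -` A \<inter> space M \<in> sets (vimage_algebra (space M) X0 PN)"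
      by (simp only: in_vimage_algebra)
    moreover have "Y -` B \<inter> space M \<in> sets (vimage_algebra (space M) Y PT)"
      using B by (rule in_vimage_algebra)
    moreover have "indep_set (sets (vimage_algebra (space M) X0 PN)) (sets (vimage_algebra (space M) Y PT))"
      using N_T_indep unfolding PN_def PT_def X0_def[abs_def] Y_def[abs_def] .
    ultimately have "prob ((X -` A \<inter> space M) \<inter> (Y -` B \<inter> space M)) = prob (X -` A \<inter> space M) * prob (Y -` B \<inter> space M)"
      by (intro indep_setD)
    then have *: "emeasure M ((X -` A \<inter> space M) \<inter> (Y -` B \<inter> space M)) = emeasure M (X -` A \<inter> space M) * emeasure M (Y -` B \<inter> space M)"
      by (simp add: emeasure_eq_measure ennreal_mult'')
    have "emeasure (distr M (PK \<Otimes>\<^sub>M PT) (\<lambda>\<omega>. (X \<omega>, Y \<omega>))) (A \<times> B) = emeasure M ((\<lambda>\<omega>. (X \<omega>, Y \<omega>)) -` (A \<times> B) \<inter> space M)"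
      using Xm Ym A B by (intro emeasure_distr) auto
    also have "(\<lambda>\<omega>. (X \<omega>, Y \<omega>)) -` (A \<times> B) \<inter> space M = (X -` A \<inter> space M) \<inter> (Y -` B \<inter> space M)" by auto
    finally show "emeasure (distr M PK X) A * emeasure (distr M PT Y) B = emeasure (distr M (PK \<Otimes>\<^sub>M PT) (\<lambda>\<omega>. (X \<omega>, Y \<omega>))) (A \<times> B)"
      using * by (simp add: emeasure_distr Xm Ym A B)
  qed
  define H :: "(nat \<times> nat \<Rightarrow> nat) \<times> ((nat \<times> nat) option \<Rightarrow> real) \<Rightarrow> ennreal" where
    "H p = nexp (b * snd p None) * (\<Prod>x\<in>{1..L}. \<Prod>j<J. ch x j (fst p (x, Suc j) - fst p (x, j)) *
      (\<Prod>i\<in>{fst p (x, j)<..fst p (x, Suc j)}. nexp (a x j * snd p (Some (x, i)))))" for p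
  have H [measurable]: "H \<in> borel_measurable (PK \<Otimes>\<^sub>M PT)"
    unfolding H_def[abs_def]
  proof (intro borel_measurable_times_ennreal borel_measurable_prod_ennreal)
    have sndm: "(\<lambda>p. snd p k) \<in> borel_measurable (PK \<Otimes>\<^sub>M PT)" if "k \<in> T_index" for k
      using that unfolding PT_def by (intro measurable_compose[OF measurable_snd] measurable_component_singleton)
    have fstm: "(\<lambda>p. fst p k) \<in> PK \<Otimes>\<^sub>M PT \<rightarrow>\<^sub>M count_space UNIV" if "k \<in> K" for k
      using that unfolding PK_def by (intro measurable_compose[OF measurable_fst] measurable_component_singleton)
    have [measurable]: "(\<lambda>p. snd p None) \<in> borel_measurable (PK \<Otimes>\<^sub>M PT)"
      by (rule sndm) (simp add: T_index_def)
    show "(\<lambda>p. nexp (b * snd p None)) \<in> borel_measurable (PK \<Otimes>\<^sub>M PT)" by measurable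
    fix x j assume x: "x \<in> {1..L}" and j: "j \<in> {..<J}"
    have [measurable]: "(\<lambda>p. fst p (x, j)) \<in> PK \<Otimes>\<^sub>M PT \<rightarrow>\<^sub>M count_space UNIV" "(\<lambda>p. fst p (x, Suc j)) \<in> PK \<Otimes>\<^sub>M PT \<rightarrow>\<^sub>M count_space UNIV"
      using x j by (intro fstm; simp add: K_def)+
    show "(\<lambda>p. ch x j (fst p (x, Suc j) - fst p (x, j))) \<in> borel_measurable (PK \<Otimes>\<^sub>M PT)" by measurable
    have "(\<lambda>p. (\<lambda>q. \<Prod>i\<in>{fst q<..snd q}. nexp (a x j * snd p (Some (x, i)))) (fst p (x, j), fst p (x, Suc j))) \<in> borel_measurable (PK \<Otimes>\<^sub>M PT)"
    proof (rule measurable_compose_countable[where g="\<lambda>p. (fst p (x, j), fst p (x, Suc j))"])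
      show "(\<lambda>p. (fst p (x, j), fst p (x, Suc j))) \<in> PK \<Otimes>\<^sub>M PT \<rightarrow>\<^sub>M count_space UNIV"
        by (subst pair_measure_countable[of UNIV UNIV, symmetric, simplified UNIV_Times_UNIV]) (simp_all, measurable)
      fix q :: "nat \<times> nat"
      show "(\<lambda>p. \<Prod>i\<in>{fst q<..snd q}. nexp (a x j * snd p (Some (x, i)))) \<in> borel_measurable (PK \<Otimes>\<^sub>M PT)"
      proof (rule borel_measurable_prod_ennreal)
        fix i assume "i \<in> {fst q<..snd q}"
        then have [measurable]: "(\<lambda>p. snd p (Some (x, i))) \<in> borel_measurable (PK \<Otimes>\<^sub>M PT)"
          using x by (intro sndm) (auto simp: T_index_def)
        show "(\<lambda>p. nexp (a x j * snd p (Some (x, i)))) \<in> borel_measurable (PK \<Otimes>\<^sub>M PT)" by measurable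
      qed
    qed
    then show "(\<lambda>p. \<Prod>i\<in>{fst p (x, j)<..fst p (x, Suc j)}. nexp (a x j * snd p (Some (x, i)))) \<in> borel_measurable (PK \<Otimes>\<^sub>M PT)"
      by simp
  qed
  have HX: "H (X \<omega>, Y \<omega>') = nexp (b * T0 \<omega>') * (\<Prod>x\<in>{1..L}. \<Prod>j<J.
      ch x j (incr h x j \<omega>) *
      (\<Prod>i\<in>{N x (real j * h) \<omega> <..N x (real (Suc j) * h) \<omega>}. nexp (a x j * T x i \<omega>')))" for \<omega> \<omega>'
    unfolding H_def fst_conv snd_conv
  proof (intro arg_cong2[where f="(*)"] prod.cong refl)
    show "nexp (b * Y \<omega>' None) = nexp (b * T0 \<omega>')"
      by (simp add: Y_def T_index_def T_family_def)
    fix x j assume xj: "x \<in> {1..L}" "j \<in> {..<J}"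
    then have *: "X \<omega> (x, j) = N x (real j * h) \<omega>" "X \<omega> (x, Suc j) = N x (real (Suc j) * h) \<omega>"
      by (simp_all add: X_def K_def)
    show "ch x j (X \<omega> (x, Suc j) - X \<omega> (x, j)) = ch x j (incr h x j \<omega>)"
      unfolding * ..
    show "{X \<omega> (x, j)<..X \<omega> (x, Suc j)} = {N x (real j * h) \<omega> <..N x (real (Suc j) * h) \<omega>}"
      unfolding * ..
    fix i assume "i \<in> {N x (real j * h) \<omega> <..N x (real (Suc j) * h) \<omega>}"
    then have "Some (x, i) \<in> T_index" using xj by (auto simp: T_index_def)
    then show "nexp (a x j * Y \<omega>' (Some (x, i))) = nexp (a x j * T x i \<omega>')"
      by (simp add: Y_def T_family_def)
  qed
  have Hu: "(\<lambda>u. \<integral>\<^sup>+v. H (u, v) \<partial>distr M PT Y) \<in> borel_measurable PK"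
    by (rule PY.borel_measurable_nn_integral_fst) simp
  have "(\<integral>\<^sup>+\<omega>. H (X \<omega>, Y \<omega>) \<partial>M) = (\<integral>\<^sup>+p. H p \<partial>distr M (PK \<Otimes>\<^sub>M PT) (\<lambda>\<omega>. (X \<omega>, Y \<omega>)))"
    using Xm Ym by (subst nn_integral_distr) (auto simp del: of_nat_Suc)
  also have "\<dots> = (\<integral>\<^sup>+u. (\<integral>\<^sup>+v. H (u, v) \<partial>distr M PT Y) \<partial>distr M PK X)"
    unfolding prod[symmetric] by (rule PY.nn_integral_fst[symmetric]) simp
  also have "\<dots> = (\<integral>\<^sup>+\<omega>. (\<integral>\<^sup>+v. H (X \<omega>, v) \<partial>distr M PT Y) \<partial>M)"
    by (subst nn_integral_distr) (use Xm Hu in simp_all)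
  also have "\<dots> = (\<integral>\<^sup>+\<omega>. (\<integral>\<^sup>+\<omega>'. H (X \<omega>, Y \<omega>') \<partial>M) \<partial>M)"
  proof (rule nn_integral_cong)
    fix \<omega> assume "\<omega> \<in> space M"
    then have "X \<omega> \<in> space PK" by (rule measurable_space[OF Xm])
    then have "(\<lambda>v. H (X \<omega>, v)) \<in> borel_measurable PT" by measurable
    then show "(\<integral>\<^sup>+v. H (X \<omega>, v) \<partial>distr M PT Y) = (\<integral>\<^sup>+\<omega>'. H (X \<omega>, Y \<omega>') \<partial>M)"
      by (subst nn_integral_distr) (use Ym in simp_all)
  qed
  \<comment> \<open>With the Poisson values frozen at \<open>\<omega>\<close> the blocks are
    deterministic, and only the exponential variables are integrated.\<close>
  also have "\<dots> = (\<integral>\<^sup>+\<omega>. ennreal (1 / (1 + b)) * (\<Prod>x\<in>{1..L}. \<Prod>j<J.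
      ch x j (incr h x j \<omega>) * ennreal (1 / (1 + a x j)) ^ (incr h x j \<omega>)) \<partial>M)"
  proof (rule nn_integral_cong)
    fix \<omega> assume \<omega>: "\<omega> \<in> space M"
    \<comment> \<open>The value 0 outside \<open>{1..L}\<close> makes every \<open>S x\<close>
      monotone.\<close>
    define S :: "nat \<Rightarrow> nat \<Rightarrow> nat" where "S x j = (if x \<in> {1..L} then N x (real j * h) \<omega> else 0)" for x j
    have Seq: "S x j = N x (real j * h) \<omega>" if "x \<in> {1..L}" for x j
      using that by (simp add: S_def)
    have P1: "(\<Prod>x\<in>{1..L}. \<Prod>j<J. \<Prod>i\<in>{S x j<..S x (Suc j)}. nexp (a x j * T x i \<omega>')) =
      (\<Prod>x\<in>{1..L}. \<Prod>j<J. \<Prod>i\<in>{N x (real j * h) \<omega> <..N x (real (Suc j) * h) \<omega>}. nexp (a x j * T x i \<omega>'))" for \<omega>'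
      by (rule prod.cong[OF refl], rule prod.cong[OF refl]) (simp only: Seq)
    have P2: "(\<Prod>x\<in>{1..L}. \<Prod>j<J. ennreal (1 / (1 + a x j)) ^ (S x (Suc j) - S x j)) =
      (\<Prod>x\<in>{1..L}. \<Prod>j<J. ennreal (1 / (1 + a x j)) ^ (incr h x j \<omega>))"
      by (rule prod.cong[OF refl], rule prod.cong[OF refl]) (simp only: Seq)
    define c where "c = (\<Prod>x\<in>{1..L}. \<Prod>j<J. ch x j (incr h x j \<omega>))"
    have S: "mono (S x)" for x
      using counting_mono[OF N_counting[OF _ \<omega>]] h by (intro monoI) (auto simp: S_def mult_right_mono)
    have Sm: "(\<lambda>\<omega>'. nexp (b * T0 \<omega>') * (\<Prod>x\<in>{1..L}. \<Prod>j<J. \<Prod>i\<in>{S x j<..S x (Suc j)}. nexp (a x j * T x i \<omega>'))) \<in> borel_measurable M"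
    proof (intro borel_measurable_times_ennreal borel_measurable_prod_ennreal)
      show "(\<lambda>\<omega>'. nexp (b * T0 \<omega>')) \<in> borel_measurable M" by measurable
      fix x j i assume "x \<in> {1..L}" "i \<in> {S x j<..S x (Suc j)}"
      then have [measurable]: "T x i \<in> borel_measurable M" by (intro T_meas) auto
      show "(\<lambda>\<omega>'. nexp (a x j * T x i \<omega>')) \<in> borel_measurable M" by measurable
    qed
    have "(\<integral>\<^sup>+\<omega>'. H (X \<omega>, Y \<omega>') \<partial>M) = (\<integral>\<^sup>+\<omega>'. c * (nexp (b * T0 \<omega>') * (\<Prod>x\<in>{1..L}. \<Prod>j<J. \<Prod>i\<in>{S x j<..S x (Suc j)}. nexp (a x j * T x i \<omega>'))) \<partial>M)"
      unfolding HX prod.distrib P1 c_def[symmetric] by (simp only: mult.left_commute)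
    also have "\<dots> = c * (ennreal (1 / (1 + b)) * (\<Prod>x\<in>{1..L}. \<Prod>j<J. ennreal (1 / (1 + a x j)) ^ (S x (Suc j) - S x j)))"
      using Sm T_blocks_laplace[of S a b, OF S a b] by (simp add: nn_integral_cmult)
    also have "\<dots> = ennreal (1 / (1 + b)) * (\<Prod>x\<in>{1..L}. \<Prod>j<J.
      ch x j (incr h x j \<omega>) * ennreal (1 / (1 + a x j)) ^ (incr h x j \<omega>))"
      unfolding prod.distrib P2 c_def[symmetric] by (simp only: mult.left_commute)
    finally show "(\<integral>\<^sup>+\<omega>'. H (X \<omega>, Y \<omega>') \<partial>M) = ennreal (1 / (1 + b)) * (\<Prod>x\<in>{1..L}. \<Prod>j<J.
      ch x j (incr h x j \<omega>) * ennreal (1 / (1 + a x j)) ^ (incr h x j \<omega>))" .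
  qed
  also have "\<dots> = ennreal (1 / (1 + b)) * (\<integral>\<^sup>+\<omega>. (\<Prod>x\<in>{1..L}. \<Prod>j<J.
      ch x j (incr h x j \<omega>) * ennreal (1 / (1 + a x j)) ^ (incr h x j \<omega>)) \<partial>M)"
  proof (rule nn_integral_cmult, intro borel_measurable_prod_ennreal)
    fix x j assume "x \<in> {1..L}"
    then have [measurable]: "N x (real (Suc j) * h) \<in> M \<rightarrow>\<^sub>M count_space UNIV" "N x (real j * h) \<in> M \<rightarrow>\<^sub>M count_space UNIV"
      using h by (intro N_meas; simp)+
    show "(\<lambda>\<omega>. ch x j (incr h x j \<omega>) * ennreal (1 / (1 + a x j)) ^ (incr h x j \<omega>)) \<in> borel_measurable M"
      by measurable
  qed
  also have "(\<integral>\<^sup>+\<omega>. (\<Prod>x\<in>{1..L}. \<Prod>j<J.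
      ch x j (incr h x j \<omega>) * ennreal (1 / (1 + a x j)) ^ (incr h x j \<omega>)) \<partial>M) =
     (\<Prod>x\<in>{1..L}. \<Prod>j<J. \<integral>\<^sup>+n. ch x j n * ennreal (1 / (1 + a x j)) ^ n \<partial>measure_pmf (poisson_pmf h))"
    by (rule N_increments[OF h, where F="\<lambda>x j n. ch x j n * ennreal (1 / (1 + a x j)) ^ n"])
  finally show ?thesis unfolding HX .
qed

end

section \<open>The real-valued clock and the mean of a grid cell\<close>

lemma sum_upto_shift: "(\<Sum>x\<in>{1..L}. f x) = (\<Sum>n<L. f (Suc n))" for f :: "nat \<Rightarrow> 'a::comm_monoid_add"
  by (induction L) simp_all

locale K_setting = K_inputs M N T0 T for M :: "'v measure" and N T0 T +
  fixes \<gamma> :: "nat \<Rightarrow> real" and c :: real and y :: enat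
  assumes \<gamma>_pos: "\<And>x. 1 \<le> x \<Longrightarrow> 0 < \<gamma> x" and \<gamma>_summable: "summable (\<lambda>n. \<gamma> (Suc n))"
    and c_nonneg: "0 \<le> c" and y_Nbar: "y \<in> Nbar"
begin

definition jump_part :: "nat \<Rightarrow> real \<Rightarrow> 'v \<Rightarrow> real" where
  "jump_part n t \<omega> = \<gamma> (Suc n) * (\<Sum>i=1..N (Suc n) t \<omega>. T (Suc n) i \<omega>)"

definition jumps :: "real \<Rightarrow> 'v \<Rightarrow> ennreal" where
  "jumps t \<omega> = (\<Sum>n. ennreal (\<gamma> (Suc n)) * (\<Sum>i=1..N (Suc n) t \<omega>. ennreal (T (Suc n) i \<omega>)))"

definition nonneg :: "'v \<Rightarrow> bool" where
  "nonneg \<omega> \<longleftrightarrow> 0 \<le> T0 \<omega> \<and> (\<forall>x\<ge>1. \<forall>i\<ge>1. 0 \<le> T x i \<omega>)"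

definition gam0 :: real where "gam0 = extend_infty \<gamma> y"

text \<open>The clock as a real number; it agrees with \<open>K_clock\<close> wherever the
  exponential variables are nonnegative and the jumps have a finite sum (\<open>clock_G\<close>),
  hence almost surely.\<close>

definition G :: "real \<Rightarrow> 'v \<Rightarrow> real" where
  "G t \<omega> = gam0 * T0 \<omega> + (\<Sum>n. jump_part n t \<omega>) + c * t"

lemma gam0_nonneg: "0 \<le> gam0"
  using y_Nbar \<gamma>_pos by (auto simp: gam0_def extend_infty_def Nbar_cases less_imp_le)

lemma gam_Suc: "0 < \<gamma> (Suc n)" by (rule \<gamma>_pos) simp

lemma jump_part_nonneg: "nonneg \<omega> \<Longrightarrow> 0 \<le> jump_part n t \<omega>"
  unfolding jump_part_def nonneg_def using gam_Suc[of n] by (intro mult_nonneg_nonneg sum_nonneg) auto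

lemma jump_part_mono:
  assumes "nonneg \<omega>" "\<omega> \<in> space M" "0 \<le> s" "s \<le> t"
  shows "jump_part n s \<omega> \<le> jump_part n t \<omega>"
  unfolding jump_part_def
proof (intro mult_left_mono sum_mono2)
  show "{1..N (Suc n) s \<omega>} \<subseteq> {1..N (Suc n) t \<omega>}"
    using counting_mono[OF N_counting[of "Suc n" \<omega>] assms(3,4)] assms(2) by auto
qed (use assms gam_Suc[of n] in \<open>auto simp: nonneg_def less_imp_le\<close>)

lemma jumps_zz: "nonneg \<omega> \<Longrightarrow> jumps t \<omega> = (\<Sum>n. ennreal (jump_part n t \<omega>))"
proof -
  assume *: "nonneg \<omega>"
  have "ennreal (\<gamma> (Suc n)) * (\<Sum>i=1..N (Suc n) t \<omega>. ennreal (T (Suc n) i \<omega>)) = ennreal (jump_part n t \<omega>)" for n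
    using * gam_Suc[of n] unfolding jump_part_def
    by (subst sum_ennreal) (auto simp: nonneg_def ennreal_mult' less_imp_le)
  then show ?thesis unfolding jumps_def by simp
qed

lemma jump_part_summable: "nonneg \<omega> \<Longrightarrow> jumps t \<omega> < \<top> \<Longrightarrow> summable (\<lambda>n. jump_part n t \<omega>)"
  using summable_suminf_not_top[of "\<lambda>n. jump_part n t \<omega>"] by (simp add: jumps_zz jump_part_nonneg)

lemma jumps_meas: "0 \<le> t \<Longrightarrow> jumps t \<in> borel_measurable M"
proof -
  assume t: "0 \<le> t"
  have "(\<lambda>\<omega>. K_clock \<gamma> 0 \<infinity> N T0 T \<omega> t) \<in> borel_measurable M"
    by (rule clock_at_meas) (use t in auto)
  then show ?thesis
    by (simp add: K_clock_def extend_infty_def jumps_def[abs_def])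
qed

lemma jumps_mono: "\<omega> \<in> space M \<Longrightarrow> 0 \<le> s \<Longrightarrow> s \<le> t \<Longrightarrow> jumps s \<omega> \<le> jumps t \<omega>"
  using clock_mono[of 0 \<omega> s t \<gamma> \<infinity>] by (simp add: K_clock_def extend_infty_def jumps_def)

lemma clock_G:
  assumes "nonneg \<omega>" "jumps t \<omega> < \<top>" "0 \<le> t"
  shows "K_clock \<gamma> c y N T0 T \<omega> t = ennreal (G t \<omega>)"
proof -
  note s = jump_part_summable[OF assms(1,2)]
  have "K_clock \<gamma> c y N T0 T \<omega> t = ennreal (gam0 * T0 \<omega>) + jumps t \<omega> + ennreal (c * t)"
    by (simp add: K_clock_def jumps_def gam0_def)
  also have "jumps t \<omega> = ennreal (\<Sum>n. jump_part n t \<omega>)"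
    unfolding jumps_zz[OF assms(1)] using s jump_part_nonneg[OF assms(1)] by (intro suminf_ennreal2) auto
  finally show ?thesis
    using assms gam0_nonneg c_nonneg suminf_nonneg[OF s jump_part_nonneg[OF assms(1)]]
    by (simp add: G_def nonneg_def ennreal_plus[symmetric] del: ennreal_plus)
qed

lemma hold_lap_bounds:
  assumes "0 \<le> a" "1 \<le> x"
  shows "0 \<le> hold_lap \<gamma> a x \<and> hold_lap \<gamma> a x \<le> 1"
proof -
  have g: "0 < \<gamma> x" using \<gamma>_pos assms by simp
  then have "0 \<le> a * \<gamma> x" using assms by simp
  then show ?thesis unfolding hold_lap_def by simp
qed

lemma prod_exp_zz:
  assumes \<omega>: "\<omega> \<in> space M" and h: "0 < h"
  shows "(\<Prod>x\<in>{1..L}. \<Prod>j<J. \<Prod>i\<in>{N x (real j * h) \<omega> <..N x (real (Suc j) * h) \<omega>}. nexp (a j * \<gamma> x * T x i \<omega>)) =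
    (\<Prod>j<J. nexp (a j * ((\<Sum>n<L. jump_part n (real (Suc j) * h) \<omega>) - (\<Sum>n<L. jump_part n (real j * h) \<omega>))))"
proof -
  have blk: "(\<Prod>i\<in>{N x (real j * h) \<omega> <..N x (real (Suc j) * h) \<omega>}. nexp (a j * \<gamma> x * T x i \<omega>)) =
     nexp (a j * (jump_part (x - 1) (real (Suc j) * h) \<omega> - jump_part (x - 1) (real j * h) \<omega>))" if x: "x \<in> {1..L}" for x j
  proof -
    define p q where "p = N x (real j * h) \<omega>" and "q = N x (real (Suc j) * h) \<omega>"
    have pq: "p \<le> q" unfolding p_def q_def
      by (rule counting_mono[OF N_counting]) (use x \<omega> h in \<open>auto intro!: mult_right_mono\<close>)
    have x1: "Suc (x - 1) = x" using x by simp
    have "{1..q} = {1..p} \<union> {p<..q}" using pq by auto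
    then have s: "(\<Sum>i=1..q. T x i \<omega>) = (\<Sum>i=1..p. T x i \<omega>) + (\<Sum>i\<in>{p<..q}. T x i \<omega>)"
      by (subst sum.union_disjoint[symmetric]) auto
    have "(\<Prod>i\<in>{p<..q}. nexp (a j * \<gamma> x * T x i \<omega>)) = ennreal (exp (\<Sum>i\<in>{p<..q}. - (a j * \<gamma> x * T x i \<omega>)))"
      by (simp add: prod_ennreal exp_sum)
    also have "(\<Sum>i\<in>{p<..q}. - (a j * \<gamma> x * T x i \<omega>)) = - (a j * (jump_part (x - 1) (real (Suc j) * h) \<omega> - jump_part (x - 1) (real j * h) \<omega>))"
      unfolding jump_part_def x1 p_def[symmetric] q_def[symmetric] s
      by (simp add: sum_negf sum_distrib_left[symmetric] distrib_left mult.assoc)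
    finally show ?thesis unfolding p_def q_def .
  qed
  have "(\<Prod>x\<in>{1..L}. \<Prod>j<J. \<Prod>i\<in>{N x (real j * h) \<omega> <..N x (real (Suc j) * h) \<omega>}. nexp (a j * \<gamma> x * T x i \<omega>)) =
    (\<Prod>j<J. \<Prod>x\<in>{1..L}. nexp (a j * (jump_part (x - 1) (real (Suc j) * h) \<omega> - jump_part (x - 1) (real j * h) \<omega>)))"
    by (subst prod.swap, rule prod.cong[OF refl], rule prod.cong[OF refl], rule blk)
  also have "\<dots> = (\<Prod>j<J. nexp (a j * ((\<Sum>n<L. jump_part n (real (Suc j) * h) \<omega>) - (\<Sum>n<L. jump_part n (real j * h) \<omega>))))"
  proof (rule prod.cong[OF refl])
    fix j
    have "(\<Prod>x\<in>{1..L}. nexp (a j * (jump_part (x - 1) (real (Suc j) * h) \<omega> - jump_part (x - 1) (real j * h) \<omega>))) =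
       ennreal (exp (\<Sum>x\<in>{1..L}. - (a j * (jump_part (x - 1) (real (Suc j) * h) \<omega> - jump_part (x - 1) (real j * h) \<omega>))))"
      by (simp add: prod_ennreal exp_sum)
    also have "(\<Sum>x\<in>{1..L}. - (a j * (jump_part (x - 1) (real (Suc j) * h) \<omega> - jump_part (x - 1) (real j * h) \<omega>))) =
        - (a j * ((\<Sum>n<L. jump_part n (real (Suc j) * h) \<omega>) - (\<Sum>n<L. jump_part n (real j * h) \<omega>)))"
      by (subst sum_upto_shift) (simp add: sum_negf sum_distrib_left[symmetric] sum_subtractf del: of_nat_Suc)
    finally show "(\<Prod>x\<in>{1..L}. nexp (a j * (jump_part (x - 1) (real (Suc j) * h) \<omega> - jump_part (x - 1) (real j * h) \<omega>))) =
       nexp (a j * ((\<Sum>n<L. jump_part n (real (Suc j) * h) \<omega>) - (\<Sum>n<L. jump_part n (real j * h) \<omega>)))" .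
  qed
  finally show ?thesis .
qed

text \<open>For s > 0 the mean of exp (- s * jumps), counted as 0 where the sum is infinite, is at
  least exp (- t s \<sigma>) with \<sigma> = (\<Sum>n. \<gamma> (Suc n)), because the partial sums
  satisfy this bound for every \<open>L\<close>. The mean is also at most the probability of a
  finite sum, and s tends to 0.\<close>

lemma jumps_finite:
  assumes t: "0 < t"
  shows "AE \<omega> in M. jumps t \<omega> < \<top>"
proof -
  define f where "f s L \<omega> = (\<Prod>x\<in>{1..L}. \<Prod>j<1. \<Prod>i\<in>{N x (real j * t) \<omega> <..N x (real (Suc j) * t) \<omega>}. nexp (s * \<gamma> x * T x i \<omega>))" for s L \<omega>
  define sg where "sg = (\<Sum>n. \<gamma> (Suc n))"
  have [measurable]: "jumps t \<in> borel_measurable M" using t by (intro jumps_meas) simp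
  have fm [measurable]: "f s L \<in> borel_measurable M" for s L
  proof -
    have "(\<lambda>\<omega>. \<Prod>i\<in>{N x (real j * t) \<omega> <..N x (real (Suc j) * t) \<omega>}. nexp (s * \<gamma> x * T x i \<omega>)) \<in> borel_measurable M"
      if x: "1 \<le> x" for x j
    proof (rule measurable_compose_countable[where g="\<lambda>\<omega>. N x (real j * t) \<omega>"], rule measurable_compose_countable[where g="\<lambda>\<omega>. N x (real (Suc j) * t) \<omega>"])
      show "(\<lambda>\<omega>. N x (real (Suc j) * t) \<omega>) \<in> M \<rightarrow>\<^sub>M count_space UNIV" "(\<lambda>\<omega>. N x (real j * t) \<omega>) \<in> M \<rightarrow>\<^sub>M count_space UNIV"
        using t x by (intro N_meas; simp)+
      fix p q :: nat
      show "(\<lambda>\<omega>. \<Prod>i\<in>{p<..q}. nexp (s * \<gamma> x * T x i \<omega>)) \<in> borel_measurable M"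
      proof (rule borel_measurable_prod_ennreal)
        fix i assume "i \<in> {p<..q}"
        then have [measurable]: "T x i \<in> borel_measurable M" using x by (intro T_meas) auto
        show "(\<lambda>\<omega>. nexp (s * \<gamma> x * T x i \<omega>)) \<in> borel_measurable M" by measurable
      qed
    qed
    then show ?thesis
      unfolding f_def[abs_def]
    proof (intro borel_measurable_prod_ennreal)
      fix x j assume m: "\<And>x j. 1 \<le> x \<Longrightarrow> (\<lambda>\<omega>. \<Prod>i\<in>{N x (real j * t) \<omega> <..N x (real (Suc j) * t) \<omega>}. nexp (s * \<gamma> x * T x i \<omega>)) \<in> borel_measurable M"
        and "x \<in> {1..L}"
      then show "(\<lambda>\<omega>. \<Prod>i\<in>{N x (real j * t) \<omega> <..N x (real (Suc j) * t) \<omega>}. nexp (s * \<gamma> x * T x i \<omega>)) \<in> borel_measurable M"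
        by (intro m) simp
    qed
  qed
  have lower: "nexp (t * (s * sg)) \<le> emeasure M {\<omega> \<in> space M. jumps t \<omega> < \<top>}" if s: "0 < s" for s
  proof -
    have int: "nexp (t * (s * sg)) \<le> (\<integral>\<^sup>+\<omega>. f s L \<omega> \<partial>M)" for L
    proof -
      define a' where "a' x j = (if x \<in> {1..L} then s * \<gamma> x else 0)" for x j :: nat
      have a'0: "0 \<le> a' x j" for x j using s \<gamma>_pos by (simp add: a'_def less_imp_le)
      have "(\<integral>\<^sup>+\<omega>. f s L \<omega> \<partial>M) = (\<integral>\<^sup>+\<omega>. nexp (0 * T0 \<omega>) * (\<Prod>x\<in>{1..L}. \<Prod>j<1.
          1 * (\<Prod>i\<in>{N x (real j * t) \<omega> <..N x (real (Suc j) * t) \<omega>}. nexp (a' x j * T x i \<omega>))) \<partial>M)"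
        unfolding f_def by (intro nn_integral_cong) (simp add: a'_def)
      also have "\<dots> = ennreal (1 / (1 + 0)) * (\<Prod>x\<in>{1..L}. \<Prod>j<1. \<integral>\<^sup>+n. 1 * ennreal (1 / (1 + a' x j)) ^ n \<partial>measure_pmf (poisson_pmf t))"
        by (intro cells_finite t a'0) simp
      also have "\<dots> = (\<Prod>x\<in>{1..L}. nexp (t * (1 - 1 / (1 + a' x 0))))"
        using a'0 nn_integral_poisson_power(1)[OF t] by (simp add: add_nonneg_nonneg)
      also have "\<dots> = (\<Prod>x\<in>{1..L}. nexp (t * (1 - hold_lap \<gamma> s x)))"
        by (intro prod.cong) (auto simp: hold_lap_def a'_def)
      also have "\<dots> = ennreal (exp (\<Sum>x\<in>{1..L}. - (t * (1 - hold_lap \<gamma> s x))))"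
        by (simp add: prod_ennreal exp_sum)
      also have "\<dots> \<ge> nexp (t * (s * sg))"
      proof -
        \<comment> \<open>Here summability of \<open>\<gamma>\<close> enters: 1 -
          \<open>hold_lap \<gamma> s x\<close> = s * \<open>hold_res \<gamma> s x\<close> is at most
          s * \<gamma> x.\<close>
        have "(\<Sum>x\<in>{1..L}. 1 - hold_lap \<gamma> s x) \<le> (\<Sum>x\<in>{1..L}. s * \<gamma> x)"
          using one_minus_hold_lap hold_res_le \<gamma>_pos s by (intro sum_mono) (auto intro!: mult_left_mono)
        also have "\<dots> = s * (\<Sum>n<L. \<gamma> (Suc n))"
          by (subst sum_upto_shift) (simp add: sum_distrib_left)
        also have "\<dots> \<le> s * sg"
          unfolding sg_def using s gam_Suc by (intro mult_left_mono sum_le_suminf \<gamma>_summable) (auto simp: less_imp_le)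
        finally show ?thesis
          using t by (intro ennreal_leI) (simp add: sum_negf sum_distrib_left[symmetric])
      qed
      finally show ?thesis .
    qed
    define g where "g \<omega> = (if jumps t \<omega> < \<top> then nexp (s * enn2real (jumps t \<omega>)) else 0)" for \<omega>
    have "(\<lambda>L. \<integral>\<^sup>+\<omega>. f s L \<omega> \<partial>M) \<longlonglongrightarrow> (\<integral>\<^sup>+\<omega>. g \<omega> \<partial>M)"
    proof (rule nn_integral_dominated_convergence[where w="\<lambda>_. 1"])
      have feq: "f s L \<omega> = nexp (s * (\<Sum>n<L. jump_part n t \<omega>))" if "\<omega> \<in> space M" for L \<omega>
      proof -
        have "N x 0 \<omega> = 0" if "1 \<le> x" for x
          using N_counting[OF that \<open>\<omega> \<in> space M\<close>] by (simp add: counting_def)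
        then have "jump_part n 0 \<omega> = 0" for n by (simp add: jump_part_def)
        then show ?thesis
          unfolding f_def using prod_exp_zz[OF that t, where a="\<lambda>_. s" and J=1 and L=L] by simp
      qed
      show "AE \<omega> in M. (\<lambda>L. f s L \<omega>) \<longlonglongrightarrow> g \<omega>"
        using T_nonneg AE_space
      proof eventually_elim
        case (elim \<omega>)
        then have nn: "nonneg \<omega>" by (simp add: nonneg_def)
        have z: "0 \<le> jump_part n t \<omega>" for n by (rule jump_part_nonneg[OF nn])
        have "(\<lambda>L. \<Sum>n<L. ennreal (jump_part n t \<omega>)) \<longlonglongrightarrow> jumps t \<omega>"
          unfolding jumps_zz[OF nn] by (rule summable_LIMSEQ) simp
        then have lim: "(\<lambda>L. ennreal (\<Sum>n<L. jump_part n t \<omega>)) \<longlonglongrightarrow> jumps t \<omega>"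
          using z by simp
        show ?case
        proof (cases "jumps t \<omega> < \<top>")
          case True
          then have "(\<lambda>L. ennreal (\<Sum>n<L. jump_part n t \<omega>)) \<longlonglongrightarrow> ennreal (enn2real (jumps t \<omega>))"
            using lim by simp
          then have "(\<lambda>L. \<Sum>n<L. jump_part n t \<omega>) \<longlonglongrightarrow> enn2real (jumps t \<omega>)"
            using z by (subst (asm) tendsto_ennreal_iff) (auto intro!: always_eventually sum_nonneg)
          then have "(\<lambda>L. nexp (s * (\<Sum>n<L. jump_part n t \<omega>))) \<longlonglongrightarrow> nexp (s * enn2real (jumps t \<omega>))"
            by (intro tendsto_intros tendsto_ennrealI)
          then show ?thesis using elim True by (simp add: feq g_def)
        next
          case False
          then have "jumps t \<omega> = \<top>" by (simp add: less_top[symmetric])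
          then have "filterlim (\<lambda>L. \<Sum>n<L. jump_part n t \<omega>) at_top sequentially"
            using lim by (simp add: ennreal_tendsto_top_eq_at_top)
          then have "filterlim (\<lambda>L. s * (\<Sum>n<L. jump_part n t \<omega>)) at_top sequentially"
            using s by (intro filterlim_tendsto_pos_mult_at_top[OF tendsto_const])
          then have "(\<lambda>L. exp (- (s * (\<Sum>n<L. jump_part n t \<omega>)))) \<longlonglongrightarrow> 0"
            by (intro filterlim_compose[OF exp_at_bot] filterlim_compose[OF filterlim_uminus_at_bot_at_top])
          then have "(\<lambda>L. nexp (s * (\<Sum>n<L. jump_part n t \<omega>))) \<longlonglongrightarrow> ennreal 0"
            by (rule tendsto_ennrealI)
          then show ?thesis using elim False by (simp add: feq g_def)
        qed
      qed
      show "AE \<omega> in M. f s L \<omega> \<le> 1" for L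
        using T_nonneg AE_space
      proof eventually_elim
        case (elim \<omega>)
        then have "nonneg \<omega>" by (simp add: nonneg_def)
        then have "0 \<le> s * (\<Sum>n<L. jump_part n t \<omega>)"
          using s jump_part_nonneg by (intro mult_nonneg_nonneg sum_nonneg) auto
        then show ?case using elim by (simp add: feq)
      qed
      show "g \<in> borel_measurable M" unfolding g_def[abs_def] by measurable
    qed (simp_all add: emeasure_space_1)
    then have "nexp (t * (s * sg)) \<le> (\<integral>\<^sup>+\<omega>. g \<omega> \<partial>M)"
      by (rule LIMSEQ_le_const) (use int in blast)
    also have "\<dots> \<le> (\<integral>\<^sup>+\<omega>. indicator {\<omega> \<in> space M. jumps t \<omega> < \<top>} \<omega> \<partial>M)"
      using s by (intro nn_integral_mono) (auto simp: g_def indicator_def)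
    also have "\<dots> = emeasure M {\<omega> \<in> space M. jumps t \<omega> < \<top>}"
      by (rule nn_integral_indicator) measurable
    finally show ?thesis .
  qed
  have "(\<lambda>n. nexp (t * (1 / real (Suc n) * sg))) \<longlonglongrightarrow> nexp (t * (0 * sg))"
    by (intro tendsto_intros tendsto_ennrealI LIMSEQ_Suc[OF lim_1_over_n])
  then have "nexp (t * (0 * sg)) \<le> emeasure M {\<omega> \<in> space M. jumps t \<omega> < \<top>}"
    by (rule LIMSEQ_le_const2) (rule exI[of _ 0], intro allI impI lower, simp)
  then have "emeasure M {\<omega> \<in> space M. jumps t \<omega> < \<top>} = 1"
    by (intro antisym emeasure_le_1) simp
  moreover have "{\<omega> \<in> space M. jumps t \<omega> < \<top>} \<in> sets M" by measurable
  ultimately show ?thesis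
    using AE_iff_emeasure_eq_1[of "\<lambda>\<omega>. jumps t \<omega> < \<top>"] by simp
qed

definition regular :: "'v \<Rightarrow> bool" where
  "regular \<omega> \<longleftrightarrow> \<omega> \<in> space M \<and> nonneg \<omega> \<and> (\<forall>t\<ge>0. jumps t \<omega> < \<top>)"

lemma AE_regular: "AE \<omega> in M. regular \<omega>"
proof -
  have "AE \<omega> in M. \<forall>k::nat. jumps (real (Suc k)) \<omega> < \<top>"
    unfolding AE_all_countable by (intro allI jumps_finite) simp
  then show ?thesis
    using T_nonneg AE_space
  proof eventually_elim
    case (elim \<omega>)
    have "jumps t \<omega> < \<top>" if t: "0 \<le> t" for t
    proof -
      have "t \<le> real (Suc (nat \<lceil>t\<rceil>))" using real_nat_ceiling_ge[of t] by simp
      then have "jumps t \<omega> \<le> jumps (real (Suc (nat \<lceil>t\<rceil>))) \<omega>"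
        using elim(3) t by (intro jumps_mono)
      moreover have "jumps (real (Suc (nat \<lceil>t\<rceil>))) \<omega> < \<top>" using elim(1) by (rule spec)
      ultimately show ?thesis by (rule le_less_trans)
    qed
    then show ?case using elim by (simp add: regular_def nonneg_def)
  qed
qed

text \<open>\<open>\<kappa>\<close> is the type of the only event in the cell, or \<^const>\<open>None\<close> if there is no event.\<close>

definition cellfac :: "real \<Rightarrow> nat set \<Rightarrow> nat \<Rightarrow> real \<Rightarrow> nat option \<Rightarrow> 'v \<Rightarrow> ennreal" where
  "cellfac h B j a \<kappa> \<omega> = nexp (a * (G (real (Suc j) * h) \<omega> - G (real j * h) \<omega>)) *
    of_bool (\<forall>x\<in>B. incr h x j \<omega> = of_bool (\<kappa> = Some x))"

text \<open>The mean of \<open>cellfac\<close>, see \<open>cell_laplace\<close>. The exponential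
  combines the drift, the jumps of types outside \<open>B\<close>, and the probability that no type
  of \<open>B\<close> has an event; an event of type \<open>z\<close> contributes the further
  factor.\<close>

definition cellval :: "real \<Rightarrow> nat set \<Rightarrow> real \<Rightarrow> nat option \<Rightarrow> real" where
  "cellval h B a \<kappa> = exp (- (h * exponent \<gamma> c B a)) * (case \<kappa> of None \<Rightarrow> 1 | Some z \<Rightarrow> h * hold_lap \<gamma> a z)"

text \<open>With g for \<open>hold_lap \<gamma> a\<close>, a type x outside \<open>B\<close>
  contributes exp (- h (1 - g x)), a type in \<open>B\<close> only exp (- h), and the event, if any,
  the factor h g z. Adding and subtracting g over \<open>B\<close> turns the exponent into a sum
  over all types plus the sum of g over \<open>B\<close>.\<close>

lemma cell_sum:
  assumes B: "finite B" "B \<subseteq> {1..L}" and h: "0 < h" and a: "0 < a" and \<kappa>: "\<And>z. \<kappa> = Some z \<Longrightarrow> z \<in> B"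
  shows "(\<Prod>x\<in>{1..L}. \<integral>\<^sup>+n. (if x \<in> B then of_bool (n = of_bool (\<kappa> = Some x)) else 1) * ennreal (hold_lap \<gamma> a x) ^ n \<partial>measure_pmf (poisson_pmf h)) =
    ennreal (exp (- (h * (a * (\<Sum>n<L. hold_res \<gamma> a (Suc n)) + (\<Sum>x\<in>B. hold_lap \<gamma> a x)))) * (case \<kappa> of None \<Rightarrow> 1 | Some z \<Rightarrow> h * hold_lap \<gamma> a z))"
proof -
  have g: "0 \<le> hold_lap \<gamma> a x" if "x \<in> {1..L}" for x using hold_lap_bounds[of a x] a that by simp
  define w where "w x = (if x \<in> B then exp (- h) * (if \<kappa> = Some x then h * hold_lap \<gamma> a x else 1) else exp (- (h * (1 - hold_lap \<gamma> a x))))" for x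
  have w0: "0 \<le> w x" if "x \<in> {1..L}" for x using g[OF that] h by (simp add: w_def)
  have "(\<Prod>x\<in>{1..L}. \<integral>\<^sup>+n. (if x \<in> B then of_bool (n = of_bool (\<kappa> = Some x)) else 1) * ennreal (hold_lap \<gamma> a x) ^ n \<partial>measure_pmf (poisson_pmf h)) =
     (\<Prod>x\<in>{1..L}. ennreal (w x))"
  proof (rule prod.cong[OF refl])
    fix x assume x: "x \<in> {1..L}"
    show "(\<integral>\<^sup>+n. (if x \<in> B then of_bool (n = of_bool (\<kappa> = Some x)) else 1) * ennreal (hold_lap \<gamma> a x) ^ n \<partial>measure_pmf (poisson_pmf h)) = ennreal (w x)"
      using nn_integral_poisson_power(1)[OF h g[OF x]] nn_integral_poisson_power(2)[OF h g[OF x], of "of_bool (\<kappa> = Some x)"]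
      by (cases "x \<in> B"; cases "\<kappa> = Some x") (simp_all add: w_def mult_ac)
  qed
  also have "\<dots> = ennreal (\<Prod>x\<in>{1..L}. w x)" using w0 by (rule prod_ennreal)
  also have "(\<Prod>x\<in>{1..L}. w x) = (\<Prod>x\<in>{1..L} - B. w x) * (\<Prod>x\<in>B. w x)"
    using B by (intro prod.subset_diff) auto
  also have "(\<Prod>x\<in>{1..L} - B. w x) = exp (\<Sum>x\<in>{1..L} - B. - (h * (1 - hold_lap \<gamma> a x)))"
  proof -
    have "(\<Prod>x\<in>{1..L} - B. w x) = (\<Prod>x\<in>{1..L} - B. exp (- (h * (1 - hold_lap \<gamma> a x))))"
      by (rule prod.cong[OF refl]) (simp add: w_def)
    then show ?thesis by (simp add: exp_sum)
  qed
  also have "(\<Prod>x\<in>B. w x) = exp (- (h * card B)) * (case \<kappa> of None \<Rightarrow> 1 | Some z \<Rightarrow> h * hold_lap \<gamma> a z)"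
  proof -
    have "(\<Prod>x\<in>B. w x) = (\<Prod>x\<in>B. exp (- h)) * (\<Prod>x\<in>B. if \<kappa> = Some x then h * hold_lap \<gamma> a x else 1)"
      by (simp add: w_def prod.distrib cong: prod.cong)
    also have "(\<Prod>x\<in>B. exp (- h)) = exp (- (h * card B))"
      by (simp add: exp_of_nat_mult[symmetric] mult.commute)
    also have "(\<Prod>x\<in>B. if \<kappa> = Some x then h * hold_lap \<gamma> a x else 1) = (case \<kappa> of None \<Rightarrow> 1 | Some z \<Rightarrow> h * hold_lap \<gamma> a z)"
    proof (cases \<kappa>)
      case (Some z)
      then have "(\<Prod>x\<in>B. if \<kappa> = Some x then h * hold_lap \<gamma> a x else 1) = (\<Prod>x\<in>B. if x = z then h * hold_lap \<gamma> a z else 1)"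
        by (intro prod.cong) auto
      then show ?thesis using \<kappa>[OF Some] B(1) Some by (simp add: prod.delta)
    qed simp
    finally show ?thesis .
  qed
  also have "exp (\<Sum>x\<in>{1..L} - B. - (h * (1 - hold_lap \<gamma> a x))) * (exp (- (h * card B)) * (case \<kappa> of None \<Rightarrow> 1 | Some z \<Rightarrow> h * hold_lap \<gamma> a z)) =
      exp ((\<Sum>x\<in>{1..L} - B. - (h * (1 - hold_lap \<gamma> a x))) - h * card B) * (case \<kappa> of None \<Rightarrow> 1 | Some z \<Rightarrow> h * hold_lap \<gamma> a z)"
    unfolding mult.assoc[symmetric] mult_exp_exp by simp
  also have "(\<Sum>x\<in>{1..L} - B. - (h * (1 - hold_lap \<gamma> a x))) - h * card B = - (h * (a * (\<Sum>n<L. hold_res \<gamma> a (Suc n)) + (\<Sum>x\<in>B. hold_lap \<gamma> a x)))"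
  proof -
    have "(\<Sum>x\<in>{1..L}. 1 - hold_lap \<gamma> a x) = (\<Sum>x\<in>{1..L} - B. 1 - hold_lap \<gamma> a x) + (\<Sum>x\<in>B. 1 - hold_lap \<gamma> a x)"
      using B by (intro sum.subset_diff) auto
    moreover have "(\<Sum>x\<in>{1..L}. 1 - hold_lap \<gamma> a x) = a * (\<Sum>n<L. hold_res \<gamma> a (Suc n))"
      using one_minus_hold_lap[of \<gamma> _ a] gam_Suc a by (subst sum_upto_shift) (simp add: sum_distrib_left)
    moreover have "(\<Sum>x\<in>B. 1 - hold_lap \<gamma> a x) = card B - (\<Sum>x\<in>B. hold_lap \<gamma> a x)"
      by (simp add: sum_subtractf)
    ultimately have "(\<Sum>x\<in>{1..L} - B. 1 - hold_lap \<gamma> a x) = a * (\<Sum>n<L. hold_res \<gamma> a (Suc n)) + (\<Sum>x\<in>B. hold_lap \<gamma> a x) - card B" by simp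
    moreover have "(\<Sum>x\<in>{1..L} - B. - (h * (1 - hold_lap \<gamma> a x))) = - (h * (\<Sum>x\<in>{1..L} - B. 1 - hold_lap \<gamma> a x))"
      by (simp add: sum_negf sum_distrib_left)
    ultimately have "(\<Sum>x\<in>{1..L} - B. - (h * (1 - hold_lap \<gamma> a x))) = - (h * (a * (\<Sum>n<L. hold_res \<gamma> a (Suc n)) + (\<Sum>x\<in>B. hold_lap \<gamma> a x) - card B))"
      by simp
    then show ?thesis by (simp only:) (simp add: right_diff_distrib)
  qed
  finally show ?thesis .
qed

lemma jump_part_meas:
  assumes t: "0 \<le> t"
  shows "jump_part n t \<in> borel_measurable M"
  unfolding jump_part_def[abs_def]
proof (rule borel_measurable_times[OF borel_measurable_const])
  show "(\<lambda>\<omega>. \<Sum>i=1..N (Suc n) t \<omega>. T (Suc n) i \<omega>) \<in> borel_measurable M"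
  proof (rule measurable_compose_countable[where g="N (Suc n) t"])
    show "N (Suc n) t \<in> M \<rightarrow>\<^sub>M count_space UNIV" using t by (intro N_meas) auto
    fix k
    show "(\<lambda>\<omega>. \<Sum>i=1..k. T (Suc n) i \<omega>) \<in> borel_measurable M"
      by (rule borel_measurable_sum) (rule T_meas, auto)
  qed
qed

lemma G_meas:
  assumes "0 \<le> t" shows "G t \<in> borel_measurable M"
proof -
  note [measurable] = jump_part_meas[OF assms]
  show ?thesis unfolding G_def[abs_def] by measurable
qed

lemma cell_event_meas:
  assumes B: "finite B" "B \<subseteq> {1..}" and h: "0 < h"
  shows "Measurable.pred M (\<lambda>\<omega>. \<forall>x\<in>B. incr h x j \<omega> = of_bool (\<kappa> = Some x))"
proof (rule pred_intros_finite[OF B(1)])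
  fix x assume "x \<in> B"
  then have [measurable]: "N x (real (Suc j) * h) \<in> M \<rightarrow>\<^sub>M count_space UNIV" "N x (real j * h) \<in> M \<rightarrow>\<^sub>M count_space UNIV"
    using h B by (intro N_meas; auto)+
  show "Measurable.pred M (\<lambda>\<omega>. incr h x j \<omega> = of_bool (\<kappa> = Some x))" by measurable
qed

lemma cellfac_meas:
  assumes B: "finite B" "B \<subseteq> {1..}" and h: "0 < h"
  shows "cellfac h B j a \<kappa> \<in> borel_measurable M"
proof -
  have [measurable]: "G (real (Suc j) * h) \<in> borel_measurable M" "G (real j * h) \<in> borel_measurable M"
    using h by (intro G_meas; simp)+
  note [measurable] = cell_event_meas[OF B h]
  show ?thesis
    unfolding cellfac_def[abs_def] of_bool_def[where ?'a=ennreal] by measurable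
qed

text \<open>The formula for finitely many types, \<open>cells_finite\<close>, is extended by
  dominated convergence. The drift is absent from the finite products and accounts for the
  deterministic factor \<open>K\<close>.\<close>

lemma cell_laplace:
  assumes B: "finite B" "B \<subseteq> {1..}" and h: "0 < h" and b: "0 \<le> b"
    and a: "\<And>j. 0 < a j" and \<kappa>: "\<And>j z. \<kappa> j = Some z \<Longrightarrow> z \<in> B"
  shows "(\<integral>\<^sup>+\<omega>. nexp (b * (gam0 * T0 \<omega>)) * (\<Prod>j<J. cellfac h B j (a j) (\<kappa> j) \<omega>) \<partial>M) =
    ennreal (1 / (1 + b * gam0)) * (\<Prod>j<J. ennreal (cellval h B (a j) (\<kappa> j)))"
proof -
  let ?E = "\<lambda>\<omega>. nexp (b * (gam0 * T0 \<omega>))" and ?w = "\<lambda>j. (case \<kappa> j of None \<Rightarrow> 1 | Some z \<Rightarrow> h * hold_lap \<gamma> (a j) z)"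
    and ?I = "\<lambda>\<omega>. (\<Prod>j<J. of_bool (\<forall>x\<in>B. incr h x j \<omega> = of_bool (\<kappa> j = Some x))) :: ennreal"
  let ?X = "\<lambda>L j \<omega>. exp (- (a j * ((\<Sum>n<L. jump_part n (real (Suc j) * h) \<omega>) - (\<Sum>n<L. jump_part n (real j * h) \<omega>))))"
    and ?X_lim = "\<lambda>j \<omega>. exp (- (a j * ((\<Sum>n. jump_part n (real (Suc j) * h) \<omega>) - (\<Sum>n. jump_part n (real j * h) \<omega>))))"
    and ?Y = "\<lambda>L j. exp (- (h * (a j * (\<Sum>n<L. hold_res \<gamma> (a j) (Suc n)) + (\<Sum>x\<in>B. hold_lap \<gamma> (a j) x))))"
    and ?Y_lim = "\<lambda>j. exp (- (h * (a j * (\<Sum>n. hold_res \<gamma> (a j) (Suc n)) + (\<Sum>x\<in>B. hold_lap \<gamma> (a j) x))))"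
  define ch :: "nat \<Rightarrow> nat \<Rightarrow> nat \<Rightarrow> ennreal" where "ch x j n = (if x \<in> B then of_bool (n = of_bool (\<kappa> j = Some x)) else 1)" for x j n
  define f where "f L \<omega> = nexp (b * gam0 * T0 \<omega>) * (\<Prod>x\<in>{1..L}. \<Prod>j<J.
      ch x j (incr h x j \<omega>) *
      (\<Prod>i\<in>{N x (real j * h) \<omega> <..N x (real (Suc j) * h) \<omega>}. nexp (a j * \<gamma> x * T x i \<omega>)))" for L \<omega>
  define K where "K = (\<Prod>j<J. ennreal (exp (a j * (c * h))))"
  have Kinv: "(\<Prod>j<J. nexp (a j * (c * h))) * K = 1"
    unfolding K_def prod.distrib[symmetric] ennreal_mult''[OF exp_ge_zero, symmetric] mult_exp_exp by simp
  define L0 where "L0 = Max (insert 0 B)"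
  have BL: "B \<subseteq> {1..L}" if "L0 \<le> L" for L
  proof
    fix x assume x: "x \<in> B"
    then have "x \<le> L0" unfolding L0_def using B(1) by (intro Max_ge) auto
    moreover have "1 \<le> x" using x B(2) by auto
    ultimately show "x \<in> {1..L}" using that by simp
  qed
  have int: "(\<integral>\<^sup>+\<omega>. f L \<omega> \<partial>M) = ennreal (1 / (1 + b * gam0)) * (\<Prod>j<J. ennreal (?Y L j *
      ?w j))" if L: "L0 \<le> L" for L
  proof -
    define a' where "a' x j = (if x \<in> {1..L} then a j * \<gamma> x else 0)" for x j
    have a'0: "0 \<le> a' x j" for x j using a \<gamma>_pos by (simp add: a'_def less_imp_le)
    have "(\<integral>\<^sup>+\<omega>. f L \<omega> \<partial>M) = (\<integral>\<^sup>+\<omega>. nexp (b * gam0 * T0 \<omega>) * (\<Prod>x\<in>{1..L}. \<Prod>j<J.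
      ch x j (incr h x j \<omega>) *
      (\<Prod>i\<in>{N x (real j * h) \<omega> <..N x (real (Suc j) * h) \<omega>}. nexp (a' x j * T x i \<omega>))) \<partial>M)"
      unfolding f_def by (intro nn_integral_cong arg_cong2[where f="(*)"] refl prod.cong) (simp_all add: a'_def)
    also have "\<dots> = ennreal (1 / (1 + b * gam0)) * (\<Prod>x\<in>{1..L}. \<Prod>j<J. \<integral>\<^sup>+n. ch x j n * ennreal (1 / (1 + a' x j)) ^ n \<partial>measure_pmf (poisson_pmf h))"
      using b gam0_nonneg by (intro cells_finite h a'0) simp
    also have "(\<Prod>x\<in>{1..L}. \<Prod>j<J. \<integral>\<^sup>+n. ch x j n * ennreal (1 / (1 + a' x j)) ^ n \<partial>measure_pmf (poisson_pmf h)) =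
      (\<Prod>j<J. \<Prod>x\<in>{1..L}. \<integral>\<^sup>+n. (if x \<in> B then of_bool (n = of_bool (\<kappa> j = Some x)) else 1) * ennreal (hold_lap \<gamma> (a j) x) ^ n \<partial>measure_pmf (poisson_pmf h))"
      by (subst prod.swap, rule prod.cong[OF refl], rule prod.cong[OF refl]) (simp add: ch_def a'_def hold_lap_def)
    also have "\<dots> = (\<Prod>j<J. ennreal (?Y L j *
      ?w j))"
      using \<kappa> by (intro prod.cong refl cell_sum B BL L h a) auto
    finally show ?thesis .
  qed
  have lim1: "(\<lambda>L. \<integral>\<^sup>+\<omega>. f L \<omega> \<partial>M) \<longlonglongrightarrow> ennreal (1 / (1 + b * gam0)) *
      (\<Prod>j<J. ennreal (?Y_lim j * ?w j))"
    (is "_ \<longlonglongrightarrow> ?R")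
  proof (rule Lim_transform_eventually)
    have "0 \<le> ?w j" for j
      using h hold_lap_bounds[of "a j"] a[of j] \<kappa>[of j] B by (auto split: option.split simp: less_imp_le subset_iff)
    then show "(\<lambda>L. ennreal (1 / (1 + b * gam0)) * ennreal (\<Prod>j<J. ?Y L j *
      ?w j)) \<longlonglongrightarrow> ?R"
      using less_imp_le[OF a]
      by (subst prod_ennreal) (auto intro!: ennreal_tendsto_cmult tendsto_ennrealI tendsto_intros summable_LIMSEQ hold_res_summable \<gamma>_pos \<gamma>_summable)
    show "\<forall>\<^sub>F L in sequentially. ennreal (1 / (1 + b * gam0)) * ennreal (\<Prod>j<J. ?Y L j *
      ?w j) = (\<integral>\<^sup>+\<omega>. f L \<omega> \<partial>M)"
      using eventually_ge_at_top[of L0]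
    proof eventually_elim
      case (elim L)
      show ?case
        unfolding int[OF elim] using \<open>\<And>j. 0 \<le> ?w j\<close>
        by (subst prod_ennreal) auto
    qed
  qed
  define F where "F \<omega> = ?E \<omega> * (\<Prod>j<J. cellfac h B j (a j) (\<kappa> j) \<omega>)" for \<omega>
  have Fm [measurable]: "F \<in> borel_measurable M"
    unfolding F_def[abs_def] by (intro borel_measurable_times_ennreal borel_measurable_prod_ennreal cellfac_meas B h) measurable
  have feq: "f L \<omega> = ?E \<omega> * (?I \<omega> *
      (\<Prod>j<J. ennreal (?X L j \<omega>)))"
    if \<omega>: "\<omega> \<in> space M" and L: "L0 \<le> L" for L \<omega>
  proof -
    have "(\<Prod>x\<in>{1..L}. \<Prod>j<J. ch x j (incr h x j \<omega>)) =
       ?I \<omega>"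
    proof (subst prod.swap, rule prod.cong[OF refl])
      fix j
      have "(\<Prod>x\<in>{1..L}. ch x j (incr h x j \<omega>)) = (\<Prod>x\<in>B. ch x j (incr h x j \<omega>))"
        using BL[OF L] by (intro prod.mono_neutral_right) (auto simp: ch_def)
      also have "\<dots> = of_bool (\<forall>x\<in>B. incr h x j \<omega> = of_bool (\<kappa> j = Some x))"
      proof (cases "\<forall>x\<in>B. incr h x j \<omega> = of_bool (\<kappa> j = Some x)")
        case True
        then show ?thesis by (simp add: ch_def)
      next
        case False
        then obtain x where x: "x \<in> B" "incr h x j \<omega> \<noteq> of_bool (\<kappa> j = Some x)"
          by blast
        have "ch x j (incr h x j \<omega>) = 0"
          unfolding ch_def using x by (simp only: if_True of_bool_eq)
        then have "(\<Prod>x\<in>B. ch x j (incr h x j \<omega>)) = 0"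
          using B(1) x(1) by (intro prod_zero bexI)
        then show ?thesis by (simp only: False of_bool_eq)
      qed
      finally show "(\<Prod>x\<in>{1..L}. ch x j (incr h x j \<omega>)) = of_bool (\<forall>x\<in>B. incr h x j \<omega> = of_bool (\<kappa> j = Some x))" .
    qed
    then show ?thesis
      unfolding f_def prod.distrib prod_exp_zz[OF \<omega> h] by (simp add: mult.assoc)
  qed
  \<comment> \<open>The shift by \<open>L0\<close> makes every member of the sequence contain all
    types of \<open>B\<close>, so that \<open>feq\<close> applies throughout.\<close>
  have "(\<lambda>L. \<integral>\<^sup>+\<omega>. f (L + L0) \<omega> \<partial>M) \<longlonglongrightarrow> (\<integral>\<^sup>+\<omega>. F \<omega> * K \<partial>M)"
  proof (rule nn_integral_dominated_convergence[where w="\<lambda>_. 1"])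
    show "f (L + L0) \<in> borel_measurable M" for L
    proof (rule measurable_cong[THEN iffD2])
      show "f (L + L0) \<omega> = ?E \<omega> * (?I \<omega> *
          (\<Prod>j<J. ennreal (?X (L + L0) j \<omega>)))" if "\<omega> \<in> space M" for \<omega>
        by (rule feq[OF that]) simp
      have [measurable]: "jump_part n (real (Suc j) * h) \<in> borel_measurable M" "jump_part n (real j * h) \<in> borel_measurable M" for n j
        using h by (intro jump_part_meas; simp)+
      note [measurable] = cell_event_meas[OF B h]
      have [measurable]: "(\<lambda>\<omega>. of_bool (\<forall>x\<in>B. incr h x j \<omega> = of_bool (\<kappa> j = Some x)) :: ennreal) \<in> borel_measurable M" for j
        unfolding of_bool_def[where ?'a=ennreal] by measurable
      show "(\<lambda>\<omega>. ?E \<omega> * (?I \<omega> *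
          (\<Prod>j<J. ennreal (?X (L + L0) j \<omega>)))) \<in> borel_measurable M"
        by (intro borel_measurable_times_ennreal borel_measurable_prod_ennreal) measurable
    qed
    show "(\<lambda>\<omega>. F \<omega> * K) \<in> borel_measurable M" by measurable
    show "AE \<omega> in M. (\<lambda>L. f (L + L0) \<omega>) \<longlonglongrightarrow> F \<omega> * K"
      using AE_regular
    proof eventually_elim
      case (elim \<omega>)
      then have \<omega>: "\<omega> \<in> space M" "nonneg \<omega>" and jf: "\<And>t. 0 \<le> t \<Longrightarrow> jumps t \<omega> < \<top>"
        by (auto simp: regular_def)
      have z: "(\<lambda>L. \<Sum>n<L + L0. jump_part n (real j * h) \<omega>) \<longlonglongrightarrow> (\<Sum>n. jump_part n (real j * h) \<omega>)" for j
        using h by (intro LIMSEQ_ignore_initial_segment summable_LIMSEQ jump_part_summable \<omega> jf) auto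
      have Gd: "(\<Sum>n. jump_part n (real (Suc j) * h) \<omega>) - (\<Sum>n. jump_part n (real j * h) \<omega>) = G (real (Suc j) * h) \<omega> - G (real j * h) \<omega> - c * h" for j
        by (simp add: G_def algebra_simps)
      have "(\<lambda>L. ?E \<omega> * (?I \<omega> *
          ennreal (\<Prod>j<J. ?X (L + L0) j \<omega>))) \<longlonglongrightarrow>
         ?E \<omega> * (?I \<omega> *
          ennreal (\<Prod>j<J. ?X_lim j \<omega>))"
      proof (intro ennreal_tendsto_cmult tendsto_ennrealI tendsto_intros z)
        have "(\<Prod>j<J. of_bool (\<forall>x\<in>B. incr h x j \<omega> = of_bool (\<kappa> j = Some x)) :: ennreal) \<le> 1"
          by (intro prod_le_1) auto
        then show "(\<Prod>j<J. of_bool (\<forall>x\<in>B. incr h x j \<omega> = of_bool (\<kappa> j = Some x)) :: ennreal) < \<top>"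
          by (rule le_less_trans) simp
      qed simp
      also have "(\<lambda>L. ?E \<omega> * (?I \<omega> *
          ennreal (\<Prod>j<J. ?X (L + L0) j \<omega>))) = (\<lambda>L. f (L + L0) \<omega>)"
        by (rule ext) (simp add: feq[OF \<omega>(1)] prod_ennreal)
      also have "?E \<omega> * (?I \<omega> *
          ennreal (\<Prod>j<J. ?X_lim j \<omega>)) = F \<omega> * K"
      proof -
        have "ennreal (?X_lim j \<omega>) =
            nexp (a j * (G (real (Suc j) * h) \<omega> - G (real j * h) \<omega>)) * ennreal (exp (a j * (c * h)))" for j
          unfolding Gd by (simp only: ennreal_mult''[OF exp_ge_zero, symmetric] mult_exp_exp right_diff_distrib) (simp add: algebra_simps)
        then have "ennreal (\<Prod>j<J. ?X_lim j \<omega>) =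
            (\<Prod>j<J. nexp (a j * (G (real (Suc j) * h) \<omega> - G (real j * h) \<omega>))) * K"
          unfolding K_def by (subst prod_ennreal[symmetric]) (simp_all add: prod.distrib[symmetric])
        then show ?thesis
          unfolding F_def cellfac_def prod.distrib by (simp only: mult_ac)
      qed
      finally show ?case .
    qed
    show "AE \<omega> in M. f (L + L0) \<omega> \<le> 1" for L
      using AE_regular
    proof eventually_elim
      case (elim \<omega>)
      then have \<omega>: "\<omega> \<in> space M" "nonneg \<omega>" by (auto simp: regular_def)
      have "(\<Sum>n<L + L0. jump_part n (real j * h) \<omega>) \<le> (\<Sum>n<L + L0. jump_part n (real (Suc j) * h) \<omega>)" for j
        using h by (intro sum_mono jump_part_mono \<omega>) (auto intro: mult_right_mono)
      then have "ennreal (?X (L + L0) j \<omega>) \<le> 1" for j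
        using a[of j] by (simp add: mult_nonneg_nonneg less_imp_le del: of_nat_Suc)
      moreover have "?E \<omega> \<le> 1"
        using b gam0_nonneg \<omega>(2) by (simp add: nonneg_def)
      ultimately show ?case
        unfolding feq[OF \<omega>(1) le_add2] by (intro mult_le_one prod_le_1) (auto simp del: of_nat_Suc)
    qed
  qed (simp_all add: emeasure_space_1)
  moreover have "(\<lambda>L. \<integral>\<^sup>+\<omega>. f (L + L0) \<omega> \<partial>M) \<longlonglongrightarrow> ?R"
    using lim1 by (rule LIMSEQ_ignore_initial_segment)
  ultimately have "(\<integral>\<^sup>+\<omega>. F \<omega> * K \<partial>M) = ?R"
    by (rule LIMSEQ_unique)
  then have FK: "(\<integral>\<^sup>+\<omega>. F \<omega> \<partial>M) * K = ?R"
    by (simp add: nn_integral_multc)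
  \<comment> \<open>\<open>K\<close> is removed by multiplying with its inverse from
    \<open>Kinv\<close> instead of dividing in \<open>ennreal\<close>.\<close>
  have "(\<integral>\<^sup>+\<omega>. F \<omega> \<partial>M) = (\<integral>\<^sup>+\<omega>. F \<omega> \<partial>M) * ((\<Prod>j<J. nexp (a j * (c * h))) * K)"
    unfolding Kinv by simp
  also have "\<dots> = ?R * (\<Prod>j<J. nexp (a j * (c * h)))"
    unfolding FK[symmetric] by (simp only: mult_ac)
  also have "\<dots> = ennreal (1 / (1 + b * gam0)) * (\<Prod>j<J. ennreal (cellval h B (a j) (\<kappa> j)))"
    unfolding mult.assoc prod.distrib[symmetric]
  proof (intro arg_cong2[where f="(*)"] prod.cong refl)
    fix j
    show "ennreal (?Y_lim j * ?w j) *
        nexp (a j * (c * h)) = ennreal (cellval h B (a j) (\<kappa> j))"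
    proof -
      have "?Y_lim j * exp (- (a j * (c * h))) = exp (- (h * exponent \<gamma> c B (a j)))"
        unfolding mult_exp_exp exponent_def by (simp add: algebra_simps)
      then show ?thesis
        unfolding cellval_def ennreal_mult''[OF exp_ge_zero, symmetric] by (metis mult.assoc mult.commute)
    qed
  qed
  finally show ?thesis unfolding F_def .
qed

end

section \<open>The skeleton of the K-process\<close>

locale K_target = K_setting M N T0 T \<gamma> c y for M :: "'v measure" and N T0 T \<gamma> c y +
  fixes B :: "nat set"
  assumes B_fin: "finite B" and B_ne: "B \<noteq> {}" and B_pos: "B \<subseteq> {1..}"
begin

text \<open>The events of the superposition \<open>nB\<close> of the processes indexed by \<open>B\<close> are the visits to \<open>B\<close>; \<open>U i\<close> is
  the type of the \<open>(i + 1)\<close>-st event, which occurs at \<open>S (i + 1)\<close>.\<close>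

definition nB :: "'v \<Rightarrow> real \<Rightarrow> nat" where
  "nB \<omega> u = (\<Sum>x\<in>B. N x u \<omega>)"

definition S :: "nat \<Rightarrow> 'v \<Rightarrow> real" where
  "S i \<omega> = (if reached (nB \<omega>) i then evt (nB \<omega>) i else 0)"

definition good :: "'v \<Rightarrow> bool" where
  "good \<omega> \<longleftrightarrow> regular \<omega> \<and> (\<forall>i. reached (nB \<omega>) i) \<and> (\<forall>i. S i \<omega> < S (Suc i) \<omega>)"

definition U :: "nat \<Rightarrow> 'v \<Rightarrow> nat" where
  "U i \<omega> = (LEAST x. x \<in> B \<and> N x (S i \<omega>) \<omega> < N x (S (Suc i) \<omega>) \<omega>)"

definition Gl :: "real \<Rightarrow> 'v \<Rightarrow> real" where
  "Gl s \<omega> = enn2real (left_lim (clock \<gamma> c y \<omega>) s)"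

text \<open>All durations are increments of the clock: from one event until just before the next at
  odd indices, across an event at positive even indices, and the initial hold at 0.\<close>

definition V :: "nat \<Rightarrow> 'v \<Rightarrow> real" where
  "V j \<omega> = (if j = 0 then gam0 * T0 \<omega>
    else if odd j then Gl (S (Suc (j div 2)) \<omega>) \<omega> - enn2real (clock \<gamma> c y \<omega> (S (j div 2) \<omega>))
    else enn2real (clock \<gamma> c y \<omega> (S (j div 2) \<omega>)) - Gl (S (j div 2) \<omega>) \<omega>)"

lemma B_ge: "x \<in> B \<Longrightarrow> 1 \<le> x"
  using B_pos by auto

lemma nB_counting: 
  assumes \<omega>: "\<omega> \<in> space M" shows "counting (nB \<omega>)"
proof -
  have n: "counting (\<lambda>u. N x u \<omega>)" if "x \<in> B" for x
    by (rule N_counting[OF B_ge[OF that] \<omega>])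
  have "nB \<omega> 0 = 0" using n by (simp add: nB_def counting_def)
  moreover have "mono_on {0..} (nB \<omega>)"
    unfolding nB_def by (intro mono_onI sum_mono counting_mono[OF n]) auto
  moreover have "(nB \<omega> \<longlongrightarrow> nB \<omega> t) (at_right t)" if "0 \<le> t" for t
    unfolding nB_def using n that by (intro tendsto_sum) (simp add: counting_def)
  ultimately show ?thesis unfolding counting_def by blast
qed

lemma nB_meas: "0 \<le> t \<Longrightarrow> (\<lambda>\<omega>. nB \<omega> t) \<in> M \<rightarrow>\<^sub>M count_space UNIV"
proof -
  assume t: "0 \<le> t"
  have "(\<lambda>\<omega>. \<Sum>x\<in>B'. N x t \<omega>) \<in> M \<rightarrow>\<^sub>M count_space UNIV" if "finite B'" "B' \<subseteq> B" for B'
    using that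
  proof (induction B' rule: finite_induct)
    case (insert x B')
    then have [measurable]: "N x t \<in> M \<rightarrow>\<^sub>M count_space UNIV" "(\<lambda>\<omega>. \<Sum>x\<in>B'. N x t \<omega>) \<in> M \<rightarrow>\<^sub>M count_space UNIV"
      using N_meas[of x] B_ge t by auto
    have "(\<lambda>\<omega>. N x t \<omega> + (\<Sum>x\<in>B'. N x t \<omega>)) \<in> M \<rightarrow>\<^sub>M count_space UNIV" by measurable
    then show ?case using insert by simp
  qed simp
  then show ?thesis unfolding nB_def using B_fin by blast
qed

lemma S_meas [measurable]: "S i \<in> borel_measurable M"
  unfolding S_def[abs_def] by (rule evt_meas) (auto intro: nB_meas nB_counting)

lemma S_nonneg: "0 \<le> S i \<omega>"
  unfolding S_def using evt_nonneg by simp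

lemma U_meas [measurable]: "U i \<in> M \<rightarrow>\<^sub>M count_space UNIV"
proof -
  have NS: "(\<lambda>\<omega>. N x (S i \<omega>) \<omega>) \<in> M \<rightarrow>\<^sub>M count_space UNIV" if "x \<in> B" for x i
    by (rule counting_at_meas[OF _ _ S_meas S_nonneg]) (use N_meas N_counting B_ge that in auto)
  have "Measurable.pred M (\<lambda>\<omega>. x \<in> B \<and> N x (S i \<omega>) \<omega> < N x (S (Suc i) \<omega>) \<omega>)" for x
  proof (cases "x \<in> B")
    case True
    have "(\<lambda>\<omega>. N x (S i \<omega>) \<omega>) \<in> borel_measurable M" for i
      by (rule measurable_compose[OF NS[OF True]]) simp
    note [measurable] = this
    show ?thesis by measurable
  qed simp
  then show ?thesis unfolding U_def[abs_def] by measurable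
qed

lemma V_meas [measurable]: "V j \<in> borel_measurable M"
proof -
  have [measurable]: "(\<lambda>\<omega>. clock \<gamma> c y \<omega> (S i \<omega>)) \<in> borel_measurable M" for i
    by (rule clock_at_meas) (auto intro: S_nonneg)
  have [measurable]: "(\<lambda>\<omega>. left_lim (clock \<gamma> c y \<omega>) (S i \<omega>)) \<in> borel_measurable M" for i
    by (rule left_clock_at_meas) simp
  show ?thesis unfolding V_def[abs_def] Gl_def by measurable
qed

section \<open>Monotonicity and one-sided limits of the clock\<close>

lemma clock_regular:
  assumes "regular \<omega>" "0 \<le> t"
  shows "clock \<gamma> c y \<omega> t = ennreal (G t \<omega>)"
  using assms clock_G unfolding regular_def by blast

lemma G_nonneg:
  assumes "regular \<omega>" "0 \<le> t"
  shows "0 \<le> G t \<omega>"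
  unfolding G_def
proof (intro add_nonneg_nonneg suminf_nonneg)
  show "summable (\<lambda>n. jump_part n t \<omega>)" "0 \<le> jump_part n t \<omega>" for n
    using assms jump_part_summable jump_part_nonneg unfolding regular_def by blast+
qed (use assms c_nonneg gam0_nonneg in \<open>auto simp: regular_def nonneg_def\<close>)

lemma G_mono:
  assumes r: "regular \<omega>" and s: "0 \<le> s" "s \<le> t"
  shows "G s \<omega> \<le> G t \<omega>"
proof -
  have "clock \<gamma> c y \<omega> s \<le> clock \<gamma> c y \<omega> t"
    using r s c_nonneg by (intro clock_mono) (auto simp: regular_def)
  then have "ennreal (G s \<omega>) \<le> ennreal (G t \<omega>)"
    using clock_regular[OF r] s by simp
  then show ?thesis
    using G_nonneg[OF r, of t] s by (subst (asm) ennreal_le_iff) auto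
qed

text \<open>Each jump part is constant just after \<open>s\<close>. The limit passes through the
  infinite sum by domination, since on the next unit of time every term is at most its value at s +
  1.\<close>

lemma G_right:
  assumes r: "regular \<omega>" and s: "0 \<le> s"
  shows "((\<lambda>t. G t \<omega>) \<longlongrightarrow> G s \<omega>) (at_right s)"
proof -
  have \<omega>: "\<omega> \<in> space M" "nonneg \<omega>" "jumps (s + 1) \<omega> < \<top>"
    using r s unfolding regular_def by auto
  have "((\<lambda>t. jump_part n t \<omega>) \<longlongrightarrow> jump_part n s \<omega>) (at_right s)" for n
  proof (rule tendsto_eventually)
    have "\<forall>\<^sub>F t in at_right s. N (Suc n) t \<omega> = N (Suc n) s \<omega>"
      by (rule counting_right[OF N_counting s]) (use \<omega> in auto)
    then show "\<forall>\<^sub>F t in at_right s. jump_part n t \<omega> = jump_part n s \<omega>"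
      by eventually_elim (simp add: jump_part_def)
  qed
  moreover have "\<forall>\<^sub>F p in at_top \<times>\<^sub>F at_right s. (\<lambda>(n, t). norm (jump_part n t \<omega>) \<le> jump_part n (s + 1) \<omega>) p"
    unfolding eventually_prod_filter
  proof (intro exI conjI allI impI)
    show "\<forall>\<^sub>F n :: nat in at_top. True" by simp
    show "\<forall>\<^sub>F t in at_right s. t \<in> {s<..<s + 1}"
      by (rule eventually_at_right_real) simp
    fix n t assume "t \<in> {s<..<s + 1}"
    then show "(\<lambda>(n, t). norm (jump_part n t \<omega>) \<le> jump_part n (s + 1) \<omega>) (n, t)"
      using jump_part_mono[OF \<omega>(2,1), of t "s + 1" n] jump_part_nonneg[OF \<omega>(2), of n t] s by simp
  qed
  ultimately have "((\<lambda>t. \<Sum>n. jump_part n t \<omega>) \<longlongrightarrow> (\<Sum>n. jump_part n s \<omega>)) (at_right s)"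
    using tannerys_theorem[of "\<lambda>n t. jump_part n t \<omega>" "\<lambda>n. jump_part n s \<omega>" "at_right s" "\<lambda>n. jump_part n (s + 1) \<omega>"] jump_part_summable[OF \<omega>(2,3)]
    by simp
  then show ?thesis
    unfolding G_def by (intro tendsto_intros)
qed

lemma G_left:
  assumes r: "regular \<omega>" and s: "0 < s"
  shows "((\<lambda>t. G t \<omega>) \<longlongrightarrow> Gl s \<omega>) (at_left s)" "left_lim (clock \<gamma> c y \<omega>) s = ennreal (Gl s \<omega>)"
proof -
  have m: "clock \<gamma> c y \<omega> u \<le> clock \<gamma> c y \<omega> v" if "0 \<le> u" "u \<le> v" for u v
    using r that c_nonneg by (intro clock_mono) (auto simp: regular_def)
  have "left_lim (clock \<gamma> c y \<omega>) s \<le> clock \<gamma> c y \<omega> s"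
    unfolding left_lim_def using s by (intro SUP_least m) auto
  also have "\<dots> < \<top>" using clock_regular[OF r, of s] s by simp
  finally show e: "left_lim (clock \<gamma> c y \<omega>) s = ennreal (Gl s \<omega>)"
    unfolding Gl_def by simp
  have "(clock \<gamma> c y \<omega> \<longlongrightarrow> ennreal (Gl s \<omega>)) (at_left s)"
    using left_lim_tendsto[of "clock \<gamma> c y \<omega>", OF m s] unfolding e by simp
  then have "((\<lambda>t. enn2real (clock \<gamma> c y \<omega> t)) \<longlongrightarrow> Gl s \<omega>) (at_left s)"
    by (rule tendsto_enn2real) (simp add: Gl_def)
  moreover have "\<forall>\<^sub>F t in at_left s. enn2real (clock \<gamma> c y \<omega> t) = G t \<omega>"
    using eventually_at_left_real[OF s]
  proof eventually_elim
    case (elim t)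
    then show ?case using clock_regular[OF r, of t] G_nonneg[OF r, of t] by simp
  qed
  ultimately show "((\<lambda>t. G t \<omega>) \<longlongrightarrow> Gl s \<omega>) (at_left s)"
    by (simp cong: tendsto_cong)
qed

lemma G_left_bounds:
  assumes r: "regular \<omega>" and s: "0 \<le> u" "u < s"
  shows "G u \<omega> \<le> Gl s \<omega>" "Gl s \<omega> \<le> G s \<omega>"
proof -
  have s0: "0 < s" using s by simp
  have "\<forall>\<^sub>F t in at_left s. G u \<omega> \<le> G t \<omega>"
    using eventually_at_left_real[OF s(2)] by eventually_elim (use s G_mono[OF r, of u] in auto)
  then show "G u \<omega> \<le> Gl s \<omega>"
    by (rule tendsto_lowerbound[OF G_left(1)[OF r s0]]) simp
  have "\<forall>\<^sub>F t in at_left s. G t \<omega> \<le> G s \<omega>"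
    using eventually_at_left_real[OF s0] by eventually_elim (use G_mono[OF r, of _ s] in auto)
  then show "Gl s \<omega> \<le> G s \<omega>"
    by (rule tendsto_upperbound[OF G_left(1)[OF r s0]]) simp
qed

lemma G_0: "regular \<omega> \<Longrightarrow> G 0 \<omega> = gam0 * T0 \<omega>"
proof -
  assume "regular \<omega>"
  then have "N (Suc n) 0 \<omega> = 0" for n
    using N_counting[of "Suc n" \<omega>] by (simp add: regular_def counting_def)
  then show ?thesis by (simp add: G_def jump_part_def)
qed

section \<open>A single good path: events of the superposition and the skeleton\<close>

context
  fixes \<omega> assumes good: "good \<omega>"
begin

lemma good_space: "\<omega> \<in> space M" and good_regular: "regular \<omega>" and good_reached: "reached (nB \<omega>) i"
  and S_less: "S i \<omega> < S (Suc i) \<omega>"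
  using good by (auto simp: good_def regular_def)

lemma S_evt: "S i \<omega> = evt (nB \<omega>) i"
  using good_reached[of i] by (simp add: S_def)

lemma S_0: "S 0 \<omega> = 0"
  using evt_le[of 0 0 "nB \<omega>"] S_nonneg[of 0 \<omega>] by (simp add: S_evt)

lemma nB_ge_iff: "0 \<le> t \<Longrightarrow> i \<le> nB \<omega> t \<longleftrightarrow> S i \<omega> \<le> t"
  using evt_le_iff[OF nB_counting[OF good_space]] good_reached by (simp add: S_evt)

lemma nB_eq_iff: 
  assumes "0 \<le> t" shows "nB \<omega> t = i \<longleftrightarrow> S i \<omega> \<le> t \<and> t < S (Suc i) \<omega>"
  using nB_ge_iff[OF assms, of i] nB_ge_iff[OF assms, of "Suc i"] by linarith

lemma nB_S: "nB \<omega> (S i \<omega>) = i"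
  using nB_eq_iff[OF S_nonneg] S_less by simp

lemma N_mono: "x \<in> B \<Longrightarrow> 0 \<le> u \<Longrightarrow> u \<le> v \<Longrightarrow> N x u \<omega> \<le> N x v \<omega>"
  by (rule counting_mono[OF N_counting[OF B_ge good_space]])

text \<open>A sum of monotone terms is unchanged only if each of its terms is.\<close>

lemma N_const:
  assumes "x \<in> B" "0 \<le> u" "u \<le> v" "nB \<omega> u = nB \<omega> v"
  shows "N x u \<omega> = N x v \<omega>"
  by (rule sum_mono_inv[of "\<lambda>x. N x u \<omega>" B "\<lambda>x. N x v \<omega>" x]) (use assms N_mono B_fin in \<open>auto simp: nB_def\<close>)

lemma nB_less:
  assumes "x \<in> B" "0 \<le> u" "u \<le> v" "N x u \<omega> < N x v \<omega>"
  shows "nB \<omega> u < nB \<omega> v"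
  unfolding nB_def using assms N_mono B_fin by (intro sum_strict_mono_ex1) auto

text \<open>From \<open>S i\<close> to \<open>S (Suc i)\<close> the total count rises by exactly 1,
  so exactly one process of \<open>B\<close> moves, and by 1.\<close>

lemma U_jump: "U i \<omega> \<in> B \<and> (\<forall>x\<in>B. N x (S (Suc i) \<omega>) \<omega> - N x (S i \<omega>) \<omega> = of_bool (x = U i \<omega>))"
proof -
  have le: "N x (S i \<omega>) \<omega> \<le> N x (S (Suc i) \<omega>) \<omega>" if "x \<in> B" for x
    using that S_less[of i] by (intro N_mono S_nonneg) auto
  have "(\<Sum>x\<in>B. N x (S (Suc i) \<omega>) \<omega> - N x (S i \<omega>) \<omega>) = nB \<omega> (S (Suc i) \<omega>) - nB \<omega> (S i \<omega>)"
    unfolding nB_def by (rule sum_subtractf_nat) (rule le)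
  also have "\<dots> = 1" by (simp add: nB_S)
  finally obtain z where z: "z \<in> B" "N z (S (Suc i) \<omega>) \<omega> - N z (S i \<omega>) \<omega> = 1"
    "\<And>x. x \<in> B \<Longrightarrow> z \<noteq> x \<Longrightarrow> N x (S (Suc i) \<omega>) \<omega> - N x (S i \<omega>) \<omega> = 0"
    unfolding sum_eq_1_iff[OF B_fin] by blast
  have "U i \<omega> = z"
    unfolding U_def
  proof (rule Least_equality)
    show "z \<in> B \<and> N z (S i \<omega>) \<omega> < N z (S (Suc i) \<omega>) \<omega>" using z(1,2) by simp
    fix x assume x: "x \<in> B \<and> N x (S i \<omega>) \<omega> < N x (S (Suc i) \<omega>) \<omega>"
    then have "x = z" using z(3)[of x] by fastforce
    then show "z \<le> x" by simp
  qed
  moreover have "N x (S (Suc i) \<omega>) \<omega> - N x (S i \<omega>) \<omega> = of_bool (x = z)" if "x \<in> B" for x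
    using z(2) z(3)[OF that] by (cases "x = z") auto
  ultimately show ?thesis using z(1) by simp
qed

text \<open>Between consecutive events of the superposition every count in \<open>B\<close> is
  constant. Hence an event of the process \<open>x\<close> can only occur at some
  \<open>S (Suc i)\<close>, and there only the process of type \<open>U i\<close> jumps.\<close>

lemma events_iff:
  assumes x: "x \<in> B"
  shows "(\<exists>j\<ge>1. reached (\<lambda>u. N x u \<omega>) j \<and> e = evt (\<lambda>u. N x u \<omega>) j) \<longleftrightarrow> (\<exists>i. U i \<omega> = x \<and> e = S (Suc i) \<omega>)"
proof
  note n = N_counting[OF B_ge[OF x] good_space]
  assume "\<exists>j\<ge>1. reached (\<lambda>u. N x u \<omega>) j \<and> e = evt (\<lambda>u. N x u \<omega>) j"
  then obtain j where j: "1 \<le> j" "reached (\<lambda>u. N x u \<omega>) j" "e = evt (\<lambda>u. N x u \<omega>) j" by blast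
  have e0: "0 < e" using evt_pos[OF n j(2,1)] j(3) by simp
  have je: "j \<le> N x e \<omega>" using evt_attained[OF n j(2)] j(3) by simp
  have before: "N x u \<omega> < j" if "0 \<le> u" "u < e" for u
    using evt_before[of u "\<lambda>u. N x u \<omega>" j] that j(3) by simp
  have "nB \<omega> 0 < nB \<omega> e"
    using e0 je before[of 0] by (intro nB_less[OF x]) auto
  then obtain i where i: "nB \<omega> e = Suc i" by (cases "nB \<omega> e") auto
  have Se: "S (Suc i) \<omega> \<le> e" using nB_ge_iff[of e "Suc i"] i e0 by simp
  have "e = S (Suc i) \<omega>"
  proof (rule ccontr)
    assume "e \<noteq> S (Suc i) \<omega>"
    then have lt: "S (Suc i) \<omega> < e" using Se by simp
    have "N x (S (Suc i) \<omega>) \<omega> = N x e \<omega>"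
      using lt i nB_S[of "Suc i"] by (intro N_const[OF x S_nonneg]) auto
    then show False using before[OF S_nonneg lt] je by simp
  qed
  moreover have "U i \<omega> = x"
  proof -
    have "N x (S i \<omega>) \<omega> < N x (S (Suc i) \<omega>) \<omega>"
      using before[OF S_nonneg, of i \<omega>] S_less[of i] je calculation by simp
    then have "N x (S (Suc i) \<omega>) \<omega> - N x (S i \<omega>) \<omega> \<noteq> 0" by simp
    moreover have "N x (S (Suc i) \<omega>) \<omega> - N x (S i \<omega>) \<omega> = of_bool (x = U i \<omega>)"
      using U_jump[of i] x by blast
    ultimately show ?thesis by (cases "x = U i \<omega>") auto
  qed
  ultimately show "\<exists>i. U i \<omega> = x \<and> e = S (Suc i) \<omega>" by blast
next
  note n = N_counting[OF B_ge[OF x] good_space]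
  assume "\<exists>i. U i \<omega> = x \<and> e = S (Suc i) \<omega>"
  then obtain i where i: "U i \<omega> = x" "e = S (Suc i) \<omega>" by blast
  have "N x (S (Suc i) \<omega>) \<omega> - N x (S i \<omega>) \<omega> = of_bool (x = U i \<omega>)"
    using U_jump[of i] x by blast
  then have lt: "N x (S i \<omega>) \<omega> < N x e \<omega>" using i by simp
  define j where "j = N x e \<omega>"
  have e0: "0 \<le> e" using i(2) S_nonneg by simp
  have r: "reached (\<lambda>u. N x u \<omega>) j"
    by (rule reachedI[OF n e0]) (simp add: j_def)
  define u where "u = evt (\<lambda>u. N x u \<omega>) j"
  have ju: "j \<le> N x u \<omega>" using evt_attained[OF n r] by (simp add: u_def)
  have u0: "0 \<le> u" using evt_nonneg[OF r] by (simp add: u_def)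
  have ue: "u \<le> e" unfolding u_def by (rule evt_le[OF e0]) (simp add: j_def)
  have "u = e"
  proof (rule ccontr)
    assume "u \<noteq> e"
    then have lt': "u < S (Suc i) \<omega>" using ue i by simp
    have Su: "S i \<omega> \<le> u"
    proof (rule ccontr)
      assume "\<not> S i \<omega> \<le> u"
      then have "N x u \<omega> \<le> N x (S i \<omega>) \<omega>" using u0 by (intro N_mono[OF x]) auto
      then show False using ju lt j_def by simp
    qed
    have "nB \<omega> u = i" using nB_eq_iff[OF u0] Su lt' by simp
    then have "N x (S i \<omega>) \<omega> = N x u \<omega>"
      using nB_S[of i] by (intro N_const[OF x S_nonneg Su]) simp
    then show False using ju lt j_def by simp
  qed
  moreover have "1 \<le> j" using lt j_def by simp
  ultimately show "\<exists>j\<ge>1. reached (\<lambda>u. N x u \<omega>) j \<and> e = evt (\<lambda>u. N x u \<omega>) j"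
    using r u_def by blast
qed

lemma S_Suc_pos: "0 < S (Suc i) \<omega>"
  using S_less[of i] S_nonneg[of i \<omega>] by simp

lemma V_good: "V 0 \<omega> = G (S 0 \<omega>) \<omega>" "V (2 * i + 1) \<omega> = Gl (S (Suc i) \<omega>) \<omega> - G (S i \<omega>) \<omega>"
   "V (2 * i + 2) \<omega> = G (S (Suc i) \<omega>) \<omega> - Gl (S (Suc i) \<omega>) \<omega>"
proof -
  have c: "enn2real (clock \<gamma> c y \<omega> (S i \<omega>)) = G (S i \<omega>) \<omega>" for i
    using clock_regular[OF good_regular S_nonneg] G_nonneg[OF good_regular S_nonneg] by simp
  show "V 0 \<omega> = G (S 0 \<omega>) \<omega>"
    by (simp add: V_def S_0 G_0[OF good_regular])
  show "V (2 * i + 1) \<omega> = Gl (S (Suc i) \<omega>) \<omega> - G (S i \<omega>) \<omega>"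
    by (simp add: V_def c)
  show "V (2 * i + 2) \<omega> = G (S (Suc i) \<omega>) \<omega> - Gl (S (Suc i) \<omega>) \<omega>"
    by (simp add: V_def c)
qed

lemma V_nonneg: "0 \<le> V j \<omega>"
proof -
  consider "j = 0" | i where "j = 2 * i + 1" | i where "j = 2 * i + 2"
    by (cases j) (auto elim: evenE oddE simp: numeral_2_eq_2, metis One_nat_def add.right_neutral add_Suc_right evenE oddE mult_2 plus_1_eq_Suc)
  then show ?thesis
  proof cases
    case 1
    then show ?thesis using V_good(1) G_nonneg[OF good_regular S_nonneg] by simp
  next
    case (2 i)
    then show ?thesis using V_good(2)[of i] G_left_bounds(1)[OF good_regular S_nonneg S_less, of i] by simp
  next
    case (3 i)
    then show ?thesis using V_good(3)[of i] G_left_bounds(2)[OF good_regular S_nonneg S_less, of i] by simp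
  qed
qed

lemma V_sum: "(\<Sum>j<2*i+1. V j \<omega>) = G (S i \<omega>) \<omega>" "(\<Sum>j<2*i+2. V j \<omega>) = Gl (S (Suc i) \<omega>) \<omega>"
   "(\<Sum>j<2*i+3. V j \<omega>) = G (S (Suc i) \<omega>) \<omega>"
proof -
  have step: "(\<Sum>j<2*i+2. V j \<omega>) = (\<Sum>j<2*i+1. V j \<omega>) + V (2 * i + 1) \<omega>"
     "(\<Sum>j<2*i+3. V j \<omega>) = (\<Sum>j<2*i+2. V j \<omega>) + V (2 * i + 2) \<omega>" for i
  proof -
    have "2 * i + 2 = Suc (2 * i + 1)" "2 * i + 3 = Suc (2 * i + 2)" by simp_all
    then show "(\<Sum>j<2*i+2. V j \<omega>) = (\<Sum>j<2*i+1. V j \<omega>) + V (2 * i + 1) \<omega>"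
     "(\<Sum>j<2*i+3. V j \<omega>) = (\<Sum>j<2*i+2. V j \<omega>) + V (2 * i + 2) \<omega>"
      by (simp_all only: sum.lessThan_Suc)
  qed
  have main: "(\<Sum>j<2*i+1. V j \<omega>) = G (S i \<omega>) \<omega>" for i
  proof (induction i)
    case 0
    then show ?case using V_good(1) by simp
  next
    case (Suc i)
    have "2 * Suc i + 1 = 2 * i + 3" by simp
    then have "(\<Sum>j<2*Suc i+1. V j \<omega>) = (\<Sum>j<2*i+3. V j \<omega>)" by (simp only:)
    also have "\<dots> = G (S (Suc i) \<omega>) \<omega>"
      unfolding step Suc.IH V_good by simp
    finally show ?case .
  qed
  show "(\<Sum>j<2*i+1. V j \<omega>) = G (S i \<omega>) \<omega>" by (rule main)
  show "(\<Sum>j<2*i+2. V j \<omega>) = Gl (S (Suc i) \<omega>) \<omega>" "(\<Sum>j<2*i+3. V j \<omega>) = G (S (Suc i) \<omega>) \<omega>"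
    unfolding step main V_good by simp_all
qed

lemma sits_good:
  assumes x: "x \<in> B" and t: "0 \<le> t"
  shows "K_sits_at \<gamma> c y N T0 T t \<omega> x \<longleftrightarrow> (\<exists>i. U i \<omega> = x \<and> (\<Sum>j<2*i+2. V j \<omega>) \<le> t \<and> t < (\<Sum>j<2*i+3. V j \<omega>))"
proof -
  let ?L = "\<lambda>e. left_lim (clock \<gamma> c y \<omega>) e \<le> ennreal t \<and> ennreal t < clock \<gamma> c y \<omega> e"
  have "K_sits_at \<gamma> c y N T0 T t \<omega> x \<longleftrightarrow> (\<exists>e. (\<exists>j\<ge>1. reached (\<lambda>u. N x u \<omega>) j \<and> e = evt (\<lambda>u. N x u \<omega>) j) \<and> ?L e)"
    unfolding sits_iff[OF c_nonneg good_space B_ge[OF x]] by blast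
  also have "\<dots> \<longleftrightarrow> (\<exists>i. U i \<omega> = x \<and> ?L (S (Suc i) \<omega>))"
    unfolding events_iff[OF x] by blast
  also have "\<dots> \<longleftrightarrow> (\<exists>i. U i \<omega> = x \<and> Gl (S (Suc i) \<omega>) \<omega> \<le> t \<and> t < G (S (Suc i) \<omega>) \<omega>)"
  proof -
    have "?L (S (Suc i) \<omega>) \<longleftrightarrow> Gl (S (Suc i) \<omega>) \<omega> \<le> t \<and> t < G (S (Suc i) \<omega>) \<omega>" for i
      unfolding G_left(2)[OF good_regular S_Suc_pos] clock_regular[OF good_regular S_nonneg]
      using t G_nonneg[OF good_regular S_nonneg, of "Suc i"] by (simp add: ennreal_less_iff ennreal_le_iff)
    then show ?thesis by simp
  qed
  finally show ?thesis unfolding V_sum .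
qed

lemma V_sum_mono: "i \<le> j \<Longrightarrow> (\<Sum>k<i. V k \<omega>) \<le> (\<Sum>k<j. V k \<omega>)"
  by (rule sum_mono2) (auto intro: V_nonneg)

lemma sits_unique:
  assumes x: "x \<in> B" "x' \<in> B" and t: "0 \<le> t"
    and s: "K_sits_at \<gamma> c y N T0 T t \<omega> x" "K_sits_at \<gamma> c y N T0 T t \<omega> x'"
  shows "x = x'"
proof -
  obtain i where i: "U i \<omega> = x" "(\<Sum>j<2*i+2. V j \<omega>) \<le> t" "t < (\<Sum>j<2*i+3. V j \<omega>)"
    using s(1) unfolding sits_good[OF x(1) t] by blast
  obtain i' where i': "U i' \<omega> = x'" "(\<Sum>j<2*i'+2. V j \<omega>) \<le> t" "t < (\<Sum>j<2*i'+3. V j \<omega>)"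
    using s(2) unfolding sits_good[OF x(2) t] by blast
  have "i = i'"
  proof (rule ccontr)
    assume "i \<noteq> i'"
    then consider "2 * i + 3 \<le> 2 * i' + 2" | "2 * i' + 3 \<le> 2 * i + 2" by linarith
    then show False
      using V_sum_mono[of "2 * i + 3" "2 * i' + 2"] V_sum_mono[of "2 * i' + 3" "2 * i + 2"] i i' by cases linarith+
  qed
  then show ?thesis using i i' by simp
qed

text \<open>Uniqueness is demanded among all states and not only within \<open>B\<close>, because
  the \<open>LEAST\<close> in \<open>K_process\<close> ranges over all of them.\<close>

lemma Z_skel_good:
  assumes u: "\<And>x x'. 1 \<le> x \<Longrightarrow> 1 \<le> x' \<Longrightarrow> K_sits_at \<gamma> c y N T0 T t \<omega> x \<Longrightarrow> K_sits_at \<gamma> c y N T0 T t \<omega> x' \<Longrightarrow> x = x'"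
    and x: "x \<in> B" and t: "0 \<le> t"
  shows "K_process \<gamma> c y N T0 T t \<omega> = enat x \<longleftrightarrow> skel_at y UNIV (\<lambda>i. U i \<omega>) (\<lambda>i. V i \<omega>) t x"
proof (cases "t < V 0 \<omega>")
  case True
  then have "K_process \<gamma> c y N T0 T t \<omega> = y" by (simp add: K_process_def V_def gam0_def)
  moreover have "\<not> (\<Sum>j<2*i+2. V j \<omega>) \<le> t" for i
    using V_sum_mono[of 1 "2 * i + 2"] True by simp
  ultimately show ?thesis using True by (auto simp: skel_at_def)
next
  case False
  have "K_process \<gamma> c y N T0 T t \<omega> = enat x \<longleftrightarrow> K_sits_at \<gamma> c y N T0 T t \<omega> x"
  proof
    assume "K_process \<gamma> c y N T0 T t \<omega> = enat x"
    then have *: "\<exists>x. K_sits_at \<gamma> c y N T0 T t \<omega> x" "x = (LEAST x. K_sits_at \<gamma> c y N T0 T t \<omega> x)"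
      using False by (auto simp: K_process_def V_def gam0_def split: if_splits)
    then show "K_sits_at \<gamma> c y N T0 T t \<omega> x" by (metis LeastI_ex)
  next
    assume s: "K_sits_at \<gamma> c y N T0 T t \<omega> x"
    have "(LEAST x. K_sits_at \<gamma> c y N T0 T t \<omega> x) = x"
    proof (rule Least_equality[of "K_sits_at \<gamma> c y N T0 T t \<omega>" x, OF s])
      fix x' assume s': "K_sits_at \<gamma> c y N T0 T t \<omega> x'"
      then have "1 \<le> x'" unfolding K_sits_at_def by (rule conjunct1)
      then show "x \<le> x'" using u[OF B_ge[OF x] _ s s'] by simp
    qed
    then show "K_process \<gamma> c y N T0 T t \<omega> = enat x"
      using False s by (auto simp: K_process_def V_def gam0_def)
  qed
  then show ?thesis
    using False unfolding sits_good[OF x t] skel_at_def by simp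
qed

end

text \<open>Where level \<open>k\<close> is never reached, the count n of a single process of
  \<open>B\<close> stays at most \<open>k\<close>, so (1/2)^n is at least (1/2)^k. But the mean of
  (1/2)^n at time t is exp (- t / 2), which tends to 0.\<close>

lemma AE_reached: "AE \<omega> in M. \<forall>k. reached (nB \<omega>) k"
proof -
  obtain z where z: "z \<in> B" using B_ne by blast
  note z1 = B_ge[OF z]
  have [measurable]: "(\<lambda>\<omega>. nB \<omega> (real r)) \<in> M \<rightarrow>\<^sub>M count_space UNIV" for r by (rule nB_meas) simp
  have [measurable]: "Measurable.pred M (\<lambda>\<omega>. reached (nB \<omega>) k)" for k
    unfolding reached_def by measurable
  have "AE \<omega> in M. reached (nB \<omega>) k" for k
  proof (rule AE_I)
    let ?A = "{\<omega> \<in> space M. \<not> reached (nB \<omega>) k}"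
    show "{\<omega> \<in> space M. \<not> reached (nB \<omega>) k} \<subseteq> ?A" by simp
    show A: "?A \<in> sets M" by measurable
    have bound: "ennreal ((1/2) ^ k) * emeasure M ?A \<le> nexp (real (Suc r) / 2)" for r
    proof -
      have d: "distr M (count_space UNIV) (\<lambda>\<omega>. N z (real (Suc r)) \<omega> - N z 0 \<omega>) = measure_pmf (poisson_pmf (1 * (real (Suc r) - 0)))"
      proof -
        have "\<forall>s t. 0 \<le> s \<and> s < t \<longrightarrow> distr M (count_space UNIV) (\<lambda>\<omega>. N z t \<omega> - N z s \<omega>) = measure_pmf (poisson_pmf (1 * (t - s)))"
          using N_poisson[OF z1] unfolding poisson_process_def by (elim conjE)
        from this[rule_format, of 0 "real (Suc r)"] show ?thesis by (simp del: of_nat_Suc)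
      qed
      have [measurable]: "N z (real (Suc r)) \<in> M \<rightarrow>\<^sub>M count_space UNIV" "N z 0 \<in> M \<rightarrow>\<^sub>M count_space UNIV"
        by (intro N_meas z1; simp)+
      have "ennreal ((1/2) ^ k) * emeasure M ?A = (\<integral>\<^sup>+\<omega>. ennreal ((1/2) ^ k) * indicator ?A \<omega> \<partial>M)"
        by (rule nn_integral_cmult_indicator[OF A, symmetric])
      also have "\<dots> \<le> (\<integral>\<^sup>+\<omega>. ennreal (1/2) ^ (N z (real (Suc r)) \<omega> - N z 0 \<omega>) \<partial>M)"
      proof (rule nn_integral_mono)
        fix \<omega> assume \<omega>: "\<omega> \<in> space M"
        show "ennreal ((1/2) ^ k) * indicator ?A \<omega> \<le> ennreal (1/2) ^ (N z (real (Suc r)) \<omega> - N z 0 \<omega>)"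
        proof (cases "reached (nB \<omega>) k")
          case False
          then have "\<not> k \<le> nB \<omega> (real (Suc r))" unfolding reached_def by blast
          moreover have "N z (real (Suc r)) \<omega> \<le> nB \<omega> (real (Suc r))"
            unfolding nB_def by (rule member_le_sum[OF z]) (use B_fin in auto)
          ultimately have "N z (real (Suc r)) \<omega> - N z 0 \<omega> \<le> k" by simp
          then have "(1/2 :: real) ^ k \<le> (1/2) ^ (N z (real (Suc r)) \<omega> - N z 0 \<omega>)"
            by (intro power_decreasing) auto
          then have "ennreal ((1/2) ^ k) \<le> ennreal ((1/2) ^ (N z (real (Suc r)) \<omega> - N z 0 \<omega>))"
            by (rule ennreal_leI)
          also have "\<dots> = ennreal (1/2) ^ (N z (real (Suc r)) \<omega> - N z 0 \<omega>)"
            by (rule ennreal_power[symmetric]) simp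
          finally show ?thesis using mult_right_mono[of "indicator ?A \<omega>" 1 "ennreal ((1/2) ^ k)"]
            by (simp add: indicator_def del: of_nat_Suc)
        qed simp
      qed
      also have "\<dots> = (\<integral>\<^sup>+n. ennreal (1/2) ^ n \<partial>distr M (count_space UNIV) (\<lambda>\<omega>. N z (real (Suc r)) \<omega> - N z 0 \<omega>))"
      proof -
        have "(\<lambda>\<omega>. N z (real (Suc r)) \<omega> - N z 0 \<omega>) \<in> M \<rightarrow>\<^sub>M count_space UNIV" by measurable
        then show ?thesis by (rule nn_integral_distr[symmetric]) simp
      qed
      also have "\<dots> = nexp (real (Suc r) * (1 - 1/2))"
        unfolding d mult_1 diff_0_right by (rule nn_integral_poisson_power(1)) simp_all
      finally show ?thesis by simp
    qed
    have "(\<lambda>r. nexp (real (Suc r) / 2)) \<longlonglongrightarrow> ennreal 0"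
    proof (rule tendsto_ennrealI)
      have "(\<lambda>r. exp (- (1/2)) ^ Suc r :: real) \<longlonglongrightarrow> 0"
        by (rule LIMSEQ_Suc[OF LIMSEQ_realpow_zero]) auto
      also have "(\<lambda>r. exp (- (1/2)) ^ Suc r) = (\<lambda>r. exp (- (real (Suc r) / 2)))"
        by (rule ext) (simp add: exp_of_nat_mult[symmetric] del: of_nat_Suc power_Suc)
      finally show "(\<lambda>r. exp (- (real (Suc r) / 2))) \<longlonglongrightarrow> 0" .
    qed
    then have "ennreal ((1/2) ^ k) * emeasure M ?A \<le> ennreal 0"
      by (rule LIMSEQ_le_const) (use bound in blast)
    then show "emeasure M ?A = 0" by simp
  qed
  then show ?thesis by (simp add: AE_all_countable)
qed

text \<open>The types of \<open>B\<close> have at most one event in the cell; \<open>None\<close>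
  stands for no event.\<close>

definition fair :: "real \<Rightarrow> nat \<Rightarrow> 'v \<Rightarrow> bool" where
  "fair h j \<omega> \<longleftrightarrow> (\<exists>\<kappa>\<in>insert None (Some ` B). \<forall>x\<in>B. incr h x j \<omega> = of_bool (\<kappa> = Some x))"

lemma cell_event_prob:
  assumes h: "0 < h" and \<kappa>: "\<kappa> \<in> insert None (Some ` B)"
  shows "emeasure M {\<omega> \<in> space M. \<forall>x\<in>B. incr h x j \<omega> = of_bool (\<kappa> = Some x)} =
    ennreal (exp (- (h * card B)) * (if \<kappa> = None then 1 else h))"
proof -
  define L where "L = Max B"
  have BL: "B \<subseteq> {1..L}" using B_ge B_fin by (auto simp: L_def)
  define F :: "nat \<Rightarrow> nat \<Rightarrow> nat \<Rightarrow> ennreal" where "F x i n = (if i = j \<and> x \<in> B then of_bool (n = of_bool (\<kappa> = Some x)) else 1)" for x i n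
  have FL: "(\<Prod>x\<in>{1..L}. \<Prod>i<Suc j. F' x i) = (\<Prod>x\<in>B. F' x j)" if "\<And>x i. x \<notin> B \<or> i \<noteq> j \<Longrightarrow> F' x i = 1" for F' :: "nat \<Rightarrow> nat \<Rightarrow> ennreal"
  proof -
    have "(\<Prod>i<Suc j. F' x i) = F' x j" for x
      using that by (subst prod.lessThan_Suc, subst prod.neutral) auto
    then show ?thesis using BL that by (simp only:) (intro prod.mono_neutral_right, auto)
  qed
  have "emeasure M {\<omega> \<in> space M. \<forall>x\<in>B. incr h x j \<omega> = of_bool (\<kappa> = Some x)} =
    (\<integral>\<^sup>+\<omega>. indicator {\<omega> \<in> space M. \<forall>x\<in>B. incr h x j \<omega> = of_bool (\<kappa> = Some x)} \<omega> \<partial>M)"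
    using cell_event_meas[OF B_fin B_pos h, of j \<kappa>] by (intro nn_integral_indicator[symmetric]) simp
  also have "\<dots> = (\<integral>\<^sup>+\<omega>. (\<Prod>x\<in>{1..L}. \<Prod>i<Suc j. F x i (incr h x i \<omega>)) \<partial>M)"
  proof (rule nn_integral_cong)
    fix \<omega> assume \<omega>: "\<omega> \<in> space M"
    have "(\<Prod>x\<in>{1..L}. \<Prod>i<Suc j. F x i (incr h x i \<omega>)) = (\<Prod>x\<in>B. F x j (incr h x j \<omega>))"
      by (rule FL) (auto simp: F_def)
    also have "\<dots> = (\<Prod>x\<in>B. of_bool (incr h x j \<omega> = of_bool (\<kappa> = Some x)))"
      by (rule prod.cong[OF refl]) (simp add: F_def)
    also have "\<dots> = of_bool (\<forall>x\<in>B. incr h x j \<omega> = of_bool (\<kappa> = Some x))"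
      using B_fin by (induction B rule: finite_induct) auto
    finally show "indicator {\<omega> \<in> space M. \<forall>x\<in>B. incr h x j \<omega> = of_bool (\<kappa> = Some x)} \<omega> = (\<Prod>x\<in>{1..L}. \<Prod>i<Suc j. F x i (incr h x i \<omega>))"
      using \<omega> by (simp only: indicator_def mem_Collect_eq simp_thms)
  qed
  also have "\<dots> = (\<Prod>x\<in>{1..L}. \<Prod>i<Suc j. \<integral>\<^sup>+n. F x i n \<partial>measure_pmf (poisson_pmf h))"
    by (rule N_increments[OF h])
  also have "\<dots> = (\<Prod>x\<in>B. \<integral>\<^sup>+n. F x j n \<partial>measure_pmf (poisson_pmf h))"
    by (rule FL) (auto simp: F_def measure_pmf.emeasure_space_1)
  also have "\<dots> = (\<Prod>x\<in>B. ennreal (exp (- h) * (if \<kappa> = Some x then h else 1)))"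
  proof (rule prod.cong[OF refl])
    fix x assume "x \<in> B"
    then show "(\<integral>\<^sup>+n. F x j n \<partial>measure_pmf (poisson_pmf h)) = ennreal (exp (- h) * (if \<kappa> = Some x then h else 1))"
      using nn_integral_poisson_power(2)[OF h, of 1 "of_bool (\<kappa> = Some x)"]
      by (cases "\<kappa> = Some x") (simp_all add: F_def mult_ac)
  qed
  also have "\<dots> = ennreal (\<Prod>x\<in>B. exp (- h) * (if \<kappa> = Some x then h else 1))"
    using h by (intro prod_ennreal) auto
  also have "(\<Prod>x\<in>B. exp (- h) * (if \<kappa> = Some x then h else 1)) = (\<Prod>x\<in>B. exp (- h)) * (\<Prod>x\<in>B. if \<kappa> = Some x then h else 1)"
    by (rule prod.distrib)
  also have "(\<Prod>x\<in>B. exp (- h)) = exp (- (h * card B))"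
    by (simp add: exp_of_nat_mult[symmetric] mult.commute)
  also have "(\<Prod>x\<in>B. if \<kappa> = Some x then h else 1) = (if \<kappa> = None then 1 else h)"
  proof (cases \<kappa>)
    case (Some z)
    then have "(\<Prod>x\<in>B. if \<kappa> = Some x then h else 1) = (\<Prod>x\<in>B. if x = z then h else 1)"
      by (intro prod.cong) auto
    then show ?thesis using \<kappa> B_fin Some by (auto simp: prod.delta)
  qed simp
  finally show ?thesis .
qed

text \<open>With u = h |B|, a cell is fair with probability exp (- u) (1 + u) \<ge> (1 - u) (1 + u)
  = 1 - u^2.\<close>

lemma unfair_prob:
  assumes h: "0 < h"
  shows "emeasure M {\<omega> \<in> space M. \<not> fair h j \<omega>} \<le> ennreal ((real (card B) * h)\<^sup>2)"
proof -
  define E where "E \<kappa> = {\<omega> \<in> space M. \<forall>x\<in>B. incr h x j \<omega> = of_bool (\<kappa> = Some x)}" for \<kappa>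
  have Em: "E \<kappa> \<in> sets M" for \<kappa> unfolding E_def using cell_event_meas[OF B_fin B_pos h] by simp
  have fairE: "{\<omega> \<in> space M. fair h j \<omega>} = (\<Union>\<kappa>\<in>insert None (Some ` B). E \<kappa>)"
    unfolding fair_def E_def by blast
  have dj: "disjoint_family_on E (insert None (Some ` B))"
    unfolding disjoint_family_on_def
  proof (intro ballI impI)
    fix \<kappa> \<kappa>' assume k: "\<kappa> \<in> insert None (Some ` B)" "\<kappa>' \<in> insert None (Some ` B)" "\<kappa> \<noteq> \<kappa>'"
    then obtain z where z: "z \<in> B" "(\<kappa> = Some z) \<noteq> (\<kappa>' = Some z)" by blast
    have False if "\<omega> \<in> E \<kappa>" "\<omega> \<in> E \<kappa>'" for \<omega>
    proof -
      have "incr h z j \<omega> = of_bool (\<kappa> = Some z)"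
        "incr h z j \<omega> = of_bool (\<kappa>' = Some z)"
        using that z(1) unfolding E_def by blast+
      then have "(of_bool (\<kappa> = Some z) :: nat) = of_bool (\<kappa>' = Some z)" by (rule trans[OF sym])
      then have "(\<kappa> = Some z) = (\<kappa>' = Some z)" by (simp only: of_bool_eq_iff)
      then show False by (rule notE[OF z(2)])
    qed
    then show "E \<kappa> \<inter> E \<kappa>' = {}" by blast
  qed
  have "measure M (\<Union>\<kappa>\<in>insert None (Some ` B). E \<kappa>) = (\<Sum>\<kappa>\<in>insert None (Some ` B). measure M (E \<kappa>))"
    using B_fin Em dj by (intro finite_measure_finite_Union) auto
  also have "\<dots> = (\<Sum>\<kappa>\<in>insert None (Some ` B). exp (- (h * card B)) * (if \<kappa> = None then 1 else h))"
  proof (rule sum.cong[OF refl])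
    fix \<kappa> assume "\<kappa> \<in> insert None (Some ` B)"
    from cell_event_prob[OF h this, of j] show "measure M (E \<kappa>) = exp (- (h * card B)) * (if \<kappa> = None then 1 else h)"
      unfolding E_def[symmetric] using h by (simp add: measure_def)
  qed
  also have "\<dots> = exp (- (h * card B)) * (1 + h * card B)"
    using B_fin by (simp add: sum.reindex algebra_simps)
  finally have p: "measure M {\<omega> \<in> space M. fair h j \<omega>} = exp (- (h * card B)) * (1 + h * card B)"
    unfolding fairE .
  have fm: "{\<omega> \<in> space M. fair h j \<omega>} \<in> sets M"
    unfolding fairE using B_fin Em by auto
  have "1 - (h * card B) \<le> exp (- (h * card B))" using exp_ge_add_one_self[of "- (h * card B)"] by simp
  then have "(1 - h * card B) * (1 + h * card B) \<le> exp (- (h * card B)) * (1 + h * card B)"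
    using h by (intro mult_right_mono) auto
  moreover have "(1 - h * card B) * (1 + h * card B) = 1 - (real (card B) * h)\<^sup>2"
    by (simp add: power2_eq_square algebra_simps)
  ultimately have le: "1 - measure M {\<omega> \<in> space M. fair h j \<omega>} \<le> (real (card B) * h)\<^sup>2" using p by linarith
  have "{\<omega> \<in> space M. \<not> fair h j \<omega>} = space M - {\<omega> \<in> space M. fair h j \<omega>}" by blast
  then have "measure M {\<omega> \<in> space M. \<not> fair h j \<omega>} = 1 - measure M {\<omega> \<in> space M. fair h j \<omega>}"
    using prob_compl[OF fm] by simp
  then show ?thesis using le by (simp add: emeasure_eq_measure ennreal_leI)
qed

lemma unfair_sets: 
  assumes h: "0 < h" shows "{\<omega> \<in> space M. \<not> fair h j \<omega>} \<in> sets M"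
proof -
  have "Measurable.pred M (fair h j)"
    unfolding fair_def[abs_def] by (rule pred_intros_finite) (simp add: B_fin, rule cell_event_meas[OF B_fin B_pos h])
  then show ?thesis by simp
qed

lemma fair_increment:
  assumes "fair h j \<omega>" and h: "0 < h" and \<omega>: "\<omega> \<in> space M"
  shows "nB \<omega> (real (Suc j) * h) \<le> Suc (nB \<omega> (real j * h))"
proof -
  obtain \<kappa> where k: "\<And>x. x \<in> B \<Longrightarrow> incr h x j \<omega> = of_bool (\<kappa> = Some x)"
    using assms(1) unfolding fair_def by blast
  have le: "N x (real j * h) \<omega> \<le> N x (real (Suc j) * h) \<omega>" if "x \<in> B" for x
    by (rule counting_mono[OF N_counting[OF B_ge[OF that] \<omega>]]) (use h in \<open>auto intro: mult_right_mono\<close>)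
  have "nB \<omega> (real (Suc j) * h) - nB \<omega> (real j * h) = (\<Sum>x\<in>B. incr h x j \<omega>)"
    unfolding nB_def by (rule sum_subtractf_nat[symmetric]) (rule le)
  also have "\<dots> = (\<Sum>x\<in>B. of_bool (\<kappa> = Some x))" by (rule sum.cong[OF refl k])
  also have "\<dots> \<le> 1"
  proof (cases \<kappa>)
    case (Some z)
    then have "(\<Sum>x\<in>B. of_bool (\<kappa> = Some x)) = (\<Sum>x\<in>B. if x = z then 1 else 0 :: nat)"
      by (intro sum.cong) auto
    then show ?thesis using B_fin by (simp add: sum.delta)
  qed simp
  finally show ?thesis by simp
qed

text \<open>Up to time K there are K n cells of mesh 1 / n, each unfair with probability of order 1
  / n^2, so almost surely some mesh has only fair cells there. Two simultaneous events would lie in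
  a common cell.\<close>

lemma AE_simple: "AE \<omega> in M. (\<forall>k. reached (nB \<omega>) k) \<longrightarrow> (\<forall>i. S i \<omega> < S (Suc i) \<omega>)"
proof -
  have ae: "AE \<omega> in M. \<exists>r. \<forall>j<K * Suc r. fair (1 / real (Suc r)) j \<omega>" for K
  proof (rule AE_I)
    let ?A = "\<Inter>r. \<Union>j<K * Suc r. {\<omega> \<in> space M. \<not> fair (1 / real (Suc r)) j \<omega>}"
    show "{\<omega> \<in> space M. \<not> (\<exists>r. \<forall>j<K * Suc r. fair (1 / real (Suc r)) j \<omega>)} \<subseteq> ?A"
      by (auto simp del: of_nat_Suc mult_Suc_right)
    have m: "(\<Union>j<K * Suc r. {\<omega> \<in> space M. \<not> fair (1 / real (Suc r)) j \<omega>}) \<in> sets M" for r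
      by (intro sets.finite_UN unfair_sets) auto
    then show "?A \<in> sets M" by (intro sets.countable_INT) auto
    have "emeasure M ?A \<le> ennreal (real K * (real (card B))\<^sup>2 * (1 / real (Suc r)))" for r
    proof -
      have "emeasure M ?A \<le> emeasure M (\<Union>j<K * Suc r. {\<omega> \<in> space M. \<not> fair (1 / real (Suc r)) j \<omega>})"
        by (intro emeasure_mono m) blast
      also have "\<dots> \<le> (\<Sum>j<K * Suc r. emeasure M {\<omega> \<in> space M. \<not> fair (1 / real (Suc r)) j \<omega>})"
        by (intro emeasure_subadditive_finite) (auto intro!: unfair_sets simp del: of_nat_Suc)
      also have "\<dots> \<le> (\<Sum>j<K * Suc r. ennreal ((real (card B) * (1 / real (Suc r)))\<^sup>2))"
        by (intro sum_mono unfair_prob) simp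
      also have "\<dots> = ennreal (real (K * Suc r) * (real (card B) * (1 / real (Suc r)))\<^sup>2)"
        by (simp add: ennreal_mult' ennreal_of_nat_eq_real_of_nat del: of_nat_Suc mult_Suc_right of_nat_mult)
      also have "real (K * Suc r) * (real (card B) * (1 / real (Suc r)))\<^sup>2 = real K * (real (card B))\<^sup>2 * (1 / real (Suc r))"
        by (simp add: power2_eq_square field_simps del: of_nat_Suc mult_Suc_right)
      finally show ?thesis .
    qed
    moreover have "(\<lambda>r. ennreal (real K * (real (card B))\<^sup>2 * (1 / real (Suc r)))) \<longlonglongrightarrow> ennreal (real K * (real (card B))\<^sup>2 * 0)"
      by (intro tendsto_intros tendsto_ennrealI LIMSEQ_Suc[OF lim_1_over_n])
    ultimately have "emeasure M ?A \<le> ennreal (real K * (real (card B))\<^sup>2 * 0)"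
      by (intro LIMSEQ_le_const) blast+
    then show "emeasure M ?A = 0" by simp
  qed
  have "AE \<omega> in M. \<forall>K. \<exists>r. \<forall>j<K * Suc r. fair (1 / real (Suc r)) j \<omega>"
    unfolding AE_all_countable using ae by blast
  then show ?thesis
    using AE_space
  proof eventually_elim
    case (elim \<omega>)
    show ?case
    proof (intro impI allI)
      fix i assume r: "\<forall>k. reached (nB \<omega>) k"
      note n = nB_counting[OF elim(2)]
      have Se: "S k \<omega> = evt (nB \<omega>) k" for k using r by (simp add: S_def)
      have iff: "k \<le> nB \<omega> t \<longleftrightarrow> S k \<omega> \<le> t" if "0 \<le> t" for k t
        using evt_le_iff[OF n that] r by (simp add: Se)
      show "S i \<omega> < S (Suc i) \<omega>"
      proof (rule ccontr)
        assume nl: "\<not> S i \<omega> < S (Suc i) \<omega>"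
        define s where "s = S (Suc i) \<omega>"
        have s0: "0 < s" using evt_pos[OF n r[rule_format], of "Suc i"] by (simp add: s_def Se)
        obtain rr where fair: "\<And>j. j < nat \<lceil>s\<rceil> * Suc rr \<Longrightarrow> fair (1 / real (Suc rr)) j \<omega>"
          using elim(1) by blast
        define h where "h = 1 / real (Suc rr)"
        have h: "0 < h" by (simp add: h_def)
        \<comment> \<open>The cell containing \<open>s\<close> extends from (q - 1) h, exclusive, to
          q h, inclusive.\<close>
        define q where "q = nat \<lceil>s / h\<rceil>"
        have sh: "0 < s / h" using s0 h by simp
        then have q0: "0 < q" by (simp add: q_def)
        then obtain j where j: "q = Suc j" by (cases q) auto
        have sq: "s \<le> real q * h"
          using real_nat_ceiling_ge[of "s / h"] h by (simp add: q_def pos_divide_le_eq)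
        have jq: "real j * h < s"
        proof -
          have "real q < s / h + 1" unfolding q_def using sh by linarith
          then have "real j < s / h" using j by simp
          then show ?thesis using h by (simp add: pos_less_divide_eq)
        qed
        have "real q < s / h + 1" unfolding q_def using sh by linarith
        moreover have "s \<le> real (nat \<lceil>s\<rceil>)" by (rule real_nat_ceiling_ge)
        then have "s * real (Suc rr) \<le> real (nat \<lceil>s\<rceil>) * real (Suc rr)"
          by (intro mult_right_mono) auto
        then have "s / h \<le> real (nat \<lceil>s\<rceil> * Suc rr)"
          unfolding h_def of_nat_mult by (simp del: of_nat_Suc)
        ultimately have "j < nat \<lceil>s\<rceil> * Suc rr" using j by linarith
        then have "nB \<omega> (real (Suc j) * h) \<le> Suc (nB \<omega> (real j * h))"
          using fair_increment[OF fair h[unfolded h_def] elim(2)] by (simp add: h_def)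
        moreover have "Suc i \<le> nB \<omega> (real (Suc j) * h)"
          using iff[of "real (Suc j) * h" "Suc i"] sq j h by (simp add: s_def)
        moreover have "\<not> i \<le> nB \<omega> (real j * h)"
          using iff[of "real j * h" i] jq nl h by (simp add: s_def)
        ultimately show False by simp
      qed
    qed
  qed
qed

lemma AE_good: "AE \<omega> in M. good \<omega>"
  using AE_simple AE_reached AE_regular by eventually_elim (simp add: good_def)

end

text \<open>For one pair of states the results for \<open>B = {x, x'}\<close> apply, and there are
  only countably many pairs.\<close>

lemma (in K_setting) AE_sits_unique:
  "AE \<omega> in M. \<forall>x\<ge>1. \<forall>x'\<ge>1. \<forall>t\<ge>0. K_sits_at \<gamma> c y N T0 T t \<omega> x \<longrightarrow> K_sits_at \<gamma> c y N T0 T t \<omega> x' \<longrightarrow> x = x'"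
proof -
  have "AE \<omega> in M. \<forall>t\<ge>0. K_sits_at \<gamma> c y N T0 T t \<omega> x \<longrightarrow> K_sits_at \<gamma> c y N T0 T t \<omega> x' \<longrightarrow> x = x'"
    if "1 \<le> x" "1 \<le> x'" for x x'
  proof -
    interpret K: K_target M N T0 T \<gamma> c y "{x, x'}"
      by unfold_locales (use that in auto)
    show ?thesis
      using K.AE_good by eventually_elim (use K.sits_unique in blast)
  qed
  then have "AE \<omega> in M. 1 \<le> x \<longrightarrow> 1 \<le> x' \<longrightarrow> (\<forall>t\<ge>0. K_sits_at \<gamma> c y N T0 T t \<omega> x \<longrightarrow> K_sits_at \<gamma> c y N T0 T t \<omega> x' \<longrightarrow> x = x')" for x x'
    by (intro AE_impI)
  then have "AE \<omega> in M. \<forall>x x'. 1 \<le> x \<longrightarrow> 1 \<le> x' \<longrightarrow> (\<forall>t\<ge>0. K_sits_at \<gamma> c y N T0 T t \<omega> x \<longrightarrow> K_sits_at \<gamma> c y N T0 T t \<omega> x' \<longrightarrow> x = x')"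
    unfolding AE_all_countable by (intro allI)
  then show ?thesis
    by (rule eventually_mono) blast
qed

lemma (in K_target) Z_skel:
  "AE \<omega> in M. \<forall>t\<ge>0. \<forall>x\<in>B. K_process \<gamma> c y N T0 T t \<omega> = enat x \<longleftrightarrow> skel_at y UNIV (\<lambda>i. U i \<omega>) (\<lambda>i. V i \<omega>) t x"
  using AE_good AE_sits_unique
proof eventually_elim
  case (elim \<omega>)
  show ?case
    by (intro allI impI ballI Z_skel_good[OF elim(1)]) (use elim(2) in blast)+
qed

text \<open>The sequence may take the value \<open>s\<close> itself, which the filter
  \<open>at_right s\<close> leaves out.\<close>

lemma tendsto_right_sequence:
  fixes f :: "real \<Rightarrow> real"
  assumes f: "(f \<longlongrightarrow> f s) (at_right s)" and X: "X \<longlonglongrightarrow> s" "\<And>r. s \<le> X r"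
  shows "(\<lambda>r. f (X r)) \<longlonglongrightarrow> f s"
proof (rule tendstoI)
  fix e :: real assume e: "0 < e"
  obtain b where b: "s < b" "\<And>u. s < u \<Longrightarrow> u < b \<Longrightarrow> dist (f u) (f s) < e"
    using tendstoD[OF f e] unfolding eventually_at_right_field by blast
  have "\<forall>\<^sub>F r in sequentially. X r < b"
    by (rule order_tendstoD(2)[OF X(1) b(1)])
  then show "\<forall>\<^sub>F r in sequentially. dist (f (X r)) (f s) < e"
  proof eventually_elim
    case (elim r)
    then show ?case using b(2)[of "X r"] X(2)[of r] e by (cases "X r = s") auto
  qed
qed

text \<open>The expression is the factor of one cycle in \<open>grid_sum_integral\<close>: the cell
  with the event, times a geometric series over the number of preceding empty cells. The limit
  follows from 1 - exp (- h \<theta>) being asymptotic to h \<theta>.\<close>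

lemma grid_ratio_limit:
  fixes \<theta> \<theta>' g :: real
  assumes \<theta>: "0 < \<theta>"
  shows "(\<lambda>r. exp (- (1 / real (Suc r) * \<theta>')) * (1 / real (Suc r) * g) / (1 - exp (- (1 / real (Suc r) * \<theta>)))) \<longlonglongrightarrow> g / \<theta>"
proof -
  have h: "(\<lambda>r. 1 / real (Suc r)) \<longlonglongrightarrow> 0"
    by (rule LIMSEQ_Suc[OF lim_1_over_n])
  have z: "(\<lambda>r. - (1 / real (Suc r) * \<theta>)) \<longlonglongrightarrow> - (0 * \<theta>)"
    by (intro tendsto_intros h)
  have "filterlim (\<lambda>r. - (1 / real (Suc r) * \<theta>)) (at 0) sequentially"
    unfolding filterlim_at using z \<theta> by (auto intro!: always_eventually simp del: of_nat_Suc)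
  from filterlim_compose[OF lim_exp_minus_1 this]
  have l: "(\<lambda>r. (exp (- (1 / real (Suc r) * \<theta>)) - 1) / (- (1 / real (Suc r) * \<theta>))) \<longlonglongrightarrow> 1" .
  have "(\<lambda>r. exp (- (1 / real (Suc r) * \<theta>')) * g / (\<theta> * ((exp (- (1 / real (Suc r) * \<theta>)) - 1) / (- (1 / real (Suc r) * \<theta>))))) \<longlonglongrightarrow>
      exp (- (0 * \<theta>')) * g / (\<theta> * 1)"
    using \<theta> by (intro tendsto_intros h l) auto
  moreover have "exp (- (1 / real (Suc r) * \<theta>')) * g / (\<theta> * ((exp (- (1 / real (Suc r) * \<theta>)) - 1) / (- (1 / real (Suc r) * \<theta>)))) =
      exp (- (1 / real (Suc r) * \<theta>')) * (1 / real (Suc r) * g) / (1 - exp (- (1 / real (Suc r) * \<theta>)))" for r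
  proof -
    define k where "k = 1 / real (Suc r)"
    have k: "0 < k" by (simp add: k_def)
    have "0 < k * \<theta>" using k \<theta> by simp
    then have "exp (- (k * \<theta>)) < 1" by (simp only: exp_less_one_iff neg_less_0_iff_less)
    then have "1 - exp (- (k * \<theta>)) \<noteq> 0" by linarith
    moreover have "\<theta> * ((exp (- (k * \<theta>)) - 1) / (- (k * \<theta>))) = (1 - exp (- (k * \<theta>))) / k"
      using k \<theta> by (simp add: field_simps)
    ultimately show ?thesis
      unfolding k_def[symmetric] using k by (simp add: field_simps)
  qed
  ultimately show ?thesis by simp
qed

section \<open>Refining grids and the transform of the skeleton of the K-process\<close>

context K_target
begin

text \<open>The sum runs over the possible cells of the first \<open>m\<close> events after the cell \<open>J\<close>. Once the mesh separates the
  events of a path, a single term of it is nonzero.\<close>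

primrec grid_sum :: "real \<Rightarrow> nat \<Rightarrow> nat \<Rightarrow> (nat \<Rightarrow> real) \<Rightarrow> (nat \<Rightarrow> nat) \<Rightarrow> 'v \<Rightarrow> ennreal" where
  "grid_sum h 0 J a x \<omega> = 1"
| "grid_sum h (Suc m) J a x \<omega> = (\<Sum>d. (\<Prod>j<d. cellfac h B (J + j) (a 0) None \<omega>) *
    cellfac h B (J + d) (a 1) (Some (x 0)) \<omega> * grid_sum h m (Suc (J + d)) (\<lambda>k. a (k + 2)) (\<lambda>k. x (Suc k)) \<omega>)"

declare grid_sum.simps(2) [simp del]

lemma grid_sum_meas [measurable]: "0 < h \<Longrightarrow> grid_sum h m J a x \<in> borel_measurable M"
proof (induction m arbitrary: J a x)
  case 0
  then show ?case by (simp add: grid_sum.simps(1)[abs_def])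
next
  case (Suc m)
  note [measurable] = cellfac_meas[OF B_fin B_pos Suc.prems] Suc.IH[OF Suc.prems]
  show ?case unfolding grid_sum.simps(2)[abs_def] by measurable
qed

lemma exponent_pos: "0 < a \<Longrightarrow> 0 < exponent \<gamma> c B a"
  unfolding exponent_def
proof (intro add_nonneg_pos add_nonneg_nonneg)
  assume a: "0 < a"
  show "0 \<le> a * (\<Sum>n. hold_res \<gamma> a (Suc n))"
    using a hold_res_pos[of \<gamma> _ a] gam_Suc \<gamma>_pos hold_res_summable[of \<gamma> a] \<gamma>_summable
    by (intro mult_nonneg_nonneg suminf_nonneg) (auto simp: less_imp_le hold_res_def)
  show "0 < (\<Sum>x\<in>B. hold_lap \<gamma> a x)"
  proof (rule sum_pos[OF B_fin B_ne])
    fix x assume "x \<in> B"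
    then have "0 < a * \<gamma> x" using a \<gamma>_pos[OF B_ge] by (intro mult_pos_pos)
    then show "0 < hold_lap \<gamma> a x" unfolding hold_lap_def by simp
  qed
qed (use c_nonneg in auto)

text \<open>A prescription \<open>p\<close>, \<open>\<kappa>\<close> for the first \<open>J\<close>
  cells is carried along so that each term of the sum over \<open>d\<close> is again of this form,
  with \<open>Suc (J + d)\<close> cells. The terms form a geometric series whose ratio is the value
  of an empty cell.\<close>

lemma grid_sum_integral:
  assumes h: "0 < h" and b: "0 \<le> b"
  shows "(\<And>j. 0 < p j) \<Longrightarrow> (\<And>j z. \<kappa> j = Some z \<Longrightarrow> z \<in> B) \<Longrightarrow> (\<And>k. 0 < a k) \<Longrightarrow> (\<And>k. x k \<in> B) \<Longrightarrow>
    (\<integral>\<^sup>+\<omega>. nexp (b * (gam0 * T0 \<omega>)) * (\<Prod>j<J. cellfac h B j (p j) (\<kappa> j) \<omega>) * grid_sum h m J a x \<omega> \<partial>M) =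
    ennreal (1 / (1 + b * gam0)) * (\<Prod>j<J. ennreal (cellval h B (p j) (\<kappa> j))) *
     (\<Prod>k<m. ennreal (exp (- (h * exponent \<gamma> c B (a (2 * k + 1)))) * (h * hold_lap \<gamma> (a (2 * k + 1)) (x k)) / (1 - exp (- (h * exponent \<gamma> c B (a (2 * k)))))))"
proof (induction m arbitrary: J p \<kappa> a x)
  case 0
  then show ?case using cell_laplace[OF B_fin B_pos h b, of p \<kappa> J] by simp
next
  case (Suc m)
  note [measurable] = cellfac_meas[OF B_fin B_pos h] grid_sum_meas[OF h]
  \<comment> \<open>The old prescription, followed by \<open>d\<close> empty cells and the cell with
    the event.\<close>
  define p' where "p' d j = (if j < J then p j else if j < J + d then a 0 else a 1)" for d j
  define \<kappa>' where "\<kappa>' d j = (if j < J then \<kappa> j else if j < J + d then None else Some (x 0))" for d j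
  define a' where "a' k = a (k + 2)" for k
  define x' where "x' k = x (Suc k)" for k
  have split: "(\<Prod>j<Suc (J + d). F j (p' d j) (\<kappa>' d j)) = (\<Prod>j<J. F j (p j) (\<kappa> j)) * ((\<Prod>j<d. F (J + j) (a 0) None) * F (J + d) (a 1) (Some (x 0)))"
    for d and F :: "nat \<Rightarrow> real \<Rightarrow> nat option \<Rightarrow> ennreal"
  proof -
    have "(\<Prod>j<J + d'. F j (p' d j) (\<kappa>' d j)) = (\<Prod>j<J. F j (p j) (\<kappa> j)) * (\<Prod>j<d'. F (J + j) (a 0) None)" if "d' \<le> d" for d'
      using that
    proof (induction d')
      case 0
      then show ?case by (simp add: p'_def \<kappa>'_def)
    next
      case (Suc d')
      then show ?case by (simp add: p'_def \<kappa>'_def mult.assoc)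
    qed
    from this[of d] show ?thesis by (simp add: p'_def \<kappa>'_def mult.assoc)
  qed
  define E where "E \<omega> = nexp (b * (gam0 * T0 \<omega>))" for \<omega>
  have [measurable]: "E \<in> borel_measurable M" unfolding E_def[abs_def] by measurable
  define R where "R = (\<Prod>k<m. ennreal (exp (- (h * exponent \<gamma> c B (a' (2 * k + 1)))) * (h * hold_lap \<gamma> (a' (2 * k + 1)) (x' k)) / (1 - exp (- (h * exponent \<gamma> c B (a' (2 * k)))))))"
  define v where "v = exp (- (h * exponent \<gamma> c B (a 0)))"
  define w where "w = exp (- (h * exponent \<gamma> c B (a 1))) * (h * hold_lap \<gamma> (a 1) (x 0))"
  have v: "0 \<le> v" "v < 1" using exponent_pos[OF Suc.prems(3)[of 0]] h by (simp_all add: v_def)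
  have w: "0 \<le> w" unfolding w_def using h hold_lap_bounds[of "a 1" "x 0"] Suc.prems(3)[of 1] B_ge[OF Suc.prems(4)[of 0]]
    by (intro mult_nonneg_nonneg) auto
  have "(\<integral>\<^sup>+\<omega>. E \<omega> * (\<Prod>j<J. cellfac h B j (p j) (\<kappa> j) \<omega>) * grid_sum h (Suc m) J a x \<omega> \<partial>M) =
     (\<integral>\<^sup>+\<omega>. (\<Sum>d. E \<omega> * (\<Prod>j<Suc (J + d). cellfac h B j (p' d j) (\<kappa>' d j) \<omega>) * grid_sum h m (Suc (J + d)) a' x' \<omega>) \<partial>M)"
  proof (rule nn_integral_cong)
    fix \<omega>
    have "E \<omega> * (\<Prod>j<J. cellfac h B j (p j) (\<kappa> j) \<omega>) * grid_sum h (Suc m) J a x \<omega> =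
       (\<Sum>d. E \<omega> * (\<Prod>j<J. cellfac h B j (p j) (\<kappa> j) \<omega>) * ((\<Prod>j<d. cellfac h B (J + j) (a 0) None \<omega>) *
        cellfac h B (J + d) (a 1) (Some (x 0)) \<omega> * grid_sum h m (Suc (J + d)) a' x' \<omega>))"
      unfolding grid_sum.simps(2) a'_def[abs_def] x'_def[abs_def] by (rule ennreal_suminf_cmult[symmetric])
    also have "\<dots> = (\<Sum>d. E \<omega> * (\<Prod>j<Suc (J + d). cellfac h B j (p' d j) (\<kappa>' d j) \<omega>) * grid_sum h m (Suc (J + d)) a' x' \<omega>)"
      unfolding split[of "\<lambda>j p \<kappa>. cellfac h B j p \<kappa> \<omega>"] by (simp only: mult.assoc)
    finally show "E \<omega> * (\<Prod>j<J. cellfac h B j (p j) (\<kappa> j) \<omega>) * grid_sum h (Suc m) J a x \<omega> =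
       (\<Sum>d. E \<omega> * (\<Prod>j<Suc (J + d). cellfac h B j (p' d j) (\<kappa>' d j) \<omega>) * grid_sum h m (Suc (J + d)) a' x' \<omega>)" .
  qed
  also have "\<dots> = (\<Sum>d. \<integral>\<^sup>+\<omega>. E \<omega> * (\<Prod>j<Suc (J + d). cellfac h B j (p' d j) (\<kappa>' d j) \<omega>) * grid_sum h m (Suc (J + d)) a' x' \<omega> \<partial>M)"
    by (rule nn_integral_suminf) measurable
  also have "\<dots> = (\<Sum>d. ennreal (1 / (1 + b * gam0)) * (\<Prod>j<Suc (J + d). ennreal (cellval h B (p' d j) (\<kappa>' d j))) * R)"
  proof (rule suminf_cong)
    fix d
    show "(\<integral>\<^sup>+\<omega>. E \<omega> * (\<Prod>j<Suc (J + d). cellfac h B j (p' d j) (\<kappa>' d j) \<omega>) * grid_sum h m (Suc (J + d)) a' x' \<omega> \<partial>M) =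
      ennreal (1 / (1 + b * gam0)) * (\<Prod>j<Suc (J + d). ennreal (cellval h B (p' d j) (\<kappa>' d j))) * R"
      unfolding E_def R_def
    proof (rule Suc.IH)
      show "0 < p' d j" for j using Suc.prems by (simp add: p'_def)
      show "\<kappa>' d j = Some z \<Longrightarrow> z \<in> B" for j z using Suc.prems by (auto simp: \<kappa>'_def split: if_splits)
      show "0 < a' k" for k using Suc.prems by (simp add: a'_def)
      show "x' k \<in> B" for k using Suc.prems by (simp add: x'_def)
    qed
  qed
  also have "\<dots> = (\<Sum>d. (ennreal (1 / (1 + b * gam0)) * (\<Prod>j<J. ennreal (cellval h B (p j) (\<kappa> j))) * R * ennreal w) * ennreal (v ^ d))"
  proof (rule suminf_cong)
    fix d
    have "(\<Prod>j<d. ennreal (cellval h B (a 0) None)) * ennreal (cellval h B (a 1) (Some (x 0))) = ennreal w * ennreal (v ^ d)"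
      using v(1) by (simp add: cellval_def v_def[symmetric] w_def ennreal_power mult.commute)
    then show "ennreal (1 / (1 + b * gam0)) * (\<Prod>j<Suc (J + d). ennreal (cellval h B (p' d j) (\<kappa>' d j))) * R =
       (ennreal (1 / (1 + b * gam0)) * (\<Prod>j<J. ennreal (cellval h B (p j) (\<kappa> j))) * R * ennreal w) * ennreal (v ^ d)"
      unfolding split[of "\<lambda>j p \<kappa>. ennreal (cellval h B p \<kappa>)"] by (simp only: mult_ac)
  qed
  also have "\<dots> = (ennreal (1 / (1 + b * gam0)) * (\<Prod>j<J. ennreal (cellval h B (p j) (\<kappa> j))) * R * ennreal w) * (\<Sum>d. ennreal (v ^ d))"
    by (rule ennreal_suminf_cmult)
  also have "(\<Sum>d. ennreal (v ^ d)) = ennreal (1 / (1 - v))"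
    using v by (intro suminf_ennreal_eq geometric_sums) auto
  also have "(ennreal (1 / (1 + b * gam0)) * (\<Prod>j<J. ennreal (cellval h B (p j) (\<kappa> j))) * R * ennreal w) * ennreal (1 / (1 - v)) =
      ennreal (1 / (1 + b * gam0)) * (\<Prod>j<J. ennreal (cellval h B (p j) (\<kappa> j))) * (ennreal (w / (1 - v)) * R)"
  proof -
    have "ennreal w * ennreal (1 / (1 - v)) = ennreal (w / (1 - v))"
      using w v by (simp add: ennreal_mult[symmetric])
    from this[symmetric] show ?thesis by (simp only: mult_ac)
  qed
  also have "ennreal (w / (1 - v)) * R = (\<Prod>k<Suc m. ennreal (exp (- (h * exponent \<gamma> c B (a (2 * k + 1)))) * (h * hold_lap \<gamma> (a (2 * k + 1)) (x k)) / (1 - exp (- (h * exponent \<gamma> c B (a (2 * k)))))))"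
    unfolding prod.lessThan_Suc_shift R_def a'_def x'_def w_def v_def by simp
  finally show ?case unfolding E_def .
qed

lemma cellfac_le_1:
  assumes r: "regular \<omega>" and h: "0 < h" and a: "0 \<le> a"
  shows "cellfac h B j a \<kappa> \<omega> \<le> 1"
proof -
  have "G (real j * h) \<omega> \<le> G (real (Suc j) * h) \<omega>"
    using h by (intro G_mono[OF r]) (auto intro: mult_right_mono)
  then have "nexp (a * (G (real (Suc j) * h) \<omega> - G (real j * h) \<omega>)) \<le> 1"
    using a by (simp del: of_nat_Suc)
  then show ?thesis
    unfolding cellfac_def by (intro mult_le_one) auto
qed

context
  fixes \<omega> assumes good: "good \<omega>"
begin

lemmas r = good_regular[OF good]

text \<open>For \<open>i > 0\<close> the event time \<open>S i\<close> lies in the cell that ends at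
  this grid point, open on the left and closed on the right; for \<open>i = 0\<close> the value is
  0.\<close>

definition cell_end :: "real \<Rightarrow> nat \<Rightarrow> nat" where
  "cell_end h i = nat \<lceil>S i \<omega> / h\<rceil>"

lemma cell_end_ge:
  assumes "0 < h" shows "S i \<omega> \<le> real (cell_end h i) * h"
  using real_nat_ceiling_ge[of "S i \<omega> / h"] assms by (simp add: cell_end_def pos_divide_le_eq)

lemma cell_end_less:
  assumes h: "0 < h" and j: "real j * h < S i \<omega>"
  shows "j < cell_end h i"
proof -
  have "real j * h < real (cell_end h i) * h" using cell_end_ge[OF h, of i] j by linarith
  then show ?thesis using h by simp
qed

lemma cell_end_pred:
  assumes h: "0 < h"
  shows "0 < cell_end h (Suc i)" "real (cell_end h (Suc i) - 1) * h < S (Suc i) \<omega>"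
proof -
  show p: "0 < cell_end h (Suc i)" using cell_end_less[OF h, of 0 "Suc i"] S_Suc_pos[OF good] by simp
  have "0 < S (Suc i) \<omega> / h" using S_Suc_pos[OF good] h by simp
  then have "real (cell_end h (Suc i)) < S (Suc i) \<omega> / h + 1" unfolding cell_end_def by linarith
  then have "real (cell_end h (Suc i) - 1) < S (Suc i) \<omega> / h" using p by (simp add: of_nat_diff)
  then show "real (cell_end h (Suc i) - 1) * h < S (Suc i) \<omega>" using h by (simp add: pos_less_divide_eq)
qed

lemma cellfac_None_prod:
  assumes "\<And>j x. j < d \<Longrightarrow> x \<in> B \<Longrightarrow> N x (real (Suc (J + j)) * h) \<omega> = N x (real (J + j) * h) \<omega>"
  shows "(\<Prod>j<d. cellfac h B (J + j) a None \<omega>) = nexp (a * (G (real (J + d) * h) \<omega> - G (real J * h) \<omega>))"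
  using assms
proof (induction d)
  case (Suc d)
  have "cellfac h B (J + d) a None \<omega> = nexp (a * (G (real (J + Suc d) * h) \<omega> - G (real (J + d) * h) \<omega>))"
    using Suc.prems[of d] by (simp add: cellfac_def del: of_nat_Suc)
  moreover have "(\<Prod>j<d. cellfac h B (J + j) a None \<omega>) = nexp (a * (G (real (J + d) * h) \<omega> - G (real J * h) \<omega>))"
    by (rule Suc.IH) (rule Suc.prems, simp_all)
  ultimately show ?case
    unfolding prod.lessThan_Suc by (simp only: ennreal_mult''[OF exp_ge_zero, symmetric] mult_exp_exp) (simp add: algebra_simps)
qed simp

text \<open>Only the \<open>d\<close> whose cell contains the next event can contribute: a smaller
  one asks for an event in an empty cell, a larger one forbids events in the cell that has
  one.\<close>

lemma grid_sum_collapse: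
  assumes h: "0 < h" and i: "nB \<omega> (real J * h) = i" and x: "x 0 \<in> B"
  defines "q \<equiv> cell_end h (Suc i)"
  shows "J < q" "grid_sum h (Suc m) J a x \<omega> =
    nexp (a 0 * (G (real (q - 1) * h) \<omega> - G (real J * h) \<omega>)) *
    cellfac h B (q - 1) (a 1) (Some (x 0)) \<omega> * grid_sum h m q (\<lambda>k. a (k + 2)) (\<lambda>k. x (Suc k)) \<omega>"
proof -
  have J0: "0 \<le> real J * h" using h by simp
  have SJ: "S i \<omega> \<le> real J * h" "real J * h < S (Suc i) \<omega>"
    using nB_eq_iff[OF good J0, of i] i by auto
  show Jq: "J < q" unfolding q_def by (rule cell_end_less[OF h SJ(2)])
  define d where "d = q - 1 - J"
  have Jd: "J + d = q - 1" "Suc (J + d) = q" using Jq by (simp_all add: d_def)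
  have const: "N x (real (J + j') * h) \<omega> = N x (real J * h) \<omega>" if "x \<in> B" "j' \<le> d" for x j'
  proof -
    have le: "real (J + j') * h \<le> real (q - 1) * h"
      using that h Jd by (intro mult_right_mono) auto
    have ge: "real J * h \<le> real (J + j') * h" using h by (intro mult_right_mono) auto
    have "nB \<omega> (real (J + j') * h) = i"
    proof (rule nB_eq_iff[OF good, THEN iffD2, OF _ conjI])
      show "0 \<le> real (J + j') * h" using h by simp
      show "S i \<omega> \<le> real (J + j') * h" using SJ(1) ge by linarith
      show "real (J + j') * h < S (Suc i) \<omega>" using le cell_end_pred(2)[OF h, of i] unfolding q_def by linarith
    qed
    then show ?thesis using i ge h by (intro N_const[OF good that(1), symmetric]) auto
  qed
  have jump: "\<exists>x\<in>B. incr h x (J + d) \<omega> \<noteq> 0"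
  proof (rule ccontr)
    assume n: "\<not> ?thesis"
    have le: "real (J + d) * h \<le> real (Suc (J + d)) * h" using h by (intro mult_right_mono) auto
    have "N x (real (Suc (J + d)) * h) \<omega> = N x (real (J + d) * h) \<omega>" if "x \<in> B" for x
      using n that N_mono[OF good that _ le] h by force
    then have "nB \<omega> (real q * h) = nB \<omega> (real J * h)"
      unfolding nB_def Jd(2) using const[of _ d] by (intro sum.cong) auto
    moreover have "Suc i \<le> nB \<omega> (real q * h)"
      using nB_ge_iff[OF good, of "real q * h" "Suc i"] cell_end_ge[OF h, of "Suc i"] h unfolding q_def by simp
    ultimately show False using i by simp
  qed
  have eq: "N x (real (Suc (J + j)) * h) \<omega> = N x (real (J + j) * h) \<omega>" if "j < d" "x \<in> B" for j x
    using const[OF that(2), of j] const[OF that(2), of "Suc j"] that(1) by (simp del: of_nat_Suc)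
  have None0: "cellfac h B (J + d) a' None \<omega> = 0" for a'
  proof -
    have "\<not> (\<forall>x\<in>B. incr h x (J + d) \<omega> = of_bool (None = Some x))"
      using jump by auto
    then show ?thesis unfolding cellfac_def by (simp only: of_bool_eq mult_zero_right)
  qed
  have Some0: "cellfac h B (J + j) a' (Some (x 0)) \<omega> = 0" if "j < d" for j a'
  proof -
    have "\<not> (\<forall>z\<in>B. incr h z (J + j) \<omega> = of_bool (Some (x 0) = Some z))"
      using eq[OF that x] x by (intro notI) (drule bspec[OF _ x], simp)
    then show ?thesis unfolding cellfac_def by (simp only: of_bool_eq mult_zero_right)
  qed
  have "grid_sum h (Suc m) J a x \<omega> = (\<Sum>d\<in>{d}. (\<Prod>j<d. cellfac h B (J + j) (a 0) None \<omega>) *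
    cellfac h B (J + d) (a 1) (Some (x 0)) \<omega> * grid_sum h m (Suc (J + d)) (\<lambda>k. a (k + 2)) (\<lambda>k. x (Suc k)) \<omega>)"
    unfolding grid_sum.simps(2)
  proof (rule suminf_finite)
    fix e assume "e \<notin> {d}"
    then consider "e < d" | "d < e" by fastforce
    then show "(\<Prod>j<e. cellfac h B (J + j) (a 0) None \<omega>) *
      cellfac h B (J + e) (a 1) (Some (x 0)) \<omega> * grid_sum h m (Suc (J + e)) (\<lambda>k. a (k + 2)) (\<lambda>k. x (Suc k)) \<omega> = 0"
    proof cases
      case 1
      then show ?thesis by (simp add: Some0)
    next
      case 2
      then have "(\<Prod>j<e. cellfac h B (J + j) (a 0) None \<omega>) = 0"
        by (intro prod_zero) (auto intro: bexI[of _ d] None0)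
      then show ?thesis by simp
    qed
  qed simp
  also have "\<dots> = nexp (a 0 * (G (real (q - 1) * h) \<omega> - G (real J * h) \<omega>)) *
    cellfac h B (q - 1) (a 1) (Some (x 0)) \<omega> * grid_sum h m q (\<lambda>k. a (k + 2)) (\<lambda>k. x (Suc k)) \<omega>"
  proof -
    have "(\<Prod>j<d. cellfac h B (J + j) (a 0) None \<omega>) = nexp (a 0 * (G (real (J + d) * h) \<omega> - G (real J * h) \<omega>))"
      by (rule cellfac_None_prod) (rule eq)
    then show ?thesis unfolding Jd(1)[symmetric] by (simp only: Jd(2) sum.insert sum.empty finite.emptyI empty_iff not_False_eq_True add_0_right)
  qed
  finally show "grid_sum h (Suc m) J a x \<omega> =
    nexp (a 0 * (G (real (q - 1) * h) \<omega> - G (real J * h) \<omega>)) *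
    cellfac h B (q - 1) (a 1) (Some (x 0)) \<omega> * grid_sum h m q (\<lambda>k. a (k + 2)) (\<lambda>k. x (Suc k)) \<omega>" .
qed

text \<open>The bound for dominated convergence; after \<open>grid_sum_collapse\<close> the series
  is a single product of factors at most 1.\<close>

lemma grid_sum_le_1:
  assumes h: "0 < h"
  shows "(\<And>k. 0 < a k) \<Longrightarrow> (\<And>k. x k \<in> B) \<Longrightarrow> grid_sum h m J a x \<omega> \<le> 1"
proof (induction m arbitrary: J a x)
  case (Suc m)
  define i where "i = nB \<omega> (real J * h)"
  note c = grid_sum_collapse(1)[OF h i_def[symmetric] Suc.prems(2)] grid_sum_collapse(2)[OF h i_def[symmetric] Suc.prems(2), where m=m and a=a]
  have "G (real J * h) \<omega> \<le> G (real (cell_end h (Suc i) - 1) * h) \<omega>"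
    using c(1) h by (intro G_mono[OF r]) (auto intro!: mult_right_mono)
  then have "nexp (a 0 * (G (real (cell_end h (Suc i) - 1) * h) \<omega> - G (real J * h) \<omega>)) \<le> 1"
    using Suc.prems(1)[of 0] by simp
  then show ?case
    unfolding c(2) using Suc.prems by (intro mult_le_one cellfac_le_1[OF r h] Suc.IH) (auto intro: less_imp_le)
qed simp

text \<open>For a fine mesh the cells of the events concerned contain no further event. Their right
  ends tend to the event times from the right, where the clock is right-continuous; their left ends
  stay strictly before, where the clock tends to its left limit.\<close>

lemma grid_sum_limit:
  shows "(\<And>k. x k \<in> B) \<Longrightarrow> (\<lambda>n. grid_sum (1 / real (Suc n)) m (cell_end (1 / real (Suc n)) i) a x \<omega>) \<longlonglongrightarrow>
    (\<Prod>k<m. nexp (a (2 * k) * V (2 * (i + k) + 1) \<omega>) * nexp (a (2 * k + 1) * V (2 * (i + k) + 2) \<omega>) *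
      of_bool (U (i + k) \<omega> = x k))"
proof (induction m arbitrary: i a x)
  case (Suc m)
  define h where "h n = 1 / real (Suc n)" for n
  have h: "0 < h n" for n by (simp add: h_def)
  have h0: "h \<longlonglongrightarrow> 0" unfolding h_def[abs_def] by (rule LIMSEQ_Suc[OF lim_1_over_n])
  define X where "X k n = real (cell_end (h n) k) * h n" for k n
  define X' where "X' n = real (cell_end (h n) (Suc i) - 1) * h n" for n
  have X_ge: "S k \<omega> \<le> X k n" for k n unfolding X_def by (rule cell_end_ge[OF h])
  have X_le: "X k n \<le> S k \<omega> + h n" for k n
  proof (cases "S k \<omega> = 0")
    case True
    then show ?thesis using h[of n] by (simp add: X_def cell_end_def)
  next
    case False
    then have "0 < S k \<omega> / h n" using S_nonneg[of k \<omega>] h[of n] by simp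
    then have "real (cell_end (h n) k) \<le> S k \<omega> / h n + 1" unfolding cell_end_def by linarith
    then have "X k n \<le> (S k \<omega> / h n + 1) * h n" unfolding X_def using h[of n] by (intro mult_right_mono) auto
    also have "\<dots> = S k \<omega> + h n" using h[of n] by (simp add: distrib_right)
    finally show ?thesis .
  qed
  have X_lim: "X k \<longlonglongrightarrow> S k \<omega>" for k
  proof (rule tendsto_sandwich[OF _ _ tendsto_const])
    show "\<forall>\<^sub>F n in sequentially. S k \<omega> \<le> X k n" "\<forall>\<^sub>F n in sequentially. X k n \<le> S k \<omega> + h n"
      using X_ge X_le by auto
    have "(\<lambda>n. S k \<omega> + h n) \<longlonglongrightarrow> S k \<omega> + 0" by (intro tendsto_intros h0)
    then show "(\<lambda>n. S k \<omega> + h n) \<longlonglongrightarrow> S k \<omega>" by simp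
  qed
  have X'_eq: "X' n = X (Suc i) n - h n" for n
    using cell_end_pred(1)[OF h[of n], of i] by (simp add: X'_def X_def of_nat_diff left_diff_distrib)
  have "X' \<longlonglongrightarrow> S (Suc i) \<omega> - 0"
    unfolding X'_eq[abs_def] by (intro tendsto_intros X_lim h0)
  then have X'_lim: "X' \<longlonglongrightarrow> S (Suc i) \<omega>" by simp
  have X'_less: "X' n < S (Suc i) \<omega>" for n
    unfolding X'_def by (rule cell_end_pred(2)[OF h])
  have GX: "(\<lambda>n. G (X k n) \<omega>) \<longlonglongrightarrow> G (S k \<omega>) \<omega>" for k
    by (rule tendsto_right_sequence[OF G_right[OF r S_nonneg] X_lim X_ge])
  have "filterlim X' (at_left (S (Suc i) \<omega>)) sequentially"
    unfolding filterlim_at using X'_lim X'_less by (auto simp: less_imp_neq)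
  then have GX': "(\<lambda>n. G (X' n) \<omega>) \<longlonglongrightarrow> Gl (S (Suc i) \<omega>) \<omega>"
    by (rule filterlim_compose[OF G_left(1)[OF r S_Suc_pos[OF good]]])
  \<comment> \<open>It suffices that the cells of the events \<open>i\<close> and
    \<open>Suc i\<close> end before the respective next events.\<close>
  have ev: "\<forall>\<^sub>F n in sequentially. grid_sum (h n) (Suc m) (cell_end (h n) i) a x \<omega> =
     nexp (a 0 * (G (X' n) \<omega> - G (X i n) \<omega>)) * (nexp (a 1 * (G (X (Suc i) n) \<omega> - G (X' n) \<omega>)) * of_bool (U i \<omega> = x 0)) *
     grid_sum (h n) m (cell_end (h n) (Suc i)) (\<lambda>k. a (k + 2)) (\<lambda>k. x (Suc k)) \<omega>"
    using order_tendstoD(2)[OF X_lim S_less[OF good], of i] order_tendstoD(2)[OF X_lim S_less[OF good], of "Suc i"]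
  proof eventually_elim
    case (elim n)
    have X0: "0 \<le> X k n" for k using X_ge[of k n] S_nonneg[of k \<omega>] by linarith
    have nBi: "nB \<omega> (X i n) = i" using nB_eq_iff[OF good X0] X_ge[of i n] elim(1) by blast
    note col = grid_sum_collapse(1)[OF h nBi[unfolded X_def] Suc.prems] grid_sum_collapse(2)[OF h nBi[unfolded X_def] Suc.prems, where m=m and a=a]
    have "X i n \<le> X' n" unfolding X_def X'_def using col(1) h[of n] by (intro mult_right_mono) auto
    then have X'0: "0 \<le> X' n" "S i \<omega> \<le> X' n" using X0[of i] X_ge[of i n] by linarith+
    have nB': "nB \<omega> (X' n) = i" using nB_eq_iff[OF good X'0(1)] X'0(2) X'_less by blast
    have nBS: "nB \<omega> (X (Suc i) n) = Suc i" using nB_eq_iff[OF good X0] X_ge[of "Suc i" n] elim(2) by blast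
    have N1: "N z (X (Suc i) n) \<omega> = N z (S (Suc i) \<omega>) \<omega>" if "z \<in> B" for z
      using nBS nB_S[OF good] by (intro N_const[OF good that S_nonneg X_ge, symmetric]) simp
    have N2: "N z (X' n) \<omega> = N z (S i \<omega>) \<omega>" if "z \<in> B" for z
      using nB' nB_S[OF good] by (intro N_const[OF good that S_nonneg X'0(2), symmetric]) simp
    have sq: "Suc (cell_end (h n) (Suc i) - 1) = cell_end (h n) (Suc i)" using col(1) by simp
    have "(\<forall>z\<in>B. N z (X (Suc i) n) \<omega> - N z (X' n) \<omega> = of_bool (Some (x 0) = Some z)) \<longleftrightarrow> U i \<omega> = x 0"
    proof
      assume *: "\<forall>z\<in>B. N z (X (Suc i) n) \<omega> - N z (X' n) \<omega> = of_bool (Some (x 0) = Some z)"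
      have "N (x 0) (S (Suc i) \<omega>) \<omega> - N (x 0) (S i \<omega>) \<omega> = of_bool (x 0 = U i \<omega>)"
        using U_jump[OF good, of i] Suc.prems by blast
      moreover have "N (x 0) (S (Suc i) \<omega>) \<omega> - N (x 0) (S i \<omega>) \<omega> = 1"
        using bspec[OF * Suc.prems[of 0]] unfolding N1[OF Suc.prems[of 0]] N2[OF Suc.prems[of 0]] by simp
      ultimately show "U i \<omega> = x 0" by (cases "x 0 = U i \<omega>") auto
    next
      assume u: "U i \<omega> = x 0"
      show "\<forall>z\<in>B. N z (X (Suc i) n) \<omega> - N z (X' n) \<omega> = of_bool (Some (x 0) = Some z)"
      proof
        fix z assume z: "z \<in> B"
        have "N z (S (Suc i) \<omega>) \<omega> - N z (S i \<omega>) \<omega> = of_bool (z = U i \<omega>)"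
          using U_jump[OF good, of i] z by blast
        then show "N z (X (Suc i) n) \<omega> - N z (X' n) \<omega> = of_bool (Some (x 0) = Some z)"
          unfolding N1[OF z] N2[OF z] u option.inject by (simp only: eq_commute)
      qed
    qed
    then have "cellfac (h n) B (cell_end (h n) (Suc i) - 1) (a 1) (Some (x 0)) \<omega> =
        nexp (a 1 * (G (X (Suc i) n) \<omega> - G (X' n) \<omega>)) * of_bool (U i \<omega> = x 0)"
      unfolding cellfac_def sq X_def[symmetric] X'_def[symmetric] by (simp only:)
    then show ?case unfolding col(2) X_def[symmetric] X'_def[symmetric] by (simp only:)
  qed
  define P where "P = (\<Prod>k<m. nexp (a (2 * k + 2) * V (2 * (Suc i + k) + 1) \<omega>) * nexp (a (2 * k + 1 + 2) * V (2 * (Suc i + k) + 2) \<omega>) *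
      of_bool (U (Suc i + k) \<omega> = x (Suc k)))"
  have IH: "(\<lambda>n. grid_sum (h n) m (cell_end (h n) (Suc i)) (\<lambda>k. a (k + 2)) (\<lambda>k. x (Suc k)) \<omega>) \<longlonglongrightarrow> P"
    unfolding h_def P_def by (rule Suc.IH) (rule Suc.prems)
  have P1: "P \<noteq> \<top>"
    unfolding P_def by (auto simp: ennreal_prod_eq_top ennreal_mult_eq_top_iff of_bool_def split: if_splits)
  have "(\<lambda>n. nexp (a 0 * (G (X' n) \<omega> - G (X i n) \<omega>)) * (nexp (a 1 * (G (X (Suc i) n) \<omega> - G (X' n) \<omega>)) * of_bool (U i \<omega> = x 0)) *
     grid_sum (h n) m (cell_end (h n) (Suc i)) (\<lambda>k. a (k + 2)) (\<lambda>k. x (Suc k)) \<omega>) \<longlonglongrightarrow>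
    nexp (a 0 * (Gl (S (Suc i) \<omega>) \<omega> - G (S i \<omega>) \<omega>)) * (nexp (a 1 * (G (S (Suc i) \<omega>) \<omega> - Gl (S (Suc i) \<omega>) \<omega>)) * of_bool (U i \<omega> = x 0)) * P"
    using P1 by (intro tendsto_mult_ennreal IH tendsto_ennrealI tendsto_intros GX GX') (auto simp: ennreal_mult_eq_top_iff)
  also have "nexp (a 0 * (Gl (S (Suc i) \<omega>) \<omega> - G (S i \<omega>) \<omega>)) * (nexp (a 1 * (G (S (Suc i) \<omega>) \<omega> - Gl (S (Suc i) \<omega>) \<omega>)) * of_bool (U i \<omega> = x 0)) * P =
    (\<Prod>k<Suc m. nexp (a (2 * k) * V (2 * (i + k) + 1) \<omega>) * nexp (a (2 * k + 1) * V (2 * (i + k) + 2) \<omega>) *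
      of_bool (U (i + k) \<omega> = x k))"
    unfolding prod.lessThan_Suc_shift P_def using V_good(2,3)[OF good, of i] by (simp add: mult.assoc)
  finally show ?case
    by (rule Lim_transform_eventually) (use ev in \<open>simp add: h_def eq_commute\<close>)
qed simp

end

lemma prod_dim: "(\<Prod>i<dim m. f i) = f 0 * (\<Prod>k<m. f (2 * k + 1) * f (2 * k + 2))" for f :: "nat \<Rightarrow> ennreal"
proof (induction m)
  case (Suc m)
  have "dim (Suc m) = Suc (Suc (dim m))" by (simp add: dim_def)
  then show ?case using Suc by (simp add: dim_def mult.assoc)
qed (simp add: dim_def)

text \<open>The mean of the grid expression is known for every mesh. It converges to the left side
  by dominated convergence and to the right side by \<open>grid_ratio_limit\<close>.\<close>

lemma V_lap:
  assumes a: "\<And>i. 0 < a i" and x: "\<And>i. x i \<in> B"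
  shows "(\<integral>\<^sup>+\<omega>. (\<Prod>i<dim m. nexp (a i * V i \<omega>)) * (\<Prod>i<m. indicator {x i} (U i \<omega>)) \<partial>M) =
    ennreal (1 / (1 + a 0 * gam0)) * (\<Prod>i<m. ennreal (1 / exponent \<gamma> c B (a (2 * i + 1))) * ennreal (hold_lap \<gamma> (a (2 * i + 2)) (x i)))"
    (is "?L = ?R")
proof -
  define h where "h n = 1 / real (Suc n)" for n
  have h: "0 < h n" for n by (simp add: h_def)
  note [measurable] = grid_sum_meas[OF h]
  \<comment> \<open>The initial duration takes \<open>a 0\<close>; the cycles use the remaining
    arguments.\<close>
  define a' where "a' k = a (Suc k)" for k
  have a': "0 < a' k" for k using a by (simp add: a'_def)
  define E where "E \<omega> = nexp (a 0 * (gam0 * T0 \<omega>))" for \<omega>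
  have [measurable]: "E \<in> borel_measurable M" unfolding E_def[abs_def] by measurable
  define W where "W n = (\<Prod>k<m. ennreal (exp (- (h n * exponent \<gamma> c B (a' (2 * k + 1)))) * (h n * hold_lap \<gamma> (a' (2 * k + 1)) (x k)) / (1 - exp (- (h n * exponent \<gamma> c B (a' (2 * k)))))))" for n
  have int: "(\<integral>\<^sup>+\<omega>. E \<omega> * grid_sum (h n) m 0 a' x \<omega> \<partial>M) = ennreal (1 / (1 + a 0 * gam0)) * W n" for n
    using grid_sum_integral[where h="h n" and b="a 0" and p="\<lambda>_. 1" and \<kappa>="\<lambda>_. None" and a=a' and x=x and J=0 and m=m, OF h less_imp_le[OF a]] a' x
    unfolding E_def W_def by simp
  have "(\<lambda>n. \<integral>\<^sup>+\<omega>. E \<omega> * grid_sum (h n) m 0 a' x \<omega> \<partial>M) \<longlonglongrightarrow> ?L"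
  proof (rule nn_integral_dominated_convergence[where w="\<lambda>_. 1"])
    show "(\<lambda>\<omega>. (\<Prod>i<dim m. nexp (a i * V i \<omega>)) * (\<Prod>i<m. indicator {x i} (U i \<omega>))) \<in> borel_measurable M"
    proof -
      have [measurable]: "(\<lambda>\<omega>. indicator {x i} (U i \<omega>) :: ennreal) \<in> borel_measurable M" for i
        by (rule measurable_compose[OF U_meas]) simp
      show ?thesis by measurable
    qed
    show "AE \<omega> in M. E \<omega> * grid_sum (h n) m 0 a' x \<omega> \<le> 1" for n
      using AE_good
    proof eventually_elim
      case (elim \<omega>)
      then have "0 \<le> gam0 * T0 \<omega>" using gam0_nonneg by (simp add: good_def regular_def nonneg_def)
      then have "0 \<le> a 0 * (gam0 * T0 \<omega>)" by (rule mult_nonneg_nonneg[OF less_imp_le[OF a]])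
      then have "E \<omega> \<le> 1" by (simp add: E_def)
      then show ?case using grid_sum_le_1[OF elim h a' x] by (intro mult_le_one) auto
    qed
    show "AE \<omega> in M. (\<lambda>n. E \<omega> * grid_sum (h n) m 0 a' x \<omega>) \<longlonglongrightarrow> (\<Prod>i<dim m. nexp (a i * V i \<omega>)) * (\<Prod>i<m. indicator {x i} (U i \<omega>))"
      using AE_good
    proof eventually_elim
      case (elim \<omega>)
      have "cell_end \<omega> k 0 = 0" for k unfolding cell_end_def[OF elim] by (simp add: S_0[OF elim])
      then have "(\<lambda>n. grid_sum (h n) m 0 a' x \<omega>) \<longlonglongrightarrow>
        (\<Prod>k<m. nexp (a' (2 * k) * V (2 * k + 1) \<omega>) * nexp (a' (2 * k + 1) * V (2 * k + 2) \<omega>) * of_bool (U k \<omega> = x k))"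
        using grid_sum_limit[OF elim, of x m 0 a', OF x] unfolding h_def by simp
      then have "(\<lambda>n. E \<omega> * grid_sum (h n) m 0 a' x \<omega>) \<longlonglongrightarrow>
        E \<omega> * (\<Prod>k<m. nexp (a' (2 * k) * V (2 * k + 1) \<omega>) * nexp (a' (2 * k + 1) * V (2 * k + 2) \<omega>) * of_bool (U k \<omega> = x k))"
        by (rule ennreal_tendsto_cmult[rotated]) (simp add: E_def)
      also have "E \<omega> * (\<Prod>k<m. nexp (a' (2 * k) * V (2 * k + 1) \<omega>) * nexp (a' (2 * k + 1) * V (2 * k + 2) \<omega>) * of_bool (U k \<omega> = x k)) =
        (\<Prod>i<dim m. nexp (a i * V i \<omega>)) * (\<Prod>i<m. indicator {x i} (U i \<omega>))"
      proof -
        have "of_bool (U k \<omega> = x k) = (indicator {x k} (U k \<omega>) :: ennreal)" for k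
          by (simp add: indicator_def)
        moreover have "E \<omega> = nexp (a 0 * V 0 \<omega>)" by (simp add: E_def V_def)
        ultimately show ?thesis
          unfolding prod_dim prod.distrib a'_def by (simp only: Suc_eq_plus1 add.assoc one_add_one mult.assoc)
      qed
      finally show ?case .
    qed
  qed (measurable, simp_all add: emeasure_space_1)
  moreover have "(\<lambda>n. \<integral>\<^sup>+\<omega>. E \<omega> * grid_sum (h n) m 0 a' x \<omega> \<partial>M) \<longlonglongrightarrow> ?R"
  proof -
    have nn: "0 \<le> exp (- (h n * exponent \<gamma> c B (a' (2 * k + 1)))) * (h n * hold_lap \<gamma> (a' (2 * k + 1)) (x k)) / (1 - exp (- (h n * exponent \<gamma> c B (a' (2 * k)))))" for n k
      using h[of n] exponent_pos[OF a'[of "2 * k"]] hold_lap_bounds[of "a' (2 * k + 1)" "x k"] a'[of "2 * k + 1"] B_ge[OF x[of k]]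
      by (intro divide_nonneg_nonneg mult_nonneg_nonneg) auto
    have W: "W n = ennreal (\<Prod>k<m. exp (- (h n * exponent \<gamma> c B (a' (2 * k + 1)))) * (h n * hold_lap \<gamma> (a' (2 * k + 1)) (x k)) / (1 - exp (- (h n * exponent \<gamma> c B (a' (2 * k))))))" for n
      unfolding W_def by (rule prod_ennreal) (rule nn)
    have "W \<longlonglongrightarrow> ennreal (\<Prod>k<m. hold_lap \<gamma> (a' (2 * k + 1)) (x k) / exponent \<gamma> c B (a' (2 * k)))"
      unfolding W[abs_def] h_def by (intro tendsto_ennrealI tendsto_prod grid_ratio_limit exponent_pos a')
    then have "(\<lambda>n. ennreal (1 / (1 + a 0 * gam0)) * W n) \<longlonglongrightarrow> ennreal (1 / (1 + a 0 * gam0)) * ennreal (\<Prod>k<m. hold_lap \<gamma> (a' (2 * k + 1)) (x k) / exponent \<gamma> c B (a' (2 * k)))"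
      by (rule ennreal_tendsto_cmult[rotated]) simp
    also have "ennreal (\<Prod>k<m. hold_lap \<gamma> (a' (2 * k + 1)) (x k) / exponent \<gamma> c B (a' (2 * k))) =
       (\<Prod>i<m. ennreal (1 / exponent \<gamma> c B (a (2 * i + 1))) * ennreal (hold_lap \<gamma> (a (2 * i + 2)) (x i)))"
    proof -
      have g: "0 \<le> hold_lap \<gamma> (a' (2 * k + 1)) (x k)" for k
        using hold_lap_bounds[of "a' (2 * k + 1)" "x k"] a'[of "2 * k + 1"] B_ge[OF x[of k]] by simp
      have "ennreal (\<Prod>k<m. hold_lap \<gamma> (a' (2 * k + 1)) (x k) / exponent \<gamma> c B (a' (2 * k))) = (\<Prod>k<m. ennreal (hold_lap \<gamma> (a' (2 * k + 1)) (x k) / exponent \<gamma> c B (a' (2 * k))))"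
        by (rule prod_ennreal[symmetric]) (intro divide_nonneg_nonneg g less_imp_le exponent_pos a')
      also have "\<dots> = (\<Prod>i<m. ennreal (1 / exponent \<gamma> c B (a (2 * i + 1))) * ennreal (hold_lap \<gamma> (a (2 * i + 2)) (x i)))"
      proof (rule prod.cong[OF refl])
        fix i
        show "ennreal (hold_lap \<gamma> (a' (2 * i + 1)) (x i) / exponent \<gamma> c B (a' (2 * i))) = ennreal (1 / exponent \<gamma> c B (a (2 * i + 1))) * ennreal (hold_lap \<gamma> (a (2 * i + 2)) (x i))"
          using g[of i] exponent_pos[OF a'[of "2 * i"]] by (simp add: a'_def ennreal_mult[symmetric])
      qed
      finally show ?thesis .
    qed
    finally show ?thesis unfolding int .
  qed
  ultimately show ?thesis by (rule LIMSEQ_unique)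
qed

lemma skeleton_K: "skeleton M y B (\<lambda>m a x. ennreal (1 / (1 + a 0 * extend_infty \<gamma> y)) *
    (\<Prod>i<m. ennreal (1 / exponent \<gamma> c B (a (2 * i + 1))) * ennreal (hold_lap \<gamma> (a (2 * i + 2)) (x i))))
    V U (K_process \<gamma> c y N T0 T)"
proof unfold_locales
  show "finite B" by (rule B_fin)
  show "V i \<in> borel_measurable M" for i by measurable
  show "U i \<in> M \<rightarrow>\<^sub>M count_space UNIV" for i by measurable
  show "AE \<omega> in M. 0 \<le> V i \<omega>" for i
    using AE_good by eventually_elim (rule V_nonneg)
  show "AE \<omega> in M. U i \<omega> \<in> B" for i
    using AE_good by eventually_elim (use U_jump in blast)
  show "K_process \<gamma> c y N T0 T t \<in> M \<rightarrow>\<^sub>M count_space Nbar" for t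
    by (rule K_process_meas[OF c_nonneg y_Nbar])
  show "AE \<omega> in M. \<forall>t\<ge>0. \<forall>x\<in>B. K_process \<gamma> c y N T0 T t \<omega> = enat x \<longleftrightarrow> skel_at y UNIV (\<lambda>i. U i \<omega>) (\<lambda>i. V i \<omega>) t x"
    by (rule Z_skel)
  fix m and a :: "nat \<Rightarrow> real" and x :: "nat \<Rightarrow> nat"
  assume a: "\<And>i. 0 < a i" and x: "\<And>i. x i \<in> B"
  show "(\<integral>\<^sup>+\<omega>. (\<Prod>i<dim m. nexp (a i * V i \<omega>)) * (\<Prod>i<m. indicator {x i} (U i \<omega>)) \<partial>M) =
    ennreal (1 / (1 + a 0 * extend_infty \<gamma> y)) * (\<Prod>i<m. ennreal (1 / exponent \<gamma> c B (a (2 * i + 1))) * ennreal (hold_lap \<gamma> (a (2 * i + 2)) (x i)))"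
    using V_lap[of a x m, OF a x] unfolding gam0_def .
qed

end

section \<open>The main theorem\<close>

lemma (in regular_process) uniform_markov_Q:
  assumes \<gamma>_pos: "\<And>x. 1 \<le> x \<Longrightarrow> 0 < \<gamma> x"
    and \<gamma>_summable: "summable (\<lambda>x. \<gamma> (Suc x))"
    and holding_finite:
      "\<And>i. 1 \<le> i \<Longrightarrow> AE \<omega> in P (enat i). hitting_time Y (Nbar - {enat i}) \<omega> < \<infinity>"
    and holding_exponential:
      "\<And>i. 1 \<le> i \<Longrightarrow>
        distributed (P (enat i)) lborel (\<lambda>\<omega>. enn2real (hitting_time Y (Nbar - {enat i}) \<omega>))
          (exponential_density (1 / \<gamma> i))"
    and hitting_finite:
      "\<And>A. finite A \<Longrightarrow> A \<noteq> {} \<Longrightarrow> A \<subseteq> Nstar \<Longrightarrow> AE \<omega> in P \<infinity>. hitting_time Y A \<omega> < \<infinity>"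
    and hitting_uniform:
      "\<And>A. finite A \<Longrightarrow> A \<noteq> {} \<Longrightarrow> A \<subseteq> Nstar \<Longrightarrow>
        distr (P \<infinity>) (count_space UNIV) (\<lambda>\<omega>. Y (enn2real (hitting_time Y A \<omega>)) \<omega>) =
          measure_pmf (pmf_of_set A)"
  shows "uniform_markov Q \<gamma>"
proof (intro uniform_markov.intro uniform_markov_axioms.intro)
  show "regular_markov Q" by unfold_locales
  show "0 < \<gamma> x" if "1 \<le> x" for x by (rule \<gamma>_pos[OF that])
  show "summable (\<lambda>x. \<gamma> (Suc x))" by (rule \<gamma>_summable)
  note [measurable] = measurable_hit[OF clopen_exit]
  show "AE f in Q (enat i). hit (Nbar - {enat i}) f < \<infinity>" if i: "1 \<le> i" for i
  proof -
    have y: "enat i \<in> Nbar" using i by simp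
    have "{f \<in> space regular_paths. hit (Nbar - {enat i}) f < \<infinity>} \<in> sets regular_paths"
      using i by measurable
    then show ?thesis
      unfolding Q_def using holding_finite[OF i] path_measurable[OF y]
      by (subst AE_distr_iff) (simp_all add: hitting_time_eq_hit)
  qed
  show "distributed (Q (enat i)) lborel (\<lambda>f. enn2real (hit (Nbar - {enat i}) f)) (exponential_density (1 / \<gamma> i))" if i: "1 \<le> i" for i
  proof -
    have [measurable]: "sample_path Y \<in> P (enat i) \<rightarrow>\<^sub>M regular_paths" using i by (intro path_measurable) simp
    have m [measurable]: "(\<lambda>f. enn2real (hit (Nbar - {enat i}) f)) \<in> borel_measurable regular_paths"
      using i by measurable
    have "distr (Q (enat i)) lborel (\<lambda>f. enn2real (hit (Nbar - {enat i}) f)) =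
        distr (P (enat i)) lborel (\<lambda>\<omega>. enn2real (hitting_time Y (Nbar - {enat i}) \<omega>))"
      unfolding Q_def by (subst distr_distr) (simp_all add: comp_def hitting_time_eq_hit)
    then show ?thesis
      using holding_exponential[OF i] by (simp add: distributed_def Q_def)
  qed
  fix F :: "nat set" assume F: "finite F" "F \<noteq> {}" "F \<subseteq> {1..}"
  have A: "finite (enat ` F)" "enat ` F \<noteq> {}" "enat ` F \<subseteq> Nstar" "clopen (enat ` F)"
    using F by (auto intro!: clopen_finite)
  note [measurable] = measurable_hit[OF A(4)] path_measurable[OF infty_Nbar]
  show "AE f in Q \<infinity>. hit (enat ` F) f < \<infinity>"
  proof -
    have "{f \<in> space regular_paths. hit (enat ` F) f < \<infinity>} \<in> sets regular_paths" by measurable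
    then show ?thesis
      unfolding Q_def using hitting_finite[OF A(1-3)]
      by (subst AE_distr_iff) (simp_all add: hitting_time_eq_hit)
  qed
  fix k assume k: "k \<in> F"
  have ev: "(\<lambda>f. f (enn2real (hit (enat ` F) f))) \<in> regular_paths \<rightarrow>\<^sub>M count_space Nbar"
    by (rule measurable_eval) (simp_all add: measurable_hit[OF A(4)])
  have Yeq: "Y (enn2real (hitting_time Y (enat ` F) \<omega>)) \<omega> = sample_path Y \<omega> (enn2real (hit (enat ` F) (sample_path Y \<omega>)))" for \<omega>
    by (simp add: sample_path_def hitting_time_eq_hit)
  have Ym: "(\<lambda>\<omega>. Y (enn2real (hitting_time Y (enat ` F) \<omega>)) \<omega>) \<in> P \<infinity> \<rightarrow>\<^sub>M count_space UNIV"
    unfolding Yeq using measurable_compose[OF measurable_compose[OF path_measurable[OF infty_Nbar] ev], of "\<lambda>z. z" "count_space UNIV"]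
    by simp
  have "emeasure (Q \<infinity>) {f \<in> space regular_paths. f (enn2real (hit (enat ` F) f)) = enat k} =
    emeasure (P \<infinity>) (sample_path Y -` {f \<in> space regular_paths. f (enn2real (hit (enat ` F) f)) = enat k} \<inter> space (P \<infinity>))"
    unfolding Q_def using pred_count_space_eq[OF ev, of "enat k"] by (intro emeasure_distr) (simp_all add: pred_def)
  also have "sample_path Y -` {f \<in> space regular_paths. f (enn2real (hit (enat ` F) f)) = enat k} \<inter> space (P \<infinity>) =
    (\<lambda>\<omega>. Y (enn2real (hitting_time Y (enat ` F) \<omega>)) \<omega>) -` {enat k} \<inter> space (P \<infinity>)"
    unfolding Yeq using path_space by auto
  also have "emeasure (P \<infinity>) \<dots> = emeasure (distr (P \<infinity>) (count_space UNIV) (\<lambda>\<omega>. Y (enn2real (hitting_time Y (enat ` F) \<omega>)) \<omega>)) {enat k}"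
    by (rule emeasure_distr[OF Ym, symmetric]) simp
  also have "\<dots> = ennreal (1 / card F)"
    unfolding hitting_uniform[OF A(1-3)] emeasure_pmf_single
    using A(1,2) k card_image[of enat F] by (simp add: inj_on_def)
  finally show "emeasure (Q \<infinity>) {f \<in> space regular_paths. f (enn2real (hit (enat ` F) f)) = enat k} = ennreal (1 / card F)" .
qed

theorem theorem4p1:
  fixes \<gamma> :: "nat \<Rightarrow> real"
    and P :: "enat \<Rightarrow> 'w measure"
    and Y :: "real \<Rightarrow> 'w \<Rightarrow> enat"
  assumes \<gamma>_pos: "\<And>x. 1 \<le> x \<Longrightarrow> 0 < \<gamma> x"
    and \<gamma>_summable: "summable (\<lambda>x. \<gamma> (Suc x))"
    and process: "Nbar_process P Y"
    and cadlag: "\<And>\<omega>. \<omega> \<in> space (P \<infinity>) \<Longrightarrow> cadlag (\<lambda>t. Y t \<omega>)"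
    and strong_markov: "strong_markov P Y"
    and holding_finite:
      "\<And>i. 1 \<le> i \<Longrightarrow> AE \<omega> in P (enat i). hitting_time Y (Nbar - {enat i}) \<omega> < \<infinity>"
    and holding_exponential:
      "\<And>i. 1 \<le> i \<Longrightarrow>
        distributed (P (enat i)) lborel (\<lambda>\<omega>. enn2real (hitting_time Y (Nbar - {enat i}) \<omega>))
          (exponential_density (1 / \<gamma> i))"
    and hitting_finite:
      "\<And>A. finite A \<Longrightarrow> A \<noteq> {} \<Longrightarrow> A \<subseteq> Nstar \<Longrightarrow> AE \<omega> in P \<infinity>. hitting_time Y A \<omega> < \<infinity>"
    and hitting_uniform:
      "\<And>A. finite A \<Longrightarrow> A \<noteq> {} \<Longrightarrow> A \<subseteq> Nstar \<Longrightarrow>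
        distr (P \<infinity>) (count_space UNIV) (\<lambda>\<omega>. Y (enn2real (hitting_time Y A \<omega>)) \<omega>) =
          measure_pmf (pmf_of_set A)"
  shows "\<exists>c\<ge>0. \<forall>y\<in>Nbar. \<forall>(M :: 'v measure) N T0 T. K_inputs M N T0 T \<longrightarrow>
    distr (P y) path_space (sample_path Y) = distr M path_space (sample_path (K_process \<gamma> c y N T0 T))"
proof -
  interpret R: regular_process P Y
    by (intro regular_process.intro regular_process_axioms.intro process cadlag strong_markov)
  interpret U: uniform_markov R.Q \<gamma>
    by (rule R.uniform_markov_Q) fact+
  obtain c where c: "0 \<le> c" "\<And>F l k. finite F \<Longrightarrow> F \<subseteq> {1..} \<Longrightarrow> k \<in> F \<Longrightarrow> 0 < l \<Longrightarrow> U.\<psi> F l k = ennreal (1 / exponent \<gamma> c F l)"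
    using U.psi_formula by blast
  show ?thesis
  proof (intro exI[of _ c] conjI c(1) ballI allI impI)
    fix y :: enat and M :: "'v measure" and N T0 T
    assume y: "y \<in> Nbar" and K: "K_inputs M N T0 T"
    interpret K: K_setting M N T0 T \<gamma> c y
      using K y c(1) \<gamma>_pos \<gamma>_summable by (intro K_setting.intro K_setting_axioms.intro)
    have m1: "sample_path Y \<in> P y \<rightarrow>\<^sub>M path_space"
      unfolding path_space_def sample_path_def
    proof (rule measurable_restrict)
      fix t :: real assume "t \<in> {0..}"
      then show "Y t \<in> P y \<rightarrow>\<^sub>M count_space Nbar"
        using R.measurable_Y[of t] measurable_cong_sets[OF R.sets_P[OF y] refl] by auto
    qed
    have m2: "sample_path (K_process \<gamma> c y N T0 T) \<in> M \<rightarrow>\<^sub>M path_space"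
      unfolding path_space_def sample_path_def
      by (rule measurable_restrict) (rule K.K_process_meas[OF c(1) y])
    show "distr (P y) path_space (sample_path Y) = distr M path_space (sample_path (K_process \<gamma> c y N T0 T))"
    proof (rule distr_path_space_eqI[OF R.prob_space_P[OF y] K.prob_space_axioms m1 m2])
      fix J :: "real set" and x :: "real \<Rightarrow> nat"
      assume J: "finite J" "J \<subseteq> {0..}" and x: "\<And>t. t \<in> J \<Longrightarrow> 1 \<le> x t"
      \<comment> \<open>The state 1 is inserted to make \<open>B\<close> nonempty even when
        \<open>J\<close> is empty.\<close>
      define B where "B = insert 1 (x ` J)"
      have B: "finite B" "B \<noteq> {}" "B \<subseteq> {1..}" using J x by (auto simp: B_def)
      interpret KB: K_target M N T0 T \<gamma> c y B
        by unfold_locales (use B in auto)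
      have ev: "{f \<in> space regular_paths. \<forall>t\<in>J. f t = enat (x t)} \<in> sets regular_paths"
      proof -
        have "Measurable.pred regular_paths (\<lambda>f. \<forall>t\<in>J. f t = enat (x t))"
          by (rule pred_intros_finite[OF J(1)]) (use J in \<open>auto intro!: pred_count_space_eq[OF measurable_eval_const]\<close>)
        then show ?thesis by (simp add: pred_def)
      qed
      have "emeasure (P y) {\<omega> \<in> space (P y). \<forall>t\<in>J. sample_path Y \<omega> t = enat (x t)} =
        emeasure (P y) (sample_path Y -` {f \<in> space regular_paths. \<forall>t\<in>J. f t = enat (x t)} \<inter> space (P y))"
        using R.path_space unfolding R.space_P[OF y] by (intro arg_cong[where f="emeasure (P y)"]) auto
      also have "\<dots> = emeasure (R.Q y) {f \<in> space (R.Q y). \<forall>t\<in>J. f t = enat (x t)}"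
        unfolding R.Q_def space_distr by (rule emeasure_distr[OF R.path_measurable[OF y] ev, symmetric])
      \<comment> \<open>By the choice of \<open>c\<close>, the skeleton of \<open>Y\<close> has
        exactly the transform that \<open>skeleton_K\<close> computes for the K-process.\<close>
      also have "\<dots> = emeasure M {\<omega> \<in> space M. \<forall>t\<in>J. K_process \<gamma> c y N T0 T t \<omega> = enat (x t)}"
        by (rule skeleton_unique[OF U.skeleton_Q[OF B y c(2)[OF B(1,3)]] KB.skeleton_K J]) (auto simp: B_def)
      also have "\<dots> = emeasure M {\<omega> \<in> space M. \<forall>t\<in>J. sample_path (K_process \<gamma> c y N T0 T) \<omega> t = enat (x t)}"
        using J by (intro arg_cong[where f="emeasure M"]) (auto simp: sample_path_def)
      finally show "emeasure (P y) {\<omega> \<in> space (P y). \<forall>t\<in>J. sample_path Y \<omega> t = enat (x t)} =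
        emeasure M {\<omega> \<in> space M. \<forall>t\<in>J. sample_path (K_process \<gamma> c y N T0 T) \<omega> t = enat (x t)}" .
    qed
  qed
qed

end
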